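(* Let $t,s\in C^{\log}_{loc}(\mathbb{T}^{n})\cap L^{\infty}(\mathbb{T}^{n})$ with $s(x)\ge s^{-}>0$, $q\in\mathcal{P}^{\log}(\mathbb{T}^{n})$, $\delta>0$, and suppose $$\sup_{x\in\mathbb{T}^{n}}\left(t(x)-s(x)+\frac{n}{q^{+}}\right)<0.$$ Let $\xi^{j}_{Gm}$ be i.i.d. draws from a centered generalized $q(\cdot)$-exponential distribution, let $$\gamma^{j}_{Gm}=2^{-j\left(s(2^{-j}m)+\frac n2-\frac{n}{q^{+}}\right)}\left(\frac1\delta\right)^{1/q^{+}},$$ and let $$u^{N}=\sum_{j=0}^{N}\sum_{G\in G^{j}}\sum_{m\in\mathbb{M}_{j}}\gamma^{j}_{Gm}\xi^{j}_{Gm}\tilde\Psi^{j}_{Gm}.$$ Then $\{u^{N}\}_{N=1}^{\infty}$ is a Cauchy sequence in the Banach space $L^{q(\cdot)}_{\mathbb{P}}(\Omega;B^{t(\cdot)}_{q(\cdot)})$. Thus the infinite series $u=\sum_{j=0}^{\infty}\sum_{G\in G^{j}}\sum_{m\in\mathbb{M}_{j}}\gamma^{j}_{Gm}\xi^{j}_{Gm}\tilde\Psi^{j}_{Gm}$ exists as a limit in $L^{q(\cdot)}_{\mathbb{P}}(\Omega;B^{t(\cdot)}_{q(\cdot)})$ for all $t$ with $\sup_{x\in\mathbb{T}^{n}}\left(t(x)-s(x)+\frac{n}{q^{+}}\right)<0$.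
   Context: $\mathbb{T}^{n}$ is the $n$-dimensional torus, $n\le3$. $\mathcal{P}$ is the set of measurable $q:\mathbb{T}^{n}\to[1,\infty)$; $q^{\pm}$ are the essential sup/inf. $g\in C^{\log}_{loc}(\mathbb{T}^{n})$ means $|g(x)-g(y)|\le c/\log(e+1/|x-y|)$ for all $x,y$ and some $c>0$; $g\in C^{\log}$ if moreover $|g(x)-g_\infty|\le c/\log(e+|x|)$ for some $g_\infty$. $\mathcal{P}^{\log}$: those $q\in\mathcal{P}$ with $1/q\in C^{\log}$ and $1\le q^{-}\le q^{+}<\infty$. Wavelets: $\psi^{F},\psi^{M}$ are the scaling function and wavelet of an orthonormal Meyer system on $\mathbb{R}$, or of a Daubechies system of regularity $k$ (compactly supported, in $C^k$, with $k$ vanishing moments of $\psi^M$), with $k$ large enough for the wavelet characterization of the spaces involved ($k>\max(-r^{-},r^{+})$ for $r\in\{s,t\}$). $G^{0}=\{F,M\}^{n}$; for $j\ge1$, $G^{j}$ is the set of $G\in\{F,M\}^{n}$ with at least one entry $M$; $\mathbb{M}_{j}=\{0,\dots,2^{j}-1\}^{n}$; $\tilde\Psi^{j}_{Gm}(x)=\prod_{r=1}^{n}\sum_{\ell\in\mathbb{Z}}2^{j/2}\psi^{G_{r}}(2^{j}(x_{r}+\ell)-m_{r})$, an orthonormal basis of $L^{2}(\mathbb{T}^{n})$. Generalized $q(\cdot)$-exponential distribution: for a probability measure $\kappa$ on $\mathbb{T}^{n}$, the centered measure on $\mathbb{R}$ with density proportional to $x\mapsto\exp\left(-\frac12\int_{\mathbb{T}^{n}}|x|^{q(y)}\kappa(dy)\right)$.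 $(\Omega,\mathbb{P})$ is the underlying probability space. Space: let $\{\varphi_{k}\}_{k\ge0}$ be a smooth dyadic resolution of unity on the Fourier side ($\varphi_k=\varphi(2^{-k}\cdot)$ for $k\ge1$) and $u_{k}=(\varphi_{k}\hat u)^{\vee}$ (Fourier transform in $x$). For random functions $u:\mathbb{T}^{n}\times\Omega\to\mathbb{R}$ put $$\rho^{E}_{B^{t(\cdot)}_{q(\cdot)}}(u)=\int_{\Omega}\int_{\mathbb{T}^{n}}\sum_{k=0}^{\infty}2^{kt(x)q(x)}|u_{k}(x,\omega)|^{q(x)}\,dx\,\mathbb{P}(d\omega).$$ $L^{q(\cdot)}_{\mathbb{P}}(\Omega;B^{t(\cdot)}_{q(\cdot)})$ is the set of $u$ with $\rho^{E}_{B^{t(\cdot)}_{q(\cdot)}}(\lambda u)<\infty$ for some $\lambda>0$, with norm $\inf\{\mu>0:\rho^{E}_{B^{t(\cdot)}_{q(\cdot)}}(u/\mu)\le1\}$.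
   Formalization: Elements of the space are taken to be random periodic distributions, with functions embedded in them, rather than random functions, because for negative t the limit is in general not a function (e.g. n=2, q=2, s=1/2, t=-1). *)

theory Defs
  imports "HOL-Probability.Probability"
begin

section \<open>Differentiability of higher order\<close>

definition partial_diff :: "'a::euclidean_space \<Rightarrow> ('a \<Rightarrow> real) \<Rightarrow> 'a \<Rightarrow> real" where
  "partial_diff b f = (\<lambda>x. frechet_derivative f (at x) b)"

definition partial_diffs :: "'a::euclidean_space list \<Rightarrow> ('a \<Rightarrow> real) \<Rightarrow> 'a \<Rightarrow> real" where
  "partial_diffs bs f = foldr partial_diff bs f"

definition C_k :: "nat \<Rightarrow> ('a::euclidean_space \<Rightarrow> real) \<Rightarrow> bool" where
  "C_k k f \<longleftrightarrow>
     (\<forall>bs. set bs \<subseteq> Basis \<longrightarrow>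
        (length bs < k \<longrightarrow> (\<forall>x. partial_diffs bs f differentiable (at x))) \<and>
        (length bs \<le> k \<longrightarrow> continuous_on UNIV (partial_diffs bs f)))"

definition C_infinity :: "('a::euclidean_space \<Rightarrow> real) \<Rightarrow> bool" where
  "C_infinity f \<longleftrightarrow> (\<forall>k. C_k k f)"


section \<open>The torus\<close>

text \<open>
  The torus is the quotient of \<open>\<real>\<^sup>n\<close>, \<open>n = CARD('n)\<close>, by the integer lattice.  Functions on the
  torus are functions on \<open>\<real>\<^sup>n\<close> of period 1 in each coordinate; measures and integrals live on the
  fundamental cell \<open>[0,1)\<^sup>n\<close>, and distances are taken modulo the lattice.
\<close>

definition lattice_pt :: "int ^ 'n \<Rightarrow> real ^ 'n" where
  "lattice_pt m = (\<chi> i. real_of_int (m $ i))"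

definition periodic :: "(real ^ 'n \<Rightarrow> 'b) \<Rightarrow> bool" where
  "periodic f \<longleftrightarrow> (\<forall>m x. f (x + lattice_pt m) = f x)"

definition torus_cell :: "(real ^ 'n) set" where
  "torus_cell = {x. \<forall>i. 0 \<le> x $ i \<and> x $ i < 1}"

definition torus :: "(real ^ 'n) measure" where
  "torus = restrict_space lborel torus_cell"

definition torus_dist :: "real ^ 'n \<Rightarrow> real ^ 'n \<Rightarrow> real" where
  "torus_dist x y = (INF m. norm (x - y + lattice_pt m))"

definition ess_sup :: "(real ^ 'n \<Rightarrow> real) \<Rightarrow> real" where
  "ess_sup f = real_of_ereal (esssup torus (\<lambda>x. ereal (f x)))"

definition ess_inf :: "(real ^ 'n \<Rightarrow> real) \<Rightarrow> real" where
  "ess_inf f = - ess_sup (\<lambda>x. - f x)"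

definition L_infinity :: "(real ^ 'n \<Rightarrow> real) \<Rightarrow> bool" where
  "L_infinity f \<longleftrightarrow> f \<in> borel_measurable torus \<and> esssup torus (\<lambda>x. ereal \<bar>f x\<bar>) < \<infinity>"

definition C_log_loc :: "(real ^ 'n \<Rightarrow> real) \<Rightarrow> bool" where
  "C_log_loc g \<longleftrightarrow> periodic g \<and>
     (\<exists>c>0. \<forall>x y. \<bar>g x - g y\<bar> \<le> c / ln (exp 1 + 1 / torus_dist x y))"

definition C_log :: "(real ^ 'n \<Rightarrow> real) \<Rightarrow> bool" where
  "C_log g \<longleftrightarrow> C_log_loc g \<and>
     (\<exists>g_inf. \<exists>c>0. \<forall>x. \<bar>g x - g_inf\<bar> \<le> c / ln (exp 1 + torus_dist x 0))"

text \<open>Measurable exponents \<open>q\<close> with values in \<open>[1,\<infinity>)\<close>, and the log-Hoelder continuous ones.\<close>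

definition P_exponent :: "(real ^ 'n \<Rightarrow> real) \<Rightarrow> bool" where
  "P_exponent q \<longleftrightarrow> periodic q \<and> q \<in> borel_measurable torus \<and> (\<forall>x. 1 \<le> q x)"

definition P_log :: "(real ^ 'n \<Rightarrow> real) \<Rightarrow> bool" where
  "P_log q \<longleftrightarrow> P_exponent q \<and> C_log (\<lambda>x. 1 / q x) \<and>
     1 \<le> ess_inf q \<and> ess_inf q \<le> ess_sup q \<and> esssup torus (\<lambda>x. ereal (q x)) < \<infinity>"


section \<open>Distributions on the torus\<close>

text \<open>
  If \<open>t\<close> takes negative values, the space with smoothness \<open>t(\<cdot>)\<close> contains distributions that are
  not functions.  Hence its elements are real-valued (random) periodic distributions, i.e.
  functionals on smooth periodic test functions; only the values on test functions matter.
\<close>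

definition test_functions :: "(real ^ 'n \<Rightarrow> real) set" where
  "test_functions = {f. periodic f \<and> C_infinity f}"

definition test_seminorm :: "nat \<Rightarrow> (real ^ 'n \<Rightarrow> real) \<Rightarrow> real" where
  "test_seminorm N f = (SUP (bs, x) \<in> {bs. set bs \<subseteq> Basis \<and> length bs \<le> N} \<times> UNIV. \<bar>partial_diffs bs f x\<bar>)"

definition distributions :: "((real ^ 'n \<Rightarrow> real) \<Rightarrow> real) set" where
  "distributions = {T.
     (\<forall>f\<in>test_functions. \<forall>g\<in>test_functions. \<forall>a b.
        T (\<lambda>x. a * f x + b * g x) = a * T f + b * T g) \<and>
     (\<exists>C N. \<forall>f\<in>test_functions. \<bar>T f\<bar> \<le> C * test_seminorm N f)}"

definition regular_distribution :: "(real ^ 'n \<Rightarrow> real) \<Rightarrow> (real ^ 'n \<Rightarrow> real) \<Rightarrow> real" where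
  "regular_distribution u f = (\<integral>x. u x * f x \<partial>torus)"

text \<open>
  The Fourier coefficient is \<open>T\<close> applied to \<open>exp (- 2 \<pi> i m \<bullet> x)\<close>, split into real and imaginary part.
\<close>

definition fourier_coeff :: "((real ^ 'n \<Rightarrow> real) \<Rightarrow> real) \<Rightarrow> int ^ 'n \<Rightarrow> complex" where
  "fourier_coeff T m =
     Complex (T (\<lambda>x. cos (2 * pi * (lattice_pt m \<bullet> x)))) (- T (\<lambda>x. sin (2 * pi * (lattice_pt m \<bullet> x))))"

definition random_distributions :: "'w measure \<Rightarrow> ('w \<Rightarrow> (real ^ 'n \<Rightarrow> real) \<Rightarrow> real) set" where
  "random_distributions P = {u.
     (\<forall>\<omega>\<in>space P. u \<omega> \<in> distributions) \<and>
     (\<forall>f\<in>test_functions. (\<lambda>\<omega>. u \<omega> f) \<in> borel_measurable P)}"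


section \<open>Variable-exponent Besov spaces of random distributions\<close>

definition dyadic_block ::
    "(real ^ 'n \<Rightarrow> real) \<Rightarrow> (real ^ 'n \<Rightarrow> real) \<Rightarrow> nat \<Rightarrow> real ^ 'n \<Rightarrow> real" where
  "dyadic_block \<phi>\<^sub>0 \<phi> k \<xi> = (if k = 0 then \<phi>\<^sub>0 \<xi> else \<phi> ((1 / 2 ^ k) *\<^sub>R \<xi>))"

definition resolution_of_unity :: "(real ^ 'n \<Rightarrow> real) \<Rightarrow> (real ^ 'n \<Rightarrow> real) \<Rightarrow> bool" where
  "resolution_of_unity \<phi>\<^sub>0 \<phi> \<longleftrightarrow>
     C_infinity \<phi>\<^sub>0 \<and> C_infinity \<phi> \<and>
     (\<forall>\<xi>. \<phi>\<^sub>0 \<xi> \<noteq> 0 \<longrightarrow> norm \<xi> \<le> 2) \<and>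
     (\<forall>\<xi>. \<phi> \<xi> \<noteq> 0 \<longrightarrow> 1 / 2 \<le> norm \<xi> \<and> norm \<xi> \<le> 2) \<and>
     (\<forall>\<xi>. (\<lambda>k. dyadic_block \<phi>\<^sub>0 \<phi> k \<xi>) sums 1)"

text \<open>The piece \<open>u\<^sub>k\<close>; only finitely many terms of the sum are nonzero.\<close>

definition frequency_piece ::
    "(real ^ 'n \<Rightarrow> real) \<Rightarrow> (real ^ 'n \<Rightarrow> real) \<Rightarrow> nat \<Rightarrow> ((real ^ 'n \<Rightarrow> real) \<Rightarrow> real) \<Rightarrow> real ^ 'n \<Rightarrow> complex"
  where
  "frequency_piece \<phi>\<^sub>0 \<phi> k T x =
     (\<Sum>\<^sub>\<infinity>m\<in>UNIV. of_real (dyadic_block \<phi>\<^sub>0 \<phi> k (lattice_pt m)) * fourier_coeff T m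
                   * cis (2 * pi * (lattice_pt m \<bullet> x)))"

definition besov_modular ::
    "(real ^ 'n \<Rightarrow> real) \<Rightarrow> (real ^ 'n \<Rightarrow> real) \<Rightarrow> 'w measure \<Rightarrow> (real ^ 'n \<Rightarrow> real) \<Rightarrow> (real ^ 'n \<Rightarrow> real) \<Rightarrow>
     ('w \<Rightarrow> (real ^ 'n \<Rightarrow> real) \<Rightarrow> real) \<Rightarrow> ennreal" where
  "besov_modular \<phi>\<^sub>0 \<phi> P t q u =
     (\<integral>\<^sup>+\<omega>. \<integral>\<^sup>+x. (\<Sum>k. ennreal (2 powr (real k * t x * q x)
                          * cmod (frequency_piece \<phi>\<^sub>0 \<phi> k (u \<omega>) x) powr q x)) \<partial>torus \<partial>P)"

definition besov_space ::
    "(real ^ 'n \<Rightarrow> real) \<Rightarrow> (real ^ 'n \<Rightarrow> real) \<Rightarrow> 'w measure \<Rightarrow> (real ^ 'n \<Rightarrow> real) \<Rightarrow> (real ^ 'n \<Rightarrow> real) \<Rightarrow>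
     ('w \<Rightarrow> (real ^ 'n \<Rightarrow> real) \<Rightarrow> real) set" where
  "besov_space \<phi>\<^sub>0 \<phi> P t q =
     {u \<in> random_distributions P. \<exists>c>0. besov_modular \<phi>\<^sub>0 \<phi> P t q (\<lambda>\<omega> f. c * u \<omega> f) < \<infinity>}"

definition besov_norm ::
    "(real ^ 'n \<Rightarrow> real) \<Rightarrow> (real ^ 'n \<Rightarrow> real) \<Rightarrow> 'w measure \<Rightarrow> (real ^ 'n \<Rightarrow> real) \<Rightarrow> (real ^ 'n \<Rightarrow> real) \<Rightarrow>
     ('w \<Rightarrow> (real ^ 'n \<Rightarrow> real) \<Rightarrow> real) \<Rightarrow> ennreal" where
  "besov_norm \<phi>\<^sub>0 \<phi> P t q u =
     (INF \<mu>\<in>{\<mu>. 0 < \<mu> \<and> besov_modular \<phi>\<^sub>0 \<phi> P t q (\<lambda>\<omega> f. u \<omega> f / \<mu>) \<le> 1}. ennreal \<mu>)"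


section \<open>Wavelets\<close>

definition wavelet_dilate :: "(real \<Rightarrow> real) \<Rightarrow> nat \<Rightarrow> int \<Rightarrow> real \<Rightarrow> real" where
  "wavelet_dilate \<psi> j m x = 2 powr (real j / 2) * \<psi> (2 ^ j * x - of_int m)"

definition L2_inner :: "(real \<Rightarrow> real) \<Rightarrow> (real \<Rightarrow> real) \<Rightarrow> real" where
  "L2_inner f g = (\<integral>x. f x * g x \<partial>lborel)"

definition square_integrable :: "(real \<Rightarrow> real) \<Rightarrow> bool" where
  "square_integrable f \<longleftrightarrow> f \<in> borel_measurable lborel \<and> integrable lborel (\<lambda>x. (f x)\<^sup>2)"

text \<open>
  Two-scale relation: \<open>f\<close> belongs to the closed span of the functions \<open>sqrt 2 * \<psi> (2 x - l)\<close>, that is,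
  to the space \<open>V\<^sub>1\<close> of the multiresolution analysis generated by \<open>\<psi>\<close>.
\<close>

definition two_scale :: "(real \<Rightarrow> real) \<Rightarrow> (real \<Rightarrow> real) \<Rightarrow> bool" where
  "two_scale \<psi> f \<longleftrightarrow>
     (\<exists>h :: int \<Rightarrow> real.
        (\<lambda>N. \<integral>x. (f x - (\<Sum>l\<in>{- int N..int N}. h l * wavelet_dilate \<psi> 1 l x))\<^sup>2 \<partial>lborel) \<longlonglongrightarrow> 0)"

text \<open>
  Scaling function and wavelet of an orthonormal system: translates of the scaling function and
  dyadic dilates and translates of the wavelet form an orthonormal basis of \<open>L\<^sup>2(\<real>)\<close>, and both lie
  in \<open>V\<^sub>1\<close>.  The orthogonal decompositions of the multiresolution analysis are then automatic.
\<close>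

definition orthonormal_wavelets :: "(real \<Rightarrow> real) \<Rightarrow> (real \<Rightarrow> real) \<Rightarrow> bool" where
  "orthonormal_wavelets \<psi>F \<psi>M \<longleftrightarrow>
     square_integrable \<psi>F \<and> square_integrable \<psi>M \<and>
     (\<forall>m m'. L2_inner (wavelet_dilate \<psi>F 0 m) (wavelet_dilate \<psi>F 0 m') = of_bool (m = m')) \<and>
     (\<forall>m j m'. L2_inner (wavelet_dilate \<psi>F 0 m) (wavelet_dilate \<psi>M j m') = 0) \<and>
     (\<forall>j m j' m'. L2_inner (wavelet_dilate \<psi>M j m) (wavelet_dilate \<psi>M j' m') = of_bool (j = j' \<and> m = m')) \<and>
     (\<forall>f. square_integrable f \<longrightarrow>
        (\<forall>m. L2_inner f (wavelet_dilate \<psi>F 0 m) = 0) \<longrightarrow>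
        (\<forall>j m. L2_inner f (wavelet_dilate \<psi>M j m) = 0) \<longrightarrow> (AE x in lborel. f x = 0)) \<and>
     two_scale \<psi>F \<psi>F \<and> two_scale \<psi>F \<psi>M"

text \<open>
  Meyer system.  Its Fourier transforms (with kernel \<open>exp (- i x \<xi>)\<close>) are given by Meyer's window with
  a smooth auxiliary function \<open>\<nu>\<close>.  The products below encode the usual case distinctions: the sine
  vanishes for \<open>\<bar>\<xi>\<bar> \<le> 2\<pi>/3\<close> and equals 1 for \<open>\<bar>\<xi>\<bar> \<ge> 4\<pi>/3\<close>, the last cosine equals 1 for
  \<open>\<bar>\<xi>\<bar> \<le> 4\<pi>/3\<close> and vanishes for \<open>\<bar>\<xi>\<bar> \<ge> 8\<pi>/3\<close>.  The wavelet may be centred at any half-integer,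
  since the conventions in the literature differ there.
\<close>

definition meyer_auxiliary :: "(real \<Rightarrow> real) \<Rightarrow> bool" where
  "meyer_auxiliary \<nu> \<longleftrightarrow> C_infinity \<nu> \<and> (\<forall>x\<le>0. \<nu> x = 0) \<and> (\<forall>x\<ge>1. \<nu> x = 1) \<and>
     (\<forall>x. \<nu> x + \<nu> (1 - x) = 1)"

definition meyer_scaling_ft :: "(real \<Rightarrow> real) \<Rightarrow> real \<Rightarrow> complex" where
  "meyer_scaling_ft \<nu> \<xi> = of_real (cos (pi / 2 * \<nu> (3 * \<bar>\<xi>\<bar> / (2 * pi) - 1)))"

definition meyer_wavelet_ft :: "(real \<Rightarrow> real) \<Rightarrow> int \<Rightarrow> real \<Rightarrow> complex" where
  "meyer_wavelet_ft \<nu> c \<xi> =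
     cis (of_int c * \<xi> / 2) *
     of_real (sin (pi / 2 * \<nu> (3 * \<bar>\<xi>\<bar> / (2 * pi) - 1)) * cos (pi / 2 * \<nu> (3 * \<bar>\<xi>\<bar> / (4 * pi) - 1)))"

definition inverse_fourier :: "(real \<Rightarrow> complex) \<Rightarrow> real \<Rightarrow> complex" where
  "inverse_fourier g x = (1 / (2 * pi)) *\<^sub>R (\<integral>\<xi>. g \<xi> * cis (\<xi> * x) \<partial>lborel)"

definition meyer_system :: "(real \<Rightarrow> real) \<Rightarrow> (real \<Rightarrow> real) \<Rightarrow> bool" where
  "meyer_system \<psi>F \<psi>M \<longleftrightarrow> orthonormal_wavelets \<psi>F \<psi>M \<and>
     (\<exists>\<nu> c. meyer_auxiliary \<nu> \<and> odd c \<and>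
        (\<forall>x. of_real (\<psi>F x) = inverse_fourier (meyer_scaling_ft \<nu>) x) \<and>
        (\<forall>x. of_real (\<psi>M x) = inverse_fourier (meyer_wavelet_ft \<nu> c) x))"

definition daubechies_system :: "nat \<Rightarrow> (real \<Rightarrow> real) \<Rightarrow> (real \<Rightarrow> real) \<Rightarrow> bool" where
  "daubechies_system k \<psi>F \<psi>M \<longleftrightarrow> orthonormal_wavelets \<psi>F \<psi>M \<and>
     C_k k \<psi>F \<and> C_k k \<psi>M \<and>
     (\<exists>R. \<forall>x. R < \<bar>x\<bar> \<longrightarrow> \<psi>F x = 0 \<and> \<psi>M x = 0) \<and>
     (\<forall>a<k. (\<integral>x. x ^ a * \<psi>M x \<partial>lborel) = 0)"

definition admissible_wavelets ::
    "(real ^ 'n \<Rightarrow> real) set \<Rightarrow> (real \<Rightarrow> real) \<Rightarrow> (real \<Rightarrow> real) \<Rightarrow> bool" where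
  "admissible_wavelets rs \<psi>F \<psi>M \<longleftrightarrow> meyer_system \<psi>F \<psi>M \<or>
     (\<exists>k. daubechies_system k \<psi>F \<psi>M \<and> (\<forall>r\<in>rs. max (- ess_inf r) (ess_sup r) < real k))"

datatype gender = Father | Mother

definition G_set :: "nat \<Rightarrow> ('n \<Rightarrow> gender) set" where
  "G_set j = (if j = 0 then UNIV else {G. \<exists>r. G r = Mother})"

definition M_set :: "nat \<Rightarrow> ('n \<Rightarrow> nat) set" where
  "M_set j = {m. \<forall>r. m r < 2 ^ j}"

definition periodic_wavelet ::
    "(real \<Rightarrow> real) \<Rightarrow> (real \<Rightarrow> real) \<Rightarrow> nat \<Rightarrow> ('n::finite \<Rightarrow> gender) \<Rightarrow> ('n \<Rightarrow> nat) \<Rightarrow> real ^ 'n \<Rightarrow> real" where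
  "periodic_wavelet \<psi>F \<psi>M j G m x =
     (\<Prod>r\<in>UNIV. \<Sum>\<^sub>\<infinity>l\<in>(UNIV :: int set).
        2 powr (real j / 2) *
        (case G r of Father \<Rightarrow> \<psi>F | Mother \<Rightarrow> \<psi>M) (2 ^ j * (x $ r + of_int l) - real (m r)))"

lemma finite_M_set [simp]: "finite (M_set j :: ('n::finite \<Rightarrow> nat) set)"
proof -
  have "(M_set j :: ('n \<Rightarrow> nat) set) = Pi\<^sub>E UNIV (\<lambda>_. {..<2 ^ j})"
    by (auto simp: M_set_def PiE_def Pi_def)
  thus ?thesis by (simp add: finite_PiE)
qed

lemma finite_G_set [simp]: "finite (G_set j :: ('n::finite \<Rightarrow> gender) set)"
proof -
  have "(UNIV :: gender set) = {Father, Mother}"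
    using gender.exhaust by auto
  hence "finite (UNIV :: gender set)" by (metis finite.emptyI finite.insertI)
  hence "finite (Pi\<^sub>E (UNIV :: 'n set) (\<lambda>_. UNIV :: gender set))" by (intro finite_PiE) auto
  thus ?thesis by (rule finite_subset[rotated]) auto
qed


section \<open>The random series\<close>

definition exponential_weight :: "(real ^ 'n) measure \<Rightarrow> (real ^ 'n \<Rightarrow> real) \<Rightarrow> real \<Rightarrow> real" where
  "exponential_weight \<kappa> q x = exp (- (1 / 2) * (\<integral>y. \<bar>x\<bar> powr q y \<partial>\<kappa>))"

text \<open>The weight is even, so that the distribution is automatically centred.\<close>

definition q_exponential_density :: "(real ^ 'n) measure \<Rightarrow> (real ^ 'n \<Rightarrow> real) \<Rightarrow> real \<Rightarrow> real" where
  "q_exponential_density \<kappa> q x =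
     exponential_weight \<kappa> q x / (\<integral>z. exponential_weight \<kappa> q z \<partial>lborel)"

definition series_index :: "(nat \<times> ('n \<Rightarrow> gender) \<times> ('n \<Rightarrow> nat)) set" where
  "series_index = {(j, G, m). G \<in> G_set j \<and> m \<in> M_set j}"

definition iid_q_exponential ::
    "'w measure \<Rightarrow> (real ^ 'n) measure \<Rightarrow> (real ^ 'n \<Rightarrow> real) \<Rightarrow>
     (nat \<Rightarrow> ('n \<Rightarrow> gender) \<Rightarrow> ('n \<Rightarrow> nat) \<Rightarrow> 'w \<Rightarrow> real) \<Rightarrow> bool" where
  "iid_q_exponential P \<kappa> q \<xi> \<longleftrightarrow>
     prob_space.indep_vars P (\<lambda>_. borel) (\<lambda>(j, G, m). \<xi> j G m) series_index \<and>
     (\<forall>(j, G, m)\<in>series_index.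
        distributed P lborel (\<xi> j G m) (\<lambda>x. ennreal (q_exponential_density \<kappa> q x)))"

definition series_coeff ::
    "real \<Rightarrow> (real ^ 'n \<Rightarrow> real) \<Rightarrow> (real ^ 'n \<Rightarrow> real) \<Rightarrow> nat \<Rightarrow> ('n \<Rightarrow> nat) \<Rightarrow> real" where
  "series_coeff \<delta> s q j m =
     2 powr (- real j * (s (\<chi> r. real (m r) / 2 ^ j) + real CARD('n) / 2 - real CARD('n) / ess_sup q))
     * (1 / \<delta>) powr (1 / ess_sup q)"

definition partial_series ::
    "(real \<Rightarrow> real) \<Rightarrow> (real \<Rightarrow> real) \<Rightarrow> real \<Rightarrow> (real ^ 'n \<Rightarrow> real) \<Rightarrow> (real ^ 'n \<Rightarrow> real) \<Rightarrow>
     (nat \<Rightarrow> ('n::finite \<Rightarrow> gender) \<Rightarrow> ('n \<Rightarrow> nat) \<Rightarrow> 'w \<Rightarrow> real) \<Rightarrow> nat \<Rightarrow> 'w \<Rightarrow> real ^ 'n \<Rightarrow> real" where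
  "partial_series \<psi>F \<psi>M \<delta> s q \<xi> N \<omega> x =
     (\<Sum>j\<le>N. \<Sum>G\<in>G_set j. \<Sum>m\<in>M_set j.
        series_coeff \<delta> s q j m * \<xi> j G m \<omega> * periodic_wavelet \<psi>F \<psi>M j G m x)"

definition random_partial_series ::
    "(real \<Rightarrow> real) \<Rightarrow> (real \<Rightarrow> real) \<Rightarrow> real \<Rightarrow> (real ^ 'n \<Rightarrow> real) \<Rightarrow> (real ^ 'n \<Rightarrow> real) \<Rightarrow>
     (nat \<Rightarrow> ('n::finite \<Rightarrow> gender) \<Rightarrow> ('n \<Rightarrow> nat) \<Rightarrow> 'w \<Rightarrow> real) \<Rightarrow> nat \<Rightarrow>
     'w \<Rightarrow> (real ^ 'n \<Rightarrow> real) \<Rightarrow> real" where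
  "random_partial_series \<psi>F \<psi>M \<delta> s q \<xi> N \<omega> =
     regular_distribution (partial_series \<psi>F \<psi>M \<delta> s q \<xi> N \<omega>)"

definition admissible_smoothness ::
    "(real ^ 'n \<Rightarrow> real) \<Rightarrow> (real ^ 'n \<Rightarrow> real) \<Rightarrow> (real ^ 'n \<Rightarrow> real) \<Rightarrow> bool" where
  "admissible_smoothness s q t \<longleftrightarrow> C_log_loc t \<and> L_infinity t \<and>
     (SUP x. ereal (t x - s x + real CARD('n) / ess_sup q)) < 0"

end

theory Submission
  imports Defs
begin

text \<open>
  The modular of a random series is an integral over the probability space and the torus of powers
  \<open>\<bar>\<Sum>\<^sub>i a\<^sub>i \<xi>\<^sub>i\<bar> ^ q(x)\<close> with deterministic weights \<open>a\<^sub>i\<close>. By Jensen's inequality such a power is at most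
  \<open>\<Sum>\<^sub>i a\<^sub>i \<bar>\<xi>\<^sub>i\<bar> ^ q(x)\<close> once \<open>\<Sum>\<^sub>i a\<^sub>i \<le> 1\<close>; since all moments of the noise are finite, independence is
  irrelevant and only the sums of the weights matter. It suffices that the weights belonging to
  the wavelet level \<open>j\<close> and the frequency \<open>k\<close> add up to at most \<open>C 2 ^ (- \<eta> (j + k))\<close>, uniformly in \<open>x\<close>.
  Because \<open>t \<le> s - n / q\<^sup>+ - \<epsilon>\<close>, one may replace \<open>t\<close> by \<open>s - n / q\<^sup>+ - \<epsilon>\<close>, which is log-Hoelder continuous, so that
  \<open>2 ^ (j t)\<close> at the centre of a wavelet and at \<open>x\<close> differ by a polynomial factor in the distance. The
  decay in \<open>\<bar>j - k\<bar>\<close> comes from moving \<open>K\<close> derivatives from the frequency multiplier to the wavelet when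
  \<open>k > j\<close>, and \<open>K\<close> antiderivatives, which exist by the vanishing moments, when \<open>k \<le> j\<close>; the spatial
  decay of the multiplier kernels is obtained from summation by parts.
\<close>

section \<open>Smoothness in a direction\<close>

text \<open>Two demands shape the proof. The limit has to be one random distribution
  \<open>u\<close> for all admissible smoothness functions at once. It is therefore built pathwise,
  as an almost surely convergent series of distributions of finite order, and every statement about
  norms concerns a finite or infinite tail of that one series (\<open>is_tail\<close>); membership,
  the Cauchy property and convergence all follow from one modular estimate for tails. Secondly,
  Jensen's inequality wants weights of total mass at most 1 and a fixed power, whereas q(x) varies:
  dividing by \<mu> makes the mass small, and an even integer Q above q takes the place of q(x), so
  that one moment bound serves all x. Daubechies wavelets offer only finitely many derivatives and
  moments, so the budget is tight: with \<tau> = s - n/q+ - \<epsilon>, K antiderivatives tolerate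
  \<tau> down to -K and K derivatives tolerate \<tau> below K, and the gap 2 \<eta> left at the
  upper end is what gives decay in the frequency k beyond the wavelet level j.\<close>

definition dir_deriv :: "'a::euclidean_space \<Rightarrow> ('a \<Rightarrow> real) \<Rightarrow> ('a \<Rightarrow> real) \<Rightarrow> bool" where
  "dir_deriv e f g \<longleftrightarrow> (\<forall>x. ((\<lambda>h. f (x + h *\<^sub>R e)) has_real_derivative g x) (at 0))"

definition locally_bounded :: "('a::euclidean_space \<Rightarrow> real) \<Rightarrow> bool" where
  "locally_bounded f \<longleftrightarrow> (\<forall>R. \<exists>B. \<forall>x. norm x \<le> R \<longrightarrow> \<bar>f x\<bar> \<le> B)"

text \<open>Repeated derivatives along one fixed direction are all that the decay of a kernel in one
  coordinate requires. Local boundedness stands in for continuity: it is inherited by sums, products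
  and the quotients below, and together with compact support it gives global bounds.\<close>

fun smooth_dir :: "'a::euclidean_space \<Rightarrow> nat \<Rightarrow> ('a \<Rightarrow> real) \<Rightarrow> bool" where
  "smooth_dir e 0 f \<longleftrightarrow> locally_bounded f"
| "smooth_dir e (Suc A) f \<longleftrightarrow> locally_bounded f \<and> (\<exists>g. dir_deriv e f g \<and> smooth_dir e A g)"

lemma locally_boundedE:
  assumes "locally_bounded f"
  obtains B where "0 \<le> B" "\<And>x. norm x \<le> R \<Longrightarrow> \<bar>f x\<bar> \<le> B"
proof -
  from assms obtain B where B: "\<forall>x. norm x \<le> R \<longrightarrow> \<bar>f x\<bar> \<le> B"
    unfolding locally_bounded_def by blast
  show ?thesis
  proof (rule that[of "\<bar>B\<bar>"])
    show "\<bar>f x\<bar> \<le> \<bar>B\<bar>" if "norm x \<le> R" for x using B that abs_ge_self order_trans by blast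
  qed simp
qed

lemma dir_derivD:
  assumes "dir_deriv e f g"
  shows "((\<lambda>h. f (x + h *\<^sub>R e)) has_real_derivative g (x + h0 *\<^sub>R e)) (at h0)"
proof -
  have "((\<lambda>h. f ((x + h0 *\<^sub>R e) + h *\<^sub>R e)) has_real_derivative g (x + h0 *\<^sub>R e)) (at (h0 - h0))"
    using assms by (simp add: dir_deriv_def)
  from DERIV_shift[of "\<lambda>h. f ((x + h0 *\<^sub>R e) + h *\<^sub>R e)" _ h0 "-h0"] this
  have "((\<lambda>h. f ((x + h0 *\<^sub>R e) + (h - h0) *\<^sub>R e)) has_real_derivative g (x + h0 *\<^sub>R e)) (at h0)"
    by simp
  moreover have "(x + h0 *\<^sub>R e) + (h - h0) *\<^sub>R e = x + h *\<^sub>R e" for h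
    by (simp add: algebra_simps)
  ultimately show ?thesis by simp
qed

lemma dir_deriv_add: "dir_deriv e f f' \<Longrightarrow> dir_deriv e g g' \<Longrightarrow> dir_deriv e (\<lambda>x. f x + g x) (\<lambda>x. f' x + g' x)"
  unfolding dir_deriv_def by (intro allI DERIV_add) auto

lemma dir_deriv_mult:
  assumes "dir_deriv e f f'" "dir_deriv e g g'"
  shows "dir_deriv e (\<lambda>x. f x * g x) (\<lambda>x. f' x * g x + g' x * f x)"
  unfolding dir_deriv_def
proof
  fix x
  show "((\<lambda>h. f (x + h *\<^sub>R e) * g (x + h *\<^sub>R e)) has_real_derivative f' x * g x + g' x * f x) (at 0)"
    using DERIV_mult[OF assms(1)[unfolded dir_deriv_def, rule_format, of x] assms(2)[unfolded dir_deriv_def, rule_format, of x]] by simp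
qed

text \<open>Carries the support of a function, and its vanishing near the origin, over to its
  derivatives.\<close>

lemma dir_deriv_cong_zero:
  assumes "dir_deriv e f g" "\<And>x. x \<in> U \<Longrightarrow> f x = 0" "open U" "x \<in> U"
  shows "g x = 0"
proof -
  have "((\<lambda>h. x + h *\<^sub>R e) \<longlongrightarrow> x + 0 *\<^sub>R e) (at 0)" by (intro tendsto_intros)
  hence "eventually (\<lambda>h. x + h *\<^sub>R e \<in> U) (at 0)"
    using assms(3,4) by (intro topological_tendstoD) auto
  hence ev: "eventually (\<lambda>h. x + h *\<^sub>R e \<in> U) (nhds 0)"
    using assms(4) by (auto simp: eventually_at_filter elim!: eventually_mono)
  have "((\<lambda>h. f (x + h *\<^sub>R e)) has_real_derivative g x) (at 0)"
    using assms(1) by (simp add: dir_deriv_def)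
  moreover have "((\<lambda>h. f (x + h *\<^sub>R e)) has_real_derivative 0) (at 0)"
    by (rule DERIV_cong_ev[THEN iffD2, of _ 0 _ "\<lambda>_. 0"]) (use ev assms(2) in \<open>auto elim!: eventually_mono\<close>)
  ultimately show ?thesis by (rule DERIV_unique)
qed

lemma locally_bounded_add:
  assumes "locally_bounded f" "locally_bounded g"
  shows "locally_bounded (\<lambda>x. f x + g x)"
  unfolding locally_bounded_def
proof
  fix R
  obtain B C where "\<forall>x. norm x \<le> R \<longrightarrow> \<bar>f x\<bar> \<le> B" "\<forall>x. norm x \<le> R \<longrightarrow> \<bar>g x\<bar> \<le> C"
    using assms unfolding locally_bounded_def by meson
  hence "\<forall>x. norm x \<le> R \<longrightarrow> \<bar>f x + g x\<bar> \<le> B + C"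
    by (metis abs_triangle_ineq add_mono order_trans)
  thus "\<exists>B. \<forall>x. norm x \<le> R \<longrightarrow> \<bar>f x + g x\<bar> \<le> B" by blast
qed

lemma locally_bounded_mult:
  assumes "locally_bounded f" "locally_bounded g"
  shows "locally_bounded (\<lambda>x. f x * g x)"
  unfolding locally_bounded_def
proof
  fix R
  obtain B where B: "0 \<le> B" "\<And>x. norm x \<le> R \<Longrightarrow> \<bar>f x\<bar> \<le> B" using locally_boundedE[OF assms(1), where R = R] by blast
  obtain C where C: "0 \<le> C" "\<And>x. norm x \<le> R \<Longrightarrow> \<bar>g x\<bar> \<le> C" using locally_boundedE[OF assms(2), where R = R] by blast
  have "\<forall>x. norm x \<le> R \<longrightarrow> \<bar>f x * g x\<bar> \<le> B * C"
    using B C by (auto simp: abs_mult intro!: mult_mono)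
  thus "\<exists>B. \<forall>x. norm x \<le> R \<longrightarrow> \<bar>f x * g x\<bar> \<le> B" by blast
qed

lemma locally_bounded_const: "locally_bounded (\<lambda>_. c)"
  unfolding locally_bounded_def by (intro allI exI[of _ "\<bar>c\<bar>"]) auto

lemma locally_bounded_continuous:
  assumes "continuous_on UNIV f"
  shows "locally_bounded f"
  unfolding locally_bounded_def
proof
  fix R
  have "compact (f ` cball 0 R)"
    by (intro compact_continuous_image continuous_on_subset[OF assms]) auto
  then obtain B where "\<forall>y\<in>f ` cball 0 R. norm y \<le> B"
    using compact_imp_bounded bounded_iff by metis
  thus "\<exists>B. \<forall>x. norm x \<le> R \<longrightarrow> \<bar>f x\<bar> \<le> B" by (intro exI[of _ B]) auto
qed

lemma smooth_dir_locally_bounded: "smooth_dir e A f \<Longrightarrow> locally_bounded f"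
  by (cases A) auto

lemma smooth_dir_SucD: "smooth_dir e (Suc A) f \<Longrightarrow> smooth_dir e A f"
  by (induction A arbitrary: f) auto

lemma smooth_dir_zero: "smooth_dir e A (\<lambda>_. 0)"
proof (induction A)
  case (Suc A)
  have "dir_deriv e (\<lambda>_. 0) (\<lambda>_. 0)" by (simp add: dir_deriv_def)
  with Suc show ?case by (auto simp: locally_bounded_const)
qed (simp add: locally_bounded_const)

lemma smooth_dir_const: "smooth_dir e A (\<lambda>_. c)"
proof (cases A)
  case (Suc A)
  have "dir_deriv e (\<lambda>_. c) (\<lambda>_. 0)" by (simp add: dir_deriv_def)
  with Suc show ?thesis by (auto simp: locally_bounded_const smooth_dir_zero)
qed (simp add: locally_bounded_const)

lemma smooth_dir_inner: "smooth_dir e A (\<lambda>x. x \<bullet> b)"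
proof (cases A)
  case (Suc A)
  have "dir_deriv e (\<lambda>x. x \<bullet> b) (\<lambda>_. e \<bullet> b)"
    unfolding dir_deriv_def by (auto simp: inner_add_left intro!: derivative_eq_intros)
  with Suc show ?thesis
    by (auto simp: smooth_dir_const intro!: locally_bounded_continuous continuous_intros)
qed (auto intro!: locally_bounded_continuous continuous_intros)

lemma smooth_dir_add: "smooth_dir e A f \<Longrightarrow> smooth_dir e A g \<Longrightarrow> smooth_dir e A (\<lambda>x. f x + g x)"
proof (induction A arbitrary: f g)
  case (Suc A)
  from Suc.prems obtain f' g' where "dir_deriv e f f'" "smooth_dir e A f'" "dir_deriv e g g'" "smooth_dir e A g'"
    by auto
  with dir_deriv_add[of e f f' g g'] Suc.IH[of f' g'] Suc.prems show ?case by (auto intro: locally_bounded_add)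
qed (auto intro: locally_bounded_add)

lemma smooth_dir_mult: "smooth_dir e A f \<Longrightarrow> smooth_dir e A g \<Longrightarrow> smooth_dir e A (\<lambda>x. f x * g x)"
proof (induction A arbitrary: f g)
  case (Suc A)
  from Suc.prems obtain f' g' where *: "dir_deriv e f f'" "smooth_dir e A f'" "dir_deriv e g g'" "smooth_dir e A g'"
    by auto
  have "smooth_dir e A (\<lambda>x. f' x * g x + g' x * f x)"
    using * smooth_dir_SucD[OF Suc.prems(1)] smooth_dir_SucD[OF Suc.prems(2)]
    by (intro smooth_dir_add Suc.IH) auto
  with dir_deriv_mult[OF *(1,3)] Suc.prems show ?case by (auto intro: locally_bounded_mult)
qed (auto intro: locally_bounded_mult)

lemma smooth_dir_cmult: "smooth_dir e A f \<Longrightarrow> smooth_dir e A (\<lambda>x. c * f x)"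
  by (intro smooth_dir_mult smooth_dir_const)

lemma smooth_dir_power: "smooth_dir e A f \<Longrightarrow> smooth_dir e A (\<lambda>x. f x ^ n)"
  by (induction n) (auto intro: smooth_dir_const smooth_dir_mult)

lemma smooth_dir_sum: "(\<And>i. i \<in> I \<Longrightarrow> smooth_dir e A (f i)) \<Longrightarrow> smooth_dir e A (\<lambda>x. \<Sum>i\<in>I. f i x)"
  by (induction I rule: infinite_finite_induct) (auto intro: smooth_dir_const smooth_dir_add)

text \<open>The numerator vanishes on the ball where \<rho> may have zeros, so the quotient is 0
  there; outside, \<rho> is bounded away from 0. Serves for the decomposition of a bump on an
  annulus and for dividing a Meyer window by a power of the frequency.\<close>

lemma smooth_dir_divide:
  assumes "smooth_dir e A f" "\<And>A. smooth_dir e A \<rho>" "\<And>x. norm x < r \<Longrightarrow> f x = 0"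
    and \<rho>: "\<And>x. r \<le> norm x \<Longrightarrow> c \<le> \<bar>\<rho> x\<bar>" "0 < c"
  shows "smooth_dir e A (\<lambda>x. f x / \<rho> x)"
  using assms(1,3)
proof (induction A arbitrary: f)
  have bdd: "locally_bounded (\<lambda>x. f x / \<rho> x)"
    if bf: "locally_bounded f" and f0: "\<And>x. norm x < r \<Longrightarrow> f x = 0" for f
    unfolding locally_bounded_def
  proof
    fix R
    obtain B where B: "0 \<le> B" "\<And>x. norm x \<le> R \<Longrightarrow> \<bar>f x\<bar> \<le> B"
      using locally_boundedE[OF bf, where R = R] by blast
    have "\<bar>f x / \<rho> x\<bar> \<le> \<bar>B\<bar> / c" if x: "norm x \<le> R" for x
    proof (cases "norm x < r")
      case False
      thus ?thesis using B(2)[OF x] \<rho>(1)[of x] \<rho>(2) by (simp add: frac_le)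
    qed (use \<rho>(2) f0 B in auto)
    thus "\<exists>B. \<forall>x. norm x \<le> R \<longrightarrow> \<bar>f x / \<rho> x\<bar> \<le> B" by blast
  qed
  {
    case 0 thus ?case using bdd by auto
  next
    case (Suc A)
    from Suc.prems obtain f' where f': "dir_deriv e f f'" "smooth_dir e A f'" by auto
    from assms(2)[of "Suc A"] obtain \<rho>' where \<rho>': "dir_deriv e \<rho> \<rho>'" "smooth_dir e A \<rho>'" by auto
    have f'0: "f' x = 0" if "norm x < r" for x
      using dir_deriv_cong_zero[OF f'(1), of "ball 0 r" x] Suc.prems(2) that by auto
    \<comment> \<open>The square in the quotient rule is written as two successive divisions by
      \<rho>, each with a numerator that vanishes on the ball, so that the induction hypothesis
      covers both.\<close>
    have "smooth_dir e A (\<lambda>x. f' x / \<rho> x + (- 1) * (((f x * \<rho>' x) / \<rho> x) / \<rho> x))"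
      using Suc.prems(2) f' \<rho>' f'0 smooth_dir_SucD[OF Suc.prems(1)]
      by (intro smooth_dir_add smooth_dir_cmult Suc.IH smooth_dir_mult) auto
    moreover have "dir_deriv e (\<lambda>x. f x / \<rho> x) (\<lambda>x. f' x / \<rho> x + (- 1) * (((f x * \<rho>' x) / \<rho> x) / \<rho> x))"
      unfolding dir_deriv_def
    proof
      fix x
      show "((\<lambda>h. f (x + h *\<^sub>R e) / \<rho> (x + h *\<^sub>R e)) has_real_derivative
             f' x / \<rho> x + (- 1) * (((f x * \<rho>' x) / \<rho> x) / \<rho> x)) (at 0)"
      proof (cases "norm x < r")
        case True
        have "((\<lambda>h. norm (x + h *\<^sub>R e)) \<longlongrightarrow> norm (x + 0 *\<^sub>R e)) (nhds 0)"
          by (intro tendsto_intros filterlim_ident)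
        hence ev: "eventually (\<lambda>h. norm (x + h *\<^sub>R e) < r) (nhds 0)"
          using order_tendstoD(2)[of _ "norm x" "nhds 0" r] True by simp
        have "((\<lambda>h. f (x + h *\<^sub>R e) / \<rho> (x + h *\<^sub>R e)) has_real_derivative 0) (at 0)"
          by (rule DERIV_cong_ev[THEN iffD2, of _ 0 _ "\<lambda>_. 0"])
             (use ev Suc.prems(2) in \<open>auto elim!: eventually_mono\<close>)
        thus ?thesis using Suc.prems(2) f'0 True by simp
      next
        case False
        hence nz: "\<rho> x \<noteq> 0" using \<rho>(1)[of x] \<rho>(2) by auto
        have "((\<lambda>h. f (x + h *\<^sub>R e) / \<rho> (x + h *\<^sub>R e)) has_real_derivative
           (f' x * \<rho> (x + 0 *\<^sub>R e) - f (x + 0 *\<^sub>R e) * \<rho>' x) / (\<rho> (x + 0 *\<^sub>R e) * \<rho> (x + 0 *\<^sub>R e))) (at 0)"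
          using f'(1) \<rho>'(1) nz by (intro DERIV_divide) (auto simp: dir_deriv_def)
        thus ?thesis using nz by (simp add: field_simps)
      qed
    qed
    ultimately show ?case using bdd Suc.prems by (auto simp: smooth_dir_locally_bounded)
  }
qed

lemma dir_deriv_partial_diff:
  assumes "\<And>x. f differentiable (at x)"
  shows "dir_deriv e f (partial_diff e f)"
  unfolding dir_deriv_def
proof
  fix x
  have 1: "(f has_derivative frechet_derivative f (at x)) (at (x + 0 *\<^sub>R e))"
    using assms[of x, THEN frechet_derivative_works[THEN iffD1]] by simp
  have 2: "((\<lambda>h. x + h *\<^sub>R e) has_derivative (\<lambda>h. h *\<^sub>R e)) (at 0)"
    by (auto intro!: derivative_eq_intros)
  have "((\<lambda>h. f (x + h *\<^sub>R e)) has_derivative (\<lambda>h. frechet_derivative f (at x) (h *\<^sub>R e))) (at 0)"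
    using has_derivative_compose[OF 2 1] by simp
  moreover have "frechet_derivative f (at x) (h *\<^sub>R e) = partial_diff e f x * h" for h
    using linear_frechet_derivative[OF assms] by (simp add: linear_scale partial_diff_def)
  ultimately show "((\<lambda>h. f (x + h *\<^sub>R e)) has_real_derivative partial_diff e f x) (at 0)"
    by (simp add: has_field_derivative_def mult_commute_abs)
qed

lemma C_infinity_partial_diffs:
  assumes "C_infinity f" "set bs \<subseteq> Basis"
  shows "partial_diffs bs f differentiable (at x)" "continuous_on UNIV (partial_diffs bs f)"
  using assms lessI order_refl unfolding C_infinity_def C_k_def by blast+

lemma C_infinity_smooth_dir:
  assumes "C_infinity f" "e \<in> Basis"
  shows "smooth_dir e A f"
proof -
  have "smooth_dir e A (partial_diffs bs f)" if "set bs \<subseteq> Basis" for bs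
    using that
  proof (induction A arbitrary: bs)
    case 0
    thus ?case using C_infinity_partial_diffs[OF assms(1)] by (auto intro: locally_bounded_continuous)
  next
    case (Suc A)
    have "dir_deriv e (partial_diffs bs f) (partial_diffs (e # bs) f)"
      using dir_deriv_partial_diff[of "partial_diffs bs f" e] C_infinity_partial_diffs(1)[OF assms(1) Suc.prems]
      by (simp add: partial_diffs_def)
    thus ?case using Suc.IH[of "e # bs"] Suc.prems assms C_infinity_partial_diffs(2)[OF assms(1) Suc.prems]
      by (auto intro: locally_bounded_continuous)
  qed
  from this[of "[]"] show ?thesis by (simp add: partial_diffs_def)
qed

section \<open>Finite differences of functions with a bounded derivative of high order\<close>

fun deriv_bound :: "'a::euclidean_space \<Rightarrow> nat \<Rightarrow> real \<Rightarrow> ('a \<Rightarrow> real) \<Rightarrow> bool" where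
  "deriv_bound e 0 B f \<longleftrightarrow> (\<forall>x. \<bar>f x\<bar> \<le> B)"
| "deriv_bound e (Suc A) B f \<longleftrightarrow> (\<exists>g. dir_deriv e f g \<and> deriv_bound e A B g)"

lemma deriv_bound_compact_support:
  assumes "smooth_dir e A f" "\<And>x. R < norm x \<Longrightarrow> f x = 0"
  shows "\<exists>B. deriv_bound e A B f"
  using assms
proof (induction A arbitrary: f)
  case 0
  then obtain B where B: "0 \<le> B" "\<And>x. norm x \<le> R \<Longrightarrow> \<bar>f x\<bar> \<le> B"
    by (auto elim: locally_boundedE[where R = R])
  have "\<bar>f x\<bar> \<le> B" for x using B(1) B(2)[of x] 0(2)[of x] by (cases "norm x \<le> R") auto
  thus ?case by auto
next
  case (Suc A)
  then obtain g where g: "dir_deriv e f g" "smooth_dir e A g" by auto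
  have "g x = 0" if "R < norm x" for x
    using dir_deriv_cong_zero[OF g(1), of "- cball 0 R" x] Suc.prems(2) that by auto
  with Suc.IH[OF g(2)] g(1) show ?case by auto
qed

definition backward_diff :: "'a::ab_group_add \<Rightarrow> ('a \<Rightarrow> 'b::ab_group_add) \<Rightarrow> 'a \<Rightarrow> 'b" where
  "backward_diff v f x = f (x - v) - f x"

lemma dir_deriv_backward_diff:
  assumes "dir_deriv e f g"
  shows "dir_deriv e (backward_diff v f) (backward_diff v g)"
  unfolding dir_deriv_def
proof
  fix x
  have "((\<lambda>h. f ((x - v) + h *\<^sub>R e) - f (x + h *\<^sub>R e)) has_real_derivative g (x - v) - g x) (at 0)"
    using assms by (intro DERIV_diff) (auto simp: dir_deriv_def)
  thus "((\<lambda>h. backward_diff v f (x + h *\<^sub>R e)) has_real_derivative backward_diff v g x) (at 0)"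
    by (simp add: backward_diff_def algebra_simps)
qed

text \<open>One difference of step \<delta> consumes one derivative and yields a factor \<delta> by
  the mean value theorem; derivatives of the difference are differences of the derivatives.\<close>

lemma deriv_bound_backward_diff:
  assumes "deriv_bound e (Suc A) B f" "0 < \<delta>"
  shows "deriv_bound e A (B * \<delta>) (backward_diff (\<delta> *\<^sub>R e) f)"
  using assms(1)
proof (induction A arbitrary: f)
  case 0
  then obtain g where g: "dir_deriv e f g" "\<And>x. \<bar>g x\<bar> \<le> B" by auto
  have "\<bar>backward_diff (\<delta> *\<^sub>R e) f x\<bar> \<le> B * \<delta>" for x
  proof -
    define y where "y = x - \<delta> *\<^sub>R e"
    have "\<exists>z. 0 < z \<and> z < \<delta> \<and> f (y + \<delta> *\<^sub>R e) - f (y + 0 *\<^sub>R e) = (\<delta> - 0) * g (y + z *\<^sub>R e)"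
      by (rule MVT2) (use assms(2) dir_derivD[OF g(1), of y] in auto)
    then obtain z where "f x - f y = \<delta> * g (y + z *\<^sub>R e)" by (auto simp: y_def)
    hence "\<bar>f x - f y\<bar> = \<delta> * \<bar>g (y + z *\<^sub>R e)\<bar>" using assms(2) by (simp add: abs_mult)
    also have "\<dots> \<le> \<delta> * B" using g(2) assms(2) by (intro mult_left_mono) auto
    finally show ?thesis by (simp add: backward_diff_def y_def abs_minus_commute mult.commute)
  qed
  thus ?case by simp
next
  case (Suc A)
  obtain g where "dir_deriv e f g" "deriv_bound e (Suc A) B g"
    using Suc.prems deriv_bound.simps(2) by blast
  with Suc.IH[of g] dir_deriv_backward_diff[of e f g "\<delta> *\<^sub>R e"] show ?case by (simp only: deriv_bound.simps(2)) blast
qed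

lemma deriv_bound_finite_difference:
  assumes "deriv_bound e A B f" "0 < \<delta>"
  shows "\<bar>(backward_diff (\<delta> *\<^sub>R e) ^^ A) f x\<bar> \<le> B * \<delta> ^ A"
  using assms(1)
proof (induction A arbitrary: f B)
  case (Suc A)
  from Suc.IH[OF deriv_bound_backward_diff[OF Suc.prems assms(2)]]
  show ?case by (simp add: funpow_swap1 mult.assoc)
qed simp

section \<open>Kernels of smooth multipliers\<close>

definition int_dist :: "real \<Rightarrow> real" where
  "int_dist x = \<bar>x - of_int (round x)\<bar>"

lemma int_dist_nonneg [simp]: "0 \<le> int_dist x"
  by (simp add: int_dist_def)

lemma int_dist_le: "int_dist x \<le> \<bar>x - of_int m\<bar>"
  by (simp add: int_dist_def round_diff_minimal)

lemma int_dist_le_half: "int_dist x \<le> 1 / 2"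
  using of_int_round_abs_le[of x] by (simp add: int_dist_def abs_minus_commute)

lemma borel_measurable_int_dist [measurable]: "int_dist \<in> borel_measurable borel"
  unfolding int_dist_def round_def by measurable

text \<open>Half of Jordan's inequality. Up to pi/3 the cosine is at least 1/2 and the mean value
  theorem applies; beyond, 1/2 separates the two sides.\<close>

lemma sin_ge_linear:
  assumes "0 \<le> y" "y \<le> pi / 2"
  shows "y / pi \<le> sin y"
proof (cases "y \<le> pi / 3")
  case True
  show ?thesis
  proof (cases "y = 0")
    case False
    hence "\<exists>z. 0 < z \<and> z < y \<and> sin y - sin 0 = (y - 0) * cos z"
      using assms by (intro MVT2) (auto intro!: derivative_eq_intros)
    then obtain z where z: "0 < z" "z < y" "sin y = y * cos z" by auto
    have "cos (pi / 3) \<le> cos z"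
      using z True by (intro cos_monotone_0_pi_le) auto
    hence "y * (1 / 2) \<le> y * cos z" using assms by (intro mult_left_mono) (auto simp: cos_60)
    moreover have "y / pi \<le> y * (1 / 2)" using assms pi_gt3 mult_right_mono[of 2 pi y] by (simp add: field_simps)
    ultimately show ?thesis unfolding z(3) by linarith
  qed simp
next
  case False
  have "sin (pi / 6) \<le> sin y" using False assms pi_gt_zero by (intro sin_monotone_2pi_le) auto
  moreover have "y / pi \<le> 1 / 2" using assms pi_gt_zero by (simp add: field_simps)
  ultimately show ?thesis unfolding sin_30 by linarith
qed

text \<open>The right-hand side equals 2 |sin (pi d)| for the signed distance d of x to the nearest
  integer. It is the factor that one summation by parts puts in front of a trigonometric
  sum.\<close>

lemma int_dist_le_cis: "int_dist x \<le> cmod (cis (2 * pi * x) - 1)"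
proof -
  define d where "d = x - of_int (round x)"
  have "cis (2 * pi * x) = cis (2 * pi * d + 2 * pi * of_int (round x))"
    by (simp add: d_def algebra_simps)
  also have "\<dots> = cis (2 * pi * d) * cis (2 * pi * of_int (round x))" by (rule cis_mult[symmetric])
  also have "cis (2 * pi * of_int (round x)) = 1" by (rule cis_multiple_2pi) auto
  finally have "cis (2 * pi * x) = cis (2 * pi * d)" by simp
  moreover have "\<bar>d\<bar> \<le> cmod (cis (2 * pi * d) - 1)"
  proof (rule power2_le_imp_le)
    let ?y = "pi * \<bar>d\<bar>"
    have d: "\<bar>d\<bar> \<le> 1 / 2" using int_dist_le_half[of x] by (simp add: int_dist_def d_def)
    have "?y / pi \<le> sin ?y" using d by (intro sin_ge_linear) auto
    hence "\<bar>d\<bar>\<^sup>2 \<le> (sin ?y)\<^sup>2" by (intro power_mono) auto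
    also have "(sin ?y)\<^sup>2 = (sin (pi * d))\<^sup>2" by (cases "d \<ge> 0") auto
    also have "\<dots> \<le> 4 * (sin (pi * d))\<^sup>2" by simp
    also have "4 * (sin (pi * d))\<^sup>2 = 2 - 2 * cos (2 * (pi * d))"
      by (simp only: cos_double_sin) simp
    also have "\<dots> = (cos (2 * pi * d) - 1)\<^sup>2 + (sin (2 * pi * d))\<^sup>2"
      using sin_cos_squared_add[of "2 * pi * d"] by (simp add: power2_eq_square algebra_simps)
    also have "\<dots> = (cmod (cis (2 * pi * d) - 1))\<^sup>2" by (simp add: cmod_power2)
    finally show "\<bar>d\<bar>\<^sup>2 \<le> (cmod (cis (2 * pi * d) - 1))\<^sup>2" .
  qed simp
  ultimately show ?thesis by (simp add: int_dist_def d_def)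
qed

text \<open>A product over the coordinates rather than a power of one distance: integrals over the
  torus and sums over the dyadic grid then factor into one-dimensional ones. Exponent 2 makes these
  converge; any surplus in B is free for other uses.\<close>

definition torus_weight :: "nat \<Rightarrow> nat \<Rightarrow> real ^ 'n \<Rightarrow> real" where
  "torus_weight B k z = (\<Prod>i\<in>UNIV. 1 / (1 + 2 ^ k * int_dist (z $ i)) ^ B)"

lemma torus_weight_pos: "0 < torus_weight B k z"
  unfolding torus_weight_def by (intro prod_pos) (auto intro!: zero_less_power add_pos_nonneg)

definition int_box :: "int \<Rightarrow> (int ^ 'n) set" where
  "int_box N = {\<mu>. \<forall>i. \<bar>\<mu> $ i\<bar> \<le> N}"

lemma int_box_mono: "M \<le> N \<Longrightarrow> int_box M \<subseteq> int_box N"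
  by (auto simp: int_box_def intro: order_trans)

lemma int_box_card:
  assumes "0 \<le> N"
  shows "finite (int_box N :: (int ^ 'n) set)" "real (card (int_box N :: (int ^ 'n) set)) \<le> (2 * of_int N + 1) ^ CARD('n)"
proof -
  let ?P = "PiE (UNIV :: 'n set) (\<lambda>_. {-N..N})"
  have eq: "(int_box N :: (int ^ 'n) set) = vec_lambda ` ?P"
  proof (intro equalityI subsetI)
    fix \<mu> :: "int ^ 'n" assume "\<mu> \<in> int_box N"
    hence "\<mu> = vec_lambda (\<lambda>i. \<mu> $ i)" "(\<lambda>i. \<mu> $ i) \<in> ?P"
      by (auto simp: int_box_def abs_le_iff) (metis minus_le_iff)
    thus "\<mu> \<in> vec_lambda ` ?P" by blast
  qed (auto simp: int_box_def abs_le_iff PiE_iff minus_le_iff)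
  have fin: "finite ?P" by (intro finite_PiE) auto
  thus "finite (int_box N :: (int ^ 'n) set)" by (simp add: eq)
  have "card (int_box N :: (int ^ 'n) set) \<le> card ?P" unfolding eq by (rule card_image_le[OF fin])
  also have "card ?P = (nat (2 * N + 1)) ^ CARD('n)"
    by (simp add: card_PiE)
  finally have "real (card (int_box N :: (int ^ 'n) set)) \<le> real (nat (2 * N + 1) ^ CARD('n))"
    by (simp only: of_nat_le_iff)
  also have "\<dots> = (2 * of_int N + 1) ^ CARD('n)" using assms by (simp add: of_nat_power)
  finally show "real (card (int_box N :: (int ^ 'n) set)) \<le> (2 * of_int N + 1) ^ CARD('n)" .
qed

section \<open>Trigonometric sums and summation by parts\<close>

definition trig_sum :: "(int ^ 'n \<Rightarrow> complex) \<Rightarrow> real ^ 'n \<Rightarrow> complex" where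
  "trig_sum a z = (\<Sum>\<^sub>\<infinity>\<mu>\<in>UNIV. a \<mu> * cis (2 * pi * (lattice_pt \<mu> \<bullet> z)))"

lemma trig_sum_finite:
  assumes "finite S" "\<And>\<mu>. \<mu> \<notin> S \<Longrightarrow> a \<mu> = 0"
  shows "trig_sum a z = (\<Sum>\<mu>\<in>S. a \<mu> * cis (2 * pi * (lattice_pt \<mu> \<bullet> z)))"
proof -
  have "trig_sum a z = infsum (\<lambda>\<mu>. a \<mu> * cis (2 * pi * (lattice_pt \<mu> \<bullet> z))) S"
    unfolding trig_sum_def by (intro infsum_cong_neutral) (auto simp: assms(2))
  thus ?thesis using assms(1) by simp
qed

lemma lattice_pt_add: "lattice_pt (\<mu> + \<nu>) = lattice_pt \<mu> + lattice_pt \<nu>"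
  by (simp add: lattice_pt_def vec_eq_iff)

lemma lattice_pt_diff: "lattice_pt (\<mu> - \<nu>) = lattice_pt \<mu> - lattice_pt \<nu>"
  by (simp add: lattice_pt_def vec_eq_iff)

lemma lattice_pt_axis: "lattice_pt (axis r 1) = axis r 1"
  by (simp add: lattice_pt_def vec_eq_iff axis_def)

text \<open>Summation by parts: shifting the coefficients by one unit multiplies the sum by an
  exponential. The shift enlarges the support by one, hence the box \<open>N + 1\<close>.\<close>

lemma trig_sum_backward_diff:
  fixes a :: "int ^ 'n \<Rightarrow> complex"
  assumes "\<And>\<mu>. \<mu> \<notin> int_box N \<Longrightarrow> a \<mu> = 0" "0 \<le> N"
  shows "trig_sum (backward_diff (axis r 1) a) z = (cis (2 * pi * z $ r) - 1) * trig_sum a z"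
proof -
  let ?e = "axis r 1 :: int ^ 'n"
  let ?S = "int_box (N + 1) :: (int ^ 'n) set"
  let ?T = "int_box N :: (int ^ 'n) set"
  let ?E = "\<lambda>\<mu>. cis (2 * pi * (lattice_pt \<mu> \<bullet> z))"
  have fin: "finite ?S" "finite ?T" using assms(2) by (intro int_box_card(1); simp)+
  have sub: "?T \<subseteq> ?S" by (auto simp: int_box_def intro: order_trans)
  have sub': "(\<lambda>\<mu>. \<mu> + ?e) ` ?T \<subseteq> ?S"
    by (auto simp: int_box_def axis_def abs_le_iff intro: order_trans) 
       (smt (verit) abs_le_iff)+
  have zero: "a (\<mu> - ?e) = 0" if "\<mu> \<notin> (\<lambda>\<mu>. \<mu> + ?e) ` ?T" for \<mu>
  proof (rule assms(1), rule notI)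
    assume "\<mu> - ?e \<in> ?T"
    hence "(\<mu> - ?e) + ?e \<in> (\<lambda>\<mu>. \<mu> + ?e) ` ?T" by (rule imageI)
    thus False using that by simp
  qed
  have "trig_sum (backward_diff ?e a) z = (\<Sum>\<mu>\<in>?S. (a (\<mu> - ?e) - a \<mu>) * ?E \<mu>)"
    unfolding backward_diff_def
  proof (intro trig_sum_finite fin(1))
    fix \<mu> assume "\<mu> \<notin> ?S"
    hence "\<mu> \<notin> (\<lambda>\<mu>. \<mu> + ?e) ` ?T" "\<mu> \<notin> ?T" using sub sub' by blast+
    thus "a (\<mu> - ?e) - a \<mu> = 0" using zero[of \<mu>] assms(1)[of \<mu>] by simp
  qed
  also have "\<dots> = (\<Sum>\<mu>\<in>?S. a (\<mu> - ?e) * ?E \<mu>) - (\<Sum>\<mu>\<in>?S. a \<mu> * ?E \<mu>)"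
    by (simp add: left_diff_distrib sum_subtractf)
  also have "(\<Sum>\<mu>\<in>?S. a \<mu> * ?E \<mu>) = trig_sum a z"
    by (rule trig_sum_finite[symmetric]) (use fin assms(1) sub in auto)
  also have "(\<Sum>\<mu>\<in>?S. a (\<mu> - ?e) * ?E \<mu>) = (\<Sum>\<mu>\<in>(\<lambda>\<mu>. \<mu> + ?e) ` ?T. a (\<mu> - ?e) * ?E \<mu>)"
    by (intro sum.mono_neutral_right fin sub') (use zero in auto)
  also have "\<dots> = (\<Sum>\<mu>\<in>?T. a \<mu> * ?E (\<mu> + ?e))"
    by (subst sum.reindex) (auto simp: inj_on_def)
  also have "\<dots> = (\<Sum>\<mu>\<in>?T. cis (2 * pi * z $ r) * (a \<mu> * ?E \<mu>))"
  proof (intro sum.cong refl)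
    fix \<mu>
    have "?E (\<mu> + ?e) = cis (2 * pi * (lattice_pt \<mu> \<bullet> z) + 2 * pi * z $ r)"
      by (simp add: lattice_pt_add lattice_pt_axis inner_axis' inner_add_left algebra_simps)
    also have "\<dots> = ?E \<mu> * cis (2 * pi * z $ r)" by (rule cis_mult[symmetric])
    finally show "a \<mu> * ?E (\<mu> + ?e) = cis (2 * pi * z $ r) * (a \<mu> * ?E \<mu>)" by simp
  qed
  also have "\<dots> = cis (2 * pi * z $ r) * trig_sum a z"
    unfolding sum_distrib_left[symmetric] using trig_sum_finite[OF fin(2), of a] assms(1) by simp
  finally show ?thesis by (simp add: algebra_simps)
qed

lemma backward_diff_support:
  assumes "\<And>\<mu>. \<mu> \<notin> int_box N \<Longrightarrow> a \<mu> = 0"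
  shows "\<mu> \<notin> int_box (N + 1) \<Longrightarrow> backward_diff (axis r (1::int)) a \<mu> = 0"
proof -
  assume "\<mu> \<notin> int_box (N + 1)"
  then obtain i where i: "N + 1 < \<bar>\<mu> $ i\<bar>" by (auto simp: int_box_def not_le)
  have "\<not> \<bar>\<mu> $ i\<bar> \<le> N" "\<not> \<bar>(\<mu> - axis r 1) $ i\<bar> \<le> N" using i by (auto simp: axis_def)
  hence "\<mu> \<notin> int_box N" "\<mu> - axis r 1 \<notin> int_box N" unfolding int_box_def by blast+
  thus ?thesis using assms by (simp add: backward_diff_def)
qed

lemma trig_sum_backward_diff_pow:
  assumes "\<And>\<mu>. \<mu> \<notin> int_box N \<Longrightarrow> a \<mu> = 0" "0 \<le> N"
  shows "trig_sum ((backward_diff (axis r 1) ^^ A) a) z = (cis (2 * pi * z $ r) - 1) ^ A * trig_sum a z \<and>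
    (\<forall>\<mu>. \<mu> \<notin> int_box (N + int A) \<longrightarrow> (backward_diff (axis r 1) ^^ A) a \<mu> = 0)"
proof (induction A)
  case (Suc A)
  let ?b = "(backward_diff (axis r 1) ^^ A) a"
  have "trig_sum (backward_diff (axis r 1) ?b) z = (cis (2 * pi * z $ r) - 1) * trig_sum ?b z"
    using Suc assms(2) by (intro trig_sum_backward_diff[of "N + int A"]) auto
  moreover have "backward_diff (axis r 1) ?b \<mu> = 0" if "\<mu> \<notin> int_box (N + int A + 1)" for \<mu>
    by (rule backward_diff_support[OF _ that]) (use Suc in auto)
  ultimately show ?case using Suc by (simp add: add_ac)
qed (use assms in auto)

lemma trig_sum_bound:
  assumes "\<And>\<mu>. \<mu> \<notin> int_box N \<Longrightarrow> a \<mu> = 0" "0 \<le> N" "\<And>\<mu>. cmod (a \<mu>) \<le> M"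
  shows "cmod (trig_sum a (z :: real ^ 'n)) \<le> (2 * of_int N + 1) ^ CARD('n) * M"
proof -
  have M: "0 \<le> M" using assms(3)[of 0] norm_ge_zero order_trans by blast
  have "cmod (trig_sum a z) = cmod (\<Sum>\<mu>\<in>int_box N. a \<mu> * cis (2 * pi * (lattice_pt \<mu> \<bullet> z)))"
    by (subst trig_sum_finite[OF int_box_card(1)[OF assms(2)] assms(1)]) auto
  also have "\<dots> \<le> (\<Sum>\<mu>\<in>(int_box N :: (int ^ 'n) set). M)"
    by (rule sum_norm_le) (auto simp: norm_mult assms(3))
  also have "\<dots> \<le> (2 * of_int N + 1) ^ CARD('n) * M"
    using int_box_card(2)[OF assms(2), where 'n='n] M by (simp add: mult_right_mono)
  finally show ?thesis .
qed

text \<open>Unit differences of a symbol sampled on the scaled lattice are differences of step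
  \<delta> of the symbol itself. This is where its smoothness enters.\<close>

lemma backward_diff_lattice:
  fixes \<zeta> :: "real ^ 'n \<Rightarrow> real"
  shows
  "(backward_diff (axis r 1) ^^ A) (\<lambda>\<mu>. complex_of_real (\<zeta> (\<delta> *\<^sub>R lattice_pt \<mu>))) =
   (\<lambda>\<mu>. of_real ((backward_diff (\<delta> *\<^sub>R axis r 1) ^^ A) \<zeta> (\<delta> *\<^sub>R lattice_pt \<mu>)))"
proof (induction A)
  case (Suc A)
  show ?case
  proof
    fix \<mu> :: "int ^ 'n"
    let ?f = "(backward_diff (\<delta> *\<^sub>R axis r 1) ^^ A) \<zeta>"
    have "(backward_diff (axis r 1) ^^ Suc A) (\<lambda>\<mu>. complex_of_real (\<zeta> (\<delta> *\<^sub>R lattice_pt \<mu>))) \<mu> =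
          backward_diff (axis r 1) (\<lambda>\<mu>. complex_of_real (?f (\<delta> *\<^sub>R lattice_pt \<mu>))) \<mu>"
      by (simp add: Suc)
    also have "\<dots> = of_real (backward_diff (\<delta> *\<^sub>R axis r 1) ?f (\<delta> *\<^sub>R lattice_pt \<mu>))"
      unfolding backward_diff_def[of "axis r 1 :: int ^ 'n"] backward_diff_def[of "\<delta> *\<^sub>R axis r 1" ?f]
      by (simp add: lattice_pt_diff lattice_pt_axis scaleR_diff_right)
    finally show "(backward_diff (axis r 1) ^^ Suc A) (\<lambda>\<mu>. complex_of_real (\<zeta> (\<delta> *\<^sub>R lattice_pt \<mu>))) \<mu> =
      of_real ((backward_diff (\<delta> *\<^sub>R axis r 1) ^^ Suc A) \<zeta> (\<delta> *\<^sub>R lattice_pt \<mu>))" by simp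
  qed
qed simp

text \<open>The kernel is at most a multiple of the number of lattice points in the support, which
  is of order 2^(k n). Each difference in direction r gains 2^(-k) and costs a factor
  \<open>int_dist (z $ r)\<close>, so A of them give decay of order A in 2^k times that distance.
  Taken in the coordinate of largest distance and with A = n B, this single decay dominates the
  product \<open>torus_weight\<close>.\<close>

lemma kernel_bound:
  fixes \<zeta> :: "real ^ 'n \<Rightarrow> real"
  assumes smooth: "\<And>r A. smooth_dir (axis r 1) A \<zeta>" and supp: "\<And>x. 2 < norm x \<Longrightarrow> \<zeta> x = 0"
  shows "\<exists>C\<ge>0. \<forall>k z. cmod (trig_sum (\<lambda>\<mu>. of_real (\<zeta> ((1 / 2 ^ k) *\<^sub>R lattice_pt \<mu>))) z)
             \<le> C * (2 ^ k) ^ CARD('n) * torus_weight B k z"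
proof -
  define A where "A = CARD('n) * B"
  obtain B0 where B0: "\<And>x. \<bar>\<zeta> x\<bar> \<le> B0"
    using deriv_bound_compact_support[of _ 0 \<zeta> 2] smooth supp deriv_bound.simps(1) by metis
  have B0nn: "0 \<le> B0" using B0[of 0] by simp
  have "\<forall>r. \<exists>b. deriv_bound (axis r 1) A b \<zeta>"
    using deriv_bound_compact_support smooth supp by blast
  then obtain b where b: "\<And>r. deriv_bound (axis r 1) A (b r) \<zeta>" by metis
  define b' where "b' = B0 + (\<Sum>r\<in>UNIV. \<bar>b r\<bar>)"
  have b': "b r \<le> b'" "0 \<le> b'" for r
    using member_le_sum[of r UNIV "\<lambda>r. \<bar>b r\<bar>"] B0nn
    by (auto simp: b'_def intro!: add_nonneg_nonneg sum_nonneg)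
  \<comment> \<open>The box for \<open>N = 2 ^ (k + 1)\<close>, widened by the A differences, has
    side 2 (N + A) + 1, which is at most (5 + 2 A) 2^k.\<close>
  define c where "c = (5 + 2 * real A) ^ CARD('n)"
  have main: "cmod (trig_sum (\<lambda>\<mu>. of_real (\<zeta> ((1 / 2 ^ k) *\<^sub>R lattice_pt \<mu>))) z)
             \<le> (2 ^ A * c * b') * (2 ^ k) ^ CARD('n) * torus_weight B k z" for k and z :: "real ^ 'n"
  proof -
    let ?a = "\<lambda>\<mu>. complex_of_real (\<zeta> ((1 / 2 ^ k) *\<^sub>R lattice_pt \<mu>))"
    let ?T = "cmod (trig_sum ?a z)"
    define N :: int where "N = 2 ^ (k + 1)"
    have N0: "0 \<le> N" by (simp add: N_def)
    have a0: "?a \<mu> = 0" if "\<mu> \<notin> int_box N" for \<mu>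
    proof -
      from that obtain i where "N < \<bar>\<mu> $ i\<bar>" by (auto simp: int_box_def not_le)
      hence "real_of_int N < real_of_int \<bar>\<mu> $ i\<bar>" by (simp only: of_int_less_iff)
      also have "\<dots> = \<bar>lattice_pt \<mu> $ i\<bar>" by (simp add: lattice_pt_def)
      also have "\<dots> \<le> norm (lattice_pt \<mu>)" by (rule component_le_norm_cart)
      finally have "2 < norm ((1 / 2 ^ k) *\<^sub>R lattice_pt \<mu>)" by (simp add: N_def field_simps)
      thus ?thesis using supp by simp
    qed
    have count: "(2 * real_of_int (N + int A) + 1) ^ CARD('n) \<le> c * (2 ^ k) ^ CARD('n)"
    proof -
      have "1 \<le> (2::real) ^ k" by simp
      hence "2 * real A + 1 \<le> (2 * real A + 1) * 2 ^ k" by (simp add: mult_le_cancel_left1)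
      hence "2 * real_of_int (N + int A) + 1 \<le> (5 + 2 * real A) * 2 ^ k"
        by (simp add: N_def algebra_simps)
      hence "(2 * real_of_int (N + int A) + 1) ^ CARD('n) \<le> ((5 + 2 * real A) * 2 ^ k) ^ CARD('n)"
        using N0 by (intro power_mono) auto
      thus ?thesis by (simp add: c_def power_mult_distrib)
    qed
    have T0: "?T \<le> c * (2 ^ k) ^ CARD('n) * b'"
    proof -
      have "?T \<le> (2 * of_int (N + int A) + 1) ^ CARD('n) * B0"
      proof (rule trig_sum_bound)
        fix \<mu> :: "int ^ 'n"
        assume "\<mu> \<notin> int_box (N + int A)"
        hence "\<mu> \<notin> int_box N" using int_box_mono[of N "N + int A"] by auto
        thus "?a \<mu> = 0" by (rule a0)
      qed (use B0 N0 in auto)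
      also have "\<dots> \<le> (c * (2 ^ k) ^ CARD('n)) * b'"
        using count B0nn by (intro mult_mono) (auto simp: b'_def c_def intro!: sum_nonneg)
      finally show ?thesis .
    qed
    have T1: "(2 ^ k * int_dist (z $ r)) ^ A * ?T \<le> c * (2 ^ k) ^ CARD('n) * b'" for r
    proof -
      note * = trig_sum_backward_diff_pow[where N = N and a = ?a and r = r and A = A and z = z, OF a0 N0]
      have "int_dist (z $ r) ^ A * ?T \<le> cmod (cis (2 * pi * z $ r) - 1) ^ A * ?T"
        by (intro mult_right_mono power_mono int_dist_le_cis) auto
      also have "\<dots> = cmod (trig_sum ((backward_diff (axis r 1) ^^ A) ?a) z)"
        using * by (simp add: norm_mult norm_power)
      also have "\<dots> \<le> (2 * of_int (N + int A) + 1) ^ CARD('n) * (b' * (1 / 2 ^ k) ^ A)"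
      proof (rule trig_sum_bound)
        fix \<mu>
        have "cmod ((backward_diff (axis r 1) ^^ A) ?a \<mu>) \<le> b r * (1 / 2 ^ k) ^ A"
          unfolding backward_diff_lattice using deriv_bound_finite_difference[OF b] by simp
        also have "\<dots> \<le> b' * (1 / 2 ^ k) ^ A" using b' by (intro mult_right_mono) auto
        finally show "cmod ((backward_diff (axis r 1) ^^ A) ?a \<mu>) \<le> b' * (1 / 2 ^ k) ^ A" .
      qed (use * N0 in auto)
      also have "\<dots> \<le> (c * (2 ^ k) ^ CARD('n)) * (b' * (1 / 2 ^ k) ^ A)"
        using count b' by (intro mult_right_mono) auto
      finally have "(2 ^ k) ^ A * (int_dist (z $ r) ^ A * ?T) \<le> (2 ^ k) ^ A * ((c * (2 ^ k) ^ CARD('n)) * (b' * (1 / 2 ^ k) ^ A))"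
        by (intro mult_left_mono) auto
      thus ?thesis by (simp add: power_mult_distrib power_one_over field_simps)
    qed
    \<comment> \<open>The worst coordinate r: \<open>1 + u\<close> will bound every
      \<open>1 + 2 ^ k * int_dist (z $ i)\<close> from above.\<close>
    have "Max (range (\<lambda>i. int_dist (z $ i))) \<in> range (\<lambda>i. int_dist (z $ i))"
      by (intro Max_in) auto
    then obtain r where "Max (range (\<lambda>i. int_dist (z $ i))) = int_dist (z $ r)" by blast
    hence r: "int_dist (z $ i) \<le> int_dist (z $ r)" for i
      using Max_ge[of "range (\<lambda>i. int_dist (z $ i))" "int_dist (z $ i)"] by simp
    define u where "u = 2 ^ k * int_dist (z $ r)"
    have u0: "0 \<le> u" by (simp add: u_def)
    \<comment> \<open>For u at most 1 the trivial bound \<open>T0\<close> suffices, for larger u the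
      decay \<open>T1\<close>; in both cases passing to 1 + u costs a factor 2 per power.\<close>
    have "(1 + u) ^ A * ?T \<le> 2 ^ A * (c * (2 ^ k) ^ CARD('n) * b')"
    proof (cases "u \<le> 1")
      case True
      hence "(1 + u) ^ A \<le> 2 ^ A" using u0 by (intro power_mono) auto
      thus ?thesis using T0 by (intro mult_mono) auto
    next
      case False
      hence "(1 + u) ^ A \<le> (2 * u) ^ A" by (intro power_mono) auto
      hence "(1 + u) ^ A * ?T \<le> (2 * u) ^ A * ?T" by (intro mult_right_mono) auto
      also have "\<dots> = 2 ^ A * (u ^ A * ?T)" by (simp add: power_mult_distrib)
      also have "\<dots> \<le> 2 ^ A * (c * (2 ^ k) ^ CARD('n) * b')"
        using T1[of r] by (intro mult_left_mono) (auto simp: u_def)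
      finally show ?thesis .
    qed
    moreover have "1 / (1 + u) ^ A \<le> torus_weight B k z"
    proof -
      have "(\<Prod>i\<in>(UNIV :: 'n set). 1 / (1 + u) ^ B) \<le> torus_weight B k z"
        unfolding torus_weight_def
      proof (intro prod_mono conjI)
        fix i
        have "1 + 2 ^ k * int_dist (z $ i) \<le> 1 + u" using r[of i] by (simp add: u_def)
        thus "1 / (1 + u) ^ B \<le> 1 / (1 + 2 ^ k * int_dist (z $ i)) ^ B"
          by (intro divide_left_mono power_mono mult_pos_pos zero_less_power)
             (auto intro!: add_pos_nonneg simp: u0)
      qed (use u0 in auto)
      thus ?thesis by (simp add: A_def power_mult power_one_over mult.commute flip: power_mult)
    qed
    ultimately have "?T \<le> 2 ^ A * (c * (2 ^ k) ^ CARD('n) * b') * (1 / (1 + u) ^ A)"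
      using u0 by (simp add: field_simps)
    also have "\<dots> \<le> 2 ^ A * (c * (2 ^ k) ^ CARD('n) * b') * torus_weight B k z"
      using \<open>1 / (1 + u) ^ A \<le> torus_weight B k z\<close> b' by (intro mult_left_mono) (auto simp: c_def)
    finally show ?thesis by (simp add: algebra_simps)
  qed
  show ?thesis by (rule exI[of _ "2 ^ A * c * b'"]) (use main b' in \<open>auto simp: c_def\<close>)
qed

section \<open>Integration over the torus\<close>

lemma borel_measurable_vec_nth [measurable]: "(\<lambda>x :: real ^ 'n. x $ i) \<in> borel_measurable borel"
  by (intro borel_measurable_continuous_onI continuous_intros)

lemma torus_cell_measurable [measurable]: "torus_cell \<in> sets borel"
proof -
  have *: "(torus_cell :: (real ^ 'n) set) = {x \<in> space borel. \<forall>i. 0 \<le> x $ i \<and> x $ i < 1}"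
    by (auto simp: torus_cell_def)
  show ?thesis unfolding * by measurable
qed

lemma space_torus [simp]: "space torus = torus_cell"
  by (simp add: torus_def space_restrict_space)

lemma sets_torus: "sets torus = sets (restrict_space borel torus_cell)"
  by (simp add: torus_def sets_restrict_space)

lemma borel_measurable_torus [measurable (raw)]:
  "f \<in> borel_measurable borel \<Longrightarrow> f \<in> borel_measurable torus"
  unfolding torus_def by (rule measurable_restrict_space1) simp

lemma Basis_axis: "(Basis :: (real ^ 'n) set) = (\<lambda>i. axis i 1) ` UNIV"
  by (auto simp: Basis_vec_def)

lemma nn_integral_torus_prod:
  fixes g :: "'n::finite \<Rightarrow> real \<Rightarrow> ennreal"
  assumes [measurable]: "\<And>i. g i \<in> borel_measurable borel"
  shows "(\<integral>\<^sup>+x. (\<Prod>i\<in>UNIV. g i (x $ i)) \<partial>(torus :: (real ^ 'n) measure)) =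
         (\<Prod>i\<in>UNIV. \<integral>\<^sup>+t. g i t * indicator {0..<1} t \<partial>lborel)"
proof -
  let ?f = "\<lambda>b t. g (axis_index b) t * indicator {0..<1} t"
  have prod_Basis: "(\<Prod>b\<in>(Basis :: (real ^ 'n) set). h b) = (\<Prod>i\<in>UNIV. h (axis i 1))" for h :: "_ \<Rightarrow> ennreal"
    unfolding Basis_axis by (subst prod.reindex) (auto simp: inj_on_def axis_eq_axis)
  have ind: "indicator torus_cell x = (\<Prod>i\<in>UNIV. indicator {0..<1} (x $ i) :: ennreal)" for x :: "real ^ 'n"
  proof (cases "x \<in> torus_cell")
    case False
    then obtain i where "\<not> (0 \<le> x $ i \<and> x $ i < 1)" by (auto simp: torus_cell_def)
    hence "indicator {0..<1} (x $ i) = (0 :: ennreal)" by auto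
    hence "(\<Prod>i\<in>UNIV. indicator {0..<1} (x $ i) :: ennreal) = 0" by (intro prod_zero) auto
    thus ?thesis using False by simp
  qed (auto simp: torus_cell_def)
  have "(\<integral>\<^sup>+x. (\<Prod>i\<in>UNIV. g i (x $ i)) \<partial>(torus :: (real ^ 'n) measure)) =
        (\<integral>\<^sup>+x. (\<Prod>i\<in>UNIV. g i (x $ i)) * indicator torus_cell x \<partial>lborel)"
    unfolding torus_def by (rule nn_integral_restrict_space) simp
  also have "\<dots> = (\<integral>\<^sup>+x. (\<Prod>b\<in>Basis. ?f b (x \<bullet> b)) \<partial>(lborel :: (real ^ 'n) measure))"
    by (intro nn_integral_cong) (simp add: prod_Basis ind prod.distrib inner_axis axis_index_axis)
  also have "\<dots> = (\<Prod>b\<in>(Basis :: (real ^ 'n) set). \<integral>\<^sup>+t. ?f b t \<partial>lborel)"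
    by (rule nn_integral_lborel_prod) auto
  finally show ?thesis by (simp add: prod_Basis axis_index_axis)
qed

lemma emeasure_torus: "emeasure torus (torus_cell :: (real ^ 'n) set) = 1"
proof -
  have "(\<integral>\<^sup>+x. 1 \<partial>(torus :: (real ^ 'n) measure)) = 1"
    using nn_integral_torus_prod[of "\<lambda>(_ :: 'n) _. 1"] by simp
  thus ?thesis by simp
qed

lemma finite_measure_torus: "finite_measure torus"
  by (rule finite_measureI) (simp add: emeasure_torus)

lemma integrable_torus:
  fixes f :: "real ^ 'n \<Rightarrow> 'b::{banach, second_countable_topology}"
  assumes "f \<in> borel_measurable borel" "\<And>x. norm (f x) \<le> B"
  shows "integrable torus f"
  by (rule finite_measure.integrable_const_bound[OF finite_measure_torus, of _ B])
     (use assms in \<open>auto intro: borel_measurable_torus\<close>)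

lemma integral_torus_eq:
  fixes f :: "real ^ 'n \<Rightarrow> 'b::{banach, second_countable_topology}"
  shows "integral\<^sup>L torus f = (\<integral>x. indicator torus_cell x *\<^sub>R f x \<partial>lborel)"
  unfolding torus_def by (subst integral_restrict_space) (auto simp: set_lebesgue_integral_def)

lemma integrable_torus_iff:
  fixes f :: "real ^ 'n \<Rightarrow> 'b::{banach, second_countable_topology}"
  shows "integrable torus f \<longleftrightarrow> integrable lborel (\<lambda>x. indicator torus_cell x *\<^sub>R f x)"
  unfolding torus_def by (subst integrable_restrict_space) (auto simp: set_integrable_def)

lemma periodic_axis: "periodic f \<Longrightarrow> f (x + axis r 1) = f x"
  unfolding periodic_def using lattice_pt_axis[of r] by metis

text \<open>The shifted cell consists of the cell without the slab D, where x_r is below h, and of D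
  moved by one period in direction r; periodicity brings the second piece back.\<close>

lemma integral_torus_translate:
  fixes f :: "real ^ 'n \<Rightarrow> real"
  assumes f [measurable]: "f \<in> borel_measurable borel" and B: "\<And>x. \<bar>f x\<bar> \<le> B"
    and per: "periodic f" and h: "0 < h" "h < 1"
  shows "(\<integral>x. f (x + h *\<^sub>R axis r 1) \<partial>torus) = (\<integral>x. f x \<partial>torus)"
proof -
  let ?e = "axis r 1 :: real ^ 'n"
  define D where "D = {x \<in> torus_cell. x $ r < h}"
  have [measurable]: "D \<in> sets borel" unfolding D_def by measurable
  have shift: "(\<integral>x. g (x + v) \<partial>lborel) = (\<integral>x. g x \<partial>lborel)"
    if [measurable]: "g \<in> borel_measurable borel" for g :: "real ^ 'n \<Rightarrow> real" and v
  proof -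
    have "(\<integral>x. g x \<partial>lborel) = (\<integral>x. g x \<partial>distr lborel borel ((+) v))"
      using lborel_distr_plus[of v] by simp
    also have "\<dots> = (\<integral>x. g (v + x) \<partial>lborel)" by (rule integral_distr) auto
    finally show ?thesis by (simp add: add.commute)
  qed
  have int: "integrable lborel (\<lambda>x. indicator A x * f x)" if "A \<subseteq> torus_cell" and [measurable]: "A \<in> sets borel" for A
  proof -
    have "integrable torus (\<lambda>x. indicator A x * f x)"
      by (rule integrable_torus[where B = B]) (use B[THEN order_trans[OF abs_ge_zero]] B in \<open>auto simp: indicator_def\<close>)
    hence "integrable lborel (\<lambda>x. indicator torus_cell x *\<^sub>R (indicator A x * f x))"
      by (simp only: integrable_torus_iff)
    moreover have "(\<lambda>x. indicator torus_cell x *\<^sub>R (indicator A x * f x)) = (\<lambda>x. indicator A x * f x)"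
      using that(1) by (auto simp: fun_eq_iff indicator_def)
    ultimately show ?thesis by simp
  qed
  have split: "indicator torus_cell (x - h *\<^sub>R ?e) = (indicator (torus_cell - D) x + indicator D (x - ?e) :: real)" for x
  proof -
    have "x - h *\<^sub>R ?e \<in> torus_cell \<longleftrightarrow> (\<forall>i. i \<noteq> r \<longrightarrow> 0 \<le> x $ i \<and> x $ i < 1) \<and> h \<le> x $ r \<and> x $ r < 1 + h"
      unfolding torus_cell_def by (auto simp: axis_def split: if_splits; smt (verit))
    moreover have "x - ?e \<in> D \<longleftrightarrow> (\<forall>i. i \<noteq> r \<longrightarrow> 0 \<le> x $ i \<and> x $ i < 1) \<and> 1 \<le> x $ r \<and> x $ r < 1 + h"
      unfolding D_def torus_cell_def using h by (auto simp: axis_def split: if_splits; smt (verit))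
    moreover have "x \<in> torus_cell - D \<longleftrightarrow> (\<forall>i. i \<noteq> r \<longrightarrow> 0 \<le> x $ i \<and> x $ i < 1) \<and> h \<le> x $ r \<and> x $ r < 1"
      unfolding D_def torus_cell_def using h by (auto; smt (verit))
    ultimately show ?thesis using h by (auto simp: indicator_def)
  qed
  have "(\<integral>x. f (x + h *\<^sub>R ?e) \<partial>torus) = (\<integral>x. indicator torus_cell ((x + h *\<^sub>R ?e) - h *\<^sub>R ?e) * f (x + h *\<^sub>R ?e) \<partial>lborel)"
    by (simp add: integral_torus_eq)
  also have "\<dots> = (\<integral>x. indicator torus_cell (x - h *\<^sub>R ?e) * f x \<partial>lborel)"
    by (rule shift[of "\<lambda>x. indicator torus_cell (x - h *\<^sub>R ?e) * f x"]) measurable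
  also have "\<dots> = (\<integral>x. indicator (torus_cell - D) x * f x + indicator D (x - ?e) * f ((x - ?e)) \<partial>lborel)"
    using periodic_axis[OF per, of "_ - ?e" r] by (simp add: split algebra_simps)
  also have "\<dots> = (\<integral>x. indicator (torus_cell - D) x * f x \<partial>lborel) + (\<integral>x. indicator D (x - ?e) * f (x - ?e) \<partial>lborel)"
  proof (intro Bochner_Integration.integral_add int)
    have "integrable (distr lborel borel ((+) (- ?e))) (\<lambda>x. indicator D x * f x)"
      unfolding lborel_distr_plus by (rule int) (auto simp: D_def)
    hence "integrable lborel (\<lambda>x. indicator D (- ?e + x) * f (- ?e + x))"
      by (subst (asm) integrable_distr_eq) auto
    thus "integrable lborel (\<lambda>x. indicator D (x - ?e) * f (x - ?e))" by simp
  qed auto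
  also have "(\<integral>x. indicator D (x - ?e) * f (x - ?e) \<partial>lborel) = (\<integral>x. indicator D x * f x \<partial>lborel)"
    using shift[of "\<lambda>x. indicator D x * f x" "- ?e"] by simp
  also have "(\<integral>x. indicator (torus_cell - D) x * f x \<partial>lborel) + (\<integral>x. indicator D x * f x \<partial>lborel) =
     (\<integral>x. indicator (torus_cell - D) x * f x + indicator D x * f x \<partial>lborel)"
    by (rule Bochner_Integration.integral_add[symmetric]) (intro int; auto simp: D_def)+
  also have "\<dots> = (\<integral>x. f x \<partial>torus)"
    unfolding integral_torus_eq by (intro Bochner_Integration.integral_cong refl) (auto simp: D_def indicator_def)
  finally show ?thesis .
qed

text \<open>By translation invariance the difference quotients integrate to 0. The mean value
  theorem bounds them by the bound of the derivative, and dominated convergence passes to the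
  limit.\<close>

lemma integral_torus_dir_deriv:
  fixes f :: "real ^ 'n \<Rightarrow> real"
  assumes f [measurable]: "f \<in> borel_measurable borel" and B: "\<And>x. \<bar>f x\<bar> \<le> B"
    and f' [measurable]: "f' \<in> borel_measurable borel" and B': "\<And>x. \<bar>f' x\<bar> \<le> B'"
    and per: "periodic f" and deriv: "dir_deriv (axis r 1) f f'"
  shows "(\<integral>x. f' x \<partial>torus) = 0"
proof -
  let ?e = "axis r 1 :: real ^ 'n"
  \<comment> \<open>The offset 2 keeps h below 1 for n = 0 as well, as the translation lemma
    demands.\<close>
  define h :: "nat \<Rightarrow> real" where "h n = 1 / (real n + 2)" for n
  have h: "0 < h n" "h n < 1" for n by (auto simp: h_def)
  have "h \<longlonglongrightarrow> 0" unfolding h_def by real_asymp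
  hence lim_h: "filterlim h (at 0) sequentially"
    using h by (intro filterlim_atI) (auto simp: less_imp_neq[THEN not_sym])
  let ?s = "\<lambda>n x. (f (x + h n *\<^sub>R ?e) - f x) / h n"
  have "(\<lambda>n. \<integral>x. ?s n x \<partial>torus) \<longlonglongrightarrow> (\<integral>x. f' x \<partial>torus)"
  proof (rule integral_dominated_convergence[where w = "\<lambda>_. B'"])
    show "integrable torus (\<lambda>_ :: real ^ 'n. B')" by (rule integrable_torus) auto
    show "AE x in torus. (\<lambda>n. ?s n x) \<longlonglongrightarrow> f' x"
    proof (rule AE_I2)
      fix x
      have "((\<lambda>h. (f (x + h *\<^sub>R ?e) - f x) / h) \<longlongrightarrow> f' x) (at 0)"
        using deriv by (auto simp: dir_deriv_def has_field_derivative_iff)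
      from filterlim_compose[OF this lim_h] show "(\<lambda>n. ?s n x) \<longlonglongrightarrow> f' x" .
    qed
    show "AE x in torus. norm (?s n x) \<le> B'" for n
    proof (rule AE_I2)
      fix x
      have "\<exists>z. 0 < z \<and> z < h n \<and> f (x + h n *\<^sub>R ?e) - f (x + 0 *\<^sub>R ?e) = (h n - 0) * f' (x + z *\<^sub>R ?e)"
        by (rule MVT2) (use h dir_derivD[OF deriv, of x] in auto)
      then obtain z where "f (x + h n *\<^sub>R ?e) - f x = h n * f' (x + z *\<^sub>R ?e)" by auto
      thus "norm (?s n x) \<le> B'" using B' h[of n] by simp
    qed
  qed measurable
  moreover have "(\<integral>x. ?s n x \<partial>torus) = 0" for n
  proof -
    have "integrable torus (\<lambda>x. f (x + h n *\<^sub>R ?e))" "integrable torus f"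
      by (rule integrable_torus[where B = B]; use B in simp)+
    hence "(\<integral>x. ?s n x \<partial>torus) = ((\<integral>x. f (x + h n *\<^sub>R ?e) \<partial>torus) - (\<integral>x. f x \<partial>torus)) / h n"
      by simp
    thus ?thesis using integral_torus_translate[OF f B per h] by simp
  qed
  ultimately have "(\<lambda>n :: nat. 0) \<longlonglongrightarrow> (\<integral>x. f' x \<partial>torus)" by (simp only:)
  thus ?thesis by (simp add: LIMSEQ_const_iff)
qed

lemma torus_integration_by_parts:
  fixes f g :: "real ^ 'n \<Rightarrow> real"
  assumes meas [measurable]: "f \<in> borel_measurable borel" "f' \<in> borel_measurable borel"
      "g \<in> borel_measurable borel" "g' \<in> borel_measurable borel"
    and bdd: "\<And>x. \<bar>f x\<bar> \<le> B1" "\<And>x. \<bar>f' x\<bar> \<le> B2" "\<And>x. \<bar>g x\<bar> \<le> B3" "\<And>x. \<bar>g' x\<bar> \<le> B4"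
    and per: "periodic f" "periodic g"
    and deriv: "dir_deriv (axis r 1) f f'" "dir_deriv (axis r 1) g g'"
  shows "(\<integral>x. f' x * g x \<partial>torus) = - (\<integral>x. f x * g' x \<partial>torus)"
proof -
  have B: "0 \<le> B1" "0 \<le> B2" "0 \<le> B3" "0 \<le> B4"
    using bdd[of 0] order_trans[OF abs_ge_zero] by blast+
  have b: "\<bar>f x * g x\<bar> \<le> B1 * B3" "\<bar>f' x * g x\<bar> \<le> B2 * B3" "\<bar>g' x * f x\<bar> \<le> B4 * B1" for x
    unfolding abs_mult using bdd B by (auto intro!: mult_mono)
  have int: "integrable torus (\<lambda>x. f' x * g x)" "integrable torus (\<lambda>x. g' x * f x)"
    by (rule integrable_torus[where B = "B2 * B3"] integrable_torus[where B = "B4 * B1"]; use b in simp)+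
  have "(\<integral>x. f' x * g x + g' x * f x \<partial>torus) = 0"
  proof (rule integral_torus_dir_deriv[where f = "\<lambda>x. f x * g x" and B = "B1 * B3" and B' = "B2 * B3 + B4 * B1"])
    show "\<bar>f' x * g x + g' x * f x\<bar> \<le> B2 * B3 + B4 * B1" for x
      using abs_triangle_ineq[of "f' x * g x" "g' x * f x"] b(2,3)[of x] by linarith
    show "periodic (\<lambda>x. f x * g x)" using per by (auto simp: periodic_def)
  qed (use b deriv in \<open>auto intro: dir_deriv_mult\<close>)
  thus ?thesis using int by (simp add: mult.commute)
qed

section \<open>Fourier coefficients and multipliers\<close>

lemma fourier_coeff_regular:
  fixes f :: "real ^ 'n \<Rightarrow> real"
  assumes [measurable]: "f \<in> borel_measurable borel" and B: "\<And>x. \<bar>f x\<bar> \<le> B"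
  shows "fourier_coeff (regular_distribution f) \<mu> =
    (\<integral>x. of_real (f x) * cis (- (2 * pi * (lattice_pt \<mu> \<bullet> x))) \<partial>torus)"
proof -
  let ?g = "\<lambda>x. complex_of_real (f x) * cis (- (2 * pi * (lattice_pt \<mu> \<bullet> x)))"
  have "?g = (\<lambda>x. Complex (f x * cos (2 * pi * (lattice_pt \<mu> \<bullet> x))) (- (f x * sin (2 * pi * (lattice_pt \<mu> \<bullet> x)))))"
    by (auto simp: complex_eq_iff)
  moreover have "integrable torus ?g"
  proof (rule integrable_torus[where B = B])
    show "?g \<in> borel_measurable borel" unfolding cis_conv_exp by measurable
  qed (use B in \<open>simp add: norm_mult\<close>)
  ultimately show ?thesis
    by (simp add: fourier_coeff_def regular_distribution_def complex_eq_iff flip: integral_Re integral_Im)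
qed

text \<open>Integration by parts against cosine and sine separately, since distributions act on real
  test functions.\<close>

lemma fourier_coeff_dir_deriv:
  fixes f :: "real ^ 'n \<Rightarrow> real"
  assumes [measurable]: "f \<in> borel_measurable borel" "f' \<in> borel_measurable borel"
    and B: "\<And>x. \<bar>f x\<bar> \<le> B" "\<And>x. \<bar>f' x\<bar> \<le> B'"
    and per: "periodic f" and deriv: "dir_deriv (axis r 1) f f'"
  shows "fourier_coeff (regular_distribution f') \<mu> =
     2 * pi * \<i> * of_int (\<mu> $ r) * fourier_coeff (regular_distribution f) \<mu>"
proof -
  let ?t = "\<lambda>x. 2 * pi * (lattice_pt \<mu> \<bullet> x)"
  let ?m = "2 * pi * of_int (\<mu> $ r)"
  have t_per: "?t (x + lattice_pt m) = ?t x + 2 * pi * of_int (\<Sum>i\<in>UNIV. \<mu> $ i * m $ i)" for x m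
    by (simp add: inner_add_right inner_vec_def lattice_pt_def algebra_simps sum.distrib)
  have per_cs: "periodic (\<lambda>x. cos (?t x))" "periodic (\<lambda>x. sin (?t x))"
    unfolding periodic_def t_per cos_add sin_add cos_int_2pin sin_int_2pin by simp_all
  have t_deriv: "?t (x + h *\<^sub>R axis r 1) = ?t x + h * ?m" for x h
    by (simp add: inner_add_right inner_axis lattice_pt_def algebra_simps)
  have d_cs: "dir_deriv (axis r 1) (\<lambda>x. cos (?t x)) (\<lambda>x. - sin (?t x) * ?m)"
    "dir_deriv (axis r 1) (\<lambda>x. sin (?t x)) (\<lambda>x. cos (?t x) * ?m)"
    unfolding dir_deriv_def t_deriv by (auto intro!: derivative_eq_intros)
  have b: "\<bar>- sin (?t x) * ?m\<bar> \<le> \<bar>?m\<bar>" "\<bar>cos (?t x) * ?m\<bar> \<le> \<bar>?m\<bar>" for x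
    unfolding abs_mult[of _ ?m] by (intro mult_left_le_one_le; simp)+
  have c: "(\<integral>x. f' x * cos (?t x) \<partial>torus) = - (\<integral>x. f x * (- sin (?t x) * ?m) \<partial>torus)"
    by (rule torus_integration_by_parts[where ?B3.0 = 1, OF _ _ _ _ B _ b(1) per per_cs(1) deriv d_cs(1)]) auto
  have s: "(\<integral>x. f' x * sin (?t x) \<partial>torus) = - (\<integral>x. f x * (cos (?t x) * ?m) \<partial>torus)"
    by (rule torus_integration_by_parts[where ?B3.0 = 1, OF _ _ _ _ B _ b(2) per per_cs(2) deriv d_cs(2)]) auto
  have e: "(\<integral>x. f x * (- sin (?t x) * ?m) \<partial>torus) = - ?m * (\<integral>x. f x * sin (?t x) \<partial>torus)"
    "(\<integral>x. f x * (cos (?t x) * ?m) \<partial>torus) = ?m * (\<integral>x. f x * cos (?t x) \<partial>torus)"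
    unfolding integral_mult_right_zero[symmetric] by (rule Bochner_Integration.integral_cong; simp)+
  show ?thesis
    unfolding fourier_coeff_def regular_distribution_def c s e by (simp add: complex_eq_iff)
qed

text \<open>A finite multiplier acts as convolution with the trigonometric sum of its symbol. A
  nonnegative integral on the right spares all questions of integrability later.\<close>

lemma fourier_multiplier_bound:
  fixes f :: "real ^ 'n \<Rightarrow> real"
  assumes [measurable]: "f \<in> borel_measurable borel" and B: "\<And>x. \<bar>f x\<bar> \<le> B"
    and S: "finite S" "\<And>\<mu>. \<mu> \<notin> S \<Longrightarrow> a \<mu> = 0"
  shows "ennreal (cmod (trig_sum (\<lambda>\<mu>. a \<mu> * fourier_coeff (regular_distribution f) \<mu>) x)) \<le>
     (\<integral>\<^sup>+y. ennreal (cmod (trig_sum a (x - y)) * \<bar>f y\<bar>) \<partial>torus)"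
proof -
  let ?E = "\<lambda>\<mu> y. cis (2 * pi * (lattice_pt \<mu> \<bullet> y))"
  let ?F = "\<lambda>\<mu> y. of_real (f y) * cis (- (2 * pi * (lattice_pt \<mu> \<bullet> y)))"
  have [measurable]: "?F \<mu> \<in> borel_measurable borel" for \<mu> unfolding cis_conv_exp by measurable
  have int: "integrable torus (?F \<mu>)" for \<mu>
    by (rule integrable_torus[where B = B]) (use B in \<open>simp_all add: norm_mult\<close>)
  have ts: "trig_sum a z = (\<Sum>\<mu>\<in>S. a \<mu> * ?E \<mu> z)" for z
    using S by (rule trig_sum_finite)
  have "trig_sum (\<lambda>\<mu>. a \<mu> * fourier_coeff (regular_distribution f) \<mu>) x =
      (\<Sum>\<mu>\<in>S. a \<mu> * (\<integral>y. ?F \<mu> y \<partial>torus) * ?E \<mu> x)"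
    by (subst trig_sum_finite[OF S(1)]) (auto simp: S(2) fourier_coeff_regular[OF assms(1) B])
  also have "\<dots> = (\<integral>y. (\<Sum>\<mu>\<in>S. a \<mu> * ?F \<mu> y * ?E \<mu> x) \<partial>torus)"
    using int by (subst Bochner_Integration.integral_sum) auto
  also have "\<dots> = (\<integral>y. trig_sum a (x - y) * of_real (f y) \<partial>torus)"
  proof (intro Bochner_Integration.integral_cong refl)
    fix y
    have "?F \<mu> y * ?E \<mu> x = ?E \<mu> (x - y) * of_real (f y)" for \<mu>
      by (simp add: inner_diff_right right_diff_distrib mult.assoc mult.commute cis_mult)
    hence "a \<mu> * ?F \<mu> y * ?E \<mu> x = a \<mu> * ?E \<mu> (x - y) * of_real (f y)" for \<mu>
      unfolding mult.assoc[of "a \<mu>"] by (simp only:)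
    thus "(\<Sum>\<mu>\<in>S. a \<mu> * ?F \<mu> y * ?E \<mu> x) = trig_sum a (x - y) * of_real (f y)"
      unfolding ts sum_distrib_right by (simp only:)
  qed
  finally have eq: "trig_sum (\<lambda>\<mu>. a \<mu> * fourier_coeff (regular_distribution f) \<mu>) x =
    (\<integral>y. trig_sum a (x - y) * of_real (f y) \<partial>torus)" .
  \<comment> \<open>If the integrand were not integrable, its Bochner integral would be 0 and the
    bound trivial.\<close>
  have "ennreal (cmod (\<integral>y. trig_sum a (x - y) * of_real (f y) \<partial>torus)) \<le>
    (\<integral>\<^sup>+y. norm (trig_sum a (x - y) * of_real (f y)) \<partial>torus)"
    by (cases "integrable torus (\<lambda>y. trig_sum a (x - y) * of_real (f y))")
       (auto simp: not_integrable_integral_eq intro: integral_norm_bound_ennreal)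
  thus ?thesis unfolding eq by (simp add: norm_mult)
qed

section \<open>Integrals and sums of weights\<close>

lemma nn_integral_inverse_square: "(\<integral>\<^sup>+x. ennreal (1 / (1 + x\<^sup>2)) \<partial>lborel) < \<infinity>"
proof -
  have "integrable lborel (\<lambda>x :: real. indicator (einterval (- \<infinity>) \<infinity>) x *\<^sub>R inverse (1 + x\<^sup>2))"
    using integrable_inverse_1_plus_square by (simp add: set_integrable_def)
  hence "integrable lborel (\<lambda>x :: real. 1 / (1 + x\<^sup>2))" by (simp add: einterval_def inverse_eq_divide)
  from this[unfolded integrable_iff_bounded] show ?thesis by simp
qed

text \<open>As y runs through one period, the integer nearest to a - y takes at most two values, so
  the periodic weight is dominated by two bumps on the line, centred at c and c + 1. After scaling
  by 2^k each has the integral of 1 / (1 + x^2).\<close>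

lemma nn_integral_weight_1D:
  fixes a :: real
  shows "(\<integral>\<^sup>+y. ennreal (2 ^ k / (1 + 2 ^ k * int_dist (a - y)) ^ 2) * indicator {0..<1} y \<partial>lborel)
    \<le> 2 * (\<integral>\<^sup>+x. ennreal (1 / (1 + x\<^sup>2)) \<partial>lborel)"
proof -
  let ?g = "\<lambda>c y. ennreal (2 ^ k / (1 + (2 ^ k * (y - c))\<^sup>2))"
  define c where "c = a - of_int (round a)"
  have le: "ennreal (2 ^ k / (1 + 2 ^ k * int_dist (a - y)) ^ 2) * indicator {0..<1} y \<le> ?g c y + ?g (c + 1) y" for y
  proof (cases "y \<in> {0..<1}")
    case True
    have "round (a - 1) = round a - 1" unfolding round_def by (metis add_diff_eq diff_add_eq floor_diff_one)
    hence "round a - 1 \<le> round (a - y)" "round (a - y) \<le> round a"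
      using round_mono[of "a - 1" "a - y"] round_mono[of "a - y" a] True by auto
    hence "round (a - y) = round a \<or> round (a - y) = round a - 1" by linarith
    hence "int_dist (a - y) = \<bar>y - c\<bar> \<or> int_dist (a - y) = \<bar>y - (c + 1)\<bar>"
      by (auto simp: int_dist_def c_def abs_if)
    moreover have "2 ^ k / (1 + 2 ^ k * \<bar>z\<bar>) ^ 2 \<le> 2 ^ k / (1 + (2 ^ k * z)\<^sup>2)" for z :: real
    proof (rule divide_left_mono)
      show "1 + (2 ^ k * z)\<^sup>2 \<le> (1 + 2 ^ k * \<bar>z\<bar>) ^ 2"
        by (simp add: power2_sum power_mult_distrib)
      have "0 < 1 + 2 ^ k * \<bar>z\<bar>" by (intro add_pos_nonneg) auto
      thus "0 < (1 + 2 ^ k * \<bar>z\<bar>) ^ 2 * (1 + (2 ^ k * z)\<^sup>2)" by (intro mult_pos_pos add_pos_nonneg) auto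
    qed auto
    ultimately have "2 ^ k / (1 + 2 ^ k * int_dist (a - y)) ^ 2 \<le> 2 ^ k / (1 + (2 ^ k * (y - c))\<^sup>2) \<or>
       2 ^ k / (1 + 2 ^ k * int_dist (a - y)) ^ 2 \<le> 2 ^ k / (1 + (2 ^ k * (y - (c + 1)))\<^sup>2)" by metis
    thus ?thesis using True
      by (auto intro: order_trans[OF ennreal_leI] simp: add_increasing add_increasing2)
  qed simp
  have eq: "(\<integral>\<^sup>+y. ?g b y \<partial>lborel) = (\<integral>\<^sup>+x. ennreal (1 / (1 + x\<^sup>2)) \<partial>lborel)" for b
  proof -
    have "(\<integral>\<^sup>+x. ennreal (1 / (1 + x\<^sup>2)) \<partial>lborel) =
       ennreal \<bar>2 ^ k\<bar> * (\<integral>\<^sup>+y. ennreal (1 / (1 + (- (2 ^ k * b) + 2 ^ k * y)\<^sup>2)) \<partial>lborel)"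
      by (rule nn_integral_real_affine) auto
    also have "\<dots> = (\<integral>\<^sup>+y. ennreal \<bar>2 ^ k\<bar> * ennreal (1 / (1 + (- (2 ^ k * b) + 2 ^ k * y)\<^sup>2)) \<partial>lborel)"
      by (rule nn_integral_cmult[symmetric]) auto
    also have "\<dots> = (\<integral>\<^sup>+y. ?g b y \<partial>lborel)"
      by (intro nn_integral_cong) (simp add: ennreal_mult[symmetric] right_diff_distrib)
    finally show ?thesis by simp
  qed
  have "(\<integral>\<^sup>+y. ennreal (2 ^ k / (1 + 2 ^ k * int_dist (a - y)) ^ 2) * indicator {0..<1} y \<partial>lborel)
    \<le> (\<integral>\<^sup>+y. ?g c y + ?g (c + 1) y \<partial>lborel)" by (rule nn_integral_mono) (rule le)
  also have "\<dots> = 2 * (\<integral>\<^sup>+x. ennreal (1 / (1 + x\<^sup>2)) \<partial>lborel)"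
    by (subst nn_integral_add) (auto simp: eq mult_2)
  finally show ?thesis .
qed

lemma borel_measurable_torus_weight [measurable]: "torus_weight B k \<in> borel_measurable borel"
  unfolding torus_weight_def by measurable

lemma torus_weight_integral:
  "\<exists>C\<ge>0. \<forall>k (x :: real ^ 'n). (\<integral>\<^sup>+y. ennreal ((2 ^ k) ^ CARD('n) * torus_weight 2 k (x - y)) \<partial>torus) \<le> ennreal C"
proof -
  obtain I where I: "2 * (\<integral>\<^sup>+x. ennreal (1 / (1 + x\<^sup>2)) \<partial>lborel) = ennreal I" "0 \<le> I"
    using nn_integral_inverse_square
    by (metis ennreal_cases ennreal_mult_less_top ennreal_numeral_less_top infinity_ennreal_def less_top)
  have "(\<integral>\<^sup>+y. ennreal ((2 ^ k) ^ CARD('n) * torus_weight 2 k (x - y)) \<partial>torus) \<le> ennreal (I ^ CARD('n))"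
    for k and x :: "real ^ 'n"
  proof -
    have "(\<integral>\<^sup>+y. ennreal ((2 ^ k) ^ CARD('n) * torus_weight 2 k (x - y)) \<partial>torus) =
      (\<integral>\<^sup>+y. (\<Prod>i\<in>UNIV. ennreal (2 ^ k / (1 + 2 ^ k * int_dist (x $ i - y $ i)) ^ 2)) \<partial>torus)"
    proof (intro nn_integral_cong)
      fix y
      have "(2 ^ k) ^ CARD('n) * torus_weight 2 k (x - y) = (\<Prod>i\<in>UNIV. 2 ^ k / (1 + 2 ^ k * int_dist (x $ i - y $ i)) ^ 2)"
        by (simp add: torus_weight_def prod_dividef)
      thus "ennreal ((2 ^ k) ^ CARD('n) * torus_weight 2 k (x - y)) =
        (\<Prod>i\<in>UNIV. ennreal (2 ^ k / (1 + 2 ^ k * int_dist (x $ i - y $ i)) ^ 2))"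
        by (simp add: prod_ennreal)
    qed
    also have "\<dots> = (\<Prod>i\<in>UNIV. \<integral>\<^sup>+t. ennreal (2 ^ k / (1 + 2 ^ k * int_dist (x $ i - t)) ^ 2) * indicator {0..<1} t \<partial>lborel)"
      by (rule nn_integral_torus_prod) measurable
    also have "\<dots> \<le> (\<Prod>i\<in>(UNIV :: 'n set). ennreal I)"
      using nn_integral_weight_1D unfolding I by (intro prod_mono_ennreal) auto
    also have "\<dots> = ennreal (I ^ CARD('n))" using I(2) by (simp add: ennreal_power)
    finally show ?thesis .
  qed
  thus ?thesis using I(2) by (intro exI[of _ "I ^ CARD('n)"]) auto
qed

section \<open>Periodization\<close>

lemma inverse_square_summable_int: "(\<lambda>l :: int. 1 / (1 + \<bar>real_of_int l\<bar>) ^ 2) summable_on UNIV"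
proof -
  have "summable (\<lambda>n. inverse (real (Suc n) ^ 2))"
    using inverse_power_summable[of 2, where 'a = real] by (subst summable_Suc_iff) simp
  hence 1: "summable (\<lambda>n. 1 / (1 + real n) ^ 2)" by (simp add: inverse_eq_divide add.commute)
  have nat: "(\<lambda>n. 1 / (1 + real n) ^ 2) summable_on UNIV"
    by (rule norm_summable_imp_summable_on) (use 1 in simp)
  have "(\<lambda>l :: int. 1 / (1 + \<bar>real_of_int l\<bar>) ^ 2) summable_on (range int)"
    by (subst summable_on_reindex) (use nat in \<open>auto simp: o_def\<close>)
  moreover have "(\<lambda>l :: int. 1 / (1 + \<bar>real_of_int l\<bar>) ^ 2) summable_on (range (\<lambda>n. - int n))"
    by (subst summable_on_reindex) (use nat in \<open>auto simp: o_def inj_on_def\<close>)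
  ultimately have "(\<lambda>l :: int. 1 / (1 + \<bar>real_of_int l\<bar>) ^ 2) summable_on (range int \<union> range (\<lambda>n. - int n))"
    by (rule summable_on_union)
  also have "range int \<union> range (\<lambda>n. - int n) = UNIV"
    by (auto simp: image_iff) (metis int_cases2)
  finally show ?thesis .
qed

text \<open>The factor 4 is the price for replacing a real offset a by the nearest integer: 1 + |a +
  l| is at least half of 1 + |l + round a|, and squares are summed.\<close>

definition int_sum_const :: real where
  "int_sum_const = 4 * (\<Sum>\<^sub>\<infinity>l. 1 / (1 + \<bar>real_of_int l\<bar>) ^ 2)"

lemma int_sum_const_nonneg: "0 \<le> int_sum_const"
  unfolding int_sum_const_def by (intro mult_nonneg_nonneg infsum_nonneg) auto

lemma inverse_square_sum_int_le:
  assumes "finite F"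
  shows "(\<Sum>l\<in>F. 1 / (1 + \<bar>a + real_of_int l\<bar>) ^ 2) \<le> int_sum_const"
proof -
  let ?g = "\<lambda>l. 1 / (1 + \<bar>real_of_int l\<bar>) ^ 2"
  have "(\<Sum>l\<in>F. 1 / (1 + \<bar>a + real_of_int l\<bar>) ^ 2) \<le> (\<Sum>l\<in>F. 4 * ?g (l + round a))"
  proof (rule sum_mono)
    fix l
    define p where "p = real_of_int (l + round a)"
    have "\<bar>a - of_int (round a)\<bar> \<le> 1 / 2" using int_dist_le_half[of a] by (simp add: int_dist_def)
    moreover have "\<bar>p\<bar> \<le> \<bar>a + real_of_int l\<bar> + \<bar>a - of_int (round a)\<bar>"
      using abs_triangle_ineq4[of "a + real_of_int l" "a - of_int (round a)"] by (simp add: p_def)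
    ultimately have "(1 + \<bar>p\<bar>) / 2 \<le> 1 + \<bar>a + real_of_int l\<bar>" by argo
    hence "((1 + \<bar>p\<bar>) / 2) ^ 2 \<le> (1 + \<bar>a + real_of_int l\<bar>) ^ 2" by (intro power_mono) auto
    hence "1 / (1 + \<bar>a + real_of_int l\<bar>) ^ 2 \<le> 1 / ((1 + \<bar>p\<bar>) / 2) ^ 2"
      by (intro divide_left_mono mult_pos_pos zero_less_power add_pos_nonneg divide_pos_pos) auto
    thus "1 / (1 + \<bar>a + real_of_int l\<bar>) ^ 2 \<le> 4 * ?g (l + round a)"
      by (simp add: p_def power_divide)
  qed
  also have "\<dots> = 4 * (\<Sum>l\<in>(\<lambda>l. l + round a) ` F. ?g l)"
    by (subst sum.reindex) (auto simp: sum_distrib_left inj_on_def)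
  also have "(\<Sum>l\<in>(\<lambda>l. l + round a) ` F. ?g l) \<le> infsum ?g UNIV"
    by (intro finite_sum_le_infsum inverse_square_summable_int) (use assms in auto)
  finally show ?thesis by (simp add: int_sum_const_def)
qed

text \<open>Multiplied by 2^j, the distances become |2^j y + p m| with integers p m congruent to -m
  modulo 2^j, hence distinct; the sum is part of a sum over all integers.\<close>

lemma weight_sum_1D:
  "(\<Sum>m<2 ^ j. 1 / (1 + 2 ^ j * int_dist (y - real m / 2 ^ j)) ^ 2) \<le> int_sum_const"
proof -
  define p :: "nat \<Rightarrow> int" where "p m = - (int m + 2 ^ j * round (y - real m / 2 ^ j))" for m
  have eq: "2 ^ j * int_dist (y - real m / 2 ^ j) = \<bar>2 ^ j * y + real_of_int (p m)\<bar>" for m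
  proof -
    have "2 ^ j * int_dist (y - real m / 2 ^ j) = \<bar>2 ^ j * (y - real m / 2 ^ j - of_int (round (y - real m / 2 ^ j)))\<bar>"
      by (simp add: int_dist_def abs_mult)
    also have "2 ^ j * (y - real m / 2 ^ j - of_int (round (y - real m / 2 ^ j))) = 2 ^ j * y + real_of_int (p m)"
      by (simp add: p_def algebra_simps)
    finally show ?thesis .
  qed
  have inj: "inj_on p {..<2 ^ j}"
  proof (rule inj_onI)
    fix m m' :: nat assume *: "m \<in> {..<2 ^ j}" "m' \<in> {..<2 ^ j}" "p m = p m'"
    have "int m + 2 ^ j * round (y - real m / 2 ^ j) = int m' + 2 ^ j * round (y - real m' / 2 ^ j)"
      using *(3) unfolding p_def by (rule neg_equal_iff_equal[THEN iffD1])
    hence "(int m + 2 ^ j * round (y - real m / 2 ^ j)) mod 2 ^ j = (int m' + 2 ^ j * round (y - real m' / 2 ^ j)) mod 2 ^ j"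
      by (rule arg_cong)
    hence "int m mod 2 ^ j = int m' mod 2 ^ j" by simp
    moreover have "int m < 2 ^ j" "int m' < 2 ^ j"
      using *(1,2) of_nat_less_iff[of m "2 ^ j", where 'a = int] of_nat_less_iff[of m' "2 ^ j", where 'a = int] by simp_all
    ultimately show "m = m'" by simp
  qed
  have "(\<Sum>m<2 ^ j. 1 / (1 + 2 ^ j * int_dist (y - real m / 2 ^ j)) ^ 2) =
     (\<Sum>l\<in>p ` {..<2 ^ j}. 1 / (1 + \<bar>2 ^ j * y + real_of_int l\<bar>) ^ 2)"
    by (subst sum.reindex[OF inj]) (simp add: eq)
  also have "\<dots> \<le> int_sum_const" by (rule inverse_square_sum_int_le) auto
  finally show ?thesis .
qed

definition periodize :: "nat \<Rightarrow> nat \<Rightarrow> (real \<Rightarrow> real) \<Rightarrow> real \<Rightarrow> real" where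
  "periodize j m f x = (\<Sum>\<^sub>\<infinity>l\<in>(UNIV :: int set). 2 powr (real j / 2) * f (2 ^ j * (x + of_int l) - real m))"

text \<open>Of the B + 2 powers of decay, B are estimated by the distance to the nearest translate,
  which is the same for all l, and the remaining 2 make the sum over l converge.\<close>

lemma periodize_finite_sum:
  assumes D: "\<And>x. \<bar>f x\<bar> \<le> D / (1 + \<bar>x\<bar>) ^ (B + 2)" and "finite F"
  shows "(\<Sum>l\<in>F. \<bar>2 powr (real j / 2) * f (2 ^ j * (x + of_int l) - real m)\<bar>) \<le>
    D * int_sum_const * 2 powr (real j / 2) / (1 + 2 ^ j * int_dist (x - real m / 2 ^ j)) ^ B"
proof -
  define u where "u l = \<bar>2 ^ j * (x + of_int l) - real m\<bar>" for l :: int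
  let ?w = "1 + 2 ^ j * int_dist (x - real m / 2 ^ j)"
  have D0: "0 \<le> D" using D[of 0] by simp
  have w: "0 < ?w" by (intro add_pos_nonneg) auto
  have uw: "?w \<le> 1 + u l" for l
  proof -
    have "2 ^ j * (x + of_int l) - real m = 2 ^ j * ((x - real m / 2 ^ j) - of_int (- l))"
      by (simp add: field_simps)
    hence "u l = 2 ^ j * \<bar>(x - real m / 2 ^ j) - of_int (- l)\<bar>"
      unfolding u_def by (simp only: abs_mult) simp
    thus ?thesis using int_dist_le[of "x - real m / 2 ^ j" "- l"] by simp
  qed
  have "(\<Sum>l\<in>F. \<bar>2 powr (real j / 2) * f (2 ^ j * (x + of_int l) - real m)\<bar>) \<le>
     (\<Sum>l\<in>F. 2 powr (real j / 2) * D / ?w ^ B * (1 / (1 + \<bar>(2 ^ j * x - real m) + real_of_int (2 ^ j * l)\<bar>) ^ 2))"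
  proof (rule sum_mono)
    fix l
    have "\<bar>f (2 ^ j * (x + of_int l) - real m)\<bar> \<le> D / ((1 + u l) ^ B * (1 + u l) ^ 2)"
      using D[of "2 ^ j * (x + of_int l) - real m"] unfolding u_def power_add .
    also have "\<dots> \<le> D / (?w ^ B * (1 + u l) ^ 2)"
      using D0 w uw by (intro divide_left_mono mult_right_mono power_mono mult_pos_pos zero_less_power)
        (auto intro: less_le_trans simp: u_def add_pos_nonneg)
    finally have "2 powr (real j / 2) * \<bar>f (2 ^ j * (x + of_int l) - real m)\<bar> \<le> 2 powr (real j / 2) * (D / (?w ^ B * (1 + u l) ^ 2))"
      by (rule mult_left_mono) auto
    thus "\<bar>2 powr (real j / 2) * f (2 ^ j * (x + of_int l) - real m)\<bar> \<le>
        2 powr (real j / 2) * D / ?w ^ B * (1 / (1 + \<bar>(2 ^ j * x - real m) + real_of_int (2 ^ j * l)\<bar>) ^ 2)"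
      by (simp add: abs_mult u_def algebra_simps)
  qed
  also have "\<dots> = 2 powr (real j / 2) * D / ?w ^ B * (\<Sum>l\<in>(\<lambda>l. 2 ^ j * l) ` F. 1 / (1 + \<bar>(2 ^ j * x - real m) + real_of_int l\<bar>) ^ 2)"
    by (subst sum.reindex) (auto simp: inj_on_def sum_distrib_left)
  also have "\<dots> \<le> 2 powr (real j / 2) * D / ?w ^ B * int_sum_const"
    using D0 w assms(2) by (intro mult_left_mono inverse_square_sum_int_le) auto
  finally show ?thesis by (simp add: mult_ac)
qed

lemma periodize_summable:
  assumes D: "\<And>x. \<bar>f x\<bar> \<le> D / (1 + \<bar>x\<bar>) ^ (B + 2)"
  shows "(\<lambda>l :: int. norm (2 powr (real j / 2) * f (2 ^ j * (x + of_int l) - real m))) summable_on UNIV"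
  by (rule nonneg_bounded_partial_sums_imp_summable_on[where C = "D * int_sum_const * 2 powr (real j / 2) / (1 + 2 ^ j * int_dist (x - real m / 2 ^ j)) ^ B"])
     (use periodize_finite_sum[OF D] in \<open>auto intro!: eventually_finite_subsets_at_top_weakI\<close>)

lemma periodize_bound:
  assumes D: "\<And>x. \<bar>f x\<bar> \<le> D / (1 + \<bar>x\<bar>) ^ (B + 2)"
  shows "\<bar>periodize j m f x\<bar> \<le>
    D * int_sum_const * 2 powr (real j / 2) / (1 + 2 ^ j * int_dist (x - real m / 2 ^ j)) ^ B"
proof -
  let ?F = "\<lambda>l :: int. 2 powr (real j / 2) * f (2 ^ j * (x + of_int l) - real m)"
  have "norm (infsum ?F UNIV) \<le> (\<Sum>\<^sub>\<infinity>l. norm (?F l))" by (rule norm_infsum_bound) (rule periodize_summable[OF D])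
  also have "\<dots> \<le> D * int_sum_const * 2 powr (real j / 2) / (1 + 2 ^ j * int_dist (x - real m / 2 ^ j)) ^ B"
    using periodize_summable[OF D] by (rule infsum_le_finite_sums) (use periodize_finite_sum[OF D] in auto)
  finally show ?thesis by (simp add: periodize_def)
qed

text \<open>Enumerating the integers by \<open>int_decode\<close> turns the unordered sum into an
  ordinary series, the form used for measurability and for termwise differentiation.\<close>

lemma periodize_sums:
  assumes D: "\<And>x. \<bar>f x\<bar> \<le> D / (1 + \<bar>x\<bar>) ^ 2"
  shows "(\<lambda>n. 2 powr (real j / 2) * f (2 ^ j * (x + of_int (int_decode n)) - real m)) sums periodize j m f x"
proof -
  let ?F = "\<lambda>l :: int. 2 powr (real j / 2) * f (2 ^ j * (x + of_int l) - real m)"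
  have D': "\<bar>f x\<bar> \<le> D / (1 + \<bar>x\<bar>) ^ (0 + 2)" for x using D by (simp only: add_0)
  have "?F summable_on UNIV" using periodize_summable[OF D'] by (rule abs_summable_summable)
  hence "(?F has_sum periodize j m f x) UNIV" unfolding periodize_def by (rule has_sum_infsum)
  hence "((\<lambda>n. ?F (int_decode n)) has_sum periodize j m f x) UNIV"
    by (subst has_sum_reindex_bij_betw[OF bij_int_decode])
  thus ?thesis by (rule has_sum_imp_sums)
qed

lemma periodize_add_int: "periodize j m f (x + of_int a) = periodize j m f x"
proof -
  have "bij (\<lambda>l :: int. a + l)" by (rule bij_betwI[where g = "\<lambda>l. l - a"]) auto
  from infsum_reindex_bij_betw[OF this, of "\<lambda>l. 2 powr (real j / 2) * f (2 ^ j * (x + of_int l) - real m)"]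
  show ?thesis by (simp add: periodize_def add.assoc)
qed

lemma borel_measurable_periodize:
  assumes [measurable]: "f \<in> borel_measurable borel" and D: "\<And>x. \<bar>f x\<bar> \<le> D / (1 + \<bar>x\<bar>) ^ 2"
  shows "periodize j m f \<in> borel_measurable borel"
proof -
  have "periodize j m f = (\<lambda>x. \<Sum>n. 2 powr (real j / 2) * f (2 ^ j * (x + of_int (int_decode n)) - real m))"
    using periodize_sums[of f, OF D] by (auto simp: sums_iff fun_eq_iff)
  thus ?thesis by simp
qed

lemma periodize_deriv:
  assumes fg: "\<And>x. (f has_real_derivative g x) (at x)"
    and D: "\<And>x. \<bar>f x\<bar> \<le> D / (1 + \<bar>x\<bar>) ^ 2" and D': "\<And>x. \<bar>g x\<bar> \<le> D' / (1 + \<bar>x\<bar>) ^ 2"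
  shows "(periodize j m f has_real_derivative 2 ^ j * periodize j m g x) (at x)"
proof -
  define R where "R = \<bar>x\<bar> + 1"
  let ?S = "{-R..R}"
  let ?c = "2 powr (real j / 2)"
  let ?f = "\<lambda>n x. ?c * f (2 ^ j * (x + of_int (int_decode n)) - real m)"
  let ?f' = "\<lambda>n x. 2 ^ j * (?c * g (2 ^ j * (x + of_int (int_decode n)) - real m))"
  have D0: "0 \<le> D'" using D'[of 0] by simp
  \<comment> \<open>With v the argument of g, 2^j l = v - (2^j y - m) and |y| at most R give that 1
    + |l| is at most (1 + 2^j R + m) (1 + |v|); K is the square of that constant.\<close>
  define K where "K = (1 + 2 ^ j * R + real m) ^ 2"
  let ?M = "\<lambda>l :: int. 2 ^ j * ?c * D' * K * (1 / (1 + \<bar>real_of_int l\<bar>) ^ 2)"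
  have "((\<lambda>x. \<Sum>n. ?f n x) has_field_derivative (\<Sum>n. ?f' n x)) (at x)"
  proof (rule has_field_derivative_series'[where S = ?S and x0 = x])
    show "(?f n has_real_derivative ?f' n y) (at y within ?S)" for n y
      by (rule has_field_derivative_at_within) 
         (auto intro!: derivative_eq_intros DERIV_chain2[OF fg])
    show "uniformly_convergent_on ?S (\<lambda>n x. \<Sum>i<n. ?f' i x)"
    proof (rule Weierstrass_m_test'[where M = "\<lambda>n. ?M (int_decode n)"])
      show "norm (?f' n y) \<le> ?M (int_decode n)" if "y \<in> ?S" for n y
      proof -
        define l where "l = real_of_int (int_decode n)"
        define v where "v = 2 ^ j * (y + l) - real m"
        have "\<bar>y\<bar> \<le> R" using that by auto
        hence "\<bar>2 ^ j * y\<bar> \<le> 2 ^ j * R" by (simp add: abs_mult)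
        hence "\<bar>2 ^ j * y - real m\<bar> \<le> 2 ^ j * R + real m" by linarith
        moreover have "\<bar>l\<bar> \<le> 2 ^ j * \<bar>l\<bar>" by (simp add: mult_le_cancel_right1)
        moreover have "2 ^ j * \<bar>l\<bar> = \<bar>v - (2 ^ j * y - real m)\<bar>"
        proof -
          have "v - (2 ^ j * y - real m) = 2 ^ j * l" by (simp add: v_def algebra_simps)
          thus ?thesis by (simp only: abs_mult) simp
        qed
        ultimately have "1 + \<bar>l\<bar> \<le> 1 + \<bar>v\<bar> + (2 ^ j * R + real m)" by linarith
        also have "\<dots> \<le> (1 + 2 ^ j * R + real m) * (1 + \<bar>v\<bar>)"
          using \<open>\<bar>y\<bar> \<le> R\<close> by (simp add: algebra_simps)
        finally have "(1 + \<bar>l\<bar>) ^ 2 \<le> ((1 + 2 ^ j * R + real m) * (1 + \<bar>v\<bar>)) ^ 2" by (intro power_mono) auto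
        hence "(1 + \<bar>l\<bar>) ^ 2 \<le> K * (1 + \<bar>v\<bar>) ^ 2" by (simp add: K_def power_mult_distrib)
        hence "1 / (1 + \<bar>v\<bar>) ^ 2 \<le> K * (1 / (1 + \<bar>l\<bar>) ^ 2)"
          by (simp add: field_simps add_pos_nonneg)
        hence "D' * (1 / (1 + \<bar>v\<bar>) ^ 2) \<le> D' * (K * (1 / (1 + \<bar>l\<bar>) ^ 2))" by (rule mult_left_mono) fact
        hence "\<bar>g v\<bar> \<le> D' * (K * (1 / (1 + \<bar>l\<bar>) ^ 2))" using D'[of v] by simp
        hence "2 ^ j * ?c * \<bar>g v\<bar> \<le> 2 ^ j * ?c * (D' * (K * (1 / (1 + \<bar>l\<bar>) ^ 2)))"
          by (rule mult_left_mono) auto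
        thus ?thesis by (simp add: abs_mult v_def l_def mult_ac)
      qed
      have "(\<lambda>n. 1 / (1 + \<bar>real_of_int (int_decode n)\<bar>) ^ 2) summable_on UNIV"
        using inverse_square_summable_int by (subst summable_on_reindex_bij_betw[OF bij_int_decode])
      hence "summable (\<lambda>n. 1 / (1 + \<bar>real_of_int (int_decode n)\<bar>) ^ 2)"
        using summable_on_imp_summable by blast
      thus "summable (\<lambda>n. ?M (int_decode n))" by (rule summable_mult)
    qed
    show "summable (\<lambda>n. ?f n x)" using periodize_sums[OF D] by (simp add: sums_iff)
  qed (auto simp: R_def)
  moreover have "(\<lambda>x. \<Sum>n. ?f n x) = periodize j m f"
    using periodize_sums[of f, OF D] by (auto simp: sums_iff fun_eq_iff)
  moreover have "(\<Sum>n. ?f' n x) = 2 ^ j * periodize j m g x"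
    using sums_unique[OF sums_mult[OF periodize_sums[OF D'], of "2 ^ j" j x m]] by simp
  ultimately show ?thesis by simp
qed

section \<open>Tensor products of periodized functions, among them the periodic wavelets\<close>

definition tensor :: "nat \<Rightarrow> ('n::finite \<Rightarrow> nat) \<Rightarrow> ('n \<Rightarrow> real \<Rightarrow> real) \<Rightarrow> real ^ 'n \<Rightarrow> real" where
  "tensor j m \<theta> x = (\<Prod>r\<in>UNIV. periodize j (m r) (\<theta> r) (x $ r))"

lemma periodic_wavelet_tensor:
  "periodic_wavelet \<psi>F \<psi>M j G m = tensor j m (\<lambda>r. case G r of Father \<Rightarrow> \<psi>F | Mother \<Rightarrow> \<psi>M)"
  by (simp add: fun_eq_iff periodic_wavelet_def tensor_def periodize_def)

definition dyadic_pt :: "nat \<Rightarrow> ('n::finite \<Rightarrow> nat) \<Rightarrow> real ^ 'n" where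
  "dyadic_pt j m = (\<chi> r. real (m r) / 2 ^ j)"

lemma periodic_tensor: "periodic (tensor j m \<theta>)"
  by (simp add: periodic_def tensor_def lattice_pt_def periodize_add_int)

lemma borel_measurable_tensor:
  assumes [measurable]: "\<And>r. \<theta> r \<in> borel_measurable borel" and D: "\<And>r x. \<bar>\<theta> r x\<bar> \<le> D / (1 + \<bar>x\<bar>) ^ 2"
  shows "tensor j m \<theta> \<in> borel_measurable borel"
proof -
  have [measurable]: "periodize j (m r) (\<theta> r) \<in> borel_measurable borel" for r
    using D by (intro borel_measurable_periodize) auto
  show ?thesis unfolding tensor_def by measurable
qed

lemma tensor_bound:
  fixes \<theta> :: "'n::finite \<Rightarrow> real \<Rightarrow> real"
  assumes D: "\<And>r x. \<bar>\<theta> r x\<bar> \<le> D / (1 + \<bar>x\<bar>) ^ (B + 2)"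
  shows "\<bar>tensor j m \<theta> x\<bar> \<le> (D * int_sum_const) ^ CARD('n) * 2 powr (real j * real CARD('n) / 2) * torus_weight B j (x - dyadic_pt j m)"
proof -
  have "\<bar>tensor j m \<theta> x\<bar> = (\<Prod>r\<in>UNIV. \<bar>periodize j (m r) (\<theta> r) (x $ r)\<bar>)"
    by (simp add: tensor_def abs_prod)
  also have "\<dots> \<le> (\<Prod>r\<in>UNIV. D * int_sum_const * 2 powr (real j / 2) * (1 / (1 + 2 ^ j * int_dist (x $ r - real (m r) / 2 ^ j)) ^ B))"
    using periodize_bound[OF D] by (intro prod_mono) auto
  also have "\<dots> = (D * int_sum_const) ^ CARD('n) * (2 powr (real j / 2)) ^ CARD('n) * torus_weight B j (x - dyadic_pt j m)"
    unfolding prod.distrib torus_weight_def by (simp add: dyadic_pt_def power_mult_distrib)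
  also have "(2 powr (real j / 2)) ^ CARD('n) = 2 powr (real j * real CARD('n) / 2)"
    by (simp add: powr_realpow[symmetric] powr_powr)
  finally show ?thesis .
qed

text \<open>Only one factor depends on x_r, so the derivative is again a tensor; 2^j is the inner
  derivative.\<close>

lemma dir_deriv_tensor:
  fixes \<theta> :: "'n::finite \<Rightarrow> real \<Rightarrow> real"
  assumes fg: "\<And>x. (\<theta> r has_real_derivative g x) (at x)"
    and D: "\<And>x. \<bar>\<theta> r x\<bar> \<le> D / (1 + \<bar>x\<bar>) ^ 2" and D': "\<And>x. \<bar>g x\<bar> \<le> D' / (1 + \<bar>x\<bar>) ^ 2"
  shows "dir_deriv (axis r 1) (tensor j m \<theta>) (\<lambda>x. 2 ^ j * tensor j m (\<theta>(r := g)) x)"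
  unfolding dir_deriv_def
proof
  fix x :: "real ^ 'n"
  let ?p = "periodize j (m r) (\<theta> r)" and ?p' = "periodize j (m r) g"
  let ?Q = "\<Prod>i\<in>UNIV - {r}. periodize j (m i) (\<theta> i) (x $ i)"
  have "tensor j m \<theta> (x + h *\<^sub>R axis r 1) = ?p (x $ r + h) * ?Q" for h
    unfolding tensor_def by (subst prod.remove[of _ r]) (auto simp: axis_def intro!: prod.cong)
  moreover have "tensor j m (\<theta>(r := g)) x = ?p' (x $ r) * ?Q"
    unfolding tensor_def by (subst prod.remove[of _ r]) (auto intro!: prod.cong)
  moreover have "((\<lambda>h. ?p (x $ r + h) * ?Q) has_real_derivative (2 ^ j * ?p' (x $ r)) * ?Q) (at 0)"
  proof (rule DERIV_cmult_right)
    have "(?p has_real_derivative 2 ^ j * ?p' (x $ r)) (at (0 + x $ r))"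
      using periodize_deriv[OF fg D D', of j "m r" "x $ r"] by simp
    thus "((\<lambda>h. ?p (x $ r + h)) has_real_derivative 2 ^ j * ?p' (x $ r)) (at 0)"
      by (subst (asm) DERIV_shift) (simp add: add.commute)
  qed
  ultimately show "((\<lambda>h. tensor j m \<theta> (x + h *\<^sub>R axis r 1)) has_real_derivative 2 ^ j * tensor j m (\<theta>(r := g)) x) (at 0)"
    by (simp add: mult.assoc)
qed

section \<open>Log-Hoelder continuity\<close>

definition lattice_residue :: "real ^ 'n \<Rightarrow> real ^ 'n" where
  "lattice_residue z = z - lattice_pt (\<chi> i. round (z $ i))"

lemma lattice_residue_nth: "\<bar>lattice_residue z $ i\<bar> = int_dist (z $ i)"
  by (simp add: lattice_residue_def lattice_pt_def int_dist_def)

text \<open>Rounding minimises all components simultaneously, so the infimum over the lattice is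
  attained there.\<close>

lemma torus_dist_residue: "torus_dist x y = norm (lattice_residue (x - y))"
proof (rule antisym)
  let ?z = "x - y"
  have bdd: "bdd_below (range (\<lambda>m. norm (?z + lattice_pt m)))" by (rule bdd_belowI[of _ 0]) auto
  have "lattice_residue ?z = ?z + lattice_pt (- (\<chi> i. round (?z $ i)))"
    by (simp add: lattice_residue_def lattice_pt_def vec_eq_iff)
  thus "torus_dist x y \<le> norm (lattice_residue ?z)"
    unfolding torus_dist_def using cINF_lower[OF bdd, of "- (\<chi> i. round (?z $ i))"] by simp
  show "norm (lattice_residue ?z) \<le> torus_dist x y"
    unfolding torus_dist_def
  proof (rule cINF_greatest)
    fix m :: "int ^ 'a"
    show "norm (lattice_residue ?z) \<le> norm (?z + lattice_pt m)"
    proof (rule norm_le_componentwise_cart)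
      fix i
      have "int_dist (?z $ i) \<le> \<bar>?z $ i - of_int (- (m $ i))\<bar>" by (rule int_dist_le)
      thus "norm (lattice_residue ?z $ i) \<le> norm ((?z + lattice_pt m) $ i)"
        using lattice_residue_nth[of ?z i] by (simp add: lattice_pt_def)
    qed
  qed simp
qed

lemma one_add_sum_le_prod:
  fixes a :: "'a \<Rightarrow> real"
  assumes "finite I" "\<And>i. i \<in> I \<Longrightarrow> 0 \<le> a i"
  shows "1 + (\<Sum>i\<in>I. a i) \<le> (\<Prod>i\<in>I. 1 + a i)"
  using assms
proof (induction I rule: finite_induct)
  case (insert x F)
  have "1 + (\<Sum>i\<in>insert x F. a i) \<le> (1 + a x) * (1 + (\<Sum>i\<in>F. a i))"
    using insert by (simp add: algebra_simps sum_nonneg)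
  also have "\<dots> \<le> (1 + a x) * (\<Prod>i\<in>F. 1 + a i)"
    using insert by (intro mult_left_mono) auto
  finally show ?case using insert by simp
qed simp

lemma torus_weight_eq: "torus_weight B k z = 1 / (\<Prod>i\<in>UNIV. 1 + 2 ^ k * int_dist (z $ i)) ^ B"
  by (simp add: torus_weight_def prod_dividef prod_power_distrib)

lemma torus_weight_add: "torus_weight (A + B) k z = torus_weight A k z * torus_weight B k z"
  by (simp add: torus_weight_eq power_add)

lemma torus_weight_le_1: "torus_weight B k z \<le> 1"
  unfolding torus_weight_def
proof (rule prod_le_1)
  show "0 \<le> 1 / (1 + 2 ^ k * int_dist (z $ i)) ^ B \<and> 1 / (1 + 2 ^ k * int_dist (z $ i)) ^ B \<le> 1" for i
  proof -
    have "1 \<le> (1 + 2 ^ k * int_dist (z $ i)) ^ B" by (rule one_le_power) simp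
    thus ?thesis by (auto simp: divide_le_eq_1 intro: order_trans[OF zero_le_one] less_le_trans[OF zero_less_one])
  qed
qed

lemma torus_weight_antimono:
  assumes "l \<le> k"
  shows "torus_weight B k z \<le> torus_weight B l z"
  unfolding torus_weight_def
proof (intro prod_mono conjI)
  fix i
  have "0 < 1 + 2 ^ n * int_dist (z $ i)" for n by (intro add_pos_nonneg) auto
  moreover have "1 + 2 ^ l * int_dist (z $ i) \<le> 1 + 2 ^ k * int_dist (z $ i)"
    using assms by (intro add_left_mono mult_right_mono power_increasing) auto
  ultimately show "1 / (1 + 2 ^ k * int_dist (z $ i)) ^ B \<le> 1 / (1 + 2 ^ l * int_dist (z $ i)) ^ B"
    by (intro divide_left_mono power_mono mult_pos_pos zero_less_power) (auto intro: less_imp_le)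
qed simp

text \<open>Split at distance 2^(-l/2). For closer points the logarithm is at least (l/2) ln 2, so l
  |g x - g y| is bounded and the power of 2 is at most exp (2 c). For more distant points |g x - g
  y| is at most c, and 2^(l c) = (2^(l/2))^(2 c) is at most 2^l times the distance, raised to 2 c;
  the weight absorbs this once B is 2 c rounded up.\<close>

lemma log_hoelder_weight:
  fixes g :: "real ^ 'n \<Rightarrow> real"
  assumes "C_log_loc g"
  shows "\<exists>B. \<exists>C>0. \<forall>l x y. 2 powr (real l * \<bar>g x - g y\<bar>) * torus_weight B l (x - y) \<le> C"
proof -
  from assms obtain c where per: "periodic g" and c: "0 < c"
    and g: "\<And>x y. \<bar>g x - g y\<bar> \<le> c / ln (exp 1 + 1 / torus_dist x y)"
    unfolding C_log_loc_def by blast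
  define B where "B = nat \<lceil>2 * c\<rceil>"
  have "2 powr (real l * \<bar>g x - g y\<bar>) * torus_weight B l (x - y) \<le> exp (2 * c)" for l x y
  proof -
    define D where "D = torus_dist x y"
    let ?z = "x - y"
    let ?W = "\<Prod>i\<in>UNIV. 1 + 2 ^ l * int_dist (?z $ i)"
    have ge1: "1 \<le> exp (2 * c)" using c by simp
    have D0: "0 \<le> D" by (simp add: D_def torus_dist_residue)
    have e_le: "exp 1 \<le> exp 1 + 1 / D" using D0 by simp
    hence ln1: "1 \<le> ln (exp 1 + 1 / D)"
      by (metis exp_gt_zero less_le_trans ln_exp ln_le_cancel_iff)
    consider "D = 0" | "0 < D" "D \<le> 2 powr (- real l / 2)" | "2 powr (- real l / 2) < D"
      using D0 by fastforce
    thus ?thesis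
    proof cases
      \<comment> \<open>Here 1 / 0 = 0, so the logarithm is only 1 and gives no control that
        improves with l; periodicity gives equality instead.\<close>
      case 1
      hence "lattice_residue ?z = 0" by (simp add: D_def torus_dist_residue)
      hence "x = y + lattice_pt (\<chi> i. round (?z $ i))" by (simp add: lattice_residue_def algebra_simps)
      hence "g x = g y" using per unfolding periodic_def by metis
      thus ?thesis using order_trans[OF torus_weight_le_1[of B l ?z] ge1] by simp
    next
      case 2
      have "2 powr (real l / 2) \<le> 1 / D" using 2 by (simp add: powr_minus field_simps)
      also have "\<dots> \<le> exp 1 + 1 / D" by simp
      finally have "ln (2 powr (real l / 2)) \<le> ln (exp 1 + 1 / D)"
        using D0 by (subst ln_le_cancel_iff) (auto intro!: add_pos_nonneg)
      hence *: "real l / 2 * ln 2 \<le> ln (exp 1 + 1 / D)" by (simp add: ln_powr)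
      have "real l * \<bar>g x - g y\<bar> * ln 2 \<le> real l * (c / ln (exp 1 + 1 / D)) * ln 2"
        using g[of x y] by (intro mult_right_mono mult_left_mono) (auto simp: D_def)
      also have "\<dots> = 2 * c * ((real l / 2 * ln 2) / ln (exp 1 + 1 / D))" by simp
      also have "\<dots> \<le> 2 * c * 1"
        using * ln1 c by (intro mult_left_mono) (auto simp: divide_le_eq_1)
      finally have "2 powr (real l * \<bar>g x - g y\<bar>) \<le> exp (2 * c)" by (simp add: powr_def)
      hence "2 powr (real l * \<bar>g x - g y\<bar>) * torus_weight B l ?z \<le> exp (2 * c) * 1"
        using torus_weight_le_1 torus_weight_pos[THEN less_imp_le] by (intro mult_mono) auto
      thus ?thesis by simp
    next
      case 3
      have "\<bar>g x - g y\<bar> \<le> c / ln (exp 1 + 1 / D)" using g by (simp add: D_def)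
      also have "\<dots> \<le> c / 1" using ln1 c by (intro divide_left_mono) auto
      finally have gc: "\<bar>g x - g y\<bar> \<le> c" by simp
      have "D \<le> (\<Sum>i\<in>UNIV. int_dist (?z $ i))"
        using norm_le_l1_cart[of "lattice_residue ?z"] by (simp add: D_def torus_dist_residue lattice_residue_nth)
      hence "2 ^ l * D \<le> 1 + (\<Sum>i\<in>UNIV. 2 ^ l * int_dist (?z $ i))"
        by (simp add: sum_distrib_left[symmetric])
          (meson add_increasing mult_left_mono order_refl zero_le_numeral zero_le_one zero_le_power)
      also have "\<dots> \<le> ?W" by (rule one_add_sum_le_prod) auto
      finally have "2 ^ l * D \<le> ?W" .
      moreover have "2 powr (real l / 2) = 2 ^ l * 2 powr (- real l / 2)"
        by (simp add: powr_realpow[symmetric] powr_add[symmetric])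
      hence "2 powr (real l / 2) \<le> 2 ^ l * D" using 3 by simp
      ultimately have W: "2 powr (real l / 2) \<le> ?W" by simp
      have W1: "1 \<le> ?W" by (rule order_trans[OF _ W]) (simp add: ge_one_powr_ge_zero)
      have "2 powr (real l * \<bar>g x - g y\<bar>) \<le> 2 powr (real l * c)"
        using gc by (intro powr_mono mult_left_mono) auto
      also have "\<dots> = (2 powr (real l / 2)) powr (2 * c)" by (simp add: powr_powr)
      also have "\<dots> \<le> ?W powr (2 * c)" using W c by (intro powr_mono2) auto
      also have "\<dots> \<le> ?W powr (real B)"
        using W1 real_nat_ceiling_ge[of "2 * c"] by (intro powr_mono) (simp_all add: B_def)
      also have "\<dots> = ?W ^ B" using W1 by (intro powr_realpow) simp
      finally have "2 powr (real l * \<bar>g x - g y\<bar>) * torus_weight B l ?z \<le> ?W ^ B * torus_weight B l ?z"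
        using torus_weight_pos by (intro mult_right_mono) (auto intro: less_imp_le)
      also have "\<dots> = 1"
      proof -
        from W1 have "?W \<noteq> 0" by linarith
        thus ?thesis unfolding torus_weight_eq by (simp del: prod_zero_iff)
      qed
      finally show ?thesis using ge1 by (rule order_trans)
    qed
  qed
  thus ?thesis by (intro exI[of _ B] exI[of _ "exp (2 * c)"]) auto
qed

section \<open>Frequency pieces of wavelets\<close>

definition rapid :: "(real \<Rightarrow> real) \<Rightarrow> bool" where
  "rapid f \<longleftrightarrow> f \<in> borel_measurable borel \<and> (\<forall>A. \<exists>D. \<forall>x. \<bar>f x\<bar> \<le> D / (1 + \<bar>x\<bar>) ^ A)"

text \<open>Indexed so that it can be entered at either end: \<open>f 0 = \<psi>\<close> provides K
  rapidly decreasing derivatives of \<psi>, \<open>f K = \<psi>\<close> provides K rapidly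
  decreasing antiderivatives.\<close>

definition deriv_chain :: "nat \<Rightarrow> (nat \<Rightarrow> real \<Rightarrow> real) \<Rightarrow> bool" where
  "deriv_chain K f \<longleftrightarrow> (\<forall>i\<le>K. rapid (f i)) \<and> (\<forall>i<K. \<forall>x. (f i has_real_derivative f (Suc i) x) (at x))"

text \<open>The common interface of Meyer and Daubechies systems. The last clause, a K-fold
  antiderivative that still decays, is the form in which the vanishing moments of the wavelet are
  used.\<close>

definition regular_wavelets :: "nat \<Rightarrow> (real \<Rightarrow> real) \<Rightarrow> (real \<Rightarrow> real) \<Rightarrow> bool" where
  "regular_wavelets K \<psi>F \<psi>M \<longleftrightarrow> (\<exists>f. deriv_chain K f \<and> f 0 = \<psi>F) \<and>
     (\<exists>f. deriv_chain K f \<and> f 0 = \<psi>M) \<and> (\<exists>f. deriv_chain K f \<and> f K = \<psi>M)"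

lemma rapid_uniform:
  assumes "finite S" "\<And>f. f \<in> S \<Longrightarrow> rapid f"
  shows "\<exists>D\<ge>0. \<forall>f\<in>S. \<forall>x. \<bar>f x\<bar> \<le> D / (1 + \<bar>x\<bar>) ^ A"
proof -
  have "\<forall>f\<in>S. \<exists>D. \<forall>x. \<bar>f x\<bar> \<le> D / (1 + \<bar>x\<bar>) ^ A" using assms(2) unfolding rapid_def by blast
  then obtain D where D: "\<And>f x. f \<in> S \<Longrightarrow> \<bar>f x\<bar> \<le> D f / (1 + \<bar>x\<bar>) ^ A" by metis
  have "\<bar>f x\<bar> \<le> (\<Sum>f\<in>S. \<bar>D f\<bar>) / (1 + \<bar>x\<bar>) ^ A" if "f \<in> S" for f x
  proof -
    have "D f \<le> (\<Sum>f\<in>S. \<bar>D f\<bar>)"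
      using member_le_sum[OF that, of "\<lambda>f. \<bar>D f\<bar>"] assms(1) by simp
    thus ?thesis using D[OF that, of x] by (meson divide_right_mono order_trans zero_le_power abs_ge_zero add_nonneg_nonneg zero_le_one)
  qed
  thus ?thesis by (intro exI[of _ "\<Sum>f\<in>S. \<bar>D f\<bar>"]) (auto intro!: sum_nonneg)
qed

lemma rapid_tensor:
  fixes \<theta> :: "'n::finite \<Rightarrow> real \<Rightarrow> real"
  assumes "\<And>r. rapid (\<theta> r)"
  shows "tensor j m \<theta> \<in> borel_measurable borel" "\<exists>B. \<forall>x. \<bar>tensor j m \<theta> x\<bar> \<le> B"
proof -
  obtain D where D: "\<And>r x. \<bar>\<theta> r x\<bar> \<le> D / (1 + \<bar>x\<bar>) ^ (0 + 2)" 
    using rapid_uniform[of "range \<theta>" "0 + 2"] assms by auto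
  show "tensor j m \<theta> \<in> borel_measurable borel"
  proof (rule borel_measurable_tensor[where D = D])
    show "\<theta> r \<in> borel_measurable borel" for r using assms by (simp add: rapid_def)
    show "\<bar>\<theta> r x\<bar> \<le> D / (1 + \<bar>x\<bar>) ^ 2" for r x using D[of r x] unfolding add_0 .
  qed
  show "\<exists>B. \<forall>x. \<bar>tensor j m \<theta> x\<bar> \<le> B"
    using tensor_bound[of \<theta>, OF D] by (auto simp: torus_weight_def)
qed

lemma fourier_coeff_scale:
  "fourier_coeff (regular_distribution (\<lambda>x. c * f x)) \<mu> = of_real c * fourier_coeff (regular_distribution f) \<mu>"
  by (simp add: fourier_coeff_def regular_distribution_def complex_eq_iff mult.assoc)

lemma dir_deriv_tensor_rapid:
  fixes \<theta> :: "'n::finite \<Rightarrow> real \<Rightarrow> real"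
  assumes "rapid (\<theta> r)" "rapid g" "\<And>x. (\<theta> r has_real_derivative g x) (at x)"
  shows "dir_deriv (axis r 1) (tensor j m \<theta>) (\<lambda>x. 2 ^ j * tensor j m (\<theta>(r := g)) x)"
proof -
  obtain D where D: "\<And>x. \<bar>\<theta> r x\<bar> \<le> D / (1 + \<bar>x\<bar>) ^ 2" using assms(1) unfolding rapid_def by meson
  obtain D' where D': "\<And>x. \<bar>g x\<bar> \<le> D' / (1 + \<bar>x\<bar>) ^ 2" using assms(2) unfolding rapid_def by meson
  show ?thesis by (rule dir_deriv_tensor[where D = D and D' = D']) (use assms(3) D D' in auto)
qed

text \<open>Each derivative in coordinate r multiplies the coefficient by 2 pi i \<mu>_r, while the
  chain rule produces a factor 2^j. Written without division, the identity can be read in both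
  directions and \<mu>_r = 0 does no harm.\<close>

lemma fourier_coeff_tensor_chain:
  fixes \<theta> :: "'n::finite \<Rightarrow> real \<Rightarrow> real"
  assumes chain: "deriv_chain K f" and \<theta>: "\<And>i. rapid (\<theta> i)" and "i \<le> K"
  shows "(2 ^ j) ^ i * fourier_coeff (regular_distribution (tensor j m (\<theta>(r := f i)))) \<mu> =
     (2 * pi * \<i> * of_int (\<mu> $ r)) ^ i * fourier_coeff (regular_distribution (tensor j m (\<theta>(r := f 0)))) \<mu>"
  using assms(3)
proof (induction i)
  case (Suc i)
  let ?T = "\<lambda>i. tensor j m (\<theta>(r := f i))"
  have rap: "rapid (f i)" "rapid (f (Suc i))" using chain Suc by (auto simp: deriv_chain_def)
  have der: "\<And>x. (f i has_real_derivative f (Suc i) x) (at x)" using chain Suc by (auto simp: deriv_chain_def)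
  have r\<theta>: "rapid ((\<theta>(r := f i)) a)" "rapid ((\<theta>(r := f (Suc i))) a)" for a using rap \<theta> by simp_all
  note T = rapid_tensor[of "\<theta>(r := f i)", OF r\<theta>(1), of j m] rapid_tensor[of "\<theta>(r := f (Suc i))", OF r\<theta>(2), of j m]
  obtain B where B: "\<And>x. \<bar>?T i x\<bar> \<le> B" using T(2) by blast
  obtain B' where B': "\<And>x. \<bar>?T (Suc i) x\<bar> \<le> B'" using T(4) by blast
  have "dir_deriv (axis r 1) (?T i) (\<lambda>x. 2 ^ j * ?T (Suc i) x)"
    using dir_deriv_tensor_rapid[of "\<theta>(r := f i)" r "f (Suc i)"] rap der by simp
  hence "fourier_coeff (regular_distribution (\<lambda>x. 2 ^ j * ?T (Suc i) x)) \<mu> =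
     2 * pi * \<i> * of_int (\<mu> $ r) * fourier_coeff (regular_distribution (?T i)) \<mu>"
    by (rule fourier_coeff_dir_deriv[where B = B and B' = "2 ^ j * B'", rotated -1])
       (use T B B' periodic_tensor in \<open>auto simp: abs_mult\<close>)
  hence "2 ^ j * fourier_coeff (regular_distribution (?T (Suc i))) \<mu> =
     2 * pi * \<i> * of_int (\<mu> $ r) * fourier_coeff (regular_distribution (?T i)) \<mu>"
    unfolding fourier_coeff_scale by simp
  hence "(2 ^ j) ^ Suc i * fourier_coeff (regular_distribution (?T (Suc i))) \<mu> =
     2 * pi * \<i> * of_int (\<mu> $ r) * ((2 ^ j) ^ i * fourier_coeff (regular_distribution (?T i)) \<mu>)"
    by (simp add: mult_ac del: fun_upd_apply)
  also have "(2 ^ j) ^ i * fourier_coeff (regular_distribution (?T i)) \<mu> =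
     (2 * pi * \<i> * of_int (\<mu> $ r)) ^ i * fourier_coeff (regular_distribution (?T 0)) \<mu>"
    using Suc by (simp del: fun_upd_apply)
  finally show ?case by (simp only: power_Suc mult.assoc)
qed simp

lemma frequency_piece_trig_sum:
  "frequency_piece \<phi>\<^sub>0 \<phi> k T = trig_sum (\<lambda>\<mu>. of_real (dyadic_block \<phi>\<^sub>0 \<phi> k (lattice_pt \<mu>)) * fourier_coeff T \<mu>)"
  by (simp add: frequency_piece_def trig_sum_def fun_eq_iff)

text \<open>These properties are shared by both generators of a resolution of unity and survive
  multiplication by a power of a coordinate.\<close>

definition smooth_bump :: "(real ^ 'n \<Rightarrow> real) \<Rightarrow> bool" where
  "smooth_bump \<zeta> \<longleftrightarrow> (\<forall>r A. smooth_dir (axis r 1) A \<zeta>) \<and> (\<forall>x. 2 < norm x \<longrightarrow> \<zeta> x = 0)"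

definition scaled_symbol :: "(real ^ 'n \<Rightarrow> real) \<Rightarrow> nat \<Rightarrow> int ^ 'n \<Rightarrow> complex" where
  "scaled_symbol \<zeta> k \<mu> = of_real (\<zeta> ((1 / 2 ^ k) *\<^sub>R lattice_pt \<mu>))"

lemma norm_lattice_pt_ge: "\<mu> \<notin> int_box N \<Longrightarrow> of_int N < norm (lattice_pt \<mu>)"
proof -
  assume "\<mu> \<notin> int_box N"
  then obtain i where "N < \<bar>\<mu> $ i\<bar>" by (auto simp: int_box_def not_le)
  hence "real_of_int N < real_of_int \<bar>\<mu> $ i\<bar>" by (simp only: of_int_less_iff)
  also have "\<dots> = \<bar>lattice_pt \<mu> $ i\<bar>" by (simp add: lattice_pt_def)
  also have "\<dots> \<le> norm (lattice_pt \<mu>)" by (rule component_le_norm_cart)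
  finally show ?thesis .
qed

lemma scaled_symbol_support:
  assumes "smooth_bump \<zeta>" "\<mu> \<notin> int_box (2 ^ (k + 1))"
  shows "scaled_symbol \<zeta> k \<mu> = 0"
proof -
  have "2 < norm ((1 / 2 ^ k) *\<^sub>R lattice_pt \<mu>)"
    using norm_lattice_pt_ge[OF assms(2)] by (simp add: field_simps)
  thus ?thesis using assms(1) by (simp add: smooth_bump_def scaled_symbol_def)
qed

lemma finite_int_box: "finite (int_box (2 ^ (k + 1)) :: (int ^ 'n) set)"
  by (rule int_box_card(1)) simp

lemma scaled_kernel_bound:
  fixes \<zeta> :: "real ^ 'n \<Rightarrow> real"
  assumes "smooth_bump \<zeta>"
  shows "\<exists>C\<ge>0. \<forall>k z. cmod (trig_sum (scaled_symbol \<zeta> k) z) \<le> C * (2 ^ k) ^ CARD('n) * torus_weight B k z"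
  using kernel_bound[of \<zeta> B] assms unfolding smooth_bump_def scaled_symbol_def by blast

lemma scaled_multiplier_bound:
  fixes \<zeta> :: "real ^ 'n::finite \<Rightarrow> real"
  assumes "smooth_bump \<zeta>"
  shows "\<exists>C\<ge>0. \<forall>j k m \<theta> x. (\<forall>r. rapid (\<theta> r) \<and> (\<forall>x. \<bar>\<theta> r x\<bar> \<le> D / (1 + \<bar>x\<bar>) ^ (B + 2))) \<longrightarrow>
     ennreal (cmod (trig_sum (\<lambda>\<mu>. scaled_symbol \<zeta> k \<mu> * fourier_coeff (regular_distribution (tensor j m \<theta>)) \<mu>) x)) \<le>
       (\<integral>\<^sup>+y. ennreal (C * ((2 ^ k) ^ CARD('n) * torus_weight B k (x - y)) * (2 powr (real j * real CARD('n) / 2) * torus_weight B j (y - dyadic_pt j m))) \<partial>torus)"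
proof -
  obtain C where C: "0 \<le> C" "\<And>k z. cmod (trig_sum (scaled_symbol \<zeta> k) z) \<le> C * (2 ^ k) ^ CARD('n) * torus_weight B k z"
    using scaled_kernel_bound[OF assms, of B] by blast
  define C' where "C' = C * \<bar>D * int_sum_const\<bar> ^ CARD('n)"
  have "ennreal (cmod (trig_sum (\<lambda>\<mu>. scaled_symbol \<zeta> k \<mu> * fourier_coeff (regular_distribution (tensor j m \<theta>)) \<mu>) x)) \<le>
       (\<integral>\<^sup>+y. ennreal (C' * ((2 ^ k) ^ CARD('n) * torus_weight B k (x - y)) * (2 powr (real j * real CARD('n) / 2) * torus_weight B j (y - dyadic_pt j m))) \<partial>torus)"
    if \<theta>: "\<And>r. rapid (\<theta> r)" "\<And>r x. \<bar>\<theta> r x\<bar> \<le> D / (1 + \<bar>x\<bar>) ^ (B + 2)" for j k m \<theta> x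
  proof -
    obtain M where M: "\<And>x. \<bar>tensor j m \<theta> x\<bar> \<le> M" using rapid_tensor(2)[of \<theta> j m] \<theta>(1) by blast
    have "ennreal (cmod (trig_sum (\<lambda>\<mu>. scaled_symbol \<zeta> k \<mu> * fourier_coeff (regular_distribution (tensor j m \<theta>)) \<mu>) x)) \<le>
       (\<integral>\<^sup>+y. ennreal (cmod (trig_sum (scaled_symbol \<zeta> k) (x - y)) * \<bar>tensor j m \<theta> y\<bar>) \<partial>torus)"
      by (rule fourier_multiplier_bound[OF _ M finite_int_box])
         (use rapid_tensor(1) \<theta>(1) scaled_symbol_support[OF assms] in blast)+
    also have "\<dots> \<le> (\<integral>\<^sup>+y. ennreal (C' * ((2 ^ k) ^ CARD('n) * torus_weight B k (x - y)) * (2 powr (real j * real CARD('n) / 2) * torus_weight B j (y - dyadic_pt j m))) \<partial>torus)"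
    proof (intro nn_integral_mono ennreal_leI)
      fix y
      have "\<bar>tensor j m \<theta> y\<bar> \<le> (D * int_sum_const) ^ CARD('n) * 2 powr (real j * real CARD('n) / 2) * torus_weight B j (y - dyadic_pt j m)"
        by (rule tensor_bound[OF \<theta>(2)])
      also have "\<dots> \<le> \<bar>D * int_sum_const\<bar> ^ CARD('n) * 2 powr (real j * real CARD('n) / 2) * torus_weight B j (y - dyadic_pt j m)"
        using torus_weight_pos[THEN less_imp_le]
        by (intro mult_right_mono) (auto simp: power_abs[symmetric])
      finally have T: "\<bar>tensor j m \<theta> y\<bar> \<le> \<dots>" .
      have "cmod (trig_sum (scaled_symbol \<zeta> k) (x - y)) * \<bar>tensor j m \<theta> y\<bar> \<le> 
        (C * (2 ^ k) ^ CARD('n) * torus_weight B k (x - y)) *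
        (\<bar>D * int_sum_const\<bar> ^ CARD('n) * 2 powr (real j * real CARD('n) / 2) * torus_weight B j (y - dyadic_pt j m))"
        using C T torus_weight_pos[THEN less_imp_le] by (intro mult_mono mult_nonneg_nonneg) auto
      thus "cmod (trig_sum (scaled_symbol \<zeta> k) (x - y)) * \<bar>tensor j m \<theta> y\<bar> \<le> 
        C' * ((2 ^ k) ^ CARD('n) * torus_weight B k (x - y)) * (2 powr (real j * real CARD('n) / 2) * torus_weight B j (y - dyadic_pt j m))"
        by (simp add: C'_def mult_ac)
    qed
    finally show ?thesis .
  qed
  moreover have "0 \<le> C'" using C by (simp add: C'_def)
  ultimately show ?thesis by (intro exI[of _ C']) blast
qed

lemma axis_Basis: "axis r 1 \<in> (Basis :: (real ^ 'n) set)"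
  by (auto simp: Basis_axis)

lemma smooth_dir_nth: "smooth_dir e A (\<lambda>x :: real ^ 'n. x $ r)"
  using smooth_dir_inner[of e A "axis r 1"] by (simp add: inner_axis)

lemma smooth_bump_mult_nth_power:
  assumes "smooth_bump \<zeta>"
  shows "smooth_bump (\<lambda>x :: real ^ 'n. \<zeta> x * x $ r ^ K)"
  using assms by (auto simp: smooth_bump_def intro!: smooth_dir_mult smooth_dir_power smooth_dir_nth)

lemma resolution_smooth_bump:
  assumes "resolution_of_unity \<phi>\<^sub>0 \<phi>"
  shows "smooth_bump \<phi>\<^sub>0" "smooth_bump \<phi>"
  using assms unfolding resolution_of_unity_def smooth_bump_def
  by (meson C_infinity_smooth_dir axis_Basis not_le)+

text \<open>Derivatives in direction r call for a factor x_r^K, but no single coordinate stays away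
  from 0 on the whole annulus. The functions \<open>\<phi> x * x $ r ^ K / \<rho> x\<close>, with
  \<rho> the sum of all x_i^(2 K), share the work: \<rho> is bounded below where the norm is at
  least 1/2, and \<phi> vanishes elsewhere.\<close>

lemma annulus_decomposition:
  fixes \<phi> :: "real ^ 'n \<Rightarrow> real"
  assumes smooth: "smooth_bump \<phi>" and ann: "\<And>x. norm x < 1 / 2 \<Longrightarrow> \<phi> x = 0"
  shows "\<exists>\<zeta>. (\<forall>r. smooth_bump (\<zeta> r)) \<and> (\<forall>x. \<phi> x = (\<Sum>r\<in>UNIV. \<zeta> r x * x $ r ^ K))"
proof -
  define \<rho> where "\<rho> x = (\<Sum>i\<in>UNIV. (x $ i ^ K) ^ 2)" for x :: "real ^ 'n"
  \<comment> \<open>If the norm is at least 1/2, some coordinate is at least 1 / (2 n) in modulus,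
    because the moduli of the coordinates add up to at least the norm.\<close>
  define c where "c = ((1 / (2 * real CARD('n))) ^ K) ^ 2"
  have c0: "0 < c" by (simp add: c_def)
  have \<rho>: "c \<le> \<rho> x" if "1 / 2 \<le> norm x" for x
  proof -
    have "\<exists>i. 1 / (2 * real CARD('n)) \<le> \<bar>x $ i\<bar>"
    proof (rule ccontr)
      assume "\<not> ?thesis"
      hence "(\<Sum>i\<in>UNIV. \<bar>x $ i\<bar>) < (\<Sum>i\<in>(UNIV :: 'n set). 1 / (2 * real CARD('n)))"
        by (intro sum_strict_mono) (auto simp: not_le)
      thus False using norm_le_l1_cart[of x] that by simp
    qed
    then obtain i where "1 / (2 * real CARD('n)) \<le> \<bar>x $ i\<bar>" ..
    hence "(1 / (2 * real CARD('n))) ^ K \<le> \<bar>x $ i\<bar> ^ K" by (intro power_mono) auto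
    hence "c \<le> (\<bar>x $ i\<bar> ^ K) ^ 2" unfolding c_def by (rule power_mono) auto
    also have "\<dots> = (x $ i ^ K) ^ 2" by (metis power2_abs power_abs)
    also have "\<dots> \<le> \<rho> x"
      unfolding \<rho>_def using member_le_sum[of i UNIV "\<lambda>i. (x $ i ^ K) ^ 2"] by simp
    finally show ?thesis .
  qed
  have \<rho>_smooth: "smooth_dir e A \<rho>" for e A
    unfolding \<rho>_def by (intro smooth_dir_sum smooth_dir_power smooth_dir_nth)
  define \<zeta> where "\<zeta> r x = (\<phi> x * x $ r ^ K) / \<rho> x" for r x
  have "smooth_bump (\<zeta> r)" for r
  proof -
    have "smooth_dir (axis i 1) A (\<zeta> r)" for i A
      unfolding \<zeta>_def
    proof (rule smooth_dir_divide[where r = "1 / 2" and c = c])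
      show "c \<le> \<bar>\<rho> x\<bar>" if "1 / 2 \<le> norm x" for x using \<rho>[OF that] by simp
    qed (use smooth_bump_mult_nth_power[OF smooth] ann c0 \<rho>_smooth in \<open>auto simp: smooth_bump_def\<close>)
    thus ?thesis using smooth by (simp add: smooth_bump_def \<zeta>_def)
  qed
  moreover have "\<phi> x = (\<Sum>r\<in>UNIV. \<zeta> r x * x $ r ^ K)" for x
  proof (cases "norm x < 1 / 2")
    case False
    hence "\<rho> x \<noteq> 0" using \<rho>[of x] c0 by auto
    have "(\<Sum>r\<in>UNIV. \<zeta> r x * x $ r ^ K) = \<phi> x / \<rho> x * \<rho> x"
      unfolding \<rho>_def sum_distrib_left by (intro sum.cong) (auto simp: \<zeta>_def \<rho>_def power2_eq_square)
    thus ?thesis using \<open>\<rho> x \<noteq> 0\<close> by simp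
  qed (simp add: \<zeta>_def ann)
  ultimately show ?thesis by blast
qed

lemma two_power_ratio: "j \<le> k \<Longrightarrow> 2 ^ j / 2 ^ k = (2 powr (- real (k - j)) :: real)"
proof -
  assume "j \<le> k"
  then obtain d where "k = j + d" using le_Suc_ex by blast
  thus ?thesis by (simp add: powr_minus powr_realpow power_add inverse_eq_divide)
qed

text \<open>For frequencies above the wavelet level the symbol is split so that each part carries
  (\<mu>_r / 2^k)^K. This power times the Fourier coefficient of the wavelet is (2^j / 2^k)^K / (2
  pi i)^K times the coefficient of the tensor with its r-th factor differentiated K times, whence
  the gain.\<close>

lemma frequency_piece_high:
  fixes \<theta> :: "'n::finite \<Rightarrow> real \<Rightarrow> real" and \<zeta> :: "'n \<Rightarrow> real ^ 'n \<Rightarrow> real"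
  assumes chain: "\<And>r. deriv_chain K (f r)" "\<And>r. f r 0 = \<theta> r"
    and \<zeta>: "\<And>r. smooth_bump (\<zeta> r)" "\<And>x. \<phi> x = (\<Sum>r\<in>UNIV. \<zeta> r x * x $ r ^ K)" and "k \<ge> 1" "j \<le> k"
  shows "cmod (frequency_piece \<phi>\<^sub>0 \<phi> k (regular_distribution (tensor j m \<theta>)) x) \<le>
    (\<Sum>r\<in>UNIV. 2 powr (- (real (k - j) * real K)) *
      cmod (trig_sum (\<lambda>\<mu>. scaled_symbol (\<zeta> r) k \<mu> * fourier_coeff (regular_distribution (tensor j m (\<theta>(r := f r K)))) \<mu>) x))"
proof -
  let ?fc = "\<lambda>\<theta> \<mu>. fourier_coeff (regular_distribution (tensor j m \<theta>)) \<mu>"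
  let ?S = "int_box (2 ^ (k + 1)) :: (int ^ 'n) set"
  let ?E = "\<lambda>\<mu>. cis (2 * pi * (lattice_pt \<mu> \<bullet> x))"
  define c where "c = (2 ^ j / 2 ^ k) ^ K / (2 * of_real pi * \<i>) ^ K"
  have rap: "rapid (\<theta> r)" for r using chain[of r] unfolding deriv_chain_def by (metis le0)
  have key: "of_real (dyadic_block \<phi>\<^sub>0 \<phi> k (lattice_pt \<mu>)) * ?fc \<theta> \<mu> =
    (\<Sum>r\<in>UNIV. c * (scaled_symbol (\<zeta> r) k \<mu> * ?fc (\<theta>(r := f r K)) \<mu>))" for \<mu>
  proof -
    have "of_real (dyadic_block \<phi>\<^sub>0 \<phi> k (lattice_pt \<mu>)) * ?fc \<theta> \<mu> =
       (\<Sum>r\<in>UNIV. scaled_symbol (\<zeta> r) k \<mu> * of_real (((1 / 2 ^ k) *\<^sub>R lattice_pt \<mu>) $ r ^ K) * ?fc \<theta> \<mu>)"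
      using \<open>k \<ge> 1\<close> by (simp add: dyadic_block_def \<zeta>(2) scaled_symbol_def sum_distrib_right)
    also have "\<dots> = (\<Sum>r\<in>UNIV. c * (scaled_symbol (\<zeta> r) k \<mu> * ?fc (\<theta>(r := f r K)) \<mu>))"
    proof (intro sum.cong refl)
      fix r
      have 1: "(2 ^ j) ^ K * ?fc (\<theta>(r := f r K)) \<mu> = (2 * pi * \<i> * of_int (\<mu> $ r)) ^ K * ?fc \<theta> \<mu>"
        using fourier_coeff_tensor_chain[where \<theta> = \<theta>, OF chain(1) rap order_refl, where j = j and r = r and m = m and \<mu> = \<mu>] chain(2)
        by simp
      have "((1 / 2 ^ k) *\<^sub>R lattice_pt \<mu>) $ r ^ K * (2 ^ k) ^ K = (of_int (\<mu> $ r)) ^ K"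
        by (simp add: lattice_pt_def power_divide)
      hence "complex_of_real (((1 / 2 ^ k) *\<^sub>R lattice_pt \<mu>) $ r ^ K) = (of_int (\<mu> $ r)) ^ K / (2 ^ k) ^ K"
        by (simp add: lattice_pt_def power_divide)
      hence "of_real (((1 / 2 ^ k) *\<^sub>R lattice_pt \<mu>) $ r ^ K) * ?fc \<theta> \<mu> =
         (2 * pi * \<i> * of_int (\<mu> $ r)) ^ K * ?fc \<theta> \<mu> / ((2 ^ k) ^ K * (2 * of_real pi * \<i>) ^ K)"
        by (simp add: power_mult_distrib)
      also have "\<dots> = c * ?fc (\<theta>(r := f r K)) \<mu>"
        unfolding 1[symmetric] by (simp add: c_def power_divide del: fun_upd_apply)
      finally show "scaled_symbol (\<zeta> r) k \<mu> * of_real (((1 / 2 ^ k) *\<^sub>R lattice_pt \<mu>) $ r ^ K) * ?fc \<theta> \<mu> =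
        c * (scaled_symbol (\<zeta> r) k \<mu> * ?fc (\<theta>(r := f r K)) \<mu>)"
        by (simp add: mult.assoc mult.left_commute del: fun_upd_apply)
    qed
    finally show ?thesis .
  qed
  have supp: "scaled_symbol (\<zeta> r) k \<mu> = 0" if "\<mu> \<notin> ?S" for r \<mu>
    using scaled_symbol_support[OF \<zeta>(1) that] .
  have ts: "trig_sum (\<lambda>\<mu>. scaled_symbol (\<zeta> r) k \<mu> * ?fc \<theta>' \<mu>) x = (\<Sum>\<mu>\<in>?S. scaled_symbol (\<zeta> r) k \<mu> * ?fc \<theta>' \<mu> * ?E \<mu>)" for r \<theta>'
    by (rule trig_sum_finite[OF finite_int_box]) (simp add: supp)
  have "frequency_piece \<phi>\<^sub>0 \<phi> k (regular_distribution (tensor j m \<theta>)) x =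
     (\<Sum>\<mu>\<in>?S. (\<Sum>r\<in>UNIV. c * (scaled_symbol (\<zeta> r) k \<mu> * ?fc (\<theta>(r := f r K)) \<mu>)) * ?E \<mu>)"
    unfolding frequency_piece_trig_sum key
    by (rule trig_sum_finite[OF finite_int_box]) (simp add: supp)
  also have "\<dots> = (\<Sum>r\<in>UNIV. c * trig_sum (\<lambda>\<mu>. scaled_symbol (\<zeta> r) k \<mu> * ?fc (\<theta>(r := f r K)) \<mu>) x)"
    unfolding ts sum_distrib_left sum_distrib_right by (subst sum.swap) (simp add: mult.assoc)
  also have "cmod \<dots> \<le> (\<Sum>r\<in>UNIV. cmod c * cmod (trig_sum (\<lambda>\<mu>. scaled_symbol (\<zeta> r) k \<mu> * ?fc (\<theta>(r := f r K)) \<mu>) x))"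
    by (rule order_trans[OF norm_sum]) (simp add: norm_mult)
  also have "\<dots> \<le> (\<Sum>r\<in>UNIV. 2 powr (- (real (k - j) * real K)) * cmod (trig_sum (\<lambda>\<mu>. scaled_symbol (\<zeta> r) k \<mu> * ?fc (\<theta>(r := f r K)) \<mu>) x))"
  proof (intro sum_mono mult_right_mono)
    have "cmod c = (2 ^ j / 2 ^ k) ^ K / (2 * pi) ^ K"
      by (simp add: c_def norm_divide norm_power norm_mult)
    also have "\<dots> \<le> (2 ^ j / 2 ^ k) ^ K / 1"
      using pi_gt3 by (intro divide_left_mono one_le_power) auto
    also have "2 ^ j / 2 ^ k = (2 powr (- real (k - j)) :: real)"
      using two_power_ratio[OF \<open>j \<le> k\<close>] .
    also have "\<dots> ^ K / 1 = 2 powr (- (real (k - j) * real K))"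
      by (simp add: powr_powr flip: powr_realpow)
    finally show "cmod c \<le> 2 powr (- (real (k - j) * real K))" .
  qed auto
  finally show ?thesis .
qed

text \<open>The opposite direction: one factor is a K-th derivative, and the power \<mu>_r^K that
  this produces is put into the symbol. Multiplying a bump by x_r^K is always possible, so the
  lowest block \<open>\<phi>\<^sub>0\<close> is covered too.\<close>

lemma frequency_piece_low:
  fixes \<theta> :: "'n::finite \<Rightarrow> real \<Rightarrow> real" and \<phi> :: "real ^ 'n \<Rightarrow> real"
  assumes chain: "deriv_chain K g" "g K = \<theta> r" and rap: "\<And>i. rapid (\<theta> i)" and "k \<le> j"
    and bump: "smooth_bump \<phi>\<^sub>0" "smooth_bump \<phi>"
  shows "cmod (frequency_piece \<phi>\<^sub>0 \<phi> k (regular_distribution (tensor j m \<theta>)) x) \<le>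
    (2 * pi) ^ K * 2 powr (- (real (j - k) * real K)) *
      cmod (trig_sum (\<lambda>\<mu>. scaled_symbol (\<lambda>x. (if k = 0 then \<phi>\<^sub>0 x else \<phi> x) * x $ r ^ K) k \<mu> *
          fourier_coeff (regular_distribution (tensor j m (\<theta>(r := g 0)))) \<mu>) x)"
proof -
  let ?fc = "\<lambda>\<theta> \<mu>. fourier_coeff (regular_distribution (tensor j m \<theta>)) \<mu>"
  let ?\<zeta> = "\<lambda>x. (if k = 0 then \<phi>\<^sub>0 x else \<phi> x) * x $ r ^ K"
  let ?S = "int_box (2 ^ (k + 1)) :: (int ^ 'n) set"
  let ?E = "\<lambda>\<mu>. cis (2 * pi * (lattice_pt \<mu> \<bullet> x))"
  define c where "c = (2 ^ k / 2 ^ j) ^ K * (2 * of_real pi * \<i>) ^ K"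
  have bump': "smooth_bump ?\<zeta>"
    using smooth_bump_mult_nth_power[OF bump(1), of r K] smooth_bump_mult_nth_power[OF bump(2), of r K] by (cases "k = 0") auto
  have key: "of_real (dyadic_block \<phi>\<^sub>0 \<phi> k (lattice_pt \<mu>)) * ?fc \<theta> \<mu> =
    c * (scaled_symbol ?\<zeta> k \<mu> * ?fc (\<theta>(r := g 0)) \<mu>)" for \<mu>
  proof -
    have 1: "(2 ^ j) ^ K * ?fc \<theta> \<mu> = (2 * pi * \<i> * of_int (\<mu> $ r)) ^ K * ?fc (\<theta>(r := g 0)) \<mu>"
      using fourier_coeff_tensor_chain[where \<theta> = \<theta>, OF chain(1) rap order_refl, where j = j and r = r and m = m and \<mu> = \<mu>] chain(2)
      by simp
    have 2: "scaled_symbol ?\<zeta> k \<mu> = of_real (dyadic_block \<phi>\<^sub>0 \<phi> k (lattice_pt \<mu>)) * (of_int (\<mu> $ r) / 2 ^ k) ^ K"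
      by (simp add: scaled_symbol_def dyadic_block_def lattice_pt_def)
    have "?fc \<theta> \<mu> = (2 * pi * \<i> * of_int (\<mu> $ r)) ^ K * ?fc (\<theta>(r := g 0)) \<mu> / (2 ^ j) ^ K"
      using 1 by (simp add: field_simps del: fun_upd_apply)
    also have "\<dots> = c * ((of_int (\<mu> $ r) / 2 ^ k) ^ K * ?fc (\<theta>(r := g 0)) \<mu>)"
      by (simp add: c_def power_mult_distrib power_divide del: fun_upd_apply)
    finally show ?thesis unfolding 2 by (simp add: mult_ac del: fun_upd_apply)
  qed
  have supp: "scaled_symbol ?\<zeta> k \<mu> = 0" if "\<mu> \<notin> ?S" for \<mu>
    using scaled_symbol_support[OF bump' that] .
  have "frequency_piece \<phi>\<^sub>0 \<phi> k (regular_distribution (tensor j m \<theta>)) x = 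
      (\<Sum>\<mu>\<in>?S. c * (scaled_symbol ?\<zeta> k \<mu> * ?fc (\<theta>(r := g 0)) \<mu>) * ?E \<mu>)"
    unfolding frequency_piece_trig_sum key
    by (rule trig_sum_finite[OF finite_int_box]) (subst supp, assumption, simp)
  also have "\<dots> = c * trig_sum (\<lambda>\<mu>. scaled_symbol ?\<zeta> k \<mu> * ?fc (\<theta>(r := g 0)) \<mu>) x"
    by (subst trig_sum_finite[OF finite_int_box], subst supp, assumption, simp)
       (simp only: sum_distrib_left mult.assoc)
  also have "cmod \<dots> = cmod c * cmod (trig_sum (\<lambda>\<mu>. scaled_symbol ?\<zeta> k \<mu> * ?fc (\<theta>(r := g 0)) \<mu>) x)"
    by (rule norm_mult)
  also have "cmod c = (2 ^ k / 2 ^ j) ^ K * (2 * pi) ^ K"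
    by (simp add: c_def norm_divide norm_power norm_mult)
  also have "2 ^ k / 2 ^ j = (2 powr (- real (j - k)) :: real)"
    using two_power_ratio[OF \<open>k \<le> j\<close>] .
  also have "\<dots> ^ K = 2 powr (- (real (j - k) * real K))"
    by (simp add: powr_powr flip: powr_realpow)
  finally show ?thesis by (simp only: mult_ac order_refl)
qed

text \<open>The spatial profile of a frequency piece of one wavelet: the kernel weight of level k
  convolved with the wavelet weight of level j. It stays unevaluated until it is summed over
  m.\<close>

definition conv_weight :: "nat \<Rightarrow> nat \<Rightarrow> nat \<Rightarrow> ('n::finite \<Rightarrow> nat) \<Rightarrow> real ^ 'n \<Rightarrow> ennreal" where
  "conv_weight B j k m x = (\<integral>\<^sup>+y. ennreal (((2 ^ k) ^ CARD('n) * torus_weight B k (x - y)) *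
     (2 powr (real j * real CARD('n) / 2) * torus_weight B j (y - dyadic_pt j m))) \<partial>torus)"

lemma scaled_multiplier_bound':
  fixes \<zeta> :: "real ^ 'n::finite \<Rightarrow> real"
  assumes "smooth_bump \<zeta>"
  shows "\<exists>C\<ge>0. \<forall>j k m \<theta> x. (\<forall>r. rapid (\<theta> r) \<and> (\<forall>x. \<bar>\<theta> r x\<bar> \<le> D / (1 + \<bar>x\<bar>) ^ (B + 2))) \<longrightarrow>
     ennreal (cmod (trig_sum (\<lambda>\<mu>. scaled_symbol \<zeta> k \<mu> * fourier_coeff (regular_distribution (tensor j m \<theta>)) \<mu>) x)) \<le>
       ennreal C * conv_weight B j k m x"
proof -
  from scaled_multiplier_bound[OF assms, of D B] obtain C where "0 \<le> C" and
    C: "\<forall>j k m \<theta> x. (\<forall>r. rapid (\<theta> r) \<and> (\<forall>x. \<bar>\<theta> r x\<bar> \<le> D / (1 + \<bar>x\<bar>) ^ (B + 2))) \<longrightarrow>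
     ennreal (cmod (trig_sum (\<lambda>\<mu>. scaled_symbol \<zeta> k \<mu> * fourier_coeff (regular_distribution (tensor j m \<theta>)) \<mu>) x)) \<le>
       (\<integral>\<^sup>+y. ennreal (C * ((2 ^ k) ^ CARD('n) * torus_weight B k (x - y)) * (2 powr (real j * real CARD('n) / 2) * torus_weight B j (y - dyadic_pt j m))) \<partial>torus)"
    by (elim exE conjE)
  have "(\<integral>\<^sup>+y. ennreal (C * ((2 ^ k) ^ CARD('n) * torus_weight B k (x - y)) * (2 powr (real j * real CARD('n) / 2) * torus_weight B j (y - dyadic_pt j m))) \<partial>torus) =
    ennreal C * conv_weight B j k m x" for j k m and x :: "real ^ 'n"
    unfolding conv_weight_def using \<open>0 \<le> C\<close> torus_weight_pos[THEN less_imp_le]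
    by (subst nn_integral_cmult[symmetric]) (auto intro!: nn_integral_cong simp: ennreal_mult'[symmetric] mult.assoc)
  note eq = this
  show ?thesis
    using C \<open>0 \<le> C\<close> unfolding eq by (intro exI[of _ C] conjI)
qed

lemma wavelet_piece_bound:
  fixes \<phi>\<^sub>0 \<phi> :: "real ^ 'n::finite \<Rightarrow> real"
  assumes reg: "regular_wavelets K \<psi>F \<psi>M" and res: "resolution_of_unity \<phi>\<^sub>0 \<phi>"
  shows "\<exists>C\<ge>0. \<forall>j k G m x. G \<in> G_set j \<longrightarrow>
    ennreal (cmod (frequency_piece \<phi>\<^sub>0 \<phi> k (regular_distribution (periodic_wavelet \<psi>F \<psi>M j G m)) x)) \<le>
      ennreal (C * 2 powr (- (\<bar>real k - real j\<bar> * real K))) * conv_weight B j k m x"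
proof -
  from reg obtain fF fM gM where fF: "deriv_chain K fF" "fF 0 = \<psi>F" and fM: "deriv_chain K fM" "fM 0 = \<psi>M"
    and gM: "deriv_chain K gM" "gM K = \<psi>M" unfolding regular_wavelets_def by blast
  \<comment> \<open>All one-dimensional factors that occur after differentiating or integrating one
    coordinate; the set is finite, so one decay constant D serves them all.\<close>
  define S where "S = {fF 0, fM 0, fF K, fM K, gM 0, gM K}"
  have rapS: "rapid f" if "f \<in> S" for f
    using that fF(1) fM(1) gM(1) unfolding S_def deriv_chain_def by auto
  have "finite S" by (simp add: S_def)
  from rapid_uniform[OF this rapS] obtain D where D: "\<And>f x. f \<in> S \<Longrightarrow> \<bar>f x\<bar> \<le> D / (1 + \<bar>x\<bar>) ^ (B + 2)"
    by blast
  note bump = resolution_smooth_bump[OF res]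
  have "\<phi> x = 0" if "norm x < 1 / 2" for x
    using res that unfolding resolution_of_unity_def by (meson not_le)
  then obtain \<zeta> where \<zeta>: "\<And>r. smooth_bump (\<zeta> r)" "\<And>x. \<phi> x = (\<Sum>r\<in>UNIV. \<zeta> r x * x $ r ^ K)"
    using annulus_decomposition[OF bump(2), of K] by blast
  define admissible where "admissible \<theta> \<longleftrightarrow> (\<forall>r :: 'n. \<theta> r \<in> S)" for \<theta>
  define bound where "bound \<zeta> C \<longleftrightarrow> 0 \<le> C \<and> (\<forall>j k m \<theta> x. admissible \<theta> \<longrightarrow>
     ennreal (cmod (trig_sum (\<lambda>\<mu>. scaled_symbol \<zeta> k \<mu> * fourier_coeff (regular_distribution (tensor j m \<theta>)) \<mu>) x)) \<le>
       ennreal C * conv_weight B j k m x)" for \<zeta> :: "real ^ 'n \<Rightarrow> real" and C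
  have ex: "\<exists>C. bound \<zeta> C" if "smooth_bump \<zeta>" for \<zeta>
  proof -
    from scaled_multiplier_bound'[OF that, of D B] obtain C where C: "0 \<le> C" 
      "\<forall>j k m \<theta> x. (\<forall>r. rapid (\<theta> r) \<and> (\<forall>x. \<bar>\<theta> r x\<bar> \<le> D / (1 + \<bar>x\<bar>) ^ (B + 2))) \<longrightarrow>
     ennreal (cmod (trig_sum (\<lambda>\<mu>. scaled_symbol \<zeta> k \<mu> * fourier_coeff (regular_distribution (tensor j m \<theta>)) \<mu>) x)) \<le>
       ennreal C * conv_weight B j k m x"
      by (elim exE conjE)
    have "bound \<zeta> C"
      unfolding bound_def
    proof (intro conjI allI impI C(1))
      fix j k m \<theta> x assume "admissible \<theta>"
      hence "\<forall>r. rapid (\<theta> r) \<and> (\<forall>x. \<bar>\<theta> r x\<bar> \<le> D / (1 + \<bar>x\<bar>) ^ (B + 2))"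
        using D rapS unfolding admissible_def by blast
      thus "ennreal (cmod (trig_sum (\<lambda>\<mu>. scaled_symbol \<zeta> k \<mu> * fourier_coeff (regular_distribution (tensor j m \<theta>)) \<mu>) x)) \<le>
        ennreal C * conv_weight B j k m x" by (rule C(2)[THEN spec[of _ j], THEN spec[of _ k], THEN spec[of _ m], THEN spec[of _ \<theta>], THEN spec[of _ x], THEN mp])
    qed
    thus ?thesis ..
  qed
  have boundD: "ennreal (cmod (trig_sum (\<lambda>\<mu>. scaled_symbol \<zeta> k \<mu> * fourier_coeff (regular_distribution (tensor j m \<theta>)) \<mu>) x)) \<le>
       ennreal C * conv_weight B j k m x" "0 \<le> C" if "bound \<zeta> C" "admissible \<theta>" for \<zeta> C j k m \<theta> x
    using that unfolding bound_def by blast+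
  \<comment> \<open>Any admissible family would do; it is the witness through which
    \<open>boundD\<close> releases the nonnegativity of the constants.\<close>
  have adm0: "admissible (\<lambda>_. fF 0)" by (simp add: admissible_def S_def)
  have "\<forall>r. \<exists>C. bound (\<zeta> r) C" using ex \<zeta>(1) by blast
  then obtain C1 where C1': "\<And>r. bound (\<zeta> r) (C1 r)" by metis
  have "\<forall>r. \<exists>C. bound (\<lambda>x. \<phi>\<^sub>0 x * x $ r ^ K) C" using ex[OF smooth_bump_mult_nth_power[OF bump(1)]] by blast
  then obtain C2 where C2': "\<And>r. bound (\<lambda>x. \<phi>\<^sub>0 x * x $ r ^ K) (C2 r)" by metis
  have "\<forall>r. \<exists>C. bound (\<lambda>x. \<phi> x * x $ r ^ K) C" using ex[OF smooth_bump_mult_nth_power[OF bump(2)]] by blast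
  then obtain C3 where C3': "\<And>r. bound (\<lambda>x. \<phi> x * x $ r ^ K) (C3 r)" by metis
  obtain C0 where C0': "bound \<phi>\<^sub>0 C0" using ex[OF bump(1)] by blast
  note C1 = boundD(2)[OF C1' adm0] boundD(1)[OF C1']
  note C2 = boundD(2)[OF C2' adm0] boundD(1)[OF C2']
  note C3 = boundD(2)[OF C3' adm0] boundD(1)[OF C3']
  note C0 = boundD(2)[OF C0' adm0] boundD(1)[OF C0']
  define C where "C = C0 + (\<Sum>r\<in>UNIV. C1 r) + (2 * pi) ^ K * ((\<Sum>r\<in>UNIV. C2 r) + (\<Sum>r\<in>UNIV. C3 r))"
  have sums: "0 \<le> (\<Sum>r\<in>UNIV. C1 r)" "0 \<le> (\<Sum>r\<in>UNIV. C2 r)" "0 \<le> (\<Sum>r\<in>UNIV. C3 r)"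
    using C1 C2 C3 by (auto intro!: sum_nonneg)
  have memb: "C2 r \<le> (\<Sum>r\<in>UNIV. C2 r)" "C3 r \<le> (\<Sum>r\<in>UNIV. C3 r)" for r
    using C2(1) C3(1) by (auto intro!: member_le_sum)
  have C_ge: "C0 \<le> C" "(\<Sum>r\<in>UNIV. C1 r) \<le> C" 
    "(2 * pi) ^ K * C2 r \<le> C" "(2 * pi) ^ K * C3 r \<le> C" for r
  proof -
    have "(2 * pi) ^ K * C2 r \<le> (2 * pi) ^ K * ((\<Sum>r\<in>UNIV. C2 r) + (\<Sum>r\<in>UNIV. C3 r))"
         "(2 * pi) ^ K * C3 r \<le> (2 * pi) ^ K * ((\<Sum>r\<in>UNIV. C2 r) + (\<Sum>r\<in>UNIV. C3 r))"
         "0 \<le> (2 * pi) ^ K * ((\<Sum>r\<in>UNIV. C2 r) + (\<Sum>r\<in>UNIV. C3 r))"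
      using sums memb[of r] by (auto intro!: mult_left_mono mult_nonneg_nonneg)
    thus "C0 \<le> C" "(\<Sum>r\<in>UNIV. C1 r) \<le> C" "(2 * pi) ^ K * C2 r \<le> C" "(2 * pi) ^ K * C3 r \<le> C"
      using sums C0 unfolding C_def by linarith+
  qed
  have C_nn: "0 \<le> C" using C_ge(1) C0 by linarith
  have "ennreal (cmod (frequency_piece \<phi>\<^sub>0 \<phi> k (regular_distribution (periodic_wavelet \<psi>F \<psi>M j G m)) x)) \<le>
      ennreal (C * 2 powr (- (\<bar>real k - real j\<bar> * real K))) * conv_weight B j k m x" if G: "G \<in> G_set j" for j k G m x
  proof -
    let ?W = "conv_weight B j k m x"
    define \<theta> where "\<theta> r = (case G r of Father \<Rightarrow> \<psi>F | Mother \<Rightarrow> \<psi>M)" for r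
    have \<theta>S: "\<theta> r \<in> S" for r using fF fM by (cases "G r") (auto simp: \<theta>_def S_def)
    have wav: "periodic_wavelet \<psi>F \<psi>M j G m = tensor j m \<theta>" by (simp add: periodic_wavelet_tensor \<theta>_def[abs_def])
    have adm: "admissible \<theta>" using \<theta>S by (simp add: admissible_def)
    \<comment> \<open>The annulus decomposition requires \<open>k \<ge> 1\<close>. For
      \<open>k < j\<close> the level is positive, so \<open>G\<close> has a \<open>Mother\<close>
      entry, which possesses antiderivatives. For \<open>k = j = 0\<close> there is nothing to
      gain.\<close>
    consider "k \<ge> 1" "j \<le> k" | "k < j" | "k = 0" "j = 0" by linarith
    thus ?thesis
    proof cases
      case 1
      define f where "f r = (case G r of Father \<Rightarrow> fF | Mother \<Rightarrow> fM)" for r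
      have f: "deriv_chain K (f r)" "f r 0 = \<theta> r" "f r K \<in> S" for r
        using fF fM by (cases "G r"; simp add: f_def \<theta>_def S_def)+
      let ?T = "\<lambda>r. cmod (trig_sum (\<lambda>\<mu>. scaled_symbol (\<zeta> r) k \<mu> * fourier_coeff (regular_distribution (tensor j m (\<theta>(r := f r K)))) \<mu>) x)"
      let ?g = "2 powr (- (real (k - j) * real K)) :: real"
      have "ennreal (cmod (frequency_piece \<phi>\<^sub>0 \<phi> k (regular_distribution (tensor j m \<theta>)) x)) \<le> ennreal (\<Sum>r\<in>UNIV. ?g * ?T r)"
        by (intro ennreal_leI frequency_piece_high f(1,2) \<zeta> 1)
      also have "\<dots> = (\<Sum>r\<in>UNIV. ennreal ?g * ennreal (?T r))"
        by (subst sum_ennreal[symmetric]) (auto simp: ennreal_mult)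
      also have "\<dots> \<le> (\<Sum>r\<in>UNIV. ennreal ?g * (ennreal (C1 r) * ?W))"
      proof (intro sum_mono mult_left_mono)
        fix r
        have "admissible (\<theta>(r := f r K))" using \<theta>S f(3) by (simp add: admissible_def)
        thus "ennreal (?T r) \<le> ennreal (C1 r) * ?W" using C1(2) by blast
      qed auto
      also have "\<dots> = ennreal ?g * (\<Sum>r\<in>UNIV. ennreal (C1 r)) * ?W"
        by (simp add: sum_distrib_left sum_distrib_right mult.assoc)
      also have "(\<Sum>r\<in>UNIV. ennreal (C1 r)) = ennreal (\<Sum>r\<in>UNIV. C1 r)"
        using C1(1) by (intro sum_ennreal) auto
      also have "ennreal ?g * ennreal (\<Sum>r\<in>UNIV. C1 r) = ennreal (?g * (\<Sum>r\<in>UNIV. C1 r))"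
        using sums by (simp add: ennreal_mult)
      also have "\<dots> * ?W \<le> ennreal (?g * C) * ?W"
        using C_ge(2) by (intro mult_right_mono ennreal_leI mult_left_mono) auto
      finally show ?thesis using 1 unfolding wav by (simp add: mult.commute of_nat_diff)
    next
      case 2
      then obtain r where r: "G r = Mother" using G by (auto simp: G_set_def)
      let ?\<zeta> = "\<lambda>x. (if k = 0 then \<phi>\<^sub>0 x else \<phi> x) * x $ r ^ K"
      let ?T = "cmod (trig_sum (\<lambda>\<mu>. scaled_symbol ?\<zeta> k \<mu> * fourier_coeff (regular_distribution (tensor j m (\<theta>(r := gM 0)))) \<mu>) x)"
      let ?g = "2 powr (- (real (j - k) * real K)) :: real"
      let ?C = "if k = 0 then C2 r else C3 r"
      have "admissible (\<theta>(r := gM 0))" using \<theta>S by (simp add: admissible_def S_def)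
      hence T: "ennreal ?T \<le> ennreal ?C * ?W" using C2(2)[of "\<theta>(r := gM 0)" r k j m x] C3(2)[of "\<theta>(r := gM 0)" r k j m x] by (cases "k = 0") auto
      have "ennreal (cmod (frequency_piece \<phi>\<^sub>0 \<phi> k (regular_distribution (tensor j m \<theta>)) x)) \<le> ennreal ((2 * pi) ^ K * ?g * ?T)"
        using gM r \<theta>S rapS 2 by (intro ennreal_leI frequency_piece_low bump) (auto simp: \<theta>_def)
      also have "\<dots> = ennreal ((2 * pi) ^ K * ?g) * ennreal ?T" by (simp add: ennreal_mult)
      also have "\<dots> \<le> ennreal ((2 * pi) ^ K * ?g) * (ennreal ?C * ?W)" by (intro mult_left_mono T) auto
      also have "\<dots> = ennreal ((2 * pi) ^ K * ?C * ?g) * ?W"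
      proof -
        have "(2 * pi) ^ K * ?C * ?g = (2 * pi) ^ K * ?g * ?C" by (simp only: mult_ac)
        thus ?thesis using C2(1)[of r] C3(1)[of r] by (simp add: ennreal_mult mult_ac)
      qed
      also have "\<dots> \<le> ennreal (C * ?g) * ?W"
        using C_ge(3,4)[of r] by (intro mult_right_mono ennreal_leI) auto
      finally show ?thesis using 2 unfolding wav by (simp add: of_nat_diff)
    next
      case 3
      have "frequency_piece \<phi>\<^sub>0 \<phi> k (regular_distribution (tensor j m \<theta>)) x =
        trig_sum (\<lambda>\<mu>. scaled_symbol \<phi>\<^sub>0 k \<mu> * fourier_coeff (regular_distribution (tensor j m \<theta>)) \<mu>) x"
        using 3 by (simp add: frequency_piece_trig_sum dyadic_block_def scaled_symbol_def)
      hence "ennreal (cmod (frequency_piece \<phi>\<^sub>0 \<phi> k (regular_distribution (tensor j m \<theta>)) x)) \<le> ennreal C0 * ?W"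
        using C0(2)[OF adm] by simp
      also have "\<dots> \<le> ennreal C * ?W" using C_ge(1) by (intro mult_right_mono ennreal_leI) auto
      finally show ?thesis using 3 unfolding wav by simp
    qed
  qed
  thus ?thesis using C_nn by (intro exI[of _ C]) blast
qed

section \<open>The deterministic estimate\<close>

lemma M_set_PiE: "(M_set j :: ('n::finite \<Rightarrow> nat) set) = PiE UNIV (\<lambda>_. {..<2 ^ j})"
  by (auto simp: M_set_def PiE_def Pi_def)

lemma torus_weight_sum:
  "(\<Sum>m\<in>M_set j. torus_weight 2 j (y - dyadic_pt j m)) \<le> int_sum_const ^ CARD('n)" for y :: "real ^ 'n::finite"
proof -
  have "(\<Sum>m\<in>M_set j. torus_weight 2 j (y - dyadic_pt j m)) =
    (\<Sum>m\<in>PiE UNIV (\<lambda>_. {..<2 ^ j}). \<Prod>i\<in>UNIV. 1 / (1 + 2 ^ j * int_dist (y $ i - real (m i) / 2 ^ j)) ^ 2)"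
    by (simp add: M_set_PiE torus_weight_def dyadic_pt_def)
  also have "\<dots> = (\<Prod>i\<in>UNIV. \<Sum>l<2 ^ j. 1 / (1 + 2 ^ j * int_dist (y $ i - real l / 2 ^ j)) ^ 2)"
    by (rule prod_sum_PiE[symmetric]) auto
  also have "\<dots> \<le> (\<Prod>i\<in>(UNIV :: 'n set). int_sum_const)"
    by (intro prod_mono conjI sum_nonneg weight_sum_1D) auto
  finally show ?thesis by simp
qed

text \<open>Replaces \<tau> at the grid points by \<tau> at y. Of the exponent B + 2 of the weight,
  B pays for the replacement and 2 for the sum over the grid.\<close>

lemma weighted_dyadic_sum:
  fixes \<tau> :: "real ^ 'n::finite \<Rightarrow> real"
  assumes \<tau>: "\<And>l x y. 2 powr (real l * \<bar>\<tau> x - \<tau> y\<bar>) * torus_weight B l (x - y) \<le> C"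
  shows "(\<Sum>m\<in>M_set j. 2 powr (- real j * (\<tau> (dyadic_pt j m) + \<epsilon>)) * torus_weight (B + 2) j (y - dyadic_pt j m)) \<le>
    C * int_sum_const ^ CARD('n) * 2 powr (- real j * (\<tau> y + \<epsilon>))"
proof -
  have C0: "0 \<le> C" using \<tau>[of 0 0 0] torus_weight_pos[of B 0 0] by (auto intro: order_trans less_imp_le)
  have "(\<Sum>m\<in>M_set j. 2 powr (- real j * (\<tau> (dyadic_pt j m) + \<epsilon>)) * torus_weight (B + 2) j (y - dyadic_pt j m)) \<le>
    (\<Sum>m\<in>M_set j. 2 powr (- real j * (\<tau> y + \<epsilon>)) * C * torus_weight 2 j (y - dyadic_pt j m))"
  proof (intro sum_mono)
    fix m :: "'n \<Rightarrow> nat"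
    let ?z = "dyadic_pt j m"
    have "real j * (\<tau> y - \<tau> ?z) \<le> real j * \<bar>\<tau> y - \<tau> ?z\<bar>" by (intro mult_left_mono) auto
    hence "2 powr (- real j * (\<tau> ?z + \<epsilon>)) \<le> 2 powr (- real j * (\<tau> y + \<epsilon>) + real j * \<bar>\<tau> y - \<tau> ?z\<bar>)"
      by (intro powr_mono) (auto simp: algebra_simps)
    also have "\<dots> = 2 powr (- real j * (\<tau> y + \<epsilon>)) * 2 powr (real j * \<bar>\<tau> y - \<tau> ?z\<bar>)" by (rule powr_add)
    finally have "2 powr (- real j * (\<tau> ?z + \<epsilon>)) * torus_weight (B + 2) j (y - ?z) \<le>
       2 powr (- real j * (\<tau> y + \<epsilon>)) * 2 powr (real j * \<bar>\<tau> y - \<tau> ?z\<bar>) * torus_weight (B + 2) j (y - ?z)"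
      using torus_weight_pos[THEN less_imp_le] by (rule mult_right_mono)
    also have "\<dots> = 2 powr (- real j * (\<tau> y + \<epsilon>)) * (2 powr (real j * \<bar>\<tau> y - \<tau> ?z\<bar>) * torus_weight B j (y - ?z)) * torus_weight 2 j (y - ?z)"
      by (simp only: torus_weight_add mult.assoc)
    also have "\<dots> \<le> 2 powr (- real j * (\<tau> y + \<epsilon>)) * C * torus_weight 2 j (y - ?z)"
      using torus_weight_pos[THEN less_imp_le] \<tau> by (intro mult_right_mono mult_left_mono) auto
    finally show "2 powr (- real j * (\<tau> ?z + \<epsilon>)) * torus_weight (B + 2) j (y - ?z) \<le>
       2 powr (- real j * (\<tau> y + \<epsilon>)) * C * torus_weight 2 j (y - ?z)" .
  qed
  also have "\<dots> = 2 powr (- real j * (\<tau> y + \<epsilon>)) * C * (\<Sum>m\<in>M_set j. torus_weight 2 j (y - dyadic_pt j m))"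
    by (simp add: sum_distrib_left)
  also have "\<dots> \<le> 2 powr (- real j * (\<tau> y + \<epsilon>)) * C * int_sum_const ^ CARD('n)"
    using torus_weight_sum C0 by (intro mult_left_mono) auto
  finally show ?thesis by (simp add: mult_ac)
qed

text \<open>The bookkeeping in powers of 2, for a = \<tau> x and b = \<tau> y. For k at most j, the
  gain K per level outweighs b down to -K, and the decay comes from \<epsilon>. For k above j, it
  outweighs a with 2 \<eta> to spare per level. Exchanging a and b costs |a - b| at the lower of the
  two levels only, an amount that the weights can absorb.\<close>

lemma exponent_inequality:
  fixes a b K \<epsilon> \<eta> j k :: real
  assumes "- K \<le> b" "a \<le> K - 2 * \<eta>" "0 \<le> \<eta>" "2 * \<eta> \<le> \<epsilon>" "0 \<le> j" "0 \<le> k"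
  shows "- (\<bar>k - j\<bar> * K) + - j * (b + \<epsilon>) \<le> - k * a + - \<eta> * (j + k) + min j k * \<bar>a - b\<bar>"
proof (cases "k \<le> j")
  case True
  have "0 \<le> (j - k) * (b + K)" "k * (a - b) \<le> k * \<bar>a - b\<bar>" "j * (2 * \<eta>) \<le> j * \<epsilon>" "\<eta> * k \<le> \<eta> * j"
    using assms True by (auto intro!: mult_nonneg_nonneg mult_left_mono)
  thus ?thesis using True by (simp add: algebra_simps)
next
  case False
  have "0 \<le> (k - j) * (K - 2 * \<eta> - a)" "j * (a - b) \<le> j * \<bar>a - b\<bar>" "j * (2 * \<eta>) \<le> j * \<epsilon>" "\<eta> * j \<le> \<eta> * k"
    using assms False by (auto intro!: mult_nonneg_nonneg mult_left_mono)
  thus ?thesis using False by (simp add: algebra_simps)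
qed

text \<open>The sum over m is taken under the convolution integral, where it turns \<tau> at the
  grid points into \<tau> y; the kernel weight then moves \<tau> from y to x, and the gain in |k -
  j| turns the scale 2^(-j) of the amplitudes into the scale 2^(-k) of the frequency.\<close>

lemma wavelet_series_estimate:
  fixes \<phi>\<^sub>0 \<phi> \<tau> :: "real ^ 'n::finite \<Rightarrow> real"
  assumes reg: "regular_wavelets K \<psi>F \<psi>M" and res: "resolution_of_unity \<phi>\<^sub>0 \<phi>" and \<tau>: "C_log_loc \<tau>"
    and bounds: "\<And>x. - real K \<le> \<tau> x" "\<And>x. \<tau> x \<le> real K - 2 * \<eta>" and \<eta>: "0 < \<eta>" "2 * \<eta> \<le> \<epsilon>"
  shows "\<exists>C\<ge>0. \<forall>j k x. (\<Sum>G\<in>G_set j. \<Sum>m\<in>M_set j.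
     2 powr (- real j * (\<tau> (dyadic_pt j m) + \<epsilon> + real CARD('n) / 2)) *
     cmod (frequency_piece \<phi>\<^sub>0 \<phi> k (regular_distribution (periodic_wavelet \<psi>F \<psi>M j G m)) x))
     \<le> C * (2 powr (- real k * \<tau> x) * 2 powr (- \<eta> * (real j + real k)))"
proof -
  obtain B Ch where Ch: "\<And>l x y. 2 powr (real l * \<bar>\<tau> x - \<tau> y\<bar>) * torus_weight B l (x - y) \<le> Ch" "0 < Ch"
    using log_hoelder_weight[OF \<tau>] by blast
  obtain C1 where C1: "0 \<le> C1" "\<And>j k G m x. G \<in> G_set j \<Longrightarrow>
    ennreal (cmod (frequency_piece \<phi>\<^sub>0 \<phi> k (regular_distribution (periodic_wavelet \<psi>F \<psi>M j G m)) x)) \<le>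
      ennreal (C1 * 2 powr (- (\<bar>real k - real j\<bar> * real K))) * conv_weight (B + 2) j k m x"
    using wavelet_piece_bound[OF reg res, of "B + 2"] by blast
  obtain Ci where Ci: "0 \<le> Ci" "\<And>k x. (\<integral>\<^sup>+y. ennreal ((2 ^ k) ^ CARD('n) * torus_weight 2 k (x - y :: real ^ 'n)) \<partial>torus) \<le> ennreal Ci"
    using torus_weight_integral[where 'n = 'n] by blast
  define Cs where "Cs = Ch * int_sum_const ^ CARD('n)"
  have Cs: "0 \<le> Cs" using Ch(2) int_sum_const_nonneg by (simp add: Cs_def)
  define n where "n = real CARD('n)"
  have main: "(\<Sum>G\<in>G_set j. \<Sum>m\<in>M_set j. 2 powr (- real j * (\<tau> (dyadic_pt j m) + \<epsilon> + n / 2)) *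
     cmod (frequency_piece \<phi>\<^sub>0 \<phi> k (regular_distribution (periodic_wavelet \<psi>F \<psi>M j G m)) x))
     \<le> real (card (UNIV :: ('n \<Rightarrow> gender) set)) * (C1 * Cs * Ch * Ci) * (2 powr (- real k * \<tau> x) * 2 powr (- \<eta> * (real j + real k)))" (is "?L \<le> _")
    for j k x
  proof -
    define c where "c m = 2 powr (- real j * (\<tau> (dyadic_pt j m) + \<epsilon> + n / 2))" for m :: "'n \<Rightarrow> nat"
    define g where "g = 2 powr (- (\<bar>real k - real j\<bar> * real K))"
    define h where "h = 2 powr (- real k * \<tau> x) * 2 powr (- \<eta> * (real j + real k))"
    let ?A = "\<lambda>y. (2 ^ k) ^ CARD('n) * torus_weight (B + 2) k (x - y)"
    let ?W = "\<lambda>m y. 2 powr (real j * real CARD('n) / 2) * torus_weight (B + 2) j (y - dyadic_pt j m)"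
    let ?fp = "\<lambda>G m. cmod (frequency_piece \<phi>\<^sub>0 \<phi> k (regular_distribution (periodic_wavelet \<psi>F \<psi>M j G m)) x)"
    have tw: "0 \<le> torus_weight b l z" for b l and z :: "real ^ 'n" by (rule less_imp_le[OF torus_weight_pos])
    have cW: "(\<Sum>m\<in>M_set j. c m * ?W m y) \<le> Cs * 2 powr (- real j * (\<tau> y + \<epsilon>))" for y
    proof -
      have "c m * ?W m y = 2 powr (- real j * (\<tau> (dyadic_pt j m) + \<epsilon>)) * torus_weight (B + 2) j (y - dyadic_pt j m)" for m
      proof -
        \<comment> \<open>The n/2 in the amplitude cancels the factor 2^(j n / 2) from the L2
          normalisation of the wavelets.\<close>
        have "c m * 2 powr (real j * real CARD('n) / 2) = 2 powr (- real j * (\<tau> (dyadic_pt j m) + \<epsilon>))"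
          unfolding c_def powr_add[symmetric] by (simp add: n_def algebra_simps)
        thus ?thesis by (simp only: mult.assoc[symmetric])
      qed
      thus ?thesis using weighted_dyadic_sum[where \<tau> = \<tau>, OF Ch(1), of j \<epsilon> y] by (simp only: Cs_def)
    qed
    have pt: "?A y * (\<Sum>m\<in>M_set j. c m * ?W m y) * g \<le> Cs * Ch * h * ((2 ^ k) ^ CARD('n) * torus_weight 2 k (x - y))" for y
    proof -
      \<comment> \<open>The variation of \<tau> has to be paid at the lower level only, and there
        the kernel weight of level k is at most that of level l.\<close>
      define l where "l = min j k"
      have "g * 2 powr (- real j * (\<tau> y + \<epsilon>)) \<le> h * 2 powr (real l * \<bar>\<tau> x - \<tau> y\<bar>)"
        unfolding g_def h_def powr_add[symmetric] l_def
        using exponent_inequality[of "real K" "\<tau> y" "\<tau> x" \<eta> \<epsilon> "real j" "real k"] bounds[of x] bounds[of y] \<eta>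
        by (intro powr_mono) (auto simp: of_nat_min)
      moreover have "2 powr (real l * \<bar>\<tau> x - \<tau> y\<bar>) * torus_weight B k (x - y) \<le> Ch"
      proof (rule order_trans[OF _ Ch(1)[of l x y]])
        show "2 powr (real l * \<bar>\<tau> x - \<tau> y\<bar>) * torus_weight B k (x - y) \<le> 2 powr (real l * \<bar>\<tau> x - \<tau> y\<bar>) * torus_weight B l (x - y)"
          by (intro mult_left_mono torus_weight_antimono) (auto simp: l_def)
      qed
      moreover have h0: "0 \<le> h" by (simp add: h_def)
      ultimately have gh: "g * 2 powr (- real j * (\<tau> y + \<epsilon>)) * torus_weight B k (x - y) \<le> h * Ch"
      proof -
        assume *: "g * 2 powr (- real j * (\<tau> y + \<epsilon>)) \<le> h * 2 powr (real l * \<bar>\<tau> x - \<tau> y\<bar>)"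
          "2 powr (real l * \<bar>\<tau> x - \<tau> y\<bar>) * torus_weight B k (x - y) \<le> Ch" "0 \<le> h"
        have "g * 2 powr (- real j * (\<tau> y + \<epsilon>)) * torus_weight B k (x - y) \<le> h * 2 powr (real l * \<bar>\<tau> x - \<tau> y\<bar>) * torus_weight B k (x - y)"
          by (rule mult_right_mono[OF *(1) tw])
        also have "\<dots> = h * (2 powr (real l * \<bar>\<tau> x - \<tau> y\<bar>) * torus_weight B k (x - y))" by (rule mult.assoc)
        also have "\<dots> \<le> h * Ch" by (rule mult_left_mono[OF *(2,3)])
        finally show ?thesis .
      qed
      have "?A y * (\<Sum>m\<in>M_set j. c m * ?W m y) * g \<le> ?A y * (Cs * 2 powr (- real j * (\<tau> y + \<epsilon>))) * g"
        using cW tw by (intro mult_right_mono mult_left_mono) (auto simp: g_def)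
      also have "\<dots> = Cs * ((2 ^ k) ^ CARD('n) * torus_weight 2 k (x - y)) * (g * 2 powr (- real j * (\<tau> y + \<epsilon>)) * torus_weight B k (x - y))"
        by (simp only: torus_weight_add mult_ac)
      also have "\<dots> \<le> Cs * ((2 ^ k) ^ CARD('n) * torus_weight 2 k (x - y)) * (h * Ch)"
        using gh Cs tw by (intro mult_left_mono) auto
      finally show ?thesis by (simp add: mult_ac)
    qed
    have inner: "(\<Sum>m\<in>M_set j. ennreal (c m) * (ennreal (C1 * g) * conv_weight (B + 2) j k m x)) \<le> ennreal (C1 * Cs * Ch * Ci * h)"
    proof -
      have "(\<Sum>m\<in>M_set j. ennreal (c m) * (ennreal (C1 * g) * conv_weight (B + 2) j k m x)) =
         (\<Sum>m\<in>M_set j. \<integral>\<^sup>+y. ennreal (C1 * (?A y * (c m * ?W m y) * g)) \<partial>torus)"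
      proof (intro sum.cong refl)
        fix m :: "'n \<Rightarrow> nat"
        have "ennreal (c m) * (ennreal (C1 * g) * conv_weight (B + 2) j k m x) =
           ennreal (c m * (C1 * g)) * conv_weight (B + 2) j k m x"
          using C1(1) by (simp add: mult.assoc ennreal_mult c_def g_def)
        also have "\<dots> = (\<integral>\<^sup>+y. ennreal (c m * (C1 * g)) * ennreal (?A y * ?W m y) \<partial>torus)"
          unfolding conv_weight_def by (rule nn_integral_cmult[symmetric]) measurable
        also have "\<dots> = (\<integral>\<^sup>+y. ennreal (C1 * (?A y * (c m * ?W m y) * g)) \<partial>torus)"
          using C1(1) tw by (intro nn_integral_cong) (simp add: ennreal_mult[symmetric] c_def g_def mult_ac)
        finally show "ennreal (c m) * (ennreal (C1 * g) * conv_weight (B + 2) j k m x) = \<dots>" .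
      qed
      also have "\<dots> = (\<integral>\<^sup>+y. (\<Sum>m\<in>M_set j. ennreal (C1 * (?A y * (c m * ?W m y) * g))) \<partial>torus)"
        by (rule nn_integral_sum[symmetric]) measurable
      also have "\<dots> \<le> (\<integral>\<^sup>+y. ennreal (C1 * Cs * Ch * h) * ennreal ((2 ^ k) ^ CARD('n) * torus_weight 2 k (x - y)) \<partial>torus)"
      proof (rule nn_integral_mono)
        fix y
        have "(\<Sum>m\<in>M_set j. ennreal (C1 * (?A y * (c m * ?W m y) * g))) = ennreal (C1 * (?A y * (\<Sum>m\<in>M_set j. c m * ?W m y) * g))"
          using C1(1) tw by (subst sum_ennreal) (auto simp: c_def g_def sum_distrib_left sum_distrib_right mult_ac)
        also have "\<dots> \<le> ennreal (C1 * (Cs * Ch * h * ((2 ^ k) ^ CARD('n) * torus_weight 2 k (x - y))))"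
          using pt C1(1) by (intro ennreal_leI mult_left_mono) auto
        also have "\<dots> = ennreal (C1 * Cs * Ch * h) * ennreal ((2 ^ k) ^ CARD('n) * torus_weight 2 k (x - y))"
          using C1(1) Cs Ch(2) tw by (simp add: ennreal_mult[symmetric] h_def mult_ac)
        finally show "(\<Sum>m\<in>M_set j. ennreal (C1 * (?A y * (c m * ?W m y) * g))) \<le> \<dots>" .
      qed
      also have "\<dots> = ennreal (C1 * Cs * Ch * h) * (\<integral>\<^sup>+y. ennreal ((2 ^ k) ^ CARD('n) * torus_weight 2 k (x - y)) \<partial>torus)"
        by (rule nn_integral_cmult) measurable
      also have "\<dots> \<le> ennreal (C1 * Cs * Ch * h) * ennreal Ci" by (intro mult_left_mono Ci(2)) auto
      also have "\<dots> = ennreal (C1 * Cs * Ch * Ci * h)"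
        using C1(1) Cs Ch(2) Ci(1) by (simp add: ennreal_mult[symmetric] h_def mult_ac)
      finally show ?thesis .
    qed
    have "ennreal ?L = (\<Sum>G\<in>G_set j. \<Sum>m\<in>M_set j. ennreal (c m) * ennreal (?fp G m))"
      unfolding c_def[symmetric] by (simp add: sum_ennreal[symmetric] ennreal_mult c_def sum_nonneg)
    also have "\<dots> \<le> (\<Sum>G\<in>(G_set j :: ('n \<Rightarrow> gender) set). \<Sum>m\<in>M_set j. ennreal (c m) * (ennreal (C1 * g) * conv_weight (B + 2) j k m x))"
    proof (rule sum_mono, rule sum_mono, rule mult_left_mono)
      fix G :: "'n \<Rightarrow> gender" and m :: "'n \<Rightarrow> nat" assume "G \<in> G_set j"
      thus "ennreal (?fp G m) \<le> ennreal (C1 * g) * conv_weight (B + 2) j k m x"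
        unfolding g_def by (rule C1(2))
    qed auto
    also have "\<dots> \<le> (\<Sum>G\<in>(G_set j :: ('n \<Rightarrow> gender) set). ennreal (C1 * Cs * Ch * Ci * h))"
      by (intro sum_mono inner)
    also have "\<dots> = ennreal (real (card (G_set j :: ('n \<Rightarrow> gender) set)) * (C1 * Cs * Ch * Ci * h))"
      using C1(1) Cs Ch(2) Ci(1) by (simp add: ennreal_mult h_def ennreal_of_nat_eq_real_of_nat)
    finally have "?L \<le> real (card (G_set j :: ('n \<Rightarrow> gender) set)) * (C1 * Cs * Ch * Ci * h)"
      using C1(1) Cs Ch(2) Ci(1) by (subst (asm) ennreal_le_iff) (auto simp: h_def)
    also have "\<dots> \<le> real (card (UNIV :: ('n \<Rightarrow> gender) set)) * (C1 * Cs * Ch * Ci * h)"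
    proof (intro mult_right_mono)
      have "finite (UNIV :: ('n \<Rightarrow> gender) set)" using finite_G_set[of 0, where 'n = 'n] by (simp add: G_set_def)
      thus "real (card (G_set j :: ('n \<Rightarrow> gender) set)) \<le> real (card (UNIV :: ('n \<Rightarrow> gender) set))"
        by (simp add: card_mono)
    qed (use C1(1) Cs Ch(2) Ci(1) in \<open>auto simp: h_def\<close>)
    finally show ?thesis by (simp add: h_def mult_ac)
  qed
  show ?thesis
    by (rule exI[of _ "real (card (UNIV :: ('n \<Rightarrow> gender) set)) * (C1 * Cs * Ch * Ci)"])
       (use main C1(1) Cs Ch(2) Ci(1) in \<open>auto simp: n_def\<close>)
qed

section \<open>Test functions\<close>

lemma periodic_dir_deriv:
  assumes "periodic f" "dir_deriv e f g"
  shows "periodic g"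
  unfolding periodic_def
proof (intro allI)
  fix m x
  have "f ((x + lattice_pt m) + h *\<^sub>R e) = f (x + h *\<^sub>R e)" for h
    using assms(1) unfolding periodic_def by (metis add.commute add.left_commute)
  hence "((\<lambda>h. f (x + h *\<^sub>R e)) has_real_derivative g (x + lattice_pt m)) (at 0)"
    using assms(2)[unfolded dir_deriv_def, rule_format, of "x + lattice_pt m"] by simp
  thus "g (x + lattice_pt m) = g x"
    using assms(2)[unfolded dir_deriv_def, rule_format, of x] by (rule DERIV_unique)
qed

lemma periodic_residue: "periodic f \<Longrightarrow> f (lattice_residue x) = f x"
  unfolding periodic_def lattice_residue_def by (metis diff_add_cancel)

lemma norm_lattice_residue_le: "norm (lattice_residue (x :: real ^ 'n)) \<le> real CARD('n)"
proof -
  have "norm (lattice_residue x) \<le> (\<Sum>i\<in>(UNIV :: 'n set). \<bar>lattice_residue x $ i\<bar>)" by (rule norm_le_l1_cart)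
  also have "\<dots> \<le> (\<Sum>i\<in>(UNIV :: 'n set). 1)"
  proof (rule sum_mono)
    show "\<bar>lattice_residue x $ i\<bar> \<le> 1" for i
      using int_dist_le_half[of "x $ i"] by (simp add: lattice_residue_nth)
  qed
  finally show ?thesis by simp
qed

lemma periodic_bounded:
  fixes f :: "real ^ 'n \<Rightarrow> real"
  assumes "periodic f" "locally_bounded f"
  shows "\<exists>B\<ge>0. \<forall>x. \<bar>f x\<bar> \<le> B"
proof -
  obtain B where B: "0 \<le> B" "\<And>x. norm x \<le> real CARD('n) \<Longrightarrow> \<bar>f x\<bar> \<le> B"
    using locally_boundedE[OF assms(2), where R = "real CARD('n)"] by blast
  have "\<bar>f x\<bar> \<le> B" for x
    using B(2)[OF norm_lattice_residue_le, of x] periodic_residue[OF assms(1), of x] by simp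
  with B(1) show ?thesis by blast
qed

lemma partial_diffs_append: "partial_diffs (bs @ cs) f = partial_diffs bs (partial_diffs cs f)"
  by (simp add: partial_diffs_def)

lemma test_functionsD:
  assumes "f \<in> test_functions"
  shows "periodic f" "C_infinity f"
  using assms by (auto simp: test_functions_def)

lemma test_functions_partial_diff:
  fixes f :: "real ^ 'n \<Rightarrow> real"
  assumes "f \<in> test_functions" "e \<in> Basis"
  shows "partial_diff e f \<in> test_functions" "dir_deriv e f (partial_diff e f)"
proof -
  note C = C_infinity_partial_diffs[OF test_functionsD(2)[OF assms(1)]]
  have "f differentiable (at x)" for x using C(1)[of "[]" x] by (simp add: partial_diffs_def)
  thus d: "dir_deriv e f (partial_diff e f)" by (rule dir_deriv_partial_diff)
  have "C_infinity (partial_diff e f)"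
    unfolding C_infinity_def C_k_def
  proof (intro allI impI)
    fix k and bs :: "(real ^ 'n) list" assume "set bs \<subseteq> Basis"
    hence "set (bs @ [e]) \<subseteq> Basis" using assms(2) by simp
    from C[OF this] show "(length bs < k \<longrightarrow> (\<forall>x. partial_diffs bs (partial_diff e f) differentiable at x)) \<and>
        (length bs \<le> k \<longrightarrow> continuous_on UNIV (partial_diffs bs (partial_diff e f)))"
      unfolding partial_diffs_append by (simp add: partial_diffs_def)
  qed
  thus "partial_diff e f \<in> test_functions"
    using periodic_dir_deriv[OF test_functionsD(1)[OF assms(1)] d] by (simp add: test_functions_def)
qed

lemma test_functions_partial_diffs:
  fixes f :: "real ^ 'n \<Rightarrow> real"
  assumes "f \<in> test_functions" "set bs \<subseteq> Basis"
  shows "partial_diffs bs f \<in> test_functions"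
  using assms(2)
proof (induction bs)
  case (Cons b bs)
  hence "partial_diff b (partial_diffs bs f) \<in> test_functions" by (intro test_functions_partial_diff) auto
  thus ?case by (simp add: partial_diffs_def)
qed (simp add: partial_diffs_def assms(1))

lemma test_function_continuous:
  assumes "f \<in> test_functions"
  shows "continuous_on UNIV f" "f \<in> borel_measurable borel"
proof -
  show "continuous_on UNIV f"
    using C_infinity_partial_diffs(2)[OF test_functionsD(2)[OF assms], of "[]"] by (simp add: partial_diffs_def)
  thus "f \<in> borel_measurable borel" by (rule borel_measurable_continuous_onI)
qed

lemma test_function_bounded:
  fixes f :: "real ^ 'n \<Rightarrow> real"
  assumes "f \<in> test_functions"
  shows "\<exists>B\<ge>0. \<forall>x. \<bar>f x\<bar> \<le> B"
  by (intro periodic_bounded test_functionsD(1)[OF assms] locally_bounded_continuous test_function_continuous(1)[OF assms])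

text \<open>The supremum of reals is meaningful only once the set is bounded: there are finitely
  many lists of directions, and each derivative is bounded by periodicity and continuity.\<close>

lemma test_seminorm_bound:
  fixes f :: "real ^ 'n \<Rightarrow> real"
  assumes "f \<in> test_functions" "set bs \<subseteq> Basis" "length bs \<le> N"
  shows "\<bar>partial_diffs bs f x\<bar> \<le> test_seminorm N f"
proof -
  let ?L = "{bs :: (real ^ 'n) list. set bs \<subseteq> Basis \<and> length bs \<le> N}"
  have "\<forall>bs\<in>?L. \<exists>B\<ge>0. \<forall>x. \<bar>partial_diffs bs f x\<bar> \<le> B"
    using test_function_bounded test_functions_partial_diffs[OF assms(1)] by blast
  from bchoice[OF this] obtain B where B: "\<And>bs x. bs \<in> ?L \<Longrightarrow> \<bar>partial_diffs bs f x\<bar> \<le> B bs" by blast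
  have fin: "finite ?L" by (rule finite_lists_length_le) simp
  have "bdd_above ((\<lambda>(bs, x). \<bar>partial_diffs bs f x\<bar>) ` (?L \<times> UNIV))"
  proof (rule bdd_aboveI2)
    fix p assume "p \<in> ?L \<times> (UNIV :: (real ^ 'n) set)"
    then obtain bs x where p: "p = (bs, x)" "bs \<in> ?L" by auto
    have "\<bar>partial_diffs bs f x\<bar> \<le> B bs" by (rule B[OF p(2)])
    also have "\<dots> \<le> Max (B ` ?L)" using fin p(2) by simp
    finally show "(case p of (bs, x) \<Rightarrow> \<bar>partial_diffs bs f x\<bar>) \<le> Max (B ` ?L)" using p by simp
  qed
  from cSUP_upper[OF _ this, of "(bs, x)"] assms(2,3) show ?thesis
    unfolding test_seminorm_def by simp
qed

lemma test_seminorm_nonneg: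
  fixes f :: "real ^ 'n \<Rightarrow> real"
  assumes "f \<in> test_functions"
  shows "0 \<le> test_seminorm N f"
  using test_seminorm_bound[OF assms, of "[]" N 0] by simp

text \<open>The analogue of \<open>fourier_coeff_tensor_chain\<close> for a general test function,
  on which the derivatives fall with alternating signs.\<close>

lemma tensor_test_integration_by_parts:
  fixes \<theta> :: "'n::finite \<Rightarrow> real \<Rightarrow> real"
  assumes chain: "deriv_chain K g" and \<theta>: "\<And>i. rapid (\<theta> i)" and "i \<le> K" and "f \<in> test_functions"
  shows "(2 ^ j) ^ i * (\<integral>x. tensor j m (\<theta>(r := g i)) x * f x \<partial>torus) =
     (- 1) ^ i * (\<integral>x. tensor j m (\<theta>(r := g 0)) x * partial_diffs (replicate i (axis r 1)) f x \<partial>torus)"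
  using assms(3,4)
proof (induction i arbitrary: f)
  case (Suc i)
  let ?T = "\<lambda>i. tensor j m (\<theta>(r := g i))"
  let ?e = "axis r 1 :: real ^ 'n"
  have rap: "rapid (g i)" "rapid (g (Suc i))" using chain Suc.prems by (auto simp: deriv_chain_def)
  have der: "\<And>x. (g i has_real_derivative g (Suc i) x) (at x)" using chain Suc.prems by (auto simp: deriv_chain_def)
  have r\<theta>: "rapid ((\<theta>(r := g i)) a)" "rapid ((\<theta>(r := g (Suc i))) a)" for a using rap \<theta> by simp_all
  note T = rapid_tensor[of "\<theta>(r := g i)", OF r\<theta>(1), of j m] rapid_tensor[of "\<theta>(r := g (Suc i))", OF r\<theta>(2), of j m]
  obtain B where B: "\<And>x. \<bar>?T i x\<bar> \<le> B" using T(2) by blast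
  obtain B' where B': "\<And>x. \<bar>?T (Suc i) x\<bar> \<le> B'" using T(4) by blast
  note pd = test_functions_partial_diff[OF Suc.prems(2) axis_Basis[of r]]
  obtain B3 where B3: "\<And>x. \<bar>f x\<bar> \<le> B3" using test_function_bounded[OF Suc.prems(2)] by blast
  obtain B4 where B4: "\<And>x. \<bar>partial_diff ?e f x\<bar> \<le> B4" using test_function_bounded[OF pd(1)] by blast
  have "dir_deriv ?e (?T i) (\<lambda>x. 2 ^ j * ?T (Suc i) x)"
    using dir_deriv_tensor_rapid[of "\<theta>(r := g i)" r "g (Suc i)"] rap der by simp
  hence "(\<integral>x. (2 ^ j * ?T (Suc i) x) * f x \<partial>torus) = - (\<integral>x. ?T i x * partial_diff ?e f x \<partial>torus)"
    using T B B' B3 B4 periodic_tensor test_functionsD(1)[OF Suc.prems(2)] pd(2)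
      test_function_continuous(2)[OF Suc.prems(2)] test_function_continuous(2)[OF pd(1)]
    by (intro torus_integration_by_parts[where ?B1.0 = B and ?B2.0 = "2 ^ j * B'" and ?B3.0 = B3 and ?B4.0 = B4])
       (auto simp: abs_mult simp del: fun_upd_apply)
  hence step: "2 ^ j * (\<integral>x. ?T (Suc i) x * f x \<partial>torus) = - (\<integral>x. ?T i x * partial_diff ?e f x \<partial>torus)"
    by (simp add: mult.assoc del: fun_upd_apply)
  have "(2 ^ j) ^ Suc i * (\<integral>x. ?T (Suc i) x * f x \<partial>torus) = (2 ^ j) ^ i * (2 ^ j * (\<integral>x. ?T (Suc i) x * f x \<partial>torus))"
    by (simp only: power_Suc mult_ac)
  also have "\<dots> = - ((2 ^ j) ^ i * (\<integral>x. ?T i x * partial_diff ?e f x \<partial>torus))" unfolding step by simp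
  also have "\<dots> = - ((- 1) ^ i * (\<integral>x. ?T 0 x * partial_diffs (replicate i ?e) (partial_diff ?e f) x \<partial>torus))"
    using Suc.IH[OF _ pd(1)] Suc.prems(1) by (simp del: fun_upd_apply)
  also have "partial_diffs (replicate i ?e) (partial_diff ?e f) = partial_diffs (replicate (Suc i) ?e) f"
    using partial_diffs_append[of "replicate i ?e" "[?e]" f] by (simp add: partial_diffs_def replicate_append_same flip: replicate_Suc)
  finally show ?case by simp
qed (simp add: partial_diffs_def)

definition weight_mass :: "nat \<Rightarrow> nat \<Rightarrow> ('n::finite \<Rightarrow> nat) \<Rightarrow> ennreal" where
  "weight_mass B j m = (\<integral>\<^sup>+y. ennreal (2 powr (real j * real CARD('n) / 2) * torus_weight B j (y - dyadic_pt j m :: real ^ 'n)) \<partial>torus)"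

lemma tensor_integral_bound:
  fixes \<theta> :: "'n::finite \<Rightarrow> real \<Rightarrow> real"
  assumes D: "\<And>r x. \<bar>\<theta> r x\<bar> \<le> D / (1 + \<bar>x\<bar>) ^ (B + 2)" "0 \<le> D" and h: "\<And>x. \<bar>h x\<bar> \<le> H"
  shows "ennreal \<bar>\<integral>x. tensor j m \<theta> x * h x \<partial>torus\<bar> \<le> ennreal ((D * int_sum_const) ^ CARD('n) * H) * weight_mass B j m"
proof -
  have H: "0 \<le> H" using h[of 0] by simp
  have "ennreal \<bar>\<integral>x. tensor j m \<theta> x * h x \<partial>torus\<bar> \<le> (\<integral>\<^sup>+x. norm (tensor j m \<theta> x * h x) \<partial>torus)"
    using integral_norm_bound_ennreal[of torus "\<lambda>x. tensor j m \<theta> x * h x"]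
    by (cases "integrable torus (\<lambda>x. tensor j m \<theta> x * h x)") (auto simp: not_integrable_integral_eq)
  also have "\<dots> \<le> (\<integral>\<^sup>+x. ennreal ((D * int_sum_const) ^ CARD('n) * H) * ennreal (2 powr (real j * real CARD('n) / 2) * torus_weight B j (x - dyadic_pt j m)) \<partial>torus)"
  proof (rule nn_integral_mono)
    fix x
    have "norm (tensor j m \<theta> x * h x) \<le> ((D * int_sum_const) ^ CARD('n) * 2 powr (real j * real CARD('n) / 2) * torus_weight B j (x - dyadic_pt j m)) * H"
      unfolding real_norm_def abs_mult by (intro mult_mono tensor_bound D(1) h) 
        (use D(2) int_sum_const_nonneg torus_weight_pos[THEN less_imp_le] in \<open>auto intro!: mult_nonneg_nonneg\<close>)
    hence "ennreal (norm (tensor j m \<theta> x * h x)) \<le> ennreal (((D * int_sum_const) ^ CARD('n) * H) * (2 powr (real j * real CARD('n) / 2) * torus_weight B j (x - dyadic_pt j m)))"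
      by (intro ennreal_leI) (simp add: mult_ac)
    also have "\<dots> = ennreal ((D * int_sum_const) ^ CARD('n) * H) * ennreal (2 powr (real j * real CARD('n) / 2) * torus_weight B j (x - dyadic_pt j m))"
      using D(2) H int_sum_const_nonneg by (intro ennreal_mult') auto
    finally show "ennreal (norm (tensor j m \<theta> x * h x)) \<le> \<dots>" .
  qed
  also have "\<dots> = ennreal ((D * int_sum_const) ^ CARD('n) * H) * weight_mass B j m"
    unfolding weight_mass_def by (rule nn_integral_cmult) measurable
  finally show ?thesis .
qed

text \<open>Beyond level 0 some factor is a mother wavelet with K antiderivatives, so pairing with a
  smooth function gains 2^(-j K) at the cost of K derivatives of that function.\<close>

lemma wavelet_test_bound:
  assumes reg: "regular_wavelets K \<psi>F \<psi>M"
  shows "\<exists>C\<ge>0. \<forall>j G (m :: 'n::finite \<Rightarrow> nat) f. G \<in> G_set j \<longrightarrow> f \<in> test_functions \<longrightarrow>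
    ennreal \<bar>\<integral>x. periodic_wavelet \<psi>F \<psi>M j G m x * f x \<partial>torus\<bar> \<le>
      ennreal (C * 2 powr (- (real j * real K)) * test_seminorm K f) * weight_mass B j m"
proof -
  from reg obtain fF fM gM where fF: "deriv_chain K fF" "fF 0 = \<psi>F" and fM: "deriv_chain K fM" "fM 0 = \<psi>M"
    and gM: "deriv_chain K gM" "gM K = \<psi>M" unfolding regular_wavelets_def by blast
  define S where "S = {\<psi>F, \<psi>M, gM 0}"
  have rapS: "rapid f" if "f \<in> S" for f
    using that fF fM gM unfolding S_def deriv_chain_def by auto
  have "finite S" by (simp add: S_def)
  from rapid_uniform[OF this rapS] obtain D where D: "0 \<le> D" "\<And>f x. f \<in> S \<Longrightarrow> \<bar>f x\<bar> \<le> D / (1 + \<bar>x\<bar>) ^ (B + 2)"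
    by blast
  define C where "C = (D * int_sum_const) ^ CARD('n)"
  have C: "0 \<le> C" using D int_sum_const_nonneg by (simp add: C_def)
  have "ennreal \<bar>\<integral>x. periodic_wavelet \<psi>F \<psi>M j G m x * f x \<partial>torus\<bar> \<le>
      ennreal (C * 2 powr (- (real j * real K)) * test_seminorm K f) * weight_mass B j m"
    if G: "G \<in> G_set j" and f: "f \<in> test_functions" for j G and m :: "'n \<Rightarrow> nat" and f
  proof -
    define \<theta> where "\<theta> r = (case G r of Father \<Rightarrow> \<psi>F | Mother \<Rightarrow> \<psi>M)" for r
    have \<theta>S: "\<theta> r \<in> S" for r by (cases "G r") (auto simp: \<theta>_def S_def)
    have wav: "periodic_wavelet \<psi>F \<psi>M j G m = tensor j m \<theta>" by (simp add: periodic_wavelet_tensor \<theta>_def[abs_def])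
    show ?thesis
    proof (cases "j = 0")
      case True
      have "\<bar>f x\<bar> \<le> test_seminorm K f" for x
        using test_seminorm_bound[OF f, of "[]" K x] by (simp add: partial_diffs_def)
      from tensor_integral_bound[where \<theta> = \<theta> and h = f, OF D(2)[OF \<theta>S] D(1) this, of j m] True
      show ?thesis unfolding wav C_def by simp
    next
      case False
      then obtain r where r: "G r = Mother" using G by (auto simp: G_set_def)
      let ?\<theta> = "\<theta>(r := gM 0)"
      let ?d = "partial_diffs (replicate K (axis r 1)) f"
      have \<theta>r: "\<theta>(r := gM K) = \<theta>" using gM r by (simp add: \<theta>_def fun_eq_iff)
      have "(2 ^ j) ^ K * (\<integral>x. tensor j m \<theta> x * f x \<partial>torus) = (- 1) ^ K * (\<integral>x. tensor j m ?\<theta> x * ?d x \<partial>torus)"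
        using tensor_test_integration_by_parts[of K gM \<theta> K f j m r] gM(1) rapS \<theta>S f unfolding \<theta>r by blast
      hence "\<bar>(2 ^ j) ^ K * (\<integral>x. tensor j m \<theta> x * f x \<partial>torus)\<bar> = \<bar>\<integral>x. tensor j m ?\<theta> x * ?d x \<partial>torus\<bar>"
        by (simp add: abs_mult power_abs del: fun_upd_apply)
      hence "\<bar>\<integral>x. tensor j m \<theta> x * f x \<partial>torus\<bar> = 2 powr (- (real j * real K)) * \<bar>\<integral>x. tensor j m ?\<theta> x * ?d x \<partial>torus\<bar>"
      proof -
        assume "\<bar>(2 ^ j) ^ K * (\<integral>x. tensor j m \<theta> x * f x \<partial>torus)\<bar> = \<bar>\<integral>x. tensor j m ?\<theta> x * ?d x \<partial>torus\<bar>"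
        moreover have "(2 ^ j) ^ K = 2 powr (real j * real K)"
          by (simp add: powr_realpow[symmetric] powr_powr)
        ultimately have eq: "2 powr (real j * real K) * \<bar>\<integral>x. tensor j m \<theta> x * f x \<partial>torus\<bar> = \<bar>\<integral>x. tensor j m ?\<theta> x * ?d x \<partial>torus\<bar>"
          by (simp only: abs_mult) simp
        show ?thesis unfolding eq[symmetric] by (simp add: powr_minus)
      qed
      hence "ennreal \<bar>\<integral>x. tensor j m \<theta> x * f x \<partial>torus\<bar> = ennreal (2 powr (- (real j * real K))) * ennreal \<bar>\<integral>x. tensor j m ?\<theta> x * ?d x \<partial>torus\<bar>"
        by (simp add: ennreal_mult)
      also have "\<dots> \<le> ennreal (2 powr (- (real j * real K))) * (ennreal (C * test_seminorm K f) * weight_mass B j m)"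
        unfolding C_def
      proof (intro mult_left_mono tensor_integral_bound D(1))
        show "\<bar>?\<theta> i x\<bar> \<le> D / (1 + \<bar>x\<bar>) ^ (B + 2)" for i x
          using D(2)[of "gM 0" x] D(2)[OF \<theta>S] by (auto simp: S_def)
        show "\<bar>?d x\<bar> \<le> test_seminorm K f" for x
          by (rule test_seminorm_bound[OF f]) (use axis_Basis in auto)
      qed auto
      also have "\<dots> = ennreal (C * 2 powr (- (real j * real K)) * test_seminorm K f) * weight_mass B j m"
        using C test_seminorm_nonneg[OF f] by (simp add: ennreal_mult mult_ac)
      finally show ?thesis unfolding wav .
    qed
  qed
  thus ?thesis using C by (intro exI[of _ C]) blast
qed

text \<open>Prepares the pathwise limit. Since \<tau> is at least -K, the amplitudes contribute at
  most 2^(j K), which the gain 2^(-j K) cancels; what remains is geometric decay 2^(-\<epsilon> j)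
  of the levels as distributions of order K.\<close>

lemma wavelet_test_estimate:
  fixes \<tau> :: "real ^ 'n::finite \<Rightarrow> real"
  assumes reg: "regular_wavelets K \<psi>F \<psi>M" and \<tau>: "C_log_loc \<tau>" and lower: "\<And>x. - real K \<le> \<tau> x"
  shows "\<exists>b C. 0 \<le> C \<and> (\<forall>j (m :: 'n \<Rightarrow> nat). 0 \<le> b j m) \<and>
    (\<forall>j G m f. G \<in> G_set j \<longrightarrow> f \<in> test_functions \<longrightarrow>
       \<bar>\<integral>x. periodic_wavelet \<psi>F \<psi>M j G m x * f x \<partial>torus\<bar> \<le> b j m * test_seminorm K f) \<and>
    (\<forall>j. (\<Sum>m\<in>M_set j. 2 powr (- real j * (\<tau> (dyadic_pt j m) + \<epsilon> + real CARD('n) / 2)) * b j m) \<le> C * 2 powr (- \<epsilon> * real j))"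
proof -
  obtain B Ch where Ch: "\<And>l x y. 2 powr (real l * \<bar>\<tau> x - \<tau> y\<bar>) * torus_weight B l (x - y) \<le> Ch" "0 < Ch"
    using log_hoelder_weight[OF \<tau>] by blast
  obtain C1 where C1: "0 \<le> C1" "\<And>j G (m :: 'n \<Rightarrow> nat) f. G \<in> G_set j \<Longrightarrow> f \<in> test_functions \<Longrightarrow>
    ennreal \<bar>\<integral>x. periodic_wavelet \<psi>F \<psi>M j G m x * f x \<partial>torus\<bar> \<le>
      ennreal (C1 * 2 powr (- (real j * real K)) * test_seminorm K f) * weight_mass (B + 2) j m"
    using wavelet_test_bound[OF reg, of "B + 2", where 'n = 'n] by blast
  define Cs where "Cs = Ch * int_sum_const ^ CARD('n)"
  have Cs: "0 \<le> Cs" using Ch(2) int_sum_const_nonneg by (simp add: Cs_def)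
  define w where "w j m = enn2real (weight_mass (B + 2) j m)" for j and m :: "'n \<Rightarrow> nat"
  have tw: "0 \<le> torus_weight b l z" for b l and z :: "real ^ 'n" by (rule less_imp_le[OF torus_weight_pos])
  have w: "weight_mass (B + 2) j m = ennreal (w j m)" for j and m :: "'n \<Rightarrow> nat"
  proof -
    have "weight_mass (B + 2) j m \<le> (\<integral>\<^sup>+y. ennreal (2 powr (real j * real CARD('n) / 2) * 1) \<partial>(torus :: (real ^ 'n) measure))"
      unfolding weight_mass_def by (intro nn_integral_mono ennreal_leI mult_left_mono torus_weight_le_1) auto
    also have "\<dots> = ennreal (2 powr (real j * real CARD('n) / 2))" by (simp add: emeasure_torus)
    finally show ?thesis unfolding w_def by (simp add: le_less_trans[OF _ ennreal_less_top])
  qed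
  have w0: "0 \<le> w j m" for j m by (simp add: w_def)
  define b where "b j m = C1 * 2 powr (- (real j * real K)) * w j m" for j and m :: "'n \<Rightarrow> nat"
  have b0: "0 \<le> b j m" for j m using C1(1) w0 by (simp add: b_def)
  have bound: "\<bar>\<integral>x. periodic_wavelet \<psi>F \<psi>M j G m x * f x \<partial>torus\<bar> \<le> b j m * test_seminorm K f"
    if "G \<in> G_set j" "f \<in> test_functions" for j G and m :: "'n \<Rightarrow> nat" and f
  proof -
    have "ennreal \<bar>\<integral>x. periodic_wavelet \<psi>F \<psi>M j G m x * f x \<partial>torus\<bar> \<le> ennreal (b j m * test_seminorm K f)"
      using C1(2)[OF that, of m, unfolded w] C1(1) w0 test_seminorm_nonneg[OF that(2), of K]
      by (simp add: b_def ennreal_mult[symmetric] mult_ac)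
    thus ?thesis using b0 test_seminorm_nonneg[OF that(2), of K] by (simp add: ennreal_le_iff)
  qed
  have total: "(\<Sum>m\<in>M_set j. 2 powr (- real j * (\<tau> (dyadic_pt j m) + \<epsilon> + real CARD('n) / 2)) * b j m) \<le> (C1 * Cs) * 2 powr (- \<epsilon> * real j)" for j
  proof -
    define c where "c m = 2 powr (- real j * (\<tau> (dyadic_pt j m) + \<epsilon> + real CARD('n) / 2))" for m :: "'n \<Rightarrow> nat"
    let ?W = "\<lambda>m y. 2 powr (real j * real CARD('n) / 2) * torus_weight (B + 2) j (y - dyadic_pt j m)"
    let ?g = "2 powr (- (real j * real K))"
    have cW: "(\<Sum>m\<in>M_set j. c m * ?W m y) \<le> Cs * 2 powr (- real j * (\<tau> y + \<epsilon>))" for y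
    proof -
      have "c m * ?W m y = 2 powr (- real j * (\<tau> (dyadic_pt j m) + \<epsilon>)) * torus_weight (B + 2) j (y - dyadic_pt j m)" for m
      proof -
        have "c m * 2 powr (real j * real CARD('n) / 2) = 2 powr (- real j * (\<tau> (dyadic_pt j m) + \<epsilon>))"
          unfolding c_def powr_add[symmetric] by (simp add: algebra_simps)
        thus ?thesis by (simp only: mult.assoc[symmetric])
      qed
      thus ?thesis using weighted_dyadic_sum[where \<tau> = \<tau>, OF Ch(1), of j \<epsilon> y] by (simp only: Cs_def)
    qed
    have "ennreal (\<Sum>m\<in>M_set j. c m * w j m) = (\<Sum>m\<in>M_set j. ennreal (c m) * weight_mass (B + 2) j m)"
      unfolding w using w0 by (subst sum_ennreal[symmetric]) (auto simp: ennreal_mult c_def)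
    also have "\<dots> = (\<Sum>m\<in>M_set j. \<integral>\<^sup>+y. ennreal (c m) * ennreal (?W m y) \<partial>torus)"
      unfolding weight_mass_def by (intro sum.cong refl nn_integral_cmult[symmetric]) measurable
    also have "\<dots> = (\<integral>\<^sup>+y. (\<Sum>m\<in>M_set j. ennreal (c m) * ennreal (?W m y)) \<partial>torus)"
      by (rule nn_integral_sum[symmetric]) measurable
    also have "\<dots> \<le> (\<integral>\<^sup>+y. ennreal (Cs * 2 powr (real j * real K - \<epsilon> * real j)) \<partial>(torus :: (real ^ 'n) measure))"
    proof (rule nn_integral_mono)
      fix y :: "real ^ 'n"
      have "(\<Sum>m\<in>M_set j. ennreal (c m) * ennreal (?W m y)) = ennreal (\<Sum>m\<in>M_set j. c m * ?W m y)"
        using tw by (subst sum_ennreal[symmetric]) (auto simp: ennreal_mult c_def)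
      also have "\<dots> \<le> ennreal (Cs * 2 powr (- real j * (\<tau> y + \<epsilon>)))" by (intro ennreal_leI cW)
      also have "\<dots> \<le> ennreal (Cs * 2 powr (real j * real K - \<epsilon> * real j))"
      proof (intro ennreal_leI mult_left_mono powr_mono Cs)
        have "real j * (- real K) \<le> real j * \<tau> y" using lower by (intro mult_left_mono) auto
        thus "- real j * (\<tau> y + \<epsilon>) \<le> real j * real K - \<epsilon> * real j" by (simp add: algebra_simps)
      qed simp
      finally show "(\<Sum>m\<in>M_set j. ennreal (c m) * ennreal (?W m y)) \<le> \<dots>" .
    qed
    also have "\<dots> = ennreal (Cs * 2 powr (real j * real K - \<epsilon> * real j))" by (simp add: emeasure_torus)
    finally have "(\<Sum>m\<in>M_set j. c m * w j m) \<le> Cs * 2 powr (real j * real K - \<epsilon> * real j)"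
      using Cs by (subst (asm) ennreal_le_iff) auto
    hence "C1 * ?g * (\<Sum>m\<in>M_set j. c m * w j m) \<le> C1 * ?g * (Cs * 2 powr (real j * real K - \<epsilon> * real j))"
      using C1(1) by (intro mult_left_mono) auto
    also have "\<dots> = C1 * Cs * (?g * 2 powr (real j * real K - \<epsilon> * real j))" by (simp only: mult_ac)
    also have "?g * 2 powr (real j * real K - \<epsilon> * real j) = 2 powr (- \<epsilon> * real j)"
      by (simp add: powr_add[symmetric])
    finally have "C1 * ?g * (\<Sum>m\<in>M_set j. c m * w j m) \<le> C1 * Cs * 2 powr (- \<epsilon> * real j)" .
    moreover have "(\<Sum>m\<in>M_set j. c m * (C1 * ?g * w j m)) = C1 * ?g * (\<Sum>m\<in>M_set j. c m * w j m)"
      unfolding sum_distrib_left by (rule sum.cong) (simp_all only: mult_ac)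
    ultimately show ?thesis unfolding b_def c_def[symmetric] by (simp only:)
  qed
  show ?thesis
    by (rule exI[of _ b], rule exI[of _ "C1 * Cs"]) (use b0 bound total C1(1) Cs in auto)
qed

section \<open>Daubechies wavelets\<close>

lemma dir_deriv_real: "dir_deriv (1 :: real) f g \<Longrightarrow> (f has_real_derivative g x) (at x)"
  using dir_derivD[of 1 f g 0 x] by simp

lemma has_real_derivative_continuous_on:
  "(\<And>x. (F has_real_derivative f x) (at x)) \<Longrightarrow> continuous_on S F"
  by (intro continuous_at_imp_continuous_on ballI) (rule DERIV_isCont)

lemma smooth_dir_ident: "smooth_dir (1 :: real) A (\<lambda>x. x)"
  using smooth_dir_inner[of "1 :: real" A 1] by simp

lemma rapid_compact_support:
  assumes cont: "continuous_on UNIV f" and supp: "\<And>x. R < \<bar>x\<bar> \<Longrightarrow> f x = 0"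
  shows "rapid f"
proof -
  obtain M where M: "0 \<le> M" "\<And>x. norm x \<le> R \<Longrightarrow> \<bar>f x\<bar> \<le> M"
    using locally_boundedE[OF locally_bounded_continuous[OF cont], where R = R] by blast
  have "\<bar>f x\<bar> \<le> M * (1 + \<bar>R\<bar>) ^ A / (1 + \<bar>x\<bar>) ^ A" for x A
  proof (cases "\<bar>x\<bar> \<le> R")
    case True
    have "(1 + \<bar>x\<bar>) ^ A \<le> (1 + \<bar>R\<bar>) ^ A" using True by (intro power_mono) auto
    hence "\<bar>f x\<bar> * (1 + \<bar>x\<bar>) ^ A \<le> M * (1 + \<bar>R\<bar>) ^ A" using M True by (intro mult_mono) auto
    thus ?thesis by (simp add: pos_le_divide_eq add_pos_nonneg)
  next
    case False
    thus ?thesis using supp[of x] M(1) by simp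
  qed
  thus ?thesis using borel_measurable_continuous_onI[OF cont] unfolding rapid_def by blast
qed

lemma C_k_deriv_chain:
  fixes f :: "real \<Rightarrow> real"
  assumes C: "C_k k f" and supp: "\<And>x. R < \<bar>x\<bar> \<Longrightarrow> f x = 0"
  shows "deriv_chain k (\<lambda>i. partial_diffs (replicate i 1) f)"
proof -
  have reg: "i < k \<Longrightarrow> partial_diffs (replicate i 1) f differentiable (at x)"
    "i \<le> k \<Longrightarrow> continuous_on UNIV (partial_diffs (replicate i 1) f)" for i x
    using C[unfolded C_k_def, rule_format, of "replicate i 1"] by (auto simp: set_replicate_conv_if)
  have d: "dir_deriv 1 (partial_diffs (replicate i 1) f) (partial_diffs (replicate (Suc i) 1) f)" if "i < k" for i
    using dir_deriv_partial_diff[OF reg(1)[OF that], of 1] by (simp add: partial_diffs_def)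
  have s: "i \<le> k \<Longrightarrow> R < \<bar>x\<bar> \<Longrightarrow> partial_diffs (replicate i 1) f x = 0" for i x
  proof (induction i arbitrary: x)
    case (Suc i)
    have "open {x. R < \<bar>x\<bar>}" by (intro open_Collect_less continuous_intros)
    with Suc show ?case by (intro dir_deriv_cong_zero[OF d[of i], where U = "{x. R < \<bar>x\<bar>}"]) auto
  qed (simp add: partial_diffs_def supp)
  show ?thesis unfolding deriv_chain_def
    using d[THEN dir_deriv_real] rapid_compact_support[OF reg(2) s] by blast
qed

lemma integral_compact_support:
  fixes f :: "real \<Rightarrow> real"
  assumes cont: "continuous_on UNIV f" and supp: "\<And>x. R < \<bar>x\<bar> \<Longrightarrow> f x = 0" and ab: "a \<le> - R" "R \<le> b"
  shows "(\<integral>x. f x \<partial>lborel) = integral {a..b} f"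
proof -
  have "(\<integral>x. f x \<partial>lborel) = (LINT x : {a..b} | lborel. f x)"
    unfolding set_lebesgue_integral_def
  proof (intro Bochner_Integration.integral_cong refl)
    fix x
    have "x \<in> {a..b}" if "f x \<noteq> 0"
    proof -
      have "\<not> R < \<bar>x\<bar>" using supp that by blast
      thus ?thesis using ab by auto
    qed
    thus "f x = indicator {a..b} x *\<^sub>R f x" by (auto simp: indicator_def)
  qed
  also have "\<dots> = integral {a..b} f"
    by (intro set_borel_integral_eq_integral borel_integrable_atLeastAtMost' continuous_on_subset[OF cont]) auto
  finally show ?thesis .
qed

text \<open>The vanishing integral of f makes its primitive vanish to the right of the support as
  well. Integration by parts expresses the moment of order a of the primitive by the moment of order
  a + 1 of f, so one vanishing moment is spent per antiderivative.\<close>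

lemma compact_support_antiderivative:
  fixes f :: "real \<Rightarrow> real"
  assumes cont: "continuous_on UNIV f" and R: "0 \<le> R" and supp: "\<And>x. R < \<bar>x\<bar> \<Longrightarrow> f x = 0"
    and mom: "\<And>a. a < Suc k \<Longrightarrow> (\<integral>x. x ^ a * f x \<partial>lborel) = 0"
  shows "\<exists>F. (\<forall>x. (F has_real_derivative f x) (at x)) \<and> (\<forall>x. R < \<bar>x\<bar> \<longrightarrow> F x = 0) \<and>
     (\<forall>a<k. (\<integral>x. x ^ a * F x \<partial>lborel) = 0)"
proof -
  \<comment> \<open>Strictly left of the support, so that points from -R onwards are interior to
    \<open>{c..x + 1}\<close> and the derivative there is two-sided.\<close>
  define c where "c = - R - 1"
  define F where "F x = integral {c..x} f" for x
  have F0: "F x = 0" if "R < \<bar>x\<bar>" for x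
  proof (cases "x < 0")
    case True
    hence "integral {c..x} f = integral {c..x} (\<lambda>_. 0)"
      using that supp by (intro Henstock_Kurzweil_Integration.integral_cong) auto
    thus ?thesis by (simp add: F_def)
  next
    case False
    hence "F x = (\<integral>x. f x \<partial>lborel)"
      unfolding F_def by (intro integral_compact_support[OF cont supp, symmetric]) (use that in \<open>auto simp: c_def\<close>)
    thus ?thesis using mom[of 0] by simp
  qed
  have der: "(F has_real_derivative f x) (at x)" for x
  proof (cases "x < - R")
    case True
    have "eventually (\<lambda>y. y \<in> {..<-R}) (nhds x)" using True by (intro eventually_nhds_in_open) auto
    hence "eventually (\<lambda>y. F y = 0) (nhds x)" using F0 by (auto elim!: eventually_mono)
    hence "(F has_real_derivative 0) (at x)" by (intro DERIV_cong_ev[THEN iffD2, of x x F "\<lambda>_. 0"]) auto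
    thus ?thesis using supp[of x] True R by simp
  next
    case False
    have "((\<lambda>x. integral {c..x} f) has_real_derivative f x) (at x within {c..x + 1})"
      by (rule integral_has_real_derivative) (use continuous_on_subset[OF cont] False in \<open>auto simp: c_def\<close>)
    moreover have "x \<in> interior {c..x + 1}" using False by (simp add: c_def)
    ultimately have "((\<lambda>x. integral {c..x} f) has_real_derivative f x) (at x)" by (metis at_within_interior)
    moreover have "F = (\<lambda>x. integral {c..x} f)" by (simp add: F_def fun_eq_iff)
    ultimately show ?thesis by (simp only:)
  qed
  have contF: "continuous_on UNIV F" using der by (rule has_real_derivative_continuous_on)
  have "(\<integral>x. x ^ a * F x \<partial>lborel) = 0" if "a < k" for a
  proof -
    let ?S = "{- R - 1..R + 1}"
    have eq: "(\<integral>x. x ^ b * g x \<partial>lborel) = integral ?S (\<lambda>x. x ^ b * g x)"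
      if "continuous_on UNIV g" "\<And>x. R < \<bar>x\<bar> \<Longrightarrow> g x = 0" for b g
      by (rule integral_compact_support[where R = R]) (use that R in \<open>auto intro!: continuous_intros\<close>)
    have "((\<lambda>x. real (Suc a) * (x ^ a * F x) + x ^ Suc a * f x) has_integral
         ((R + 1) ^ Suc a * F (R + 1) - (- R - 1) ^ Suc a * F (- R - 1))) ?S"
    proof (rule fundamental_theorem_of_calculus)
      show "((\<lambda>x. x ^ Suc a * F x) has_vector_derivative real (Suc a) * (x ^ a * F x) + x ^ Suc a * f x) (at x within ?S)" for x
      proof -
        have "((\<lambda>x. x ^ Suc a * F x) has_real_derivative (real (Suc a) * x ^ a) * F x + f x * x ^ Suc a) (at x)"
          using DERIV_pow[of "Suc a" x] by (intro DERIV_mult der) simp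
        moreover have "(real (Suc a) * x ^ a) * F x + f x * x ^ Suc a = real (Suc a) * (x ^ a * F x) + x ^ Suc a * f x"
          by (simp only: mult_ac)
        ultimately show ?thesis
          unfolding has_real_derivative_iff_has_vector_derivative[symmetric] by (metis has_field_derivative_at_within)
      qed
    qed (use R in auto)
    hence "((\<lambda>x. real (Suc a) * (x ^ a * F x) + x ^ Suc a * f x) has_integral 0) ?S" using F0 R by simp
    hence "integral ?S (\<lambda>x. real (Suc a) * (x ^ a * F x) + x ^ Suc a * f x) = 0" by (rule integral_unique)
    moreover have "integral ?S (\<lambda>x. real (Suc a) * (x ^ a * F x) + x ^ Suc a * f x) =
      real (Suc a) * integral ?S (\<lambda>x. x ^ a * F x) + integral ?S (\<lambda>x. x ^ Suc a * f x)"
      by (subst Henstock_Kurzweil_Integration.integral_add)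
         (auto intro!: integrable_continuous_real continuous_intros continuous_on_subset[OF cont] continuous_on_subset[OF contF])
    moreover have "integral ?S (\<lambda>x. x ^ Suc a * f x) = 0"
      using mom[of "Suc a"] eq[OF cont supp, of "Suc a"] that by simp
    ultimately have "integral ?S (\<lambda>x. x ^ a * F x) = 0" by simp
    thus ?thesis using eq[OF contF F0] by simp
  qed
  thus ?thesis using der F0 by blast
qed

lemma vanishing_moments_chain:
  fixes f :: "real \<Rightarrow> real"
  assumes "continuous_on UNIV f" and R: "0 \<le> R" and "\<And>x. R < \<bar>x\<bar> \<Longrightarrow> f x = 0"
    and "\<And>a. a < k \<Longrightarrow> (\<integral>x. x ^ a * f x \<partial>lborel) = 0"
  shows "\<exists>g. deriv_chain k g \<and> g k = f"
  using assms(1,3,4)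
proof (induction k arbitrary: f)
  case 0
  thus ?case by (intro exI[of _ "\<lambda>_. f"]) (auto simp: deriv_chain_def intro: rapid_compact_support)
next
  case (Suc k)
  from compact_support_antiderivative[OF Suc.prems(1) R Suc.prems(2,3)]
  obtain F where F: "\<And>x. (F has_real_derivative f x) (at x)" "\<And>x. R < \<bar>x\<bar> \<Longrightarrow> F x = 0"
    "\<And>a. a < k \<Longrightarrow> (\<integral>x. x ^ a * F x \<partial>lborel) = 0" by blast
  have "continuous_on UNIV F" using F(1) by (rule has_real_derivative_continuous_on)
  from Suc.IH[OF this F(2,3)] obtain g where g: "deriv_chain k g" "g k = F" by blast
  have "deriv_chain (Suc k) (\<lambda>i. if i \<le> k then g i else f)"
    using g F(1) rapid_compact_support[OF Suc.prems(1,2)] by (auto simp: deriv_chain_def le_Suc_eq not_le less_Suc_eq)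
  thus ?case by (intro exI[of _ "\<lambda>i. if i \<le> k then g i else f"]) auto
qed

lemma daubechies_regular:
  assumes "daubechies_system k \<psi>F \<psi>M"
  shows "regular_wavelets k \<psi>F \<psi>M"
proof -
  from assms obtain R where R: "\<And>x. R < \<bar>x\<bar> \<Longrightarrow> \<psi>F x = 0" "\<And>x. R < \<bar>x\<bar> \<Longrightarrow> \<psi>M x = 0"
    and C: "C_k k \<psi>F" "C_k k \<psi>M" and mom: "\<And>a. a < k \<Longrightarrow> (\<integral>x. x ^ a * \<psi>M x \<partial>lborel) = 0"
    unfolding daubechies_system_def by blast
  have "continuous_on UNIV \<psi>M"
    using C(2)[unfolded C_k_def, rule_format, of "[]"] by (simp add: partial_diffs_def)
  hence "\<exists>g. deriv_chain k g \<and> g k = \<psi>M"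
    by (rule vanishing_moments_chain[where R = "\<bar>R\<bar>"]) (use R mom in auto)
  moreover have "partial_diffs (replicate 0 1) f = f" for f :: "real \<Rightarrow> real" by (simp add: partial_diffs_def)
  ultimately show ?thesis
    using C_k_deriv_chain[OF C(1) R(1)] C_k_deriv_chain[OF C(2) R(2)] unfolding regular_wavelets_def by blast
qed

section \<open>Meyer wavelets\<close>

text \<open>The real form of a Fourier integral over [-R, R]. The phase a keeps the family closed: a
  derivative in x multiplies h by the frequency and adds pi/2 to the phase, and an integration by
  parts differentiates h and subtracts pi/2.\<close>

definition osc :: "real \<Rightarrow> (real \<Rightarrow> real) \<Rightarrow> real \<Rightarrow> real \<Rightarrow> real" where
  "osc R h a x = integral {-R..R} (\<lambda>\<xi>. h \<xi> * cos (\<xi> * x + a))"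

lemma smooth_dir_continuous:
  assumes "smooth_dir (1 :: real) (Suc A) h"
  shows "continuous_on S h"
proof -
  from assms obtain h' where "dir_deriv 1 h h'" by auto
  thus ?thesis by (intro has_real_derivative_continuous_on) (rule dir_deriv_real)
qed

lemma osc_deriv:
  assumes "continuous_on UNIV h"
  shows "(osc R h a has_real_derivative osc R (\<lambda>\<xi>. \<xi> * h \<xi>) (a + pi / 2) x) (at x)"
proof -
  have h: "continuous_on S h" for S using assms by (rule continuous_on_subset) simp
  have "((\<lambda>x. integral (cbox (- R) R) (\<lambda>\<xi>. h \<xi> * cos (\<xi> * x + a))) has_field_derivative
     integral (cbox (- R) R) (\<lambda>\<xi>. - (\<xi> * h \<xi> * sin (\<xi> * x + a)))) (at x within UNIV)"
  proof (rule leibniz_rule_field_derivative)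
    show "((\<lambda>x. h \<xi> * cos (\<xi> * x + a)) has_real_derivative - (\<xi> * h \<xi> * sin (\<xi> * x + a))) (at x within UNIV)" for x \<xi>
      by (auto intro!: derivative_eq_intros)
    show "(\<lambda>\<xi>. h \<xi> * cos (\<xi> * x + a)) integrable_on cbox (- R) R" for x
      by (intro integrable_continuous continuous_intros h)
    have "continuous_on (UNIV \<times> cbox (- R) R) (\<lambda>p :: real \<times> real. h (snd p))"
      by (rule continuous_on_compose2[OF h[of UNIV]]) (auto intro!: continuous_intros)
    thus "continuous_on (UNIV \<times> cbox (- R) R) (\<lambda>(x, \<xi>). - (\<xi> * h \<xi> * sin (\<xi> * x + a)))"
      unfolding case_prod_beta by (intro continuous_intros)
  qed auto
  moreover have "- (\<xi> * h \<xi> * sin (\<xi> * x + a)) = \<xi> * h \<xi> * cos (\<xi> * x + (a + pi / 2))" for \<xi>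
    by (simp add: cos_add sin_add algebra_simps)
  ultimately show ?thesis by (simp add: osc_def[abs_def])
qed

lemma osc_by_parts:
  assumes h: "\<And>x. (h has_real_derivative h' x) (at x)" "continuous_on UNIV h'" and R: "0 \<le> R" "h R = 0" "h (- R) = 0"
  shows "x * osc R h a x = - osc R h' (a - pi / 2) x"
proof -
  have ch: "continuous_on S h" "continuous_on S h'" for S
    using has_real_derivative_continuous_on[OF h(1)] continuous_on_subset[OF h(2)] by auto
  have "((\<lambda>\<xi>. h' \<xi> * sin (\<xi> * x + a) + x * (h \<xi> * cos (\<xi> * x + a))) has_integral
     (h R * sin (R * x + a) - h (- R) * sin (- R * x + a))) {-R..R}"
  proof (rule fundamental_theorem_of_calculus)
    show "((\<lambda>\<xi>. h \<xi> * sin (\<xi> * x + a)) has_vector_derivative h' \<xi> * sin (\<xi> * x + a) + x * (h \<xi> * cos (\<xi> * x + a))) (at \<xi> within {-R..R})" for \<xi>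
    proof -
      have "((\<lambda>\<xi>. h \<xi> * sin (\<xi> * x + a)) has_real_derivative h' \<xi> * sin (\<xi> * x + a) + (cos (\<xi> * x + a) * x) * h \<xi>) (at \<xi>)"
        by (intro DERIV_mult h(1)) (auto intro!: derivative_eq_intros)
      moreover have "h' \<xi> * sin (\<xi> * x + a) + (cos (\<xi> * x + a) * x) * h \<xi> = h' \<xi> * sin (\<xi> * x + a) + x * (h \<xi> * cos (\<xi> * x + a))"
        by (simp only: mult_ac)
      ultimately show ?thesis
        unfolding has_real_derivative_iff_has_vector_derivative[symmetric] by (metis has_field_derivative_at_within)
    qed
  qed (use R in auto)
  hence "integral {-R..R} (\<lambda>\<xi>. h' \<xi> * sin (\<xi> * x + a) + x * (h \<xi> * cos (\<xi> * x + a))) = 0"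
    using R by (auto dest: integral_unique)
  moreover have "integral {-R..R} (\<lambda>\<xi>. h' \<xi> * sin (\<xi> * x + a) + x * (h \<xi> * cos (\<xi> * x + a))) =
     integral {-R..R} (\<lambda>\<xi>. h' \<xi> * sin (\<xi> * x + a)) + x * osc R h a x"
    unfolding osc_def
    by (subst Henstock_Kurzweil_Integration.integral_add) (auto intro!: integrable_continuous_real continuous_intros ch)
  moreover have "sin (\<xi> * x + a) = cos (\<xi> * x + (a - pi / 2))" for \<xi>
    by (simp add: cos_diff sin_add cos_add algebra_simps)
  ultimately show ?thesis by (simp add: osc_def)
qed

text \<open>Every integration by parts trades one derivative of h for one power of x. The spare
  derivative in \<open>Suc A\<close> guarantees that the last function reached is still
  continuous.\<close>

lemma osc_decay:
  assumes "smooth_dir 1 (Suc A) h" "0 \<le> R" "\<And>\<xi>. R \<le> \<bar>\<xi>\<bar> \<Longrightarrow> h \<xi> = 0"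
  shows "\<exists>M. \<forall>x. \<bar>x\<bar> ^ A * \<bar>osc R h a x\<bar> \<le> M"
  using assms(1,3)
proof (induction A arbitrary: h a)
  case 0
  note ch = smooth_dir_continuous[OF 0(1)]
  obtain B where B: "0 \<le> B" "\<And>x. norm x \<le> R \<Longrightarrow> \<bar>h x\<bar> \<le> B"
    using locally_boundedE[OF smooth_dir_locally_bounded[OF 0(1)], where R = R] by blast
  have "\<bar>osc R h a x\<bar> \<le> B * (R - - R)" for x
    unfolding osc_def real_norm_def[symmetric]
  proof (rule integral_bound)
    show "norm (h t * cos (t * x + a)) \<le> B" if "t \<in> {- R..R}" for t
    proof -
      have "\<bar>h t\<bar> * \<bar>cos (t * x + a)\<bar> \<le> B * 1" using B(2)[of t] B(1) that by (intro mult_mono) auto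
      thus ?thesis by (simp add: abs_mult)
    qed
  qed (use assms(2) in \<open>auto intro!: continuous_intros ch\<close>)
  thus ?case by auto
next
  case (Suc A)
  from Suc.prems(1) obtain h' where h': "dir_deriv 1 h h'" "smooth_dir 1 (Suc A) h'" by auto
  note ch' = smooth_dir_continuous[OF h'(2)]
  have out: "h' \<xi> = 0" if "R \<le> \<bar>\<xi>\<bar>" for \<xi>
  proof -
    have z: "h' y = 0" if "R < \<bar>y\<bar>" for y
    proof (rule dir_deriv_cong_zero[OF h'(1), of "{x. R < \<bar>x\<bar>}"])
      show "open {x. R < \<bar>x\<bar>}" by (intro open_Collect_less continuous_intros)
    qed (use Suc.prems(2) that in auto)
    \<comment> \<open>Vanishing on an open set says nothing at |\<xi>| = R itself; there the value
      of the derivative is a limit of its zeros from outside, by continuity.\<close>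
    define s where "s n = \<xi> + (if \<xi> \<ge> 0 then 1 else - 1) * inverse (real (Suc n))" for n
    have "s \<longlonglongrightarrow> \<xi> + (if \<xi> \<ge> 0 then 1 else - 1) * 0"
      unfolding s_def by (intro tendsto_intros LIMSEQ_inverse_real_of_nat)
    hence "(\<lambda>n. h' (s n)) \<longlonglongrightarrow> h' \<xi>"
      using continuous_on_tendsto_compose[OF ch'[of UNIV], of s \<xi>] by simp
    moreover have "h' (s n) = 0" for n
    proof (rule z)
      define p where "p = inverse (real (Suc n))"
      have "0 < p" by (simp add: p_def)
      thus "R < \<bar>s n\<bar>" using that unfolding s_def p_def[symmetric] by auto
    qed
    ultimately show ?thesis by (simp add: LIMSEQ_const_iff)
  qed
  from Suc.IH[OF h'(2) out] obtain M where M: "\<And>x. \<bar>x\<bar> ^ A * \<bar>osc R h' (a - pi / 2) x\<bar> \<le> M" by blast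
  have "\<bar>x\<bar> ^ Suc A * \<bar>osc R h a x\<bar> \<le> M" for x
  proof -
    have "x * osc R h a x = - osc R h' (a - pi / 2) x"
      by (rule osc_by_parts) (use dir_deriv_real[OF h'(1)] ch' assms(2) Suc.prems(2) in auto)
    hence "\<bar>x\<bar> * \<bar>osc R h a x\<bar> = \<bar>osc R h' (a - pi / 2) x\<bar>" by (metis abs_minus abs_mult)
    moreover have "\<bar>x\<bar> ^ Suc A * \<bar>osc R h a x\<bar> = \<bar>x\<bar> ^ A * (\<bar>x\<bar> * \<bar>osc R h a x\<bar>)" by simp
    ultimately show ?thesis using M[of x] by (simp only:)
  qed
  thus ?case by blast
qed

lemma osc_rapid:
  assumes h: "\<And>A. smooth_dir 1 A h" and R: "0 \<le> R" "\<And>\<xi>. R \<le> \<bar>\<xi>\<bar> \<Longrightarrow> h \<xi> = 0"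
  shows "rapid (\<lambda>x. c * osc R h a (x + d))"
proof -
  have ch: "continuous_on UNIV h" using smooth_dir_continuous[OF h] .
  have "continuous_on UNIV (osc R h a)" using osc_deriv[OF ch] by (rule has_real_derivative_continuous_on)
  hence [measurable]: "osc R h a \<in> borel_measurable borel" by (rule borel_measurable_continuous_onI)
  have "\<exists>D. \<forall>x. \<bar>c * osc R h a (x + d)\<bar> \<le> D / (1 + \<bar>x\<bar>) ^ A" for A
  proof -
    obtain M0 where M0: "\<And>x. \<bar>x\<bar> ^ 0 * \<bar>osc R h a x\<bar> \<le> M0" using osc_decay[OF h R, of 0] by blast
    obtain M where M: "\<And>x. \<bar>x\<bar> ^ A * \<bar>osc R h a x\<bar> \<le> M" using osc_decay[OF h R, of A] by blast
    have "\<bar>c * osc R h a (x + d)\<bar> \<le> \<bar>c\<bar> * (1 + \<bar>d\<bar>) ^ A * 2 ^ A * (M0 + M) / (1 + \<bar>x\<bar>) ^ A" for x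
    proof -
      let ?y = "x + d" and ?o = "\<bar>osc R h a (x + d)\<bar>"
      have Mnn: "0 \<le> M0" "0 \<le> M" using order_trans[OF _ M0[of 0]] order_trans[OF _ M[of 0]] by auto
      have "1 + \<bar>x\<bar> \<le> 1 + (\<bar>?y\<bar> + \<bar>d\<bar>)" by linarith
      also have "\<dots> \<le> (1 + \<bar>d\<bar>) * (1 + \<bar>?y\<bar>)" by (simp add: algebra_simps)
      finally have "(1 + \<bar>x\<bar>) ^ A \<le> ((1 + \<bar>d\<bar>) * (1 + \<bar>?y\<bar>)) ^ A" by (intro power_mono) auto
      hence 1: "(1 + \<bar>x\<bar>) ^ A \<le> (1 + \<bar>d\<bar>) ^ A * (1 + \<bar>?y\<bar>) ^ A" by (simp add: power_mult_distrib)
      have 2: "(1 + \<bar>?y\<bar>) ^ A * ?o \<le> 2 ^ A * (M0 + M)"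
      proof (cases "\<bar>?y\<bar> \<le> 1")
        case True
        have "(1 + \<bar>?y\<bar>) ^ A \<le> 2 ^ A" using True by (intro power_mono) auto
        thus ?thesis using M0[of ?y] Mnn by (intro mult_mono) auto
      next
        case False
        hence "(1 + \<bar>?y\<bar>) ^ A \<le> (2 * \<bar>?y\<bar>) ^ A" by (intro power_mono) auto
        hence "(1 + \<bar>?y\<bar>) ^ A * ?o \<le> (2 * \<bar>?y\<bar>) ^ A * ?o" by (intro mult_right_mono) auto
        also have "\<dots> = 2 ^ A * (\<bar>?y\<bar> ^ A * ?o)" by (simp add: power_mult_distrib)
        also have "\<dots> \<le> 2 ^ A * (M0 + M)" using M[of ?y] Mnn by (intro mult_left_mono) auto
        finally show ?thesis .
      qed
      have "(1 + \<bar>x\<bar>) ^ A * ?o \<le> (1 + \<bar>d\<bar>) ^ A * ((1 + \<bar>?y\<bar>) ^ A * ?o)"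
        using mult_right_mono[OF 1, of ?o] by (simp add: mult.assoc)
      also have "\<dots> \<le> (1 + \<bar>d\<bar>) ^ A * (2 ^ A * (M0 + M))" by (intro mult_left_mono 2) auto
      finally have "\<bar>c\<bar> * ((1 + \<bar>x\<bar>) ^ A * ?o) \<le> \<bar>c\<bar> * ((1 + \<bar>d\<bar>) ^ A * (2 ^ A * (M0 + M)))" by (intro mult_left_mono) auto
      thus ?thesis by (simp add: pos_le_divide_eq add_pos_nonneg abs_mult mult_ac)
    qed
    thus ?thesis by blast
  qed
  thus ?thesis unfolding rapid_def by simp
qed

text \<open>Powers of the frequency do no harm to a compactly supported h, so derivatives of every
  order decay rapidly; each advances the phase by pi/2.\<close>

lemma osc_chain:
  assumes h: "\<And>A. smooth_dir 1 A h" and R: "0 \<le> R" "\<And>\<xi>. R \<le> \<bar>\<xi>\<bar> \<Longrightarrow> h \<xi> = 0"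
  shows "deriv_chain K (\<lambda>i x. c * osc R (\<lambda>\<xi>. \<xi> ^ i * h \<xi>) (a + real i * (pi / 2)) (x + d))"
proof -
  have sm: "smooth_dir 1 A (\<lambda>\<xi>. \<xi> ^ i * h \<xi>)" for A i
    by (intro smooth_dir_mult smooth_dir_power h smooth_dir_ident)
  have "((\<lambda>x. c * osc R (\<lambda>\<xi>. \<xi> ^ i * h \<xi>) (a + real i * (pi / 2)) (x + d)) has_real_derivative
       c * osc R (\<lambda>\<xi>. \<xi> ^ Suc i * h \<xi>) (a + real (Suc i) * (pi / 2)) (x + d)) (at x)" for i x
  proof -
    have "(osc R (\<lambda>\<xi>. \<xi> ^ i * h \<xi>) (a + real i * (pi / 2)) has_real_derivative
      osc R (\<lambda>\<xi>. \<xi> ^ Suc i * h \<xi>) (a + real (Suc i) * (pi / 2)) (x + d)) (at (x + d))"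
    proof -
      have "a + real i * (pi / 2) + pi / 2 = a + real (Suc i) * (pi / 2)" by (simp add: field_simps)
      moreover have "(\<lambda>\<xi>. \<xi> * (\<xi> ^ i * h \<xi>)) = (\<lambda>\<xi>. \<xi> ^ Suc i * h \<xi>)" by (simp add: mult.assoc)
      ultimately show ?thesis
        using osc_deriv[OF smooth_dir_continuous[OF sm[of "Suc 0" i]], of R "a + real i * (pi / 2)" "x + d"]
        by (simp only:)
    qed
    thus ?thesis by (intro DERIV_cmult) (simp add: DERIV_shift)
  qed
  moreover have "rapid (\<lambda>x. c * osc R (\<lambda>\<xi>. \<xi> ^ i * h \<xi>) (a + real i * (pi / 2)) (x + d))" for i
    by (rule osc_rapid) (use sm R in auto)
  ultimately show ?thesis unfolding deriv_chain_def by blast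
qed

lemma smooth_dir_affine:
  fixes f :: "real \<Rightarrow> real"
  shows "smooth_dir 1 A f \<Longrightarrow> smooth_dir 1 A (\<lambda>x. f (c * x + d))"
proof (induction A arbitrary: f)
  have lb: "locally_bounded (\<lambda>x. f (c * x + d))" if lbf: "locally_bounded f" for f :: "real \<Rightarrow> real"
    unfolding locally_bounded_def
  proof
    fix R
    obtain B where "\<And>x. norm x \<le> \<bar>c\<bar> * R + \<bar>d\<bar> \<Longrightarrow> \<bar>f x\<bar> \<le> B"
      using locally_boundedE[OF lbf, where R = "\<bar>c\<bar> * R + \<bar>d\<bar>"] by blast
    moreover have "norm (c * x + d) \<le> \<bar>c\<bar> * R + \<bar>d\<bar>" if "norm x \<le> R" for x
      using that mult_left_mono[of "\<bar>x\<bar>" R "\<bar>c\<bar>"] abs_triangle_ineq[of "c * x" d] by (simp add: abs_mult)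
    ultimately show "\<exists>B. \<forall>x. norm x \<le> R \<longrightarrow> \<bar>f (c * x + d)\<bar> \<le> B" by blast
  qed
  {
    case 0 thus ?case using lb by simp
  next
    case (Suc A)
    then obtain f' where f': "dir_deriv 1 f f'" "smooth_dir 1 A f'" by auto
    have "dir_deriv 1 (\<lambda>x. f (c * x + d)) (\<lambda>x. c * f' (c * x + d))"
      unfolding dir_deriv_def
    proof
      fix x
      have "((\<lambda>h. f (c * (x + h) + d)) has_real_derivative f' (c * (x + 0) + d) * c) (at 0)"
        by (rule DERIV_chain2[OF dir_deriv_real[OF f'(1)]]) (auto intro!: derivative_eq_intros)
      thus "((\<lambda>h. f (c * (x + h *\<^sub>R 1) + d)) has_real_derivative c * f' (c * x + d)) (at 0)"
        by (simp add: mult.commute)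
    qed
    moreover have "smooth_dir 1 A (\<lambda>x. c * f' (c * x + d))" by (intro smooth_dir_cmult Suc.IH f'(2))
    ultimately show ?case using lb Suc.prems by (auto simp: smooth_dir_locally_bounded)
  }
qed

lemma smooth_dir_cos_sin:
  fixes g :: "real \<Rightarrow> real"
  shows "smooth_dir 1 A g \<Longrightarrow> smooth_dir 1 A (\<lambda>x. cos (g x)) \<and> smooth_dir 1 A (\<lambda>x. sin (g x))"
proof (induction A)
  have lb: "locally_bounded (\<lambda>x. cos (g x))" "locally_bounded (\<lambda>x. sin (g x))"
    unfolding locally_bounded_def by (intro allI exI[of _ 1]; simp)+
  {
    case 0 thus ?case using lb by simp
  next
    case (Suc A)
    then obtain g' where g': "dir_deriv 1 g g'" "smooth_dir 1 A g'" by auto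
    note IH = Suc.IH[OF smooth_dir_SucD[OF Suc.prems]]
    have g0: "((\<lambda>h. g (x + h)) has_real_derivative g' x) (at 0)" for x
      using g'(1) by (simp add: dir_deriv_def)
    have "dir_deriv 1 (\<lambda>x. cos (g x)) (\<lambda>x. (- 1) * (sin (g x) * g' x))"
      "dir_deriv 1 (\<lambda>x. sin (g x)) (\<lambda>x. cos (g x) * g' x)"
      unfolding dir_deriv_def by (auto intro!: derivative_eq_intros g0)
    moreover have "smooth_dir 1 A (\<lambda>x. (- 1) * (sin (g x) * g' x))" "smooth_dir 1 A (\<lambda>x. cos (g x) * g' x)"
      using IH g'(2) by (intro smooth_dir_cmult smooth_dir_mult; simp)+
    ultimately show ?case using lb by auto
  }
qed

text \<open>The window of the Meyer wavelet vanishes near frequency 0, so it may be divided by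
  \<xi>^K without losing smoothness, and K derivatives of the corresponding function restore the
  wavelet. K is arbitrary, so Meyer systems satisfy every requirement on regularity.\<close>

lemma meyer_regular:
  assumes "meyer_system \<psi>F \<psi>M"
  shows "regular_wavelets K \<psi>F \<psi>M"
proof -
  from assms obtain \<nu> c where \<nu>: "meyer_auxiliary \<nu>"
    and F: "\<And>x. of_real (\<psi>F x) = inverse_fourier (meyer_scaling_ft \<nu>) x"
    and M: "\<And>x. of_real (\<psi>M x) = inverse_fourier (meyer_wavelet_ft \<nu> c) x"
    unfolding meyer_system_def by blast
  have \<nu>0: "\<nu> x = 0" if "x \<le> 0" for x using \<nu> that by (simp add: meyer_auxiliary_def)
  have \<nu>1: "\<nu> x = 1" if "x \<ge> 1" for x using \<nu> that by (simp add: meyer_auxiliary_def)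
  have \<nu>s: "smooth_dir 1 A \<nu>" for A
    using C_infinity_smooth_dir[of \<nu> 1 A] \<nu> by (simp add: meyer_auxiliary_def)
  \<comment> \<open>The modulus is not smooth at 0, but \<nu> vanishes on the negative half-line, so
    the composition is a sum of two smooth terms of which at most one is nonzero.\<close>
  have abs_smooth: "smooth_dir 1 A (\<lambda>\<xi>. \<nu> (c * \<bar>\<xi>\<bar> - 1))" if "0 < c" for A c
  proof -
    have "\<nu> (c * \<bar>\<xi>\<bar> - 1) = \<nu> (c * \<xi> + (- 1)) + \<nu> ((- c) * \<xi> + (- 1))" for \<xi>
    proof (cases "\<xi> \<ge> 0")
      case True
      hence "\<nu> ((- c) * \<xi> + (- 1)) = 0" using mult_nonneg_nonneg[of c \<xi>] that True by (intro \<nu>0) linarith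
      thus ?thesis using True by simp
    next
      case False
      hence "\<nu> (c * \<xi> + (- 1)) = 0" using mult_nonneg_nonpos[of c \<xi>] that False by (intro \<nu>0) linarith
      thus ?thesis using False by simp
    qed
    thus ?thesis by (simp only: smooth_dir_add smooth_dir_affine \<nu>s)
  qed
  define w where "w \<xi> = \<nu> (3 * \<bar>\<xi>\<bar> / (2 * pi) - 1)" for \<xi>
  define w' where "w' \<xi> = \<nu> (3 * \<bar>\<xi>\<bar> / (4 * pi) - 1)" for \<xi>
  have ws: "smooth_dir 1 A w" "smooth_dir 1 A w'" for A
    using abs_smooth[of "3 / (2 * pi)" A] abs_smooth[of "3 / (4 * pi)" A] by (simp_all add: w_def[abs_def] w'_def[abs_def])
  define hF where "hF \<xi> = cos (pi / 2 * w \<xi>)" for \<xi>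
  define hM where "hM \<xi> = sin (pi / 2 * w \<xi>) * cos (pi / 2 * w' \<xi>)" for \<xi>
  have sF: "smooth_dir 1 A hF" and sM: "smooth_dir 1 A hM" for A
    unfolding hF_def[abs_def] hM_def[abs_def]
    using smooth_dir_cos_sin[OF smooth_dir_cmult[OF ws(1)], of A "pi / 2"] smooth_dir_cos_sin[OF smooth_dir_cmult[OF ws(2)], of A "pi / 2"]
    by (blast, intro smooth_dir_mult) blast+
  \<comment> \<open>From here on both arguments of \<nu> are at least 1, and the cosines become cos
    (pi/2) = 0.\<close>
  define R where "R = 8 * pi / 3"
  have R0: "0 \<le> R" by (simp add: R_def)
  have oF: "hF \<xi> = 0" and oM: "hM \<xi> = 0" if "R \<le> \<bar>\<xi>\<bar>" for \<xi>
  proof -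
    have "1 \<le> 3 * \<bar>\<xi>\<bar> / (4 * pi) - 1" using that pi_gt_zero by (simp add: R_def field_simps)
    moreover from this have "1 \<le> 3 * \<bar>\<xi>\<bar> / (2 * pi) - 1"
      using pi_gt_zero by (simp add: field_simps)
    ultimately have "w \<xi> = 1" "w' \<xi> = 1" by (auto simp: w_def w'_def \<nu>1)
    thus "hF \<xi> = 0" "hM \<xi> = 0" by (simp_all add: hF_def hM_def)
  qed
  have iM: "hM \<xi> = 0" if "norm \<xi> < 2 * pi / 3" for \<xi>
  proof -
    have "3 * \<bar>\<xi>\<bar> / (2 * pi) - 1 \<le> 0" using that pi_gt_zero by (simp add: field_simps)
    thus ?thesis by (simp add: hM_def w_def \<nu>0)
  qed
  define hK where "hK \<xi> = hM \<xi> / \<xi> ^ K" for \<xi>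
  have sK: "smooth_dir 1 A hK" for A
    unfolding hK_def
  proof (rule smooth_dir_divide[where r = "2 * pi / 3" and c = "(2 * pi / 3) ^ K"])
    show "smooth_dir 1 A (\<lambda>\<xi> :: real. \<xi> ^ K)" for A
      by (intro smooth_dir_power smooth_dir_ident)
    show "(2 * pi / 3) ^ K \<le> \<bar>\<xi> ^ K\<bar>" if "2 * pi / 3 \<le> norm \<xi>" for \<xi> :: real
      unfolding power_abs using that by (intro power_mono) auto
  qed (use sM iM in auto)
  have hK: "\<xi> ^ K * hK \<xi> = hM \<xi>" for \<xi>
    using iM[of \<xi>] by (cases "\<xi> = 0") (auto simp: hK_def)
  have re: "f x = 1 / (2 * pi) * osc R h 0 (x + d)"
    if f: "of_real (f x) = inverse_fourier (\<lambda>\<xi>. cis (d * \<xi>) * of_real (h \<xi>)) x"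
      and h: "continuous_on UNIV h" "\<And>\<xi>. R \<le> \<bar>\<xi>\<bar> \<Longrightarrow> h \<xi> = 0" for f h x d
  proof -
    let ?g = "\<lambda>\<xi>. cis (d * \<xi>) * of_real (h \<xi>) * cis (\<xi> * x)"
    have g_cont: "continuous_on S ?g" for S
      unfolding cis_conv_exp by (intro continuous_intros continuous_on_subset[OF h(1)]) auto
    have "set_integrable lborel {-R..R} ?g" by (rule borel_integrable_atLeastAtMost'[OF g_cont])
    moreover have eq: "(\<lambda>\<xi>. indicator {-R..R} \<xi> *\<^sub>R ?g \<xi>) = ?g"
      using h(2) by (auto simp: fun_eq_iff indicator_def)
    ultimately have int: "integrable lborel ?g" by (simp only: set_integrable_def)
    have g_eq: "?g \<xi> = of_real (h \<xi>) * cis (\<xi> * (x + d) + 0)" for \<xi>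
      by (simp add: cis_mult algebra_simps)
    have "f x = Re (inverse_fourier (\<lambda>\<xi>. cis (d * \<xi>) * of_real (h \<xi>)) x)" using f by (metis Re_complex_of_real)
    also have "\<dots> = 1 / (2 * pi) * Re (\<integral>\<xi>. ?g \<xi> \<partial>lborel)" by (simp add: inverse_fourier_def)
    also have "Re (\<integral>\<xi>. ?g \<xi> \<partial>lborel) = (\<integral>\<xi>. Re (?g \<xi>) \<partial>lborel)" using int by (rule integral_Re[symmetric])
    also have "\<dots> = (\<integral>\<xi>. h \<xi> * cos (\<xi> * (x + d) + 0) \<partial>lborel)" unfolding g_eq by simp
    also have "\<dots> = integral {-R..R} (\<lambda>\<xi>. h \<xi> * cos (\<xi> * (x + d) + 0))"
      by (rule integral_compact_support[where R = R]) (use h R0 in \<open>auto intro!: continuous_intros\<close>)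
    finally show ?thesis by (simp add: osc_def)
  qed
  have \<psi>F: "\<psi>F x = 1 / (2 * pi) * osc R hF 0 (x + 0)" for x
    by (rule re) (use F[of x] smooth_dir_continuous[OF sF] oF in \<open>auto simp: meyer_scaling_ft_def[abs_def] hF_def[abs_def] w_def[abs_def]\<close>)
  have \<psi>M: "\<psi>M x = 1 / (2 * pi) * osc R hM 0 (x + of_int c / 2)" for x
    by (rule re) (use M[of x] smooth_dir_continuous[OF sM] oM in
      \<open>auto simp: meyer_wavelet_ft_def[abs_def] hM_def[abs_def] w_def[abs_def] w'_def[abs_def]\<close>)
  have oK: "hK \<xi> = 0" if "R \<le> \<bar>\<xi>\<bar>" for \<xi> using oM[OF that] by (simp add: hK_def)
  have "\<exists>f. deriv_chain K f \<and> f 0 = \<psi>F"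
    by (rule exI, rule conjI[OF osc_chain[OF sF R0 oF, of K "1 / (2 * pi)" 0 0]]) (simp_all add: fun_eq_iff \<psi>F)
  moreover have "\<exists>f. deriv_chain K f \<and> f 0 = \<psi>M"
    by (rule exI, rule conjI[OF osc_chain[OF sM R0 oM, of K "1 / (2 * pi)" 0 "of_int c / 2"]]) (simp_all add: fun_eq_iff \<psi>M)
  \<comment> \<open>The initial phase anticipates the K shifts by pi/2, so that the last member of
    the chain has phase 0 and is the wavelet itself.\<close>
  moreover have "\<exists>f. deriv_chain K f \<and> f K = \<psi>M"
    by (rule exI, rule conjI[OF osc_chain[OF sK R0 oK, of K "1 / (2 * pi)" "- (real K * (pi / 2))" "of_int c / 2"]])
       (simp_all add: fun_eq_iff \<psi>M hK)
  ultimately show ?thesis unfolding regular_wavelets_def by blast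
qed

section \<open>Continuity and essential bounds\<close>

text \<open>For points closer than 2^(-l) the weight is at least 2^(-n B), so the weighted estimate
  bounds l |g x - g y| by a constant L that does not depend on l.\<close>

lemma C_log_loc_continuous:
  fixes g :: "real ^ 'n \<Rightarrow> real"
  assumes "C_log_loc g"
  shows "continuous_on UNIV g"
proof -
  obtain B C where C: "\<And>l x y. 2 powr (real l * \<bar>g x - g y\<bar>) * torus_weight B l (x - y) \<le> C"
    using log_hoelder_weight[OF assms] by blast
  define n where "n = CARD('n)"
  define L where "L = log 2 (max 1 C * (2 ^ n) ^ B)"
  have L0: "0 \<le> L" by (simp add: L_def zero_le_log_cancel_iff mult_ge1_I)
  have close: "real l * \<bar>g x - g y\<bar> \<le> L" if "dist x y < 1 / 2 ^ l" for l x y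
  proof -
    have "1 + 2 ^ l * int_dist ((x - y) $ i) \<le> 2" for i
    proof -
      have "int_dist ((x - y) $ i) \<le> \<bar>(x - y) $ i - of_int 0\<bar>" by (rule int_dist_le)
      also have "\<dots> \<le> norm (x - y)" using component_le_norm_cart[of "x - y" i] by simp
      also have "\<dots> < 1 / 2 ^ l" using that by (simp add: dist_norm)
      finally have "2 ^ l * int_dist ((x - y) $ i) < 2 ^ l * (1 / 2 ^ l)" by (intro mult_strict_left_mono) auto
      thus ?thesis by simp
    qed
    hence "(\<Prod>i\<in>UNIV. 1 + 2 ^ l * int_dist ((x - y) $ i)) \<le> (\<Prod>i\<in>(UNIV :: 'n set). 2)"
      by (intro prod_mono conjI) (auto intro: add_nonneg_nonneg)
    hence W: "(\<Prod>i\<in>UNIV. 1 + 2 ^ l * int_dist ((x - y) $ i)) \<le> 2 ^ n" by (simp add: n_def)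
    have Wpos: "0 < (\<Prod>i\<in>UNIV. 1 + 2 ^ l * int_dist ((x - y) $ i))"
      by (intro prod_pos) (auto intro: add_pos_nonneg)
    have "1 / (2 ^ n) ^ B \<le> torus_weight B l (x - y)"
      unfolding torus_weight_eq using W Wpos by (intro divide_left_mono power_mono mult_pos_pos zero_less_power) auto
    hence "2 powr (real l * \<bar>g x - g y\<bar>) * (1 / (2 ^ n) ^ B) \<le> 2 powr (real l * \<bar>g x - g y\<bar>) * torus_weight B l (x - y)"
      by (intro mult_left_mono) auto
    also have "\<dots> \<le> C" by (rule C)
    finally have "2 powr (real l * \<bar>g x - g y\<bar>) \<le> C * (2 ^ n) ^ B" by (simp add: field_simps)
    also have "\<dots> \<le> max 1 C * (2 ^ n) ^ B" by (intro mult_right_mono) auto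
    finally have "2 powr (real l * \<bar>g x - g y\<bar>) \<le> max 1 C * (2 ^ n) ^ B" .
    moreover have "0 < max 1 C * (2 ^ n) ^ B" by (intro mult_pos_pos) auto
    ultimately show ?thesis unfolding L_def by (subst le_log_iff) auto
  qed
  show ?thesis
    unfolding continuous_on_iff
  proof (intro ballI allI impI)
    fix x :: "real ^ 'n" and e :: real assume "0 < e"
    obtain l :: nat where l: "L / e < real l" using reals_Archimedean2 by blast
    have "0 < real l" using l L0 \<open>0 < e\<close> by (meson divide_nonneg_pos le_less_trans)
    have "dist (g y) (g x) < e" if "dist y x < 1 / 2 ^ l" for y
    proof -
      have "real l * \<bar>g y - g x\<bar> < real l * e" using close[OF that] l \<open>0 < e\<close> by (simp add: field_simps)
      thus ?thesis using \<open>0 < real l\<close> by (simp add: dist_real_def)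
    qed
    thus "\<exists>d>0. \<forall>x'\<in>UNIV. dist x' x < d \<longrightarrow> dist (g x') (g x) < e" by (intro exI[of _ "1 / 2 ^ l"]) auto
  qed
qed

text \<open>A violation at one point spreads by continuity to a box of positive measure. The box
  extends from y in the positive directions only, so it lies in the half-open cell even if y is on
  its lower boundary.\<close>

lemma AE_torus_le_imp_le:
  fixes g :: "real ^ 'n \<Rightarrow> real"
  assumes cont: "continuous_on UNIV g" and per: "periodic g" and ae: "AE x in torus. g x \<le> c"
  shows "g x \<le> c"
proof (rule ccontr)
  assume "\<not> g x \<le> c"
  define y where "y = x + lattice_pt (\<chi> i. - \<lfloor>x $ i\<rfloor>)"
  have "g y = g x" using per by (simp add: periodic_def y_def)
  hence gy: "c < g y" using \<open>\<not> g x \<le> c\<close> by simp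
  have y: "0 \<le> y $ i" "y $ i < 1" for i
    unfolding y_def lattice_pt_def by simp_all linarith
  have "open (g -` {c<..})" using cont by (intro open_vimage) auto
  then obtain e where e: "0 < e" "cball y e \<subseteq> g -` {c<..}" using gy open_contains_cball by blast
  define d where "d = Min (insert (e / real CARD('n)) (range (\<lambda>i. 1 - y $ i)))"
  have d0: "0 < d" unfolding d_def using y e(1) by (subst Min_gr_iff) auto
  have d_le: "d \<le> e / real CARD('n)" "d \<le> 1 - y $ i" for i unfolding d_def by (intro Min_le; simp)+
  let ?U = "box y (y + (\<chi> i. d))"
  have U: "z \<in> torus_cell" "c < g z" if "z \<in> ?U" for z
  proof -
    have z: "y $ i < z $ i" "z $ i < y $ i + d" for i using that by (auto simp: mem_box_cart)
    show "z \<in> torus_cell" unfolding torus_cell_def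
    proof (intro CollectI allI conjI)
      fix i show "0 \<le> z $ i" using y(1)[of i] z(1)[of i] by linarith
      show "z $ i < 1" using d_le(2)[of i] z(2)[of i] by linarith
    qed
    have "norm (z - y) \<le> (\<Sum>i\<in>(UNIV :: 'n set). \<bar>(z - y) $ i\<bar>)" by (rule norm_le_l1_cart)
    also have "\<dots> \<le> (\<Sum>i\<in>(UNIV :: 'n set). e / real CARD('n))"
    proof (rule sum_mono)
      fix i show "\<bar>(z - y) $ i\<bar> \<le> e / real CARD('n)" using z[of i] d_le(1) by simp
    qed
    finally have "z \<in> cball y e" by (simp add: dist_norm norm_minus_commute)
    thus "c < g z" using e(2) by auto
  qed
  have "AE z in lborel. z \<in> torus_cell \<longrightarrow> g z \<le> c"
    using ae unfolding torus_def by (subst (asm) AE_restrict_space_iff) auto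
  hence "AE z in lborel. z \<notin> ?U" by eventually_elim (use U in fastforce)
  hence "?U \<in> null_sets lborel" by (subst (asm) AE_iff_null) auto
  hence "negligible ?U" by (simp add: negligible_iff_null_sets null_sets_completionI)
  moreover have "y + (\<chi> i. d / 2) \<in> ?U" using d0 by (simp add: mem_box_cart)
  ultimately show False using open_not_negligible[of ?U] by auto
qed

lemma le_ess_sup:
  fixes g :: "real ^ 'n \<Rightarrow> real"
  assumes cont: "continuous_on UNIV g" and per: "periodic g"
  shows "g x \<le> ess_sup g"
proof -
  have [measurable]: "g \<in> borel_measurable borel" using cont by (rule borel_measurable_continuous_onI)
  define e where "e = esssup torus (\<lambda>x. ereal (g x))"
  have ae: "AE x in torus. ereal (g x) \<le> e" unfolding e_def by (rule esssup_AE)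
  obtain B where B: "\<And>x. \<bar>g x\<bar> \<le> B" using periodic_bounded[OF per locally_bounded_continuous[OF cont]] by blast
  have "e \<le> ereal B"
    unfolding e_def
  proof (rule esssup_I)
    show "AE x in torus. ereal (g x) \<le> ereal B" using B abs_le_D1 by (intro AE_I2) auto
  qed (intro borel_measurable_torus borel_measurable_ereal, simp)
  \<comment> \<open>Both infinities must be excluded, because \<open>real_of_ereal\<close> maps them
    to 0.\<close>
  hence "e \<noteq> \<infinity>" by auto
  moreover have "e \<noteq> - \<infinity>"
  proof
    assume "e = - \<infinity>"
    hence "AE x in (torus :: (real ^ 'n) measure). False" using ae by simp
    thus False by (simp add: eventually_False ae_filter_eq_bot_iff emeasure_torus)
  qed
  ultimately obtain r where r: "e = ereal r" by (cases e) auto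
  hence "AE x in torus. g x \<le> r" using ae by simp
  from AE_torus_le_imp_le[OF cont per this] show ?thesis using r by (simp add: ess_sup_def e_def)
qed

lemma ess_inf_le:
  fixes g :: "real ^ 'n \<Rightarrow> real"
  assumes "continuous_on UNIV g" "periodic g"
  shows "ess_inf g \<le> g x"
proof -
  have "continuous_on UNIV (\<lambda>x. - g x)" by (intro continuous_intros assms(1))
  moreover have "periodic (\<lambda>x. - g x)" using assms(2) by (simp add: periodic_def)
  ultimately have "- g x \<le> ess_sup (\<lambda>x. - g x)" by (rule le_ess_sup)
  thus ?thesis by (simp add: ess_inf_def)
qed

text \<open>Log-Hoelder continuity is given for 1 / q, and q inherits continuity because 1 / q has
  no zeros. Continuity turns the essential bound into a bound at every point.\<close>

lemma P_log_bounded: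
  fixes q :: "real ^ 'n \<Rightarrow> real"
  assumes "P_log q"
  shows "continuous_on UNIV q" "1 \<le> q x" "q x \<le> ess_sup q"
proof -
  have q1: "1 \<le> q x" for x using assms by (simp add: P_log_def P_exponent_def)
  have "continuous_on UNIV (\<lambda>x. 1 / q x)"
    using assms by (intro C_log_loc_continuous) (simp add: P_log_def C_log_def)
  hence "continuous_on UNIV (\<lambda>x. 1 / (1 / q x))"
  proof (rule continuous_on_divide[OF continuous_on_const])
    show "\<forall>x\<in>UNIV. 1 / q x \<noteq> 0"
    proof
      show "1 / q x \<noteq> 0" for x using q1[of x] by simp
    qed
  qed
  thus c: "continuous_on UNIV q" by simp
  show "1 \<le> q x" by (rule q1)
  have "periodic q" using assms by (simp add: P_log_def P_exponent_def)
  with c show "q x \<le> ess_sup q" by (rule le_ess_sup)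
qed

text \<open>\<epsilon> is the gap in the hypothesis on t. The lower bound on s - (n/q+ + \<epsilon>)
  comes from t, which it dominates; the upper one from s, from which a nonnegative number is
  subtracted. Meyer systems allow any K; for Daubechies systems K is their order k and half its
  distance to the supremum of s is available for \<eta>, finally capped at \<epsilon>/2.\<close>

lemma smoothness_parameters:
  fixes s t :: "real ^ 'n \<Rightarrow> real"
  assumes s: "C_log_loc s" and q: "P_log q" and t: "admissible_smoothness s q t"
    and w: "admissible_wavelets {s, t} \<psi>F \<psi>M"
  shows "\<exists>K \<eta> \<epsilon>. regular_wavelets K \<psi>F \<psi>M \<and> 0 < \<eta> \<and> 2 * \<eta> \<le> \<epsilon> \<and>
    (\<forall>x. t x \<le> s x - (real CARD('n) / ess_sup q + \<epsilon>)) \<and>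
    (\<forall>x. - real K \<le> s x - (real CARD('n) / ess_sup q + \<epsilon>)) \<and>
    (\<forall>x. s x - (real CARD('n) / ess_sup q + \<epsilon>) \<le> real K - 2 * \<eta>)"
proof -
  define \<sigma> where "\<sigma> = real CARD('n) / ess_sup q"
  have "0 \<le> ess_sup q" using P_log_bounded(2,3)[OF q, of 0] by linarith
  hence \<sigma>0: "0 \<le> \<sigma>" by (simp add: \<sigma>_def)
  have tc: "C_log_loc t" and neg: "(SUP x. ereal (t x - s x + \<sigma>)) < 0"
    using t by (auto simp: admissible_smoothness_def \<sigma>_def)
  note scont = C_log_loc_continuous[OF s] and tcont = C_log_loc_continuous[OF tc]
  have per: "periodic s" "periodic t" using s tc by (auto simp: C_log_loc_def)
  define S where "S = (SUP x. ereal (t x - s x + \<sigma>))"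
  have S_ge: "ereal (t x - s x + \<sigma>) \<le> S" for x unfolding S_def by (rule SUP_upper) simp
  have "S \<noteq> - \<infinity>" using S_ge[of 0] by auto
  then obtain r where r: "S = ereal r" "r < 0" using neg[folded S_def] by (cases S) auto
  define \<epsilon> where "\<epsilon> = - r"
  have \<epsilon>: "0 < \<epsilon>" "\<And>x. t x \<le> s x - (\<sigma> + \<epsilon>)"
  proof -
    show "0 < \<epsilon>" using r by (simp add: \<epsilon>_def)
    fix x
    have "t x - s x + \<sigma> \<le> r" using S_ge[of x] r by simp
    thus "t x \<le> s x - (\<sigma> + \<epsilon>)" by (simp add: \<epsilon>_def)
  qed
  have "\<exists>K. regular_wavelets K \<psi>F \<psi>M \<and> (\<forall>x. - real K \<le> t x) \<and> (\<exists>\<eta>>0. \<forall>x. s x \<le> real K - 2 * \<eta>)"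
    using w unfolding admissible_wavelets_def
  proof
    assume "meyer_system \<psi>F \<psi>M"
    obtain B where B: "\<And>x. \<bar>s x\<bar> \<le> B" using periodic_bounded[OF per(1) locally_bounded_continuous[OF scont]] by blast
    obtain B' where B': "\<And>x. \<bar>t x\<bar> \<le> B'" using periodic_bounded[OF per(2) locally_bounded_continuous[OF tcont]] by blast
    obtain K :: nat where K: "max (B + 2) B' < real K" using reals_Archimedean2 by blast
    have "- real K \<le> t x \<and> s x \<le> real K - 2 * 1" for x using B[of x] B'[of x] K by (auto simp: abs_le_iff)
    thus ?thesis using meyer_regular[OF \<open>meyer_system \<psi>F \<psi>M\<close>, of K] zero_less_one by blast
  next
    assume "\<exists>k. daubechies_system k \<psi>F \<psi>M \<and> (\<forall>r\<in>{s, t}. max (- ess_inf r) (ess_sup r) < real k)"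
    then obtain k where k: "daubechies_system k \<psi>F \<psi>M" "- ess_inf t < real k" "ess_sup s < real k" by auto
    define \<eta> where "\<eta> = (real k - ess_sup s) / 2"
    have "- real k \<le> t x \<and> s x \<le> real k - 2 * \<eta>" for x
      using ess_inf_le[OF tcont per(2), of x] le_ess_sup[OF scont per(1), of x] k by (simp add: \<eta>_def field_simps)
    moreover have "0 < \<eta>" using k by (simp add: \<eta>_def)
    ultimately show ?thesis using daubechies_regular[OF k(1)] by blast
  qed
  then obtain K \<eta> where K: "regular_wavelets K \<psi>F \<psi>M" "\<And>x. - real K \<le> t x" "0 < \<eta>" "\<And>x. s x \<le> real K - 2 * \<eta>" by blast
  have "- real K \<le> s x - (\<sigma> + \<epsilon>)" for x using K(2)[of x] \<epsilon>(2)[of x] by linarith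
  moreover have "s x - (\<sigma> + \<epsilon>) \<le> real K - 2 * min \<eta> (\<epsilon> / 2)" for x using K(4)[of x] \<epsilon>(1) \<sigma>0 by linarith
  ultimately show ?thesis
    unfolding \<sigma>_def[symmetric] using K(1,3) \<epsilon> by (intro exI[of _ K] exI[of _ "min \<eta> (\<epsilon> / 2)"] exI[of _ \<epsilon>]) auto
qed

lemma C_log_loc_diff_const: "C_log_loc g \<Longrightarrow> C_log_loc (\<lambda>x. g x - c)"
  by (simp add: C_log_loc_def periodic_def)

section \<open>Moments\<close>

lemma power_le_fact_exp:
  assumes "0 \<le> (x :: real)"
  shows "x ^ k \<le> fact k * exp x"
proof -
  have "(\<Sum>n\<in>{k}. x ^ n /\<^sub>R fact n) \<le> (\<Sum>n. x ^ n /\<^sub>R fact n)"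
    using assms by (intro sum_le_suminf summable_exp_generic) auto
  hence "x ^ k / fact k \<le> exp x" by (simp add: exp_def divide_inverse mult.commute)
  thus ?thesis by (simp add: field_simps)
qed

lemma power_le_exp_half: "\<bar>x\<bar> ^ k \<le> (2 ^ k * fact k) * exp (\<bar>x\<bar> / 2)" for x :: real
  using power_le_fact_exp[of "\<bar>x\<bar> / 2" k] by (simp add: power_divide field_simps)

lemma exponential_weight_le:
  fixes q :: "real ^ 'n \<Rightarrow> real"
  assumes "prob_space \<kappa>" and sets: "sets \<kappa> = sets torus" and q: "\<And>y. 1 \<le> q y" "\<And>y. q y \<le> Q"
    and qm: "q \<in> borel_measurable borel"
  shows "exponential_weight \<kappa> q x \<le> exp (1 / 2) * exp (- \<bar>x\<bar> / 2)"
proof -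
  interpret prob_space \<kappa> by fact
  have [measurable]: "q \<in> borel_measurable \<kappa>"
    using borel_measurable_torus[OF qm] measurable_cong_sets[OF sets refl] by blast
  have nn: "0 \<le> (\<integral>y. \<bar>x\<bar> powr q y \<partial>\<kappa>)" by (intro integral_nonneg_AE AE_I2) simp
  show ?thesis
  proof (cases "\<bar>x\<bar> \<le> 1")
    case True
    have "exponential_weight \<kappa> q x \<le> 1" unfolding exponential_weight_def using nn by simp
    also have "1 \<le> exp (1 / 2 + - \<bar>x\<bar> / 2)" using True by simp
    finally show ?thesis by (simp only: exp_add)
  next
    case False
    hence x1: "1 \<le> \<bar>x\<bar>" by simp
    have "\<bar>x\<bar> \<le> (\<integral>y. \<bar>x\<bar> powr q y \<partial>\<kappa>)"
    proof (rule integral_ge_const)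
      show "integrable \<kappa> (\<lambda>y. \<bar>x\<bar> powr q y)"
      proof (rule integrable_const_bound[where B = "\<bar>x\<bar> powr Q"])
        show "AE y in \<kappa>. norm (\<bar>x\<bar> powr q y) \<le> \<bar>x\<bar> powr Q" using x1 q by (intro AE_I2) (simp add: powr_mono)
      qed measurable
      show "AE y in \<kappa>. \<bar>x\<bar> \<le> \<bar>x\<bar> powr q y"
      proof (rule AE_I2)
        fix y
        have "\<bar>x\<bar> powr 1 \<le> \<bar>x\<bar> powr q y" using x1 q by (intro powr_mono) auto
        thus "\<bar>x\<bar> \<le> \<bar>x\<bar> powr q y" using x1 by simp
      qed
    qed
    hence "exponential_weight \<kappa> q x \<le> exp (1 / 2 + - \<bar>x\<bar> / 2)" unfolding exponential_weight_def by simp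
    thus ?thesis by (simp only: exp_add)
  qed
qed

lemma q_exponential_moment:
  fixes q :: "real ^ 'n \<Rightarrow> real"
  assumes \<kappa>: "prob_space \<kappa>" "sets \<kappa> = sets torus" and q: "\<And>y. 1 \<le> q y" "\<And>y. q y \<le> Q" "q \<in> borel_measurable borel"
  shows "\<exists>M\<ge>0. \<forall>P X. distributed P lborel X (\<lambda>x. ennreal (q_exponential_density \<kappa> q x)) \<longrightarrow>
    (\<integral>\<^sup>+\<omega>. ennreal (1 + 2 * \<bar>X \<omega>\<bar> ^ k) \<partial>P) \<le> ennreal M"
proof -
  define Z where "Z = (\<integral>z. exponential_weight \<kappa> q z \<partial>lborel)"
  define c where "c = \<bar>1 / Z\<bar> * exp (1 / 2)"
  \<comment> \<open>One summand for each monomial of (1 + 2 |x|^k) (1 + x^2), bounded by its own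
    multiple of exp (|x| / 2). The extra factor 1 + x^2 buys the integrable majorant 1 / (1 +
    x^2).\<close>
  define D where "D = 1 + (2 ^ 2 * fact 2) + 2 * (2 ^ k * fact k) + 2 * (2 ^ (k + 2) * fact (k + 2) :: real)"
  have D0: "0 \<le> D" by (simp add: D_def)
  obtain I where I: "(\<integral>\<^sup>+x. ennreal (1 / (1 + x\<^sup>2)) \<partial>lborel) = ennreal I" "0 \<le> I"
    using nn_integral_inverse_square by (metis ennreal_cases infinity_ennreal_def less_irrefl)
  have pt: "ennreal (q_exponential_density \<kappa> q x) * ennreal (1 + 2 * \<bar>x\<bar> ^ k) \<le> ennreal (c * D) * ennreal (1 / (1 + x\<^sup>2))" for x
  proof -
    have e1: "1 \<le> exp (\<bar>x\<bar> / 2)" by simp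
    have "(1 + 2 * \<bar>x\<bar> ^ k) * (1 + x\<^sup>2) = 1 + \<bar>x\<bar> ^ 2 + 2 * \<bar>x\<bar> ^ k + 2 * \<bar>x\<bar> ^ (k + 2)"
      by (simp add: algebra_simps power_add power2_eq_square)
    also have "\<dots> \<le> D * exp (\<bar>x\<bar> / 2)"
      using power_le_exp_half[of x 2] power_le_exp_half[of x k] power_le_exp_half[of x "k + 2"] e1
      unfolding D_def distrib_right by linarith
    finally have poly: "1 + 2 * \<bar>x\<bar> ^ k \<le> D * exp (\<bar>x\<bar> / 2) * (1 / (1 + x\<^sup>2))"
      by (simp add: pos_le_divide_eq add_pos_nonneg)
    have "q_exponential_density \<kappa> q x \<le> \<bar>1 / Z\<bar> * exponential_weight \<kappa> q x"
      unfolding q_exponential_density_def Z_def[symmetric] using abs_ge_self[of "exponential_weight \<kappa> q x / Z"]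
      by (simp add: exponential_weight_def)
    also have "\<dots> \<le> \<bar>1 / Z\<bar> * (exp (1 / 2) * exp (- \<bar>x\<bar> / 2))"
      by (intro mult_left_mono exponential_weight_le[OF \<kappa> q]) auto
    finally have dens: "q_exponential_density \<kappa> q x \<le> c * exp (- \<bar>x\<bar> / 2)" by (simp add: c_def)
    have "ennreal (q_exponential_density \<kappa> q x) * ennreal (1 + 2 * \<bar>x\<bar> ^ k) \<le>
       ennreal (c * exp (- \<bar>x\<bar> / 2)) * ennreal (D * exp (\<bar>x\<bar> / 2) * (1 / (1 + x\<^sup>2)))"
      by (intro mult_mono ennreal_leI dens poly) auto
    also have "\<dots> = ennreal ((c * exp (- \<bar>x\<bar> / 2)) * (D * exp (\<bar>x\<bar> / 2) * (1 / (1 + x\<^sup>2))))"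
      using D0 by (intro ennreal_mult[symmetric]) (auto simp: c_def)
    also have "(c * exp (- \<bar>x\<bar> / 2)) * (D * exp (\<bar>x\<bar> / 2) * (1 / (1 + x\<^sup>2))) = c * D * (exp (- \<bar>x\<bar> / 2) * exp (\<bar>x\<bar> / 2)) * (1 / (1 + x\<^sup>2))"
      by (simp only: mult_ac)
    also have "exp (- \<bar>x\<bar> / 2) * exp (\<bar>x\<bar> / 2) = 1" by (simp add: exp_add[symmetric])
    also have "ennreal (c * D * 1 * (1 / (1 + x\<^sup>2))) = ennreal (c * D) * ennreal (1 / (1 + x\<^sup>2))"
      using D0 by (simp only: mult_1_right) (intro ennreal_mult, auto simp: c_def)
    finally show ?thesis .
  qed
  have "(\<integral>\<^sup>+\<omega>. ennreal (1 + 2 * \<bar>X \<omega>\<bar> ^ k) \<partial>P) \<le> ennreal (c * D * I)"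
    if dist: "distributed P lborel X (\<lambda>x. ennreal (q_exponential_density \<kappa> q x))" for P :: "'z measure" and X
  proof -
    have "(\<integral>\<^sup>+\<omega>. ennreal (1 + 2 * \<bar>X \<omega>\<bar> ^ k) \<partial>P) = (\<integral>\<^sup>+x. ennreal (q_exponential_density \<kappa> q x) * ennreal (1 + 2 * \<bar>x\<bar> ^ k) \<partial>lborel)"
      using distributed_nn_integral[OF dist, of "\<lambda>x. ennreal (1 + 2 * \<bar>x\<bar> ^ k)"] by simp
    also have "\<dots> \<le> (\<integral>\<^sup>+x. ennreal (c * D) * ennreal (1 / (1 + x\<^sup>2)) \<partial>lborel)" by (intro nn_integral_mono pt)
    also have "\<dots> = ennreal (c * D) * ennreal I" by (subst nn_integral_cmult) (auto simp: I)
    also have "\<dots> = ennreal (c * D * I)" using D0 I(2) by (intro ennreal_mult[symmetric]) (auto simp: c_def)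
    finally show ?thesis .
  qed
  thus ?thesis using D0 I(2) by (intro exI[of _ "c * D * I"]) (auto simp: c_def)
qed

text \<open>Jensen's inequality for the normalised weights w / W; scaling back leaves a factor W^(Q
  - 1), which is at most 1. Evenness of Q makes the power convex on the whole line.\<close>

lemma weighted_power_mean:
  fixes w z :: "'i \<Rightarrow> real"
  assumes fin: "finite I" and w: "\<And>i. i \<in> I \<Longrightarrow> 0 \<le> w i" "(\<Sum>i\<in>I. w i) \<le> 1" and Q: "even Q" "0 < Q"
  shows "(\<Sum>i\<in>I. w i * z i) ^ Q \<le> (\<Sum>i\<in>I. w i * z i ^ Q)"
proof (cases "(\<Sum>i\<in>I. w i) = 0")
  case True
  hence "\<forall>i\<in>I. w i = 0" using w(1) fin by (simp add: sum_nonneg_eq_0_iff)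
  thus ?thesis using Q by (simp add: zero_power)
next
  case False
  define W where "W = (\<Sum>i\<in>I. w i)"
  have W: "0 < W" "W \<le> 1" using False w sum_nonneg[of I w] by (auto simp: W_def order_less_le)
  have "I \<noteq> {}" using False by auto
  hence "(\<Sum>i\<in>I. w i / W * z i) ^ Q \<le> (\<Sum>i\<in>I. w i / W * z i ^ Q)"
    using convex_on_sum[OF fin _ convex_power_even[OF Q(1)], of "\<lambda>i. w i / W" z] False w W
    by (auto simp: sum_divide_distrib[symmetric] W_def)
  hence "W ^ Q * (\<Sum>i\<in>I. w i / W * z i) ^ Q \<le> W ^ Q * (\<Sum>i\<in>I. w i / W * z i ^ Q)"
    using W by (intro mult_left_mono) auto
  also have "W ^ Q * (\<Sum>i\<in>I. w i / W * z i) ^ Q = (\<Sum>i\<in>I. w i * z i) ^ Q"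
    using W by (simp add: power_mult_distrib[symmetric] sum_distrib_left)
  also have "W ^ Q * (\<Sum>i\<in>I. w i / W * z i ^ Q) = W ^ (Q - 1) * (\<Sum>i\<in>I. w i * z i ^ Q)"
    using W Q by (simp add: sum_distrib_left power_eq_if)
  also have "\<dots> \<le> 1 * (\<Sum>i\<in>I. w i * z i ^ Q)"
    using W w(1) Q by (intro mult_right_mono power_le_one sum_nonneg mult_nonneg_nonneg) (auto intro: zero_le_even_power)
  finally show ?thesis by simp
qed

lemma powr_le_add_power:
  assumes "0 \<le> (v :: real)" "1 \<le> p" "p \<le> real Q"
  shows "v powr p \<le> v + v ^ Q"
proof (cases "v \<le> 1")
  case True
  have "v powr p \<le> v powr 1" if "v > 0" using True assms that by (intro powr_mono') auto
  thus ?thesis using assms by (cases "v = 0") (auto simp: add_increasing2)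
next
  case False
  hence "v powr p \<le> v powr real Q" using assms by (intro powr_mono) auto
  thus ?thesis using False by (simp add: powr_realpow)
qed

text \<open>The right-hand side does not depend on the exponent p, which will be q(x): v^p is at
  most v + v^Q, the integer power is accessible to Jensen's inequality, and z is at most 1 +
  z^Q.\<close>

lemma weighted_powr_mean:
  fixes w z :: "'i \<Rightarrow> real"
  assumes fin: "finite I" and w: "\<And>i. i \<in> I \<Longrightarrow> 0 \<le> w i" "(\<Sum>i\<in>I. w i) \<le> 1" and Q: "even Q" "0 < Q"
    and z: "\<And>i. i \<in> I \<Longrightarrow> 0 \<le> z i" and v: "0 \<le> v" "v \<le> (\<Sum>i\<in>I. w i * z i)" and p: "1 \<le> p" "p \<le> real Q"
  shows "v powr p \<le> (\<Sum>i\<in>I. w i * (1 + 2 * z i ^ Q))"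
proof -
  have "v powr p \<le> v + v ^ Q" by (rule powr_le_add_power) fact+
  also have "\<dots> \<le> (\<Sum>i\<in>I. w i * z i) + (\<Sum>i\<in>I. w i * z i) ^ Q"
    using v by (intro add_mono power_mono) auto
  also have "\<dots> \<le> (\<Sum>i\<in>I. w i * z i) + (\<Sum>i\<in>I. w i * z i ^ Q)"
    using weighted_power_mean[OF fin w Q, of z] by simp
  also have "\<dots> = (\<Sum>i\<in>I. w i * (z i + z i ^ Q))" by (simp add: sum.distrib algebra_simps)
  also have "\<dots> \<le> (\<Sum>i\<in>I. w i * (1 + 2 * z i ^ Q))"
  proof (intro sum_mono mult_left_mono w(1))
    fix i assume "i \<in> I"
    have "z i \<le> 1 + z i ^ Q"
    proof (cases "z i \<le> 1")
      case False
      hence "z i ^ 1 \<le> z i ^ Q" using Q by (intro power_increasing) auto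
      thus ?thesis by simp
    qed (use z[OF \<open>i \<in> I\<close>] in \<open>simp add: add_increasing2\<close>)
    thus "z i + z i ^ Q \<le> 1 + 2 * z i ^ Q" by simp
  qed
  finally show ?thesis .
qed

section \<open>Trigonometric test functions\<close>

text \<open>Differentiating a plane wave changes its amplitude and shifts its phase by pi/2, so the
  family is closed under all partial derivatives.\<close>

lemma partial_diffs_cos:
  "\<exists>c' a'. partial_diffs bs (\<lambda>x. c * cos (v \<bullet> x + a)) = (\<lambda>x. c' * cos (v \<bullet> x + a'))"
proof (induction bs)
  case (Cons e bs)
  then obtain c' a' where IH: "partial_diffs bs (\<lambda>x. c * cos (v \<bullet> x + a)) = (\<lambda>x. c' * cos (v \<bullet> x + a'))" by blast
  have "partial_diff e (\<lambda>x. c' * cos (v \<bullet> x + a')) = (\<lambda>x. (c' * (v \<bullet> e)) * cos (v \<bullet> x + (a' + pi / 2)))"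
  proof
    fix x
    have "((\<lambda>x. c' * cos (v \<bullet> x + a')) has_derivative (\<lambda>h. c' * (- sin (v \<bullet> x + a') * (v \<bullet> h)))) (at x)"
      by (auto intro!: derivative_eq_intros)
    from frechet_derivative_at[OF this, symmetric]
    show "partial_diff e (\<lambda>x. c' * cos (v \<bullet> x + a')) x = (c' * (v \<bullet> e)) * cos (v \<bullet> x + (a' + pi / 2))"
      by (simp add: partial_diff_def cos_add sin_add)
  qed
  hence "partial_diffs (e # bs) (\<lambda>x. c * cos (v \<bullet> x + a)) = (\<lambda>x. (c' * (v \<bullet> e)) * cos (v \<bullet> x + (a' + pi / 2)))"
    using IH by (simp add: partial_diffs_def)
  thus ?case by blast
qed (auto simp: partial_diffs_def)

lemma C_infinity_cos: "C_infinity (\<lambda>x. c * cos (v \<bullet> x + a))"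
proof -
  have "partial_diffs bs (\<lambda>x. c * cos (v \<bullet> x + a)) differentiable at x"
    "continuous_on UNIV (partial_diffs bs (\<lambda>x. c * cos (v \<bullet> x + a)))" for bs x
  proof -
    obtain c' a' where *: "partial_diffs bs (\<lambda>x. c * cos (v \<bullet> x + a)) = (\<lambda>x. c' * cos (v \<bullet> x + a'))"
      using partial_diffs_cos by blast
    have "((\<lambda>x. c' * cos (v \<bullet> x + a')) has_derivative (\<lambda>h. c' * (- sin (v \<bullet> x + a') * (v \<bullet> h)))) (at x)"
      by (auto intro!: derivative_eq_intros)
    thus "partial_diffs bs (\<lambda>x. c * cos (v \<bullet> x + a)) differentiable at x" unfolding * differentiable_def by blast
    show "continuous_on UNIV (partial_diffs bs (\<lambda>x. c * cos (v \<bullet> x + a)))" unfolding * by (intro continuous_intros)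
  qed
  thus ?thesis unfolding C_infinity_def C_k_def by blast
qed

lemma trig_test_functions:
  fixes \<mu> :: "int ^ 'n"
  shows "(\<lambda>x. cos (2 * pi * (lattice_pt \<mu> \<bullet> x))) \<in> test_functions" "(\<lambda>x. sin (2 * pi * (lattice_pt \<mu> \<bullet> x))) \<in> test_functions"
proof -
  have t_per: "2 * pi * (lattice_pt \<mu> \<bullet> (x + lattice_pt m)) = 2 * pi * (lattice_pt \<mu> \<bullet> x) + 2 * pi * of_int (\<Sum>i\<in>UNIV. \<mu> $ i * m $ i)" for x m
    by (simp add: inner_add_right inner_vec_def lattice_pt_def algebra_simps sum.distrib)
  have "periodic (\<lambda>x. cos (2 * pi * (lattice_pt \<mu> \<bullet> x)))" "periodic (\<lambda>x. sin (2 * pi * (lattice_pt \<mu> \<bullet> x)))"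
    unfolding periodic_def t_per cos_add sin_add cos_int_2pin sin_int_2pin by simp_all
  moreover have "C_infinity (\<lambda>x. cos (2 * pi * (lattice_pt \<mu> \<bullet> x)))"
    using C_infinity_cos[of 1 "(2 * pi) *\<^sub>R lattice_pt \<mu>" 0] by (simp add: mult.assoc)
  moreover have "C_infinity (\<lambda>x. sin (2 * pi * (lattice_pt \<mu> \<bullet> x)))"
    using C_infinity_cos[of 1 "(2 * pi) *\<^sub>R lattice_pt \<mu>" "- (pi / 2)"] by (simp add: mult.assoc cos_diff)
  ultimately show "(\<lambda>x. cos (2 * pi * (lattice_pt \<mu> \<bullet> x))) \<in> test_functions" "(\<lambda>x. sin (2 * pi * (lattice_pt \<mu> \<bullet> x))) \<in> test_functions"
    by (simp_all add: test_functions_def)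
qed

section \<open>The random series\<close>

text \<open>Equality on test functions is enough, because the trigonometric functions are among
  them.\<close>

lemma fourier_coeff_sum:
  assumes "finite I" "\<And>f. f \<in> test_functions \<Longrightarrow> T f = (\<Sum>i\<in>I. a i * U i f)"
  shows "fourier_coeff T \<mu> = (\<Sum>i\<in>I. of_real (a i) * fourier_coeff (U i) \<mu>)"
  unfolding fourier_coeff_def assms(2)[OF trig_test_functions(1)] assms(2)[OF trig_test_functions(2)]
  by (simp add: complex_eq_iff sum_negf)

lemma frequency_piece_finite_sum:
  assumes "resolution_of_unity \<phi>\<^sub>0 \<phi>"
  shows "frequency_piece \<phi>\<^sub>0 \<phi> k T x = (\<Sum>\<mu>\<in>int_box (2 ^ (k + 1)).
     of_real (dyadic_block \<phi>\<^sub>0 \<phi> k (lattice_pt \<mu>)) * fourier_coeff T \<mu> * cis (2 * pi * (lattice_pt \<mu> \<bullet> x)))"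
  unfolding frequency_piece_trig_sum
proof (rule trig_sum_finite[OF finite_int_box])
  fix \<mu> :: "int ^ 'a" assume "\<mu> \<notin> int_box (2 ^ (k + 1))"
  hence "scaled_symbol (if k = 0 then \<phi>\<^sub>0 else \<phi>) k \<mu> = 0"
    using resolution_smooth_bump[OF assms] by (intro scaled_symbol_support) auto
  hence "dyadic_block \<phi>\<^sub>0 \<phi> k (lattice_pt \<mu>) = 0"
    by (auto simp: scaled_symbol_def dyadic_block_def split: if_splits)
  thus "of_real (dyadic_block \<phi>\<^sub>0 \<phi> k (lattice_pt \<mu>)) * fourier_coeff T \<mu> = 0" by simp
qed

lemma frequency_piece_sum:
  assumes res: "resolution_of_unity \<phi>\<^sub>0 \<phi>"
    and "finite I" "\<And>f. f \<in> test_functions \<Longrightarrow> T f = (\<Sum>i\<in>I. a i * U i f)"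
  shows "frequency_piece \<phi>\<^sub>0 \<phi> k T x = (\<Sum>i\<in>I. of_real (a i) * frequency_piece \<phi>\<^sub>0 \<phi> k (U i) x)"
proof -
  have fc: "fourier_coeff T \<mu> = (\<Sum>i\<in>I. of_real (a i) * fourier_coeff (U i) \<mu>)" for \<mu>
    using assms(2,3) by (rule fourier_coeff_sum)
  show ?thesis
    unfolding frequency_piece_finite_sum[OF res] fc sum_distrib_left sum_distrib_right
    by (subst sum.swap) (simp add: mult_ac)
qed

text \<open>Each piece involves only finitely many Fourier coefficients, so convergence on test
  functions carries over at every point.\<close>

lemma frequency_piece_tendsto:
  assumes res: "resolution_of_unity \<phi>\<^sub>0 \<phi>" and lim: "\<And>f. f \<in> test_functions \<Longrightarrow> (\<lambda>n. T n f) \<longlonglongrightarrow> T' f"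
  shows "(\<lambda>n. frequency_piece \<phi>\<^sub>0 \<phi> k (T n) x) \<longlonglongrightarrow> frequency_piece \<phi>\<^sub>0 \<phi> k T' x"
proof -
  have "(\<lambda>n. fourier_coeff (T n) \<mu>) \<longlonglongrightarrow> fourier_coeff T' \<mu>" for \<mu>
    unfolding fourier_coeff_def
    by (intro tendsto_Complex tendsto_minus lim trig_test_functions)
  thus ?thesis unfolding frequency_piece_finite_sum[OF res] by (intro tendsto_intros)
qed

lemma borel_measurable_frequency_piece:
  assumes res: "resolution_of_unity \<phi>\<^sub>0 \<phi>"
  shows "frequency_piece \<phi>\<^sub>0 \<phi> k T \<in> borel_measurable borel"
  unfolding frequency_piece_finite_sum[OF res, abs_def] cis_conv_exp by measurable

lemma integrable_times_test_function:
  assumes "f \<in> test_functions" "bounded (range F)" "F \<in> borel_measurable borel"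
  shows "integrable torus (\<lambda>x. F x * (f x :: real))"
proof -
  obtain B where B: "\<And>x. \<bar>f x\<bar> \<le> B" using test_function_bounded[OF assms(1)] by blast
  obtain C where C: "\<And>x. \<bar>F x\<bar> \<le> C" using assms(2) by (auto simp: bounded_iff)
  have [measurable]: "f \<in> borel_measurable borel" "F \<in> borel_measurable borel"
    using test_function_continuous(2)[OF assms(1)] assms(3) by auto
  have "\<bar>F x * f x\<bar> \<le> C * B" for x
    using B[of x] C[of x] abs_ge_zero[of "F x"] unfolding abs_mult by (intro mult_mono) auto
  thus ?thesis by (intro integrable_torus[where B = "C * B"]) simp_all
qed

text \<open>The smoothness t is left out on purpose: the conclusion concerns all admissible
  smoothness functions with one limit. Any K serves at this point, where it yields decay and
  measurability of the wavelets; the K that matches a given t is obtained later.\<close>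

locale wavelet_series =
  fixes s q \<phi>\<^sub>0 \<phi> :: "real ^ 'n::finite \<Rightarrow> real"
    and \<psi>F \<psi>M :: "real \<Rightarrow> real"
    and \<delta> :: real
    and \<kappa> :: "(real ^ 'n) measure"
    and P :: "'w measure"
    and \<xi> :: "nat \<Rightarrow> ('n \<Rightarrow> gender) \<Rightarrow> ('n \<Rightarrow> nat) \<Rightarrow> 'w \<Rightarrow> real"
  assumes res: "resolution_of_unity \<phi>\<^sub>0 \<phi>" and s: "C_log_loc s" and q: "P_log q" and \<delta>: "0 < \<delta>"
    and wavelets: "\<exists>K. regular_wavelets K \<psi>F \<psi>M"
    and \<kappa>: "prob_space \<kappa>" "sets \<kappa> = sets torus"
    and P: "prob_space P" and iid: "iid_q_exponential P \<kappa> q \<xi>"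
begin

type_synonym 'm index = "nat \<times> ('m \<Rightarrow> gender) \<times> ('m \<Rightarrow> nat)"

definition block :: "nat \<Rightarrow> 'n index set" where
  "block j = {j} \<times> G_set j \<times> M_set j"

definition amp :: "'n index \<Rightarrow> real" where
  "amp = (\<lambda>(j, G, m). series_coeff \<delta> s q j m)"

definition wav :: "'n index \<Rightarrow> real ^ 'n \<Rightarrow> real" where
  "wav = (\<lambda>(j, G, m). periodic_wavelet \<psi>F \<psi>M j G m)"

definition noise :: "'n index \<Rightarrow> 'w \<Rightarrow> real" where
  "noise = (\<lambda>(j, G, m). \<xi> j G m)"

definition level :: "nat \<Rightarrow> 'w \<Rightarrow> (real ^ 'n \<Rightarrow> real) \<Rightarrow> real" where
  "level j \<omega> f = (\<Sum>i\<in>block j. amp i * noise i \<omega> * regular_distribution (wav i) f)"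

lemma finite_block [simp]: "finite (block j)"
  by (simp add: block_def)

lemma sum_block: "(\<Sum>i\<in>block j. h i) = (\<Sum>G\<in>G_set j. \<Sum>m\<in>M_set j. h (j, G, m))"
proof -
  have "block j = Pair j ` (G_set j \<times> M_set j)" by (auto simp: block_def)
  hence "(\<Sum>i\<in>block j. h i) = (\<Sum>p\<in>G_set j \<times> M_set j. h (j, p))" by (simp add: sum.reindex inj_on_def)
  also have "\<dots> = (\<Sum>G\<in>G_set j. \<Sum>m\<in>M_set j. h (j, G, m))" by (simp add: sum.cartesian_product case_prod_unfold)
  finally show ?thesis .
qed

lemma block_index: "i \<in> block j \<Longrightarrow> i \<in> series_index"
  by (auto simp: block_def series_index_def)

lemma amp_nonneg: "0 \<le> amp i"
  by (auto simp: amp_def series_coeff_def split: prod.splits)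

lemma wav_rapid: "rapid \<psi>F" "rapid \<psi>M"
proof -
  from wavelets obtain K f g where "deriv_chain K f" "f 0 = \<psi>F" "deriv_chain K g" "g 0 = \<psi>M"
    unfolding regular_wavelets_def by blast
  thus "rapid \<psi>F" "rapid \<psi>M" unfolding deriv_chain_def by auto
qed

lemma wav_measurable [measurable]: "wav i \<in> borel_measurable borel"
  and wav_bounded: "bounded (range (wav i))"
proof -
  obtain j G m where i: "i = (j, G, m)" by (cases i)
  have "rapid (case G r of Father \<Rightarrow> \<psi>F | Mother \<Rightarrow> \<psi>M)" for r using wav_rapid by (cases "G r") auto
  from rapid_tensor[of "\<lambda>r. case G r of Father \<Rightarrow> \<psi>F | Mother \<Rightarrow> \<psi>M", OF this, of j m]
  show "wav i \<in> borel_measurable borel" "bounded (range (wav i))"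
    by (auto simp: i wav_def periodic_wavelet_tensor bounded_iff)
qed

lemma wav_integrable: "f \<in> test_functions \<Longrightarrow> integrable torus (\<lambda>x. wav i x * f x)"
  by (intro integrable_times_test_function wav_bounded wav_measurable)

lemma noise_measurable [measurable]: "i \<in> block j \<Longrightarrow> noise i \<in> borel_measurable P"
  using iid block_index[of i j] unfolding iid_q_exponential_def distributed_def noise_def by fastforce

lemma noise_moment: "\<exists>M\<ge>0. \<forall>j. \<forall>i\<in>block j. (\<integral>\<^sup>+\<omega>. ennreal (1 + 2 * \<bar>noise i \<omega>\<bar> ^ k) \<partial>P) \<le> ennreal M"
proof -
  obtain M where M: "0 \<le> M" "\<And>X. distributed P lborel X (\<lambda>x. ennreal (q_exponential_density \<kappa> q x)) \<Longrightarrow>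
    (\<integral>\<^sup>+\<omega>. ennreal (1 + 2 * \<bar>X \<omega>\<bar> ^ k) \<partial>P) \<le> ennreal M"
    using q_exponential_moment[OF \<kappa> P_log_bounded(2,3)[OF q] borel_measurable_continuous_onI[OF P_log_bounded(1)[OF q]], of k] by blast
  have "distributed P lborel (noise i) (\<lambda>x. ennreal (q_exponential_density \<kappa> q x))" if "i \<in> block j" for i j
    using iid block_index[OF that] unfolding iid_q_exponential_def noise_def by fastforce
  thus ?thesis using M by blast
qed

lemma random_partial_series_level:
  assumes f: "f \<in> test_functions"
  shows "random_partial_series \<psi>F \<psi>M \<delta> s q \<xi> N \<omega> f = (\<Sum>j\<le>N. level j \<omega> f)"
proof -
  have "random_partial_series \<psi>F \<psi>M \<delta> s q \<xi> N \<omega> f = (\<integral>x. (\<Sum>j\<le>N. \<Sum>i\<in>block j. amp i * noise i \<omega> * (wav i x * f x)) \<partial>torus)"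
    unfolding random_partial_series_def regular_distribution_def partial_series_def sum_block
    by (simp add: amp_def noise_def wav_def sum_distrib_right mult.assoc)
  also have "\<dots> = (\<Sum>j\<le>N. level j \<omega> f)"
    unfolding level_def regular_distribution_def using wav_integrable[OF f]
    by (simp add: Bochner_Integration.integral_sum)
  finally show ?thesis .
qed

lemma level_linear:
  assumes "f \<in> test_functions" "g \<in> test_functions"
  shows "level j \<omega> (\<lambda>x. a * f x + b * g x) = a * level j \<omega> f + b * level j \<omega> g"
proof -
  have "regular_distribution (wav i) (\<lambda>x. a * f x + b * g x) = a * regular_distribution (wav i) f + b * regular_distribution (wav i) g" for i
  proof -
    have "regular_distribution (wav i) (\<lambda>x. a * f x + b * g x) = (\<integral>x. a * (wav i x * f x) + b * (wav i x * g x) \<partial>torus)"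
      unfolding regular_distribution_def by (intro Bochner_Integration.integral_cong) (auto simp: algebra_simps)
    thus ?thesis using wav_integrable assms by (simp add: regular_distribution_def)
  qed
  thus ?thesis by (simp add: level_def sum_distrib_left sum.distrib algebra_simps)
qed

lemma level_measurable [measurable]: "(\<lambda>\<omega>. level j \<omega> f) \<in> borel_measurable P"
  unfolding level_def by (intro borel_measurable_sum borel_measurable_times) (auto intro: noise_measurable)

text \<open>The deterministic coefficient of |noise| in the k-th term of the modular, before the
  power q(x) is taken.\<close>

definition scaled_amp :: "(real ^ 'n \<Rightarrow> real) \<Rightarrow> nat \<Rightarrow> 'n index \<Rightarrow> real ^ 'n \<Rightarrow> real" where
  "scaled_amp t k i x = 2 powr (real k * t x) * (amp i * cmod (frequency_piece \<phi>\<^sub>0 \<phi> k (regular_distribution (wav i)) x))"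

lemma scaled_amp_nonneg: "0 \<le> scaled_amp t k i x"
  using amp_nonneg by (simp add: scaled_amp_def)

definition block_rate :: "(real ^ 'n \<Rightarrow> real) \<Rightarrow> real \<Rightarrow> real \<Rightarrow> bool" where
  "block_rate t C \<eta> \<longleftrightarrow> 0 \<le> C \<and> 0 < \<eta> \<and>
     (\<forall>j k x. (\<Sum>i\<in>block j. scaled_amp t k i x) \<le> C * (2 powr - \<eta>) ^ j * (2 powr - \<eta>) ^ k)"

text \<open>\<epsilon> is subtracted and added so as to exhibit the function \<tau> of the
  deterministic estimate.\<close>

lemma amp_powr:
  "amp (j, G, m) = (1 / \<delta>) powr (1 / ess_sup q) *
     2 powr (- real j * (s (dyadic_pt j m) - (real CARD('n) / ess_sup q + \<epsilon>) + \<epsilon> + real CARD('n) / 2))"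
  by (simp add: amp_def series_coeff_def dyadic_pt_def algebra_simps)

lemma block_rate_exists:
  assumes reg: "regular_wavelets K \<psi>F \<psi>M" and \<eta>: "0 < \<eta>" "2 * \<eta> \<le> \<epsilon>"
    and t: "\<And>x. t x \<le> s x - (real CARD('n) / ess_sup q + \<epsilon>)"
    and bounds: "\<And>x. - real K \<le> s x - (real CARD('n) / ess_sup q + \<epsilon>)"
      "\<And>x. s x - (real CARD('n) / ess_sup q + \<epsilon>) \<le> real K - 2 * \<eta>"
  shows "\<exists>C. block_rate t C \<eta>"
proof -
  define \<tau> where "\<tau> x = s x - (real CARD('n) / ess_sup q + \<epsilon>)" for x
  define c where "c = (1 / \<delta>) powr (1 / ess_sup q)"
  have \<tau>: "C_log_loc \<tau>" unfolding \<tau>_def[abs_def] by (rule C_log_loc_diff_const[OF s])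
  obtain C where C: "0 \<le> C" "\<And>j k x. (\<Sum>G\<in>G_set j. \<Sum>m\<in>M_set j.
     2 powr (- real j * (\<tau> (dyadic_pt j m) + \<epsilon> + real CARD('n) / 2)) *
     cmod (frequency_piece \<phi>\<^sub>0 \<phi> k (regular_distribution (periodic_wavelet \<psi>F \<psi>M j G m)) x))
     \<le> C * (2 powr (- real k * \<tau> x) * 2 powr (- \<eta> * (real j + real k)))"
    using wavelet_series_estimate[OF reg res \<tau> bounds[folded \<tau>_def] \<eta>] by blast
  have "(\<Sum>i\<in>block j. scaled_amp t k i x) \<le> (c * C) * (2 powr - \<eta>) ^ j * (2 powr - \<eta>) ^ k" for j k x
  proof -
    let ?S = "\<Sum>G\<in>G_set j. \<Sum>m\<in>M_set j. 2 powr (- real j * (\<tau> (dyadic_pt j m) + \<epsilon> + real CARD('n) / 2)) *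
     cmod (frequency_piece \<phi>\<^sub>0 \<phi> k (regular_distribution (periodic_wavelet \<psi>F \<psi>M j G m)) x)"
    have S0: "0 \<le> ?S" by (intro sum_nonneg) auto
    have "(\<Sum>i\<in>block j. scaled_amp t k i x) = 2 powr (real k * t x) * (c * ?S)"
      unfolding sum_block scaled_amp_def amp_powr[where \<epsilon> = \<epsilon>] c_def[symmetric] wav_def \<tau>_def[symmetric]
      by (simp add: sum_distrib_left mult.assoc)
    also have "\<dots> \<le> 2 powr (real k * \<tau> x) * (c * ?S)"
    proof (intro mult_right_mono powr_mono mult_left_mono)
      show "t x \<le> \<tau> x" using t[of x] by (simp add: \<tau>_def)
    qed (use S0 in \<open>auto simp: c_def\<close>)
    also have "\<dots> \<le> 2 powr (real k * \<tau> x) * (c * (C * (2 powr (- real k * \<tau> x) * 2 powr (- \<eta> * (real j + real k)))))"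
      by (intro mult_left_mono C(2)) (auto simp: c_def)
    also have "\<dots> = c * C * (2 powr (real k * \<tau> x) * 2 powr (- real k * \<tau> x)) * 2 powr (- \<eta> * (real j + real k))"
      by (simp only: mult_ac)
    also have "2 powr (real k * \<tau> x) * 2 powr (- real k * \<tau> x) = 1" by (simp add: powr_add[symmetric])
    also have "2 powr (- \<eta> * (real j + real k)) = (2 powr - \<eta>) ^ j * (2 powr - \<eta>) ^ k"
      by (simp add: powr_realpow[symmetric] powr_powr powr_add[symmetric] algebra_simps)
    finally show ?thesis by (simp only: mult.assoc mult_1_right)
  qed
  thus ?thesis using C(1) \<eta>(1) by (intro exI[of _ "c * C"]) (auto simp: block_rate_def c_def)
qed

text \<open>With r = 2^(-\<eta>) and g = 1 / (1 - r), the first part C r^N g bounds the mass of the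
  weights from level N on, which must not exceed \<mu> for Jensen's inequality; the second part M C
  r^N g^2, divided by \<mu>, bounds the modular after summation over levels and frequencies.\<close>

definition tail_bound :: "real \<Rightarrow> real \<Rightarrow> real \<Rightarrow> nat \<Rightarrow> real" where
  "tail_bound C \<eta> M N = C * (2 powr - \<eta>) ^ N * (1 / (1 - 2 powr - \<eta>)) * (1 + M * (1 / (1 - 2 powr - \<eta>)))"

text \<open>One notion for partial sums, for their differences, for the limit and for its distance
  to a partial sum. The scalar c supplies the sign, and the limit along finite sets of levels admits
  infinite tails.\<close>

definition is_tail :: "nat \<Rightarrow> 'w \<Rightarrow> ((real ^ 'n \<Rightarrow> real) \<Rightarrow> real) \<Rightarrow> bool" where
  "is_tail N \<omega> T \<longleftrightarrow> (\<exists>J c. (\<forall>n. finite (J n) \<and> J n \<subseteq> {N..}) \<and> \<bar>c\<bar> \<le> 1 \<and>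
     (\<forall>f\<in>test_functions. (\<lambda>n. c * (\<Sum>j\<in>J n. level j \<omega> f)) \<longlonglongrightarrow> T f))"

lemma geometric_rate:
  assumes "0 < \<eta>"
  shows "0 \<le> (2 :: real) powr - \<eta>" "2 powr - \<eta> < (1 :: real)" "summable (\<lambda>j. (2 powr - \<eta>) ^ j :: real)"
    "(\<Sum>j. (2 powr - \<eta>) ^ j) = 1 / (1 - (2 :: real) powr - \<eta>)"
proof -
  show 1: "0 \<le> (2 :: real) powr - \<eta>" "2 powr - \<eta> < (1 :: real)"
    using assms powr_less_mono[of "- \<eta>" 0 "2 :: real"] by simp_all
  thus "summable (\<lambda>j. (2 powr - \<eta>) ^ j :: real)" "(\<Sum>j. (2 powr - \<eta>) ^ j) = 1 / (1 - (2 :: real) powr - \<eta>)"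
    by (simp_all add: suminf_geometric)
qed

text \<open>Jensen's inequality is applied to the finite sums, with a right-hand side that is the
  same for all n, and survives the limit because only finitely many Fourier coefficients
  enter.\<close>

lemma tail_pointwise:
  assumes rate: "block_rate t C \<eta>" and Q: "even Q" "\<And>x. q x \<le> real Q" and \<mu>: "0 < \<mu>"
    and small: "C * (2 powr - \<eta>) ^ N * (1 / (1 - 2 powr - \<eta>)) \<le> \<mu>" and tail: "is_tail N \<omega> T"
  shows "ennreal (2 powr (real k * t x * q x) * cmod (frequency_piece \<phi>\<^sub>0 \<phi> k (\<lambda>f. T f / \<mu>) x) powr q x) \<le>
    (\<Sum>j. \<Sum>i\<in>block (N + j). ennreal (scaled_amp t k i x / \<mu>) * ennreal (1 + 2 * \<bar>noise i \<omega>\<bar> ^ Q))"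
proof -
  let ?r = "2 powr - \<eta> :: real"
  have C: "0 \<le> C" and \<eta>: "0 < \<eta>"
    and blk: "\<And>j k x. (\<Sum>i\<in>block j. scaled_amp t k i x) \<le> C * ?r ^ j * ?r ^ k"
    using rate by (auto simp: block_rate_def)
  note geo = geometric_rate[OF \<eta>]
  from tail obtain J c where J: "\<And>n. finite (J n)" "\<And>n. J n \<subseteq> {N..}" and c: "\<bar>c\<bar> \<le> 1"
    and lim: "\<And>f. f \<in> test_functions \<Longrightarrow> (\<lambda>n. c * (\<Sum>j\<in>J n. level j \<omega> f)) \<longlonglongrightarrow> T f"
    unfolding is_tail_def by blast
  define I where "I n = (\<Union>j\<in>J n. block j)" for n
  have I: "finite (I n)" for n using J(1) by (simp add: I_def)
  have disj: "j \<noteq> j' \<Longrightarrow> block j \<inter> block j' = {}" for j j' by (auto simp: block_def)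
  have sum_I: "(\<Sum>i\<in>I n. h i) = (\<Sum>j\<in>J n. \<Sum>i\<in>block j. h i)" for n and h :: "'n index \<Rightarrow> real"
    unfolding I_def by (rule sum.UNION_disjoint) (use J(1) disj in auto)
  define T' where "T' n f = (c / \<mu>) * (\<Sum>j\<in>J n. level j \<omega> f)" for n f
  have T'_lim: "(\<lambda>n. T' n f) \<longlonglongrightarrow> T f / \<mu>" if "f \<in> test_functions" for f
    using tendsto_divide[OF lim[OF that] tendsto_const[of \<mu>]] \<mu> by (simp add: T'_def)
  have T'_sum: "T' n f = (\<Sum>i\<in>I n. (c / \<mu> * amp i * noise i \<omega>) * regular_distribution (wav i) f)" for n f
    unfolding T'_def level_def sum_I sum_distrib_left by (simp add: mult.assoc)
  define v where "v n = 2 powr (real k * t x) * cmod (frequency_piece \<phi>\<^sub>0 \<phi> k (T' n) x)" for n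
  define w where "w i = scaled_amp t k i x / \<mu>" for i
  have w0: "0 \<le> w i" for i using scaled_amp_nonneg \<mu> by (simp add: w_def)
  have v_le: "v n \<le> (\<Sum>i\<in>I n. w i * \<bar>noise i \<omega>\<bar>)" for n
  proof -
    have "cmod (frequency_piece \<phi>\<^sub>0 \<phi> k (T' n) x) = cmod (\<Sum>i\<in>I n. of_real (c / \<mu> * amp i * noise i \<omega>) *
        frequency_piece \<phi>\<^sub>0 \<phi> k (regular_distribution (wav i)) x)"
      by (subst frequency_piece_sum[OF res I T'_sum]) simp
    also have "\<dots> \<le> (\<Sum>i\<in>I n. 1 / \<mu> * amp i * \<bar>noise i \<omega>\<bar> * cmod (frequency_piece \<phi>\<^sub>0 \<phi> k (regular_distribution (wav i)) x))"
    proof (rule sum_norm_le)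
      fix i
      have "\<bar>c / \<mu> * amp i * noise i \<omega>\<bar> \<le> 1 / \<mu> * amp i * \<bar>noise i \<omega>\<bar>"
      proof -
        have "\<bar>c\<bar> * (1 / \<mu> * amp i * \<bar>noise i \<omega>\<bar>) \<le> 1 * (1 / \<mu> * amp i * \<bar>noise i \<omega>\<bar>)"
          using c \<mu> amp_nonneg[of i] by (intro mult_right_mono) auto
        thus ?thesis using \<mu> amp_nonneg[of i] by (simp add: abs_mult abs_divide)
      qed
      thus "cmod (of_real (c / \<mu> * amp i * noise i \<omega>) * frequency_piece \<phi>\<^sub>0 \<phi> k (regular_distribution (wav i)) x) \<le>
         1 / \<mu> * amp i * \<bar>noise i \<omega>\<bar> * cmod (frequency_piece \<phi>\<^sub>0 \<phi> k (regular_distribution (wav i)) x)"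
        unfolding norm_mult norm_of_real by (intro mult_right_mono) auto
    qed
    finally have "v n \<le> 2 powr (real k * t x) * (\<Sum>i\<in>I n. 1 / \<mu> * amp i * \<bar>noise i \<omega>\<bar> * cmod (frequency_piece \<phi>\<^sub>0 \<phi> k (regular_distribution (wav i)) x))"
      unfolding v_def by (intro mult_left_mono) auto
    also have "\<dots> = (\<Sum>i\<in>I n. w i * \<bar>noise i \<omega>\<bar>)"
      unfolding sum_distrib_left by (intro sum.cong) (auto simp: w_def scaled_amp_def)
    finally show ?thesis .
  qed
  have w_sum: "(\<Sum>i\<in>I n. w i) \<le> 1" for n
  proof -
    have "(\<Sum>i\<in>I n. w i) = (\<Sum>j\<in>J n. \<Sum>i\<in>block j. scaled_amp t k i x) / \<mu>"
      unfolding sum_I w_def by (simp add: sum_divide_distrib)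
    also have "\<dots> \<le> (\<Sum>j\<in>J n. C * ?r ^ j) / \<mu>"
    proof (intro divide_right_mono sum_mono)
      fix j
      have "(\<Sum>i\<in>block j. scaled_amp t k i x) \<le> C * ?r ^ j * ?r ^ k" by (rule blk)
      \<comment> \<open>For Jensen's inequality only the mass at a fixed frequency matters; the
        factor in k acts later, when the modular is summed over k.\<close>
      also have "\<dots> \<le> C * ?r ^ j * 1" using C geo(1,2) by (intro mult_left_mono power_le_one) auto
      finally show "(\<Sum>i\<in>block j. scaled_amp t k i x) \<le> C * ?r ^ j" by simp
    qed (use \<mu> in auto)
    also have "(\<Sum>j\<in>J n. C * ?r ^ j) = C * ?r ^ N * (\<Sum>j\<in>J n. ?r ^ (j - N))"
      unfolding sum_distrib_left using J(2)[of n] by (intro sum.cong) (auto simp: power_add[symmetric] mult.assoc)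
    also have "(\<Sum>j\<in>J n. ?r ^ (j - N)) = (\<Sum>j\<in>(\<lambda>j. j - N) ` J n. ?r ^ j)"
      using J(2)[of n] by (subst sum.reindex) (auto simp: inj_on_def subset_iff eq_diff_iff)
    also have "\<dots> \<le> (\<Sum>j. ?r ^ j)" using J(1)[of n] geo(1,3) by (intro sum_le_suminf) auto
    finally have "(\<Sum>i\<in>I n. w i) \<le> C * ?r ^ N * (1 / (1 - ?r)) / \<mu>"
      using C geo \<mu> by (auto simp: divide_right_mono mult_left_mono)
    also have "\<dots> \<le> 1" by (subst divide_le_eq_1_pos[OF \<mu>]) (rule small)
    finally show ?thesis .
  qed
  have Q0: "0 < Q" using order_trans[OF P_log_bounded(2)[OF q, of 0] Q(2)[of 0]] by simp
  let ?R = "\<Sum>j. \<Sum>i\<in>block (N + j). ennreal (w i) * ennreal (1 + 2 * \<bar>noise i \<omega>\<bar> ^ Q)"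
  have step: "ennreal (v n powr q x) \<le> ?R" for n
  proof -
    have "v n powr q x \<le> (\<Sum>i\<in>I n. w i * (1 + 2 * \<bar>noise i \<omega>\<bar> ^ Q))"
      by (rule weighted_powr_mean[OF I]) (use w0 w_sum Q Q0 v_le P_log_bounded(2)[OF q] in \<open>auto simp: v_def\<close>)
    hence "ennreal (v n powr q x) \<le> ennreal (\<Sum>j\<in>J n. \<Sum>i\<in>block j. w i * (1 + 2 * \<bar>noise i \<omega>\<bar> ^ Q))"
      unfolding sum_I by (rule ennreal_leI)
    also have "\<dots> = (\<Sum>j\<in>J n. \<Sum>i\<in>block j. ennreal (w i) * ennreal (1 + 2 * \<bar>noise i \<omega>\<bar> ^ Q))"
      using w0 by (simp add: sum_ennreal[symmetric] sum_nonneg ennreal_mult)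
    also have "\<dots> = (\<Sum>j\<in>(\<lambda>j. j - N) ` J n. \<Sum>i\<in>block (N + j). ennreal (w i) * ennreal (1 + 2 * \<bar>noise i \<omega>\<bar> ^ Q))"
      using J(2)[of n] by (subst sum.reindex) (auto simp: inj_on_def subset_iff eq_diff_iff intro!: sum.cong)
    also have "\<dots> \<le> ?R" using J(1)[of n] by (intro sum_le_suminf) auto
    finally show ?thesis .
  qed
  have "(\<lambda>n. v n) \<longlonglongrightarrow> 2 powr (real k * t x) * cmod (frequency_piece \<phi>\<^sub>0 \<phi> k (\<lambda>f. T f / \<mu>) x)"
    unfolding v_def by (intro tendsto_intros frequency_piece_tendsto[OF res] T'_lim)
  hence "(\<lambda>n. v n powr q x) \<longlonglongrightarrow> (2 powr (real k * t x) * cmod (frequency_piece \<phi>\<^sub>0 \<phi> k (\<lambda>f. T f / \<mu>) x)) powr q x"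
    using P_log_bounded(2)[OF q, of x] by (intro tendsto_powr') (auto simp: v_def)
  hence "(\<lambda>n. ennreal (v n powr q x)) \<longlonglongrightarrow> ennreal ((2 powr (real k * t x) * cmod (frequency_piece \<phi>\<^sub>0 \<phi> k (\<lambda>f. T f / \<mu>) x)) powr q x)"
    by (rule tendsto_ennrealI)
  hence "ennreal ((2 powr (real k * t x) * cmod (frequency_piece \<phi>\<^sub>0 \<phi> k (\<lambda>f. T f / \<mu>) x)) powr q x) \<le> ?R"
    by (rule LIMSEQ_le_const2) (use step in auto)
  thus ?thesis by (simp add: powr_mult powr_powr w_def)
qed

end

context wavelet_series
begin

lemma borel_measurable_scaled_amp:
  assumes [measurable]: "t \<in> borel_measurable borel"
  shows "scaled_amp t k i \<in> borel_measurable borel"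
proof -
  have [measurable]: "frequency_piece \<phi>\<^sub>0 \<phi> k (regular_distribution (wav i)) \<in> borel_measurable borel"
    by (rule borel_measurable_frequency_piece[OF res])
  show ?thesis unfolding scaled_amp_def[abs_def] by measurable
qed

text \<open>In the pointwise majorant the weights depend on x and the noise on \<omega> only, so by
  Tonelli the modular is at most M / \<mu> times a double geometric series in level and
  frequency.\<close>

lemma tail_modular:
  assumes rate: "block_rate t C \<eta>" and t: "t \<in> borel_measurable borel"
    and Q: "even Q" "\<And>x. q x \<le> real Q"
    and M: "0 \<le> M" "\<And>j i. i \<in> block j \<Longrightarrow> (\<integral>\<^sup>+\<omega>. ennreal (1 + 2 * \<bar>noise i \<omega>\<bar> ^ Q) \<partial>P) \<le> ennreal M"
    and \<mu>: "0 < \<mu>" and small: "tail_bound C \<eta> M N \<le> \<mu>" and tail: "AE \<omega> in P. is_tail N \<omega> (T \<omega>)"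
  shows "besov_modular \<phi>\<^sub>0 \<phi> P t q (\<lambda>\<omega> f. T \<omega> f / \<mu>) \<le> 1"
proof -
  let ?r = "2 powr - \<eta> :: real"
  let ?Z = "\<lambda>i \<omega>. ennreal (1 + 2 * \<bar>noise i \<omega>\<bar> ^ Q)"
  define g where "g = 1 / (1 - ?r)"
  have C: "0 \<le> C" and \<eta>: "0 < \<eta>"
    and blk: "\<And>j k x. (\<Sum>i\<in>block j. scaled_amp t k i x) \<le> C * ?r ^ j * ?r ^ k"
    using rate by (auto simp: block_rate_def)
  note geo = geometric_rate[OF \<eta>]
  have g0: "0 \<le> g" using geo by (simp add: g_def)
  have split: "C * ?r ^ N * g + M * (C * ?r ^ N * g * g) \<le> \<mu>"
  proof -
    have "tail_bound C \<eta> M N = C * ?r ^ N * g * (1 + M * g)" by (simp only: tail_bound_def g_def)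
    thus ?thesis using small by (simp add: algebra_simps)
  qed
  have nn: "0 \<le> C * ?r ^ N * g" "0 \<le> M * (C * ?r ^ N * g * g)" using C g0 M(1) geo by auto
  have small': "C * ?r ^ N * (1 / (1 - ?r)) \<le> \<mu>" using split nn unfolding g_def by linarith
  have [measurable]: "scaled_amp t k i \<in> borel_measurable borel" for k i by (rule borel_measurable_scaled_amp[OF t])
  have [measurable]: "(\<lambda>x. ennreal (scaled_amp t k i x / \<mu>)) \<in> borel_measurable torus" for k i
    by (intro borel_measurable_torus) measurable
  have mZ: "?Z i \<in> borel_measurable P" if "i \<in> block j" for i j
    using noise_measurable[OF that] by measurable
  let ?R = "\<lambda>\<omega> x. \<Sum>k. \<Sum>j. \<Sum>i\<in>block (N + j). ennreal (scaled_amp t k i x / \<mu>) * ?Z i \<omega>"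
  let ?A = "\<lambda>k i. \<integral>\<^sup>+x. ennreal (scaled_amp t k i x / \<mu>) \<partial>torus"
  have "besov_modular \<phi>\<^sub>0 \<phi> P t q (\<lambda>\<omega> f. T \<omega> f / \<mu>) \<le> (\<integral>\<^sup>+\<omega>. \<integral>\<^sup>+x. ?R \<omega> x \<partial>torus \<partial>P)"
    unfolding besov_modular_def
  proof (rule nn_integral_mono_AE, use tail in eventually_elim)
    case (elim \<omega>)
    show ?case
      by (intro nn_integral_mono suminf_le tail_pointwise[OF rate Q \<mu> small' elim]) auto
  qed
  also have "\<dots> = (\<integral>\<^sup>+\<omega>. (\<Sum>k. \<Sum>j. \<Sum>i\<in>block (N + j). ?A k i * ?Z i \<omega>) \<partial>P)"
  proof (rule nn_integral_cong)
    fix \<omega>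
    show "(\<integral>\<^sup>+x. ?R \<omega> x \<partial>torus) = (\<Sum>k. \<Sum>j. \<Sum>i\<in>block (N + j). ?A k i * ?Z i \<omega>)"
      by (simp add: nn_integral_suminf nn_integral_sum nn_integral_multc)
  qed
  also have "\<dots> = (\<Sum>k. \<Sum>j. \<Sum>i\<in>block (N + j). ?A k i * (\<integral>\<^sup>+\<omega>. ?Z i \<omega> \<partial>P))"
  proof -
    have m: "(\<lambda>\<omega>. \<Sum>i\<in>block (N + j). ?A k i * ?Z i \<omega>) \<in> borel_measurable P" for k j
      by (intro borel_measurable_sum borel_measurable_times mZ) auto
    have "(\<integral>\<^sup>+\<omega>. (\<Sum>k. \<Sum>j. \<Sum>i\<in>block (N + j). ?A k i * ?Z i \<omega>) \<partial>P) =
      (\<Sum>k. \<Sum>j. \<integral>\<^sup>+\<omega>. (\<Sum>i\<in>block (N + j). ?A k i * ?Z i \<omega>) \<partial>P)"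
      using m by (simp add: nn_integral_suminf)
    also have "\<dots> = (\<Sum>k. \<Sum>j. \<Sum>i\<in>block (N + j). ?A k i * (\<integral>\<^sup>+\<omega>. ?Z i \<omega> \<partial>P))"
    proof (intro arg_cong[where f = suminf] ext)
      fix k j
      have "(\<integral>\<^sup>+\<omega>. (\<Sum>i\<in>block (N + j). ?A k i * ?Z i \<omega>) \<partial>P) = (\<Sum>i\<in>block (N + j). \<integral>\<^sup>+\<omega>. ?A k i * ?Z i \<omega> \<partial>P)"
        by (intro nn_integral_sum borel_measurable_times mZ) auto
      also have "\<dots> = (\<Sum>i\<in>block (N + j). ?A k i * (\<integral>\<^sup>+\<omega>. ?Z i \<omega> \<partial>P))"
        by (intro sum.cong refl nn_integral_cmult mZ)
      finally show "(\<integral>\<^sup>+\<omega>. (\<Sum>i\<in>block (N + j). ?A k i * ?Z i \<omega>) \<partial>P) = \<dots>" .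
    qed
    finally show ?thesis .
  qed
  also have "\<dots> \<le> (\<Sum>k. \<Sum>j. ennreal (M / \<mu> * C * ?r ^ N * (?r ^ j * ?r ^ k)))"
  proof (intro suminf_le)
    fix k j
    have "(\<Sum>i\<in>block (N + j). ?A k i * (\<integral>\<^sup>+\<omega>. ?Z i \<omega> \<partial>P)) \<le> (\<Sum>i\<in>block (N + j). ?A k i * ennreal M)"
      by (intro sum_mono mult_left_mono M(2)) auto
    also have "\<dots> = (\<integral>\<^sup>+x. (\<Sum>i\<in>block (N + j). ennreal (scaled_amp t k i x / \<mu>)) \<partial>torus) * ennreal M"
      by (subst nn_integral_sum) (auto simp: sum_distrib_right)
    also have "\<dots> \<le> (\<integral>\<^sup>+x. ennreal (C * ?r ^ (N + j) * ?r ^ k / \<mu>) \<partial>(torus :: (real ^ 'n) measure)) * ennreal M"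
    proof (intro mult_right_mono nn_integral_mono)
      fix x
      have "(\<Sum>i\<in>block (N + j). ennreal (scaled_amp t k i x / \<mu>)) = ennreal ((\<Sum>i\<in>block (N + j). scaled_amp t k i x) / \<mu>)"
        using \<mu> scaled_amp_nonneg by (simp add: sum_divide_distrib)
      also have "\<dots> \<le> ennreal (C * ?r ^ (N + j) * ?r ^ k / \<mu>)" using \<mu> blk by (intro ennreal_leI divide_right_mono) auto
      finally show "(\<Sum>i\<in>block (N + j). ennreal (scaled_amp t k i x / \<mu>)) \<le> \<dots>" .
    qed auto
    also have "\<dots> = ennreal (C * ?r ^ (N + j) * ?r ^ k / \<mu>) * ennreal M" by (simp add: emeasure_torus)
    also have "\<dots> = ennreal (M / \<mu> * C * ?r ^ N * (?r ^ j * ?r ^ k))"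
      using M(1) C \<mu> geo(1) by (simp add: ennreal_mult[symmetric] power_add mult_ac)
    finally show "(\<Sum>i\<in>block (N + j). ?A k i * (\<integral>\<^sup>+\<omega>. ?Z i \<omega> \<partial>P)) \<le> \<dots>" .
  qed auto
  also have "\<dots> = ennreal (M / \<mu> * C * ?r ^ N * (g * g))"
  proof -
    let ?c = "M / \<mu> * C * ?r ^ N"
    have c0: "0 \<le> ?c" using M(1) \<mu> C geo(1) by auto
    have "(\<Sum>j. ennreal (?c * (?r ^ j * ?r ^ k))) = ennreal (?c * (g * ?r ^ k))" for k
    proof -
      have "(\<lambda>j. ?r ^ j) sums g" using geo(3,4) unfolding g_def by (simp add: sums_iff)
      hence "(\<lambda>j. ?c * (?r ^ j * ?r ^ k)) sums (?c * (g * ?r ^ k))" by (intro sums_mult sums_mult2)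
      thus ?thesis by (intro suminf_ennreal_eq mult_nonneg_nonneg[OF c0]) simp_all
    qed
    moreover have "(\<Sum>k. ennreal (?c * (g * ?r ^ k))) = ennreal (?c * (g * g))"
    proof -
      have "(\<lambda>j. ?r ^ j) sums g" using geo(3,4) unfolding g_def by (simp add: sums_iff)
      hence "(\<lambda>k. ?c * (g * ?r ^ k)) sums (?c * (g * g))" by (intro sums_mult)
      thus ?thesis using g0 by (intro suminf_ennreal_eq mult_nonneg_nonneg[OF c0]) simp_all
    qed
    ultimately show ?thesis by simp
  qed
  also have "\<dots> = ennreal (M * (C * ?r ^ N * g * g) / \<mu>)" by (simp add: mult_ac)
  also have "\<dots> \<le> ennreal 1" using split nn
    by (intro ennreal_leI, subst divide_le_eq_1_pos[OF \<mu>]) linarith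
  finally show ?thesis by simp
qed

lemma besov_norm_le:
  assumes "0 < \<mu>" "besov_modular \<phi>\<^sub>0 \<phi> P t q (\<lambda>\<omega> f. T \<omega> f / \<mu>) \<le> 1"
  shows "besov_norm \<phi>\<^sub>0 \<phi> P t q T \<le> ennreal \<mu>"
  unfolding besov_norm_def by (rule INF_lower) (use assms in simp)

lemma tail_bound_tendsto: 
  assumes "0 < \<eta>"
  shows "(\<lambda>N. tail_bound C \<eta> M N) \<longlonglongrightarrow> 0"
proof -
  have "(\<lambda>N. (2 powr - \<eta>) ^ N :: real) \<longlonglongrightarrow> 0"
    using geometric_rate[OF assms] by (intro LIMSEQ_power_zero) simp
  from tendsto_mult_left_zero[OF tendsto_mult_right_zero[OF this, of C], of "1 / (1 - 2 powr - \<eta>) * (1 + M * (1 / (1 - 2 powr - \<eta>)))"]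
  show ?thesis unfolding tail_bound_def by (simp only: mult.assoc)
qed

definition parameters :: "(real ^ 'n \<Rightarrow> real) \<Rightarrow> real \<Rightarrow> real \<Rightarrow> real \<Rightarrow> nat \<Rightarrow> bool" where
  "parameters t C \<eta> M Q \<longleftrightarrow> block_rate t C \<eta> \<and> t \<in> borel_measurable borel \<and> even Q \<and> (\<forall>x. q x \<le> real Q) \<and>
     0 \<le> M \<and> (\<forall>j. \<forall>i\<in>block j. (\<integral>\<^sup>+\<omega>. ennreal (1 + 2 * \<bar>noise i \<omega>\<bar> ^ Q) \<partial>P) \<le> ennreal M)"

lemma parameters_exist:
  assumes t: "admissible_smoothness s q t" and w: "admissible_wavelets {s, t} \<psi>F \<psi>M"
  shows "\<exists>C \<eta> M Q. parameters t C \<eta> M Q"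
proof -
  obtain K \<eta> \<epsilon> where par: "regular_wavelets K \<psi>F \<psi>M" "0 < \<eta>" "2 * \<eta> \<le> \<epsilon>"
    "\<And>x. t x \<le> s x - (real CARD('n) / ess_sup q + \<epsilon>)"
    "\<And>x. - real K \<le> s x - (real CARD('n) / ess_sup q + \<epsilon>)"
    "\<And>x. s x - (real CARD('n) / ess_sup q + \<epsilon>) \<le> real K - 2 * \<eta>"
    using smoothness_parameters[OF s q t w] by blast
  obtain C where C: "block_rate t C \<eta>" using block_rate_exists[OF par] by blast
  have tm: "t \<in> borel_measurable borel"
    using t by (intro borel_measurable_continuous_onI C_log_loc_continuous) (simp add: admissible_smoothness_def)
  \<comment> \<open>The power used is 2 n: even, as convexity demands, and above q.\<close>
  obtain n :: nat where n: "ess_sup q < real n" using reals_Archimedean2 by blast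
  have Q: "q x \<le> real (2 * n)" for x using P_log_bounded(3)[OF q, of x] n by simp
  obtain M where "0 \<le> M" "\<forall>j. \<forall>i\<in>block j. (\<integral>\<^sup>+\<omega>. ennreal (1 + 2 * \<bar>noise i \<omega>\<bar> ^ (2 * n)) \<partial>P) \<le> ennreal M"
    using noise_moment[of "2 * n"] by blast
  hence "parameters t C \<eta> M (2 * n)" using C tm Q unfolding parameters_def by auto
  thus ?thesis by blast
qed

lemma tail_modular':
  assumes "parameters t C \<eta> M Q" "0 < \<mu>" "tail_bound C \<eta> M N \<le> \<mu>" "AE \<omega> in P. is_tail N \<omega> (T \<omega>)"
  shows "besov_modular \<phi>\<^sub>0 \<phi> P t q (\<lambda>\<omega> f. T \<omega> f / \<mu>) \<le> 1"
  using assms tail_modular[of t C \<eta> Q M \<mu> N T] unfolding parameters_def by blast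

lemma tail_besov_space:
  assumes "parameters t C \<eta> M Q" "T \<in> random_distributions P" "AE \<omega> in P. is_tail 0 \<omega> (T \<omega>)"
  shows "T \<in> besov_space \<phi>\<^sub>0 \<phi> P t q"
proof -
  define \<mu> where "\<mu> = max 1 (tail_bound C \<eta> M 0)"
  have "besov_modular \<phi>\<^sub>0 \<phi> P t q (\<lambda>\<omega> f. T \<omega> f / \<mu>) \<le> 1"
    by (rule tail_modular'[OF assms(1) _ _ assms(3)]) (auto simp: \<mu>_def)
  moreover have "(\<lambda>\<omega> f. T \<omega> f / \<mu>) = (\<lambda>\<omega> f. 1 / \<mu> * T \<omega> f)" by (simp add: fun_eq_iff)
  ultimately have "besov_modular \<phi>\<^sub>0 \<phi> P t q (\<lambda>\<omega> f. 1 / \<mu> * T \<omega> f) < \<infinity>"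
    by (metis ennreal_one_less_top infinity_ennreal_def le_less_trans)
  moreover have "0 < 1 / \<mu>" by (simp add: \<mu>_def)
  ultimately show ?thesis using assms(2) unfolding besov_space_def by blast
qed

text \<open>Uniform in T, so that one threshold serves for all pairs of partial sums.\<close>

lemma tail_norm_eventually:
  assumes par: "parameters t C \<eta> M Q" and "0 < e"
  shows "\<exists>K. \<forall>N\<ge>K. \<forall>T. (AE \<omega> in P. is_tail N \<omega> (T \<omega>)) \<longrightarrow> besov_norm \<phi>\<^sub>0 \<phi> P t q T \<le> ennreal e"
proof -
  have rate: "block_rate t C \<eta>" and M: "0 \<le> M" using par by (auto simp: parameters_def)
  have "eventually (\<lambda>N. tail_bound C \<eta> M N < e) sequentially"
    using tail_bound_tendsto[of \<eta> C M] rate \<open>0 < e\<close> by (intro order_tendstoD) (auto simp: block_rate_def)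
  then obtain K where K: "\<And>N. N \<ge> K \<Longrightarrow> tail_bound C \<eta> M N < e" by (auto simp: eventually_sequentially)
  have "besov_norm \<phi>\<^sub>0 \<phi> P t q T \<le> ennreal e" if "K \<le> N" "AE \<omega> in P. is_tail N \<omega> (T \<omega>)" for N T
    by (rule besov_norm_le[OF \<open>0 < e\<close> tail_modular'[OF par \<open>0 < e\<close> less_imp_le[OF K[OF that(1)]] that(2)]])
  thus ?thesis by blast
qed

section \<open>Partial sums and their pathwise limit\<close>

abbreviation (input) partial_sum :: "nat \<Rightarrow> 'w \<Rightarrow> (real ^ 'n \<Rightarrow> real) \<Rightarrow> real" where
  "partial_sum \<equiv> random_partial_series \<psi>F \<psi>M \<delta> s q \<xi>"

text \<open>For fixed \<omega> a level is a bounded function and hence a distribution of order 0;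
  the constant may grow with the level, which is enough for finite partial sums.\<close>

lemma level_bound:
  "\<exists>B\<ge>0. \<forall>f\<in>test_functions. \<bar>level j \<omega> f\<bar> \<le> B * test_seminorm 0 f"
proof -
  have "\<exists>B\<ge>0. \<forall>f\<in>test_functions. \<bar>regular_distribution (wav i) f\<bar> \<le> B * test_seminorm 0 f" for i
  proof -
    obtain B where B: "\<And>x. \<bar>wav i x\<bar> \<le> B" using wav_bounded[of i] by (auto simp: bounded_iff)
    have "0 \<le> B" using B[of 0] by simp
    have "\<bar>regular_distribution (wav i) f\<bar> \<le> B * test_seminorm 0 f" if f: "f \<in> test_functions" for f
    proof -
      have fb: "\<bar>f x\<bar> \<le> test_seminorm 0 f" for x
        using test_seminorm_bound[OF f, of "[]" 0 x] by (simp add: partial_diffs_def)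
      have "\<bar>regular_distribution (wav i) f\<bar> \<le> (\<integral>x. \<bar>wav i x * f x\<bar> \<partial>torus)"
        unfolding regular_distribution_def by (rule integral_abs_bound)
      also have "\<dots> \<le> (\<integral>x. B * test_seminorm 0 f \<partial>(torus :: (real ^ 'n) measure))"
      proof (rule integral_mono)
        show "integrable torus (\<lambda>x. \<bar>wav i x * f x\<bar>)" using wav_integrable[OF f] by (rule integrable_abs)
        show "integrable torus (\<lambda>_ :: real ^ 'n. B * test_seminorm 0 f)" by (rule integrable_torus) auto
        show "\<bar>wav i x * f x\<bar> \<le> B * test_seminorm 0 f" for x
          using B[of x] fb[of x] \<open>0 \<le> B\<close> unfolding abs_mult by (intro mult_mono) auto
      qed
      also have "\<dots> = B * test_seminorm 0 f" by (simp add: measure_def emeasure_torus)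
      finally show ?thesis .
    qed
    with \<open>0 \<le> B\<close> show ?thesis by blast
  qed
  then obtain B where B: "\<And>i. 0 \<le> B i" "\<And>i f. f \<in> test_functions \<Longrightarrow> \<bar>regular_distribution (wav i) f\<bar> \<le> B i * test_seminorm 0 f"
    by metis
  have "\<bar>level j \<omega> f\<bar> \<le> (\<Sum>i\<in>block j. \<bar>amp i * noise i \<omega>\<bar> * B i) * test_seminorm 0 f" if "f \<in> test_functions" for f
  proof -
    have "\<bar>level j \<omega> f\<bar> \<le> (\<Sum>i\<in>block j. \<bar>amp i * noise i \<omega>\<bar> * \<bar>regular_distribution (wav i) f\<bar>)"
      unfolding level_def by (rule order_trans[OF sum_abs]) (simp add: abs_mult)
    also have "\<dots> \<le> (\<Sum>i\<in>block j. \<bar>amp i * noise i \<omega>\<bar> * (B i * test_seminorm 0 f))"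
      by (intro sum_mono mult_left_mono B that) auto
    finally show ?thesis by (simp add: sum_distrib_right mult.assoc)
  qed
  thus ?thesis using B(1) by (intro exI[of _ "\<Sum>i\<in>block j. \<bar>amp i * noise i \<omega>\<bar> * B i"]) (auto intro!: sum_nonneg)
qed

lemma random_partial_series_linear:
  assumes "f \<in> test_functions" "g \<in> test_functions"
  shows "random_partial_series \<psi>F \<psi>M \<delta> s q \<xi> N \<omega> (\<lambda>x. a * f x + b * g x) =
    a * random_partial_series \<psi>F \<psi>M \<delta> s q \<xi> N \<omega> f + b * random_partial_series \<psi>F \<psi>M \<delta> s q \<xi> N \<omega> g"
proof -
  let ?U = "partial_series \<psi>F \<psi>M \<delta> s q \<xi> N \<omega>"
  have U: "?U = (\<lambda>x. \<Sum>j\<le>N. \<Sum>i\<in>block j. amp i * noise i \<omega> * wav i x)"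
    by (simp add: fun_eq_iff partial_series_def sum_block amp_def noise_def wav_def)
  have int: "integrable torus (\<lambda>x. ?U x * f x)" if f: "f \<in> test_functions" for f
  proof -
    have "integrable torus (\<lambda>x. \<Sum>j\<le>N. \<Sum>i\<in>block j. amp i * noise i \<omega> * (wav i x * f x))"
      using wav_integrable[OF f] by simp
    thus ?thesis unfolding U by (simp add: sum_distrib_right mult.assoc)
  qed
  have "random_partial_series \<psi>F \<psi>M \<delta> s q \<xi> N \<omega> (\<lambda>x. a * f x + b * g x) = (\<integral>x. a * (?U x * f x) + b * (?U x * g x) \<partial>torus)"
    unfolding random_partial_series_def regular_distribution_def by (intro Bochner_Integration.integral_cong) (auto simp: algebra_simps)
  thus ?thesis using int[OF assms(1)] int[OF assms(2)] by (simp add: random_partial_series_def regular_distribution_def)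
qed

lemma partial_sum_random_distribution: "partial_sum N \<in> random_distributions P"
proof -
  have "partial_sum N \<omega> \<in> distributions" for \<omega>
  proof -
    have "\<exists>B. \<forall>j. 0 \<le> B j \<and> (\<forall>f\<in>test_functions. \<bar>level j \<omega> f\<bar> \<le> B j * test_seminorm 0 f)"
      using level_bound[of _ \<omega>] by (intro choice) blast
    then obtain B where B: "\<And>j. 0 \<le> B j" "\<And>j f. f \<in> test_functions \<Longrightarrow> \<bar>level j \<omega> f\<bar> \<le> B j * test_seminorm 0 f"
      by blast
    have "\<bar>partial_sum N \<omega> f\<bar> \<le> (\<Sum>j\<le>N. B j) * test_seminorm 0 f" if "f \<in> test_functions" for f
      unfolding random_partial_series_level[OF that] sum_distrib_right
      by (rule order_trans[OF sum_abs]) (intro sum_mono B that)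
    thus ?thesis unfolding distributions_def using random_partial_series_linear by blast
  qed
  moreover have "(\<lambda>\<omega>. partial_sum N \<omega> f) \<in> borel_measurable P" if "f \<in> test_functions" for f
    unfolding random_partial_series_level[OF that] by measurable
  ultimately show ?thesis by (simp add: random_distributions_def)
qed

lemma partial_sum_tail: "is_tail 0 \<omega> (partial_sum N \<omega>)"
  unfolding is_tail_def
  by (rule exI[of _ "\<lambda>_. {..N}"], rule exI[of _ 1]) (auto simp: random_partial_series_level)

lemma partial_sum_diff_tail:
  assumes "K \<le> M" "K \<le> N"
  shows "is_tail K \<omega> (\<lambda>f. partial_sum M \<omega> f - partial_sum N \<omega> f)"
proof -
  have diff: "(\<Sum>j\<le>N. h j) - (\<Sum>j\<le>M. h j) = (\<Sum>j\<in>{M<..N}. h j)" if "M \<le> N" for M N and h :: "nat \<Rightarrow> real"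
    using that by (subst sum_diff[symmetric]) (auto intro!: sum.cong)
  show ?thesis
  proof (cases "M \<le> N")
    case True
    show ?thesis
      unfolding is_tail_def using assms True
      by (intro exI[of _ "\<lambda>_. {M<..N}"] exI[of _ "- 1"]) (auto simp: random_partial_series_level diff[OF True, symmetric])
  next
    case False
    hence "N \<le> M" by simp
    show ?thesis
      unfolding is_tail_def using assms
      by (intro exI[of _ "\<lambda>_. {N<..M}"] exI[of _ 1]) (auto simp: random_partial_series_level diff[OF \<open>N \<le> M\<close>, symmetric])
  qed
qed

text \<open>The limit is defined pathwise, as a series of distributions of order \<open>K\<close>, outside a null set.\<close>

lemma limit_exists:
  assumes t: "admissible_smoothness s q t" and w: "admissible_wavelets {s, t} \<psi>F \<psi>M"
  shows "\<exists>u\<in>random_distributions P. AE \<omega> in P. \<forall>f\<in>test_functions. (\<lambda>j. level j \<omega> f) sums u \<omega> f"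
proof -
  obtain K \<eta> \<epsilon> where par: "regular_wavelets K \<psi>F \<psi>M" "0 < \<eta>" "2 * \<eta> \<le> \<epsilon>"
    "\<And>x. - real K \<le> s x - (real CARD('n) / ess_sup q + \<epsilon>)"
    using smoothness_parameters[OF s q t w] by blast
  define \<tau> where "\<tau> x = s x - (real CARD('n) / ess_sup q + \<epsilon>)" for x
  have \<tau>: "C_log_loc \<tau>" unfolding \<tau>_def[abs_def] by (rule C_log_loc_diff_const[OF s])
  obtain b C where C: "0 \<le> C" and b0: "\<And>j m. 0 \<le> b j m"
    and b: "\<And>j G m f. G \<in> G_set j \<Longrightarrow> f \<in> test_functions \<Longrightarrow>
       \<bar>\<integral>x. periodic_wavelet \<psi>F \<psi>M j G m x * f x \<partial>torus\<bar> \<le> b j m * test_seminorm K f"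
    and b_sum: "\<And>j. (\<Sum>m\<in>M_set j. 2 powr (- real j * (\<tau> (dyadic_pt j m) + \<epsilon> + real CARD('n) / 2)) * b j m) \<le> C * 2 powr (- \<epsilon> * real j)"
    using wavelet_test_estimate[OF par(1) \<tau> par(4)[folded \<tau>_def], of \<epsilon>] by blast
  define a where "a = (1 / \<delta>) powr (1 / ess_sup q)"
  define D where "D = a * real (card (UNIV :: ('n \<Rightarrow> gender) set)) * C"
  define \<beta> where "\<beta> = (\<lambda>(j, G :: 'n \<Rightarrow> gender, m). b j m)"
  define W where "W i = amp i * \<beta> i" for i
  have W0: "0 \<le> W i" for i using amp_nonneg b0 by (auto simp: W_def \<beta>_def split: prod.splits)
  have \<epsilon>: "0 < \<epsilon>" using par by linarith
  have W_sum: "(\<Sum>i\<in>block j. W i) \<le> D * (2 powr - \<epsilon>) ^ j" for j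
  proof -
    have fin: "finite (UNIV :: ('n \<Rightarrow> gender) set)" using finite_G_set[of 0, where 'n = 'n] by (simp add: G_set_def)
    have "(\<Sum>i\<in>block j. W i) = (\<Sum>G\<in>(G_set j :: ('n \<Rightarrow> gender) set). a * (\<Sum>m\<in>M_set j. 2 powr (- real j * (\<tau> (dyadic_pt j m) + \<epsilon> + real CARD('n) / 2)) * b j m))"
      unfolding sum_block W_def \<beta>_def amp_powr[where \<epsilon> = \<epsilon>] a_def \<tau>_def by (simp add: sum_distrib_left mult.assoc)
    also have "\<dots> \<le> (\<Sum>G\<in>(G_set j :: ('n \<Rightarrow> gender) set). a * (C * 2 powr (- \<epsilon> * real j)))"
      by (intro sum_mono mult_left_mono b_sum) (simp add: a_def)
    also have "\<dots> = real (card (G_set j :: ('n \<Rightarrow> gender) set)) * (a * (C * 2 powr (- \<epsilon> * real j)))" by simp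
    also have "\<dots> \<le> real (card (UNIV :: ('n \<Rightarrow> gender) set)) * (a * (C * 2 powr (- \<epsilon> * real j)))"
      using fin C by (intro mult_right_mono) (auto simp: card_mono a_def)
    also have "2 powr (- \<epsilon> * real j) = (2 powr - \<epsilon>) ^ j"
      by (simp add: powr_realpow[symmetric] powr_powr)
    finally show ?thesis by (simp add: D_def mult_ac)
  qed
  \<comment> \<open>A random majorant of the whole series against a test function of unit seminorm
    of order K. Its expectation is at most M D times a geometric series, so it is finite almost
    surely.\<close>
  define S where "S \<omega> = (\<Sum>j. \<Sum>i\<in>block j. ennreal (W i) * ennreal \<bar>noise i \<omega>\<bar>)" for \<omega>
  have nm: "(\<lambda>\<omega>. ennreal \<bar>noise i \<omega>\<bar>) \<in> borel_measurable P" if "i \<in> block j" for i j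
    using noise_measurable[OF that] by measurable
  have S_block: "(\<lambda>\<omega>. \<Sum>i\<in>block j. ennreal (W i) * ennreal \<bar>noise i \<omega>\<bar>) \<in> borel_measurable P" for j
    by (intro borel_measurable_sum borel_measurable_times nm) auto
  have [measurable]: "S \<in> borel_measurable P"
    unfolding S_def[abs_def] using S_block by (intro borel_measurable_suminf_order)
  obtain M where M: "0 \<le> M" "\<And>j i. i \<in> block j \<Longrightarrow> (\<integral>\<^sup>+\<omega>. ennreal (1 + 2 * \<bar>noise i \<omega>\<bar> ^ 1) \<partial>P) \<le> ennreal M"
    using noise_moment[of 1] by blast
  have "(\<integral>\<^sup>+\<omega>. S \<omega> \<partial>P) = (\<Sum>j. \<integral>\<^sup>+\<omega>. (\<Sum>i\<in>block j. ennreal (W i) * ennreal \<bar>noise i \<omega>\<bar>) \<partial>P)"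
    unfolding S_def using S_block by (intro nn_integral_suminf)
  also have "\<dots> \<le> (\<Sum>j. ennreal (M * D * (2 powr - \<epsilon>) ^ j))"
  proof (intro suminf_le)
    fix j
    have "(\<integral>\<^sup>+\<omega>. (\<Sum>i\<in>block j. ennreal (W i) * ennreal \<bar>noise i \<omega>\<bar>) \<partial>P) = (\<Sum>i\<in>block j. \<integral>\<^sup>+\<omega>. ennreal (W i) * ennreal \<bar>noise i \<omega>\<bar> \<partial>P)"
      using nm by (intro nn_integral_sum borel_measurable_times) auto
    also have "\<dots> = (\<Sum>i\<in>block j. ennreal (W i) * (\<integral>\<^sup>+\<omega>. ennreal \<bar>noise i \<omega>\<bar> \<partial>P))"
      using nm by (intro sum.cong refl nn_integral_cmult)
    also have "\<dots> \<le> (\<Sum>i\<in>block j. ennreal (W i) * ennreal M)"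
    proof (intro sum_mono mult_left_mono)
      fix i assume i: "i \<in> block j"
      have "(\<integral>\<^sup>+\<omega>. ennreal \<bar>noise i \<omega>\<bar> \<partial>P) \<le> (\<integral>\<^sup>+\<omega>. ennreal (1 + 2 * \<bar>noise i \<omega>\<bar> ^ 1) \<partial>P)"
        by (intro nn_integral_mono ennreal_leI) simp
      thus "(\<integral>\<^sup>+\<omega>. ennreal \<bar>noise i \<omega>\<bar> \<partial>P) \<le> ennreal M" using M(2)[OF i] by (rule order_trans)
    qed auto
    also have "\<dots> = ennreal ((\<Sum>i\<in>block j. W i) * M)"
      using W0 M(1) by (simp add: sum_distrib_right[symmetric] ennreal_mult sum_nonneg)
    also have "\<dots> \<le> ennreal (M * D * (2 powr - \<epsilon>) ^ j)"
      using mult_right_mono[OF W_sum M(1)] by (intro ennreal_leI) (simp add: mult_ac)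
    finally show "(\<integral>\<^sup>+\<omega>. (\<Sum>i\<in>block j. ennreal (W i) * ennreal \<bar>noise i \<omega>\<bar>) \<partial>P) \<le> \<dots>" .
  qed auto
  also have "\<dots> < \<infinity>"
  proof -
    have "0 \<le> D" using C by (simp add: D_def a_def)
    thus ?thesis using geometric_rate[OF \<epsilon>] M(1) by (subst suminf_ennreal2) (auto intro!: summable_mult)
  qed
  finally have "AE \<omega> in P. S \<omega> \<noteq> \<infinity>" by (intro nn_integral_PInf_AE) auto
  have conv: "summable (\<lambda>j. \<Sum>i\<in>block j. W i * \<bar>noise i \<omega>\<bar>)" if "S \<omega> \<noteq> \<infinity>" for \<omega>
  proof -
    have "S \<omega> = (\<Sum>j. ennreal (\<Sum>i\<in>block j. W i * \<bar>noise i \<omega>\<bar>))"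
      using W0 by (simp add: S_def ennreal_mult sum_nonneg flip: sum_ennreal)
    thus ?thesis using that W0 by (intro summable_suminf_not_top) (auto intro!: sum_nonneg)
  qed
  have lev: "\<bar>level j \<omega> f\<bar> \<le> (\<Sum>i\<in>block j. W i * \<bar>noise i \<omega>\<bar>) * test_seminorm K f" if f: "f \<in> test_functions" for j \<omega> f
  proof -
    have "\<bar>level j \<omega> f\<bar> \<le> (\<Sum>i\<in>block j. amp i * \<bar>noise i \<omega>\<bar> * \<bar>regular_distribution (wav i) f\<bar>)"
      unfolding level_def using amp_nonneg by (intro order_trans[OF sum_abs]) (simp add: abs_mult)
    also have "\<dots> \<le> (\<Sum>i\<in>block j. amp i * \<bar>noise i \<omega>\<bar> * (\<beta> i * test_seminorm K f))"
      using b f amp_nonneg by (intro sum_mono mult_left_mono) (auto simp: block_def wav_def \<beta>_def regular_distribution_def)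
    finally show ?thesis unfolding W_def sum_distrib_right by (simp only: mult_ac)
  qed
  \<comment> \<open>The value 0 on the exceptional null set makes \<open>u \<omega>\<close> a
    distribution for every \<omega>, as \<open>random_distributions\<close> demands.\<close>
  define u where "u \<omega> f = (if S \<omega> = \<infinity> then 0 else \<Sum>j. level j \<omega> f)" for \<omega> f
  have summable_level: "summable (\<lambda>j. level j \<omega> f)" if "S \<omega> \<noteq> \<infinity>" "f \<in> test_functions" for \<omega> f
    by (rule summable_comparison_test'[OF summable_mult2[OF conv[OF that(1)], of "test_seminorm K f"], of 0])
       (use lev[OF that(2)] in simp)
  have sums: "(\<lambda>j. level j \<omega> f) sums u \<omega> f" if "S \<omega> \<noteq> \<infinity>" "f \<in> test_functions" for \<omega> f
    using summable_level[OF that] that(1) by (simp add: u_def summable_sums)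
  have dist: "u \<omega> \<in> distributions" for \<omega>
  proof (cases "S \<omega> = \<infinity>")
    case True
    hence "u \<omega> = (\<lambda>_. 0)" by (simp add: u_def fun_eq_iff)
    thus ?thesis by (auto simp: distributions_def intro!: exI[of _ 0])
  next
    case False
    have lin: "u \<omega> (\<lambda>x. c * f x + d * g x) = c * u \<omega> f + d * u \<omega> g" if fg: "f \<in> test_functions" "g \<in> test_functions" for f g c d
    proof -
      have "(\<lambda>j. level j \<omega> (\<lambda>x. c * f x + d * g x)) sums (c * u \<omega> f + d * u \<omega> g)"
        unfolding level_linear[OF fg] by (intro sums_add sums_mult sums[OF False] fg)
      thus ?thesis using False by (simp add: u_def sums_iff)
    qed
    have "\<bar>u \<omega> f\<bar> \<le> (\<Sum>j. \<Sum>i\<in>block j. W i * \<bar>noise i \<omega>\<bar>) * test_seminorm K f" if f: "f \<in> test_functions" for f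
    proof -
      note sm = summable_mult2[OF conv[OF False], of "test_seminorm K f"]
      have "norm (\<Sum>j. level j \<omega> f) \<le> (\<Sum>j. (\<Sum>i\<in>block j. W i * \<bar>noise i \<omega>\<bar>) * test_seminorm K f)"
        by (rule norm_suminf_le[OF _ sm]) (use lev[OF f] in simp)
      also have "\<dots> = (\<Sum>j. \<Sum>i\<in>block j. W i * \<bar>noise i \<omega>\<bar>) * test_seminorm K f"
        by (rule suminf_mult2[OF conv[OF False], symmetric])
      finally show ?thesis using False by (simp add: u_def)
    qed
    thus ?thesis unfolding distributions_def using lin by blast
  qed
  have "(\<lambda>\<omega>. u \<omega> f) \<in> borel_measurable P" for f unfolding u_def by measurable
  with dist have "u \<in> random_distributions P" by (simp add: random_distributions_def)
  moreover have "AE \<omega> in P. \<forall>f\<in>test_functions. (\<lambda>j. level j \<omega> f) sums u \<omega> f"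
    using \<open>AE \<omega> in P. S \<omega> \<noteq> \<infinity>\<close> by eventually_elim (use sums in blast)
  ultimately show ?thesis by blast
qed

lemma limit_tail:
  assumes "\<forall>f\<in>test_functions. (\<lambda>j. level j \<omega> f) sums T f"
  shows "is_tail 0 \<omega> T" "is_tail N \<omega> (\<lambda>f. partial_sum N \<omega> f - T f)"
proof -
  have sums: "(\<lambda>n. \<Sum>j<n. level j \<omega> f) \<longlonglongrightarrow> T f" if "f \<in> test_functions" for f
    using assms that by (simp add: sums_def)
  show "is_tail 0 \<omega> T"
    unfolding is_tail_def by (rule exI[of _ "\<lambda>n. {..<n}"], rule exI[of _ 1]) (use sums in auto)
  \<comment> \<open>The partial sum includes level N, so the remainder begins at level N + 1 and
    enters with the scalar -1; for n = 0 the set of levels is empty.\<close>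
  have "(\<lambda>n. - 1 * (\<Sum>j\<in>{N<..<N + 1 + n}. level j \<omega> f)) \<longlonglongrightarrow> partial_sum N \<omega> f - T f" if f: "f \<in> test_functions" for f
  proof -
    have eq: "- 1 * (\<Sum>j\<in>{N<..<N + 1 + n}. level j \<omega> f) = partial_sum N \<omega> f - (\<Sum>j<n + (N + 1). level j \<omega> f)" for n
    proof -
      have un: "{..<n + (N + 1)} = {..N} \<union> {N<..<N + 1 + n}" by auto
      have "(\<Sum>j<n + (N + 1). level j \<omega> f) = (\<Sum>j\<le>N. level j \<omega> f) + (\<Sum>j\<in>{N<..<N + 1 + n}. level j \<omega> f)"
        unfolding un by (rule sum.union_disjoint) auto
      thus ?thesis unfolding random_partial_series_level[OF f] by linarith
    qed
    show ?thesis unfolding eq by (intro tendsto_intros LIMSEQ_ignore_initial_segment[OF sums[OF f]])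
  qed
  thus "is_tail N \<omega> (\<lambda>f. partial_sum N \<omega> f - T f)"
    unfolding is_tail_def by (intro exI[of _ "\<lambda>n. {N<..<N + 1 + n}"] exI[of _ "- 1"]) auto
qed

lemma partial_sum_besov_space:
  assumes t: "admissible_smoothness s q t" and w: "admissible_wavelets {s, t} \<psi>F \<psi>M"
  shows "partial_sum N \<in> besov_space \<phi>\<^sub>0 \<phi> P t q"
proof -
  obtain C \<eta> M0 Q where par: "parameters t C \<eta> M0 Q" using parameters_exist[OF t w] by blast
  show ?thesis
    by (rule tail_besov_space[OF par partial_sum_random_distribution]) (simp add: partial_sum_tail)
qed

lemma partial_sum_Cauchy:
  assumes t: "admissible_smoothness s q t" and w: "admissible_wavelets {s, t} \<psi>F \<psi>M" and "0 < \<epsilon>"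
  shows "\<exists>K. \<forall>M\<ge>K. \<forall>N\<ge>K. besov_norm \<phi>\<^sub>0 \<phi> P t q (\<lambda>\<omega> f. partial_sum M \<omega> f - partial_sum N \<omega> f) < ennreal \<epsilon>"
proof -
  obtain C \<eta> M0 Q where par: "parameters t C \<eta> M0 Q" using parameters_exist[OF t w] by blast
  \<comment> \<open>Half of \<epsilon>, because the tail estimate is not strict while the Cauchy
    property is.\<close>
  from tail_norm_eventually[OF par half_gt_zero[OF \<open>0 < \<epsilon>\<close>]] obtain K where
    K: "\<forall>N\<ge>K. \<forall>T. (AE \<omega> in P. is_tail N \<omega> (T \<omega>)) \<longrightarrow> besov_norm \<phi>\<^sub>0 \<phi> P t q T \<le> ennreal (\<epsilon> / 2)" by blast
  have "besov_norm \<phi>\<^sub>0 \<phi> P t q (\<lambda>\<omega> f. partial_sum M \<omega> f - partial_sum N \<omega> f) \<le> ennreal (\<epsilon> / 2)" if "K \<le> M" "K \<le> N" for M N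
    by (rule K[rule_format, OF order_refl]) (simp add: partial_sum_diff_tail[OF that])
  moreover have "ennreal (\<epsilon> / 2) < ennreal \<epsilon>" using \<open>0 < \<epsilon>\<close> by (intro ennreal_lessI) auto
  ultimately show ?thesis by (intro exI[of _ K]) (auto intro: le_less_trans)
qed

text \<open>The smoothness t witnesses that a pathwise limit exists. Almost surely the levels alone
  determine that limit on test functions, and they do not involve t, so the same u works for every
  t'.\<close>

lemma series_convergence:
  assumes t: "admissible_smoothness s q t" and w: "admissible_wavelets {s, t} \<psi>F \<psi>M"
  shows "\<exists>u. \<forall>t'. admissible_smoothness s q t' \<and> admissible_wavelets {s, t'} \<psi>F \<psi>M \<longrightarrow>
            u \<in> besov_space \<phi>\<^sub>0 \<phi> P t' q \<and>
            (\<lambda>N. besov_norm \<phi>\<^sub>0 \<phi> P t' q (\<lambda>\<omega> f. partial_sum N \<omega> f - u \<omega> f)) \<longlonglongrightarrow> 0"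
proof -
  obtain u where u: "u \<in> random_distributions P" "AE \<omega> in P. \<forall>f\<in>test_functions. (\<lambda>j. level j \<omega> f) sums u \<omega> f"
    using limit_exists[OF t w] by blast
  have tails: "AE \<omega> in P. is_tail 0 \<omega> (u \<omega>)" "AE \<omega> in P. is_tail N \<omega> (\<lambda>f. partial_sum N \<omega> f - u \<omega> f)" for N
    using u(2) by (eventually_elim, use limit_tail in blast)+
  have "u \<in> besov_space \<phi>\<^sub>0 \<phi> P t' q \<and> (\<lambda>N. besov_norm \<phi>\<^sub>0 \<phi> P t' q (\<lambda>\<omega> f. partial_sum N \<omega> f - u \<omega> f)) \<longlonglongrightarrow> 0"
    if adm: "admissible_smoothness s q t' \<and> admissible_wavelets {s, t'} \<psi>F \<psi>M" for t'
  proof -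
    obtain C \<eta> M0 Q where par: "parameters t' C \<eta> M0 Q" using parameters_exist adm by blast
    have "(\<lambda>N. besov_norm \<phi>\<^sub>0 \<phi> P t' q (\<lambda>\<omega> f. partial_sum N \<omega> f - u \<omega> f)) \<longlonglongrightarrow> 0"
    proof (rule order_tendstoI)
      fix e :: ennreal assume "0 < e"
      \<comment> \<open>e may be infinite, whereas the tail estimate takes a real threshold.\<close>
      then obtain e' where e': "0 < ennreal e'" "ennreal e' < e" using dense[of 0 e] by (metis ennreal_cases not_less_iff_gr_or_eq top.not_eq_extremum)
      hence "0 < e'" by simp
      from tail_norm_eventually[OF par this] obtain K where
        K: "\<And>N T. N \<ge> K \<Longrightarrow> AE \<omega> in P. is_tail N \<omega> (T \<omega>) \<Longrightarrow> besov_norm \<phi>\<^sub>0 \<phi> P t' q T \<le> ennreal e'" by blast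
      have "besov_norm \<phi>\<^sub>0 \<phi> P t' q (\<lambda>\<omega> f. partial_sum N \<omega> f - u \<omega> f) < e" if "K \<le> N" for N
        by (rule le_less_trans[OF K[OF that tails(2)] e'(2)])
      thus "\<forall>\<^sub>F N in sequentially. besov_norm \<phi>\<^sub>0 \<phi> P t' q (\<lambda>\<omega> f. partial_sum N \<omega> f - u \<omega> f) < e"
        by (auto simp: eventually_sequentially)
    qed simp
    thus ?thesis using tail_besov_space[OF par u(1) tails(1)] by blast
  qed
  thus ?thesis by blast
qed

end

theorem theorem3p2:
  fixes s t q \<phi>\<^sub>0 \<phi> :: "real ^ 'n \<Rightarrow> real"
    and \<psi>F \<psi>M :: "real \<Rightarrow> real"
    and \<delta> :: real
    and \<kappa> :: "(real ^ 'n) measure"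
    and P :: "'w measure"
    and \<xi> :: "nat \<Rightarrow> ('n \<Rightarrow> gender) \<Rightarrow> ('n \<Rightarrow> nat) \<Rightarrow> 'w \<Rightarrow> real"
  assumes "CARD('n) \<le> 3"
    and "resolution_of_unity \<phi>\<^sub>0 \<phi>"
    and "C_log_loc s" and "L_infinity s"
    and "0 < ess_inf s" and "\<forall>x. ess_inf s \<le> s x"
    and "P_log q" and "0 < \<delta>"
    and "admissible_smoothness s q t"
    and "admissible_wavelets {s, t} \<psi>F \<psi>M"
    and "prob_space \<kappa>" and "sets \<kappa> = sets torus"
    and "prob_space P"
    and "iid_q_exponential P \<kappa> q \<xi>"
  shows "(\<forall>N. random_partial_series \<psi>F \<psi>M \<delta> s q \<xi> N \<in> besov_space \<phi>\<^sub>0 \<phi> P t q) \<and>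
         (\<forall>\<epsilon>>0. \<exists>K. \<forall>M\<ge>K. \<forall>N\<ge>K.
            besov_norm \<phi>\<^sub>0 \<phi> P t q (\<lambda>\<omega> f. random_partial_series \<psi>F \<psi>M \<delta> s q \<xi> M \<omega> f
                                     - random_partial_series \<psi>F \<psi>M \<delta> s q \<xi> N \<omega> f) < ennreal \<epsilon>) \<and>
         (\<exists>u. \<forall>t'. admissible_smoothness s q t' \<and> admissible_wavelets {s, t'} \<psi>F \<psi>M \<longrightarrow>
            u \<in> besov_space \<phi>\<^sub>0 \<phi> P t' q \<and>
            (\<lambda>N. besov_norm \<phi>\<^sub>0 \<phi> P t' q (\<lambda>\<omega> f. random_partial_series \<psi>F \<psi>M \<delta> s q \<xi> N \<omega> f - u \<omega> f)) \<longlonglongrightarrow> 0)"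
proof -
  have wavelets: "\<exists>K. regular_wavelets K \<psi>F \<psi>M"
    using smoothness_parameters[OF assms(3,7,9,10)] by blast
  interpret wavelet_series s q \<phi>\<^sub>0 \<phi> \<psi>F \<psi>M \<delta> \<kappa> P \<xi>
    by (rule wavelet_series.intro) (fact assms wavelets)+
  show ?thesis
    using partial_sum_besov_space[OF assms(9,10)] partial_sum_Cauchy[OF assms(9,10)] series_convergence[OF assms(9,10)]
    by (intro conjI allI impI) assumption+
qed

end
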